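(* Let $l\ge2$. There is a unique isomorphism of free $\mathbb Z[q,q^{-1}]$-modules $\phi:V(l)\to V$ such that, for $0\le n\le l$, $$\phi\big(\overline{f^{(n)}\eta_l}\big)=\begin{cases}h_{(O+)d_n(O+)}&n\text{ even}\\ s_0h_{(O-)s_0d_n(O+)}&n\text{ odd}\end{cases}\qquad\text{and}\qquad\phi\big(b^{(n)}\eta_l\big)=\begin{cases}b_{(O+)d_n(O+)}&n\text{ even}\\ s_0b_{(O-)s_0d_n(O+)}&n\text{ odd.}\end{cases}$$ In fact, viewing $V(l)$ as a $\mathbb Z[q,q^{-1}]$-algebra by identifying it with $U^\imath_t/\operatorname{Ann}(\eta_l)$, $\phi$ is an algebra isomorphism. Also $\phi(bv)=b*\phi(v)$, $\phi(\overline v)=\overline{\phi(v)}$ and $\overline{(\overline v,\overline w)_l}=(\phi(v),\phi(w))$ for all $v,w\in V(l)$.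
   Context: $t\in\{0,1\}$ with $l\equiv t\pmod2$. $[n]_q=\frac{q^n-q^{-n}}{q-q^{-1}}$, with quantum factorials $[n]_q^!$ and binomials $\binom{l}{n}_q$. The bar on $\mathbb Z[q,q^{-1}]$ is $q\mapsto q^{-1}$; antilinear means semilinear for bar. **$V(l)$.** The $\mathbb Z[q,q^{-1}]$-form $V(l)$ of the irreducible $U_q(\mathfrak{sl}_2)$-module of highest weight $l$ is free with basis $f^{(n)}\eta_l$ ($0\le n\le l$), $f^{(n)}=f^n/[n]^!_q$, $\eta_l$ a highest weight vector. $b$ acts by $bf^{(n)}\eta_l=[n+1]_qf^{(n+1)}\eta_l+q^{2n-l-1}[l-n+1]_qf^{(n-1)}\eta_l$ (with $f^{(-1)}\eta_l=f^{(l+1)}\eta_l=0$). $U^\imath_t\subset\mathbb Q(q)[b]$ is the $\mathbb Z[q,q^{-1}]$-subalgebra with basis $b^{(n)}$, $n\ge0$, where $b^{(n)}=\frac1{[n]^!_q}\prod_{0\le k<n,\,k\equiv t(2)}(b^2-[k]_q^2)$ for $n$ even, $b^{(n)}=\frac b{[n]^!_q}\prod_{1\le k<n,\,k\equiv t(2)}(b^2-[k]_q^2)$ for $n$ odd. It acts on $V(l)$ and $V(l)=U_t^\imath\eta_l$. The bar involution on $V(l)$ is the unique antilinear map with $\overline{\eta_l}=\eta_l$ and $\overline{bv}=b\overline v$. The symmetric bilinear form $(\cdot,\cdot)_l$ on $V(l)$ is the one for which the $f^{(n)}\eta_l$ are orthogonal with $\overline{(f^{(n)}\eta_l,f^{(n)}\eta_l)_l}=q^{n(l-n)}\binom{l}{n}_q$.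 **Type $\mathrm D_l$.** $W$ is the Weyl group of type $\mathrm D_l$ acting on $\mathbb{Z}x_1\oplus\cdots\oplus\mathbb{Z}x_l$, with simple reflections $s_i$, $i\in N=\{1,-1,2,\dots,l-1\}$: for $1\le i\le l-1$ $s_i$ swaps $x_i,x_{i+1}$; $s_{-1}:x_1\mapsto-x_2,x_2\mapsto-x_1$. $s_0$ negates $x_1$ and fixes the other $x_i$. The graph automorphism $\gamma:N\to N$ swaps $\pm1$. $W_I=\langle s_i:i\in I\rangle$ with longest element $w_I$; $\ell$ the length on $W$. $O=\{2,\dots,l-1\}$, $O+=O\cup\{1\}$, $O-=O\cup\{-1\}$. $d_n$ ($0\le n\le l$) is the signed permutation $x_i\mapsto-x_{n+1-i}$ for $1\le i\le n$, $x_i\mapsto x_i$ for $i>n$; $d_n\in W$ for $n$ even, $s_0d_n\in W$ for $n$ odd. **Hecke and $q$-Schur algebra.** $H$ is the Hecke algebra of $W$ over $\mathbb Z[q,q^{-1}]$ with basis $h_w$; $h_{s_i}h_w=h_{s_iw}$ if $\ell(s_iw)>\ell(w)$, and $=h_{s_iw}-(q-q^{-1})h_w$ otherwise. Bar: antilinear algebra involution $\overline{h_w}=h_{w^{-1}}^{-1}$. $\rho:H\to H$, $h_w\mapsto h_{w^{-1}}$ linear anti-involution. $b_w$ is the unique bar-invariant element of $h_w+\sum_{w'<w}q\mathbb Z[q]h_{w'}$. $\pi_I^+=\sum_{w\in W_I}q^{2\ell(w)}$, $\pi_I=q^{-\ell(w_I)}\pi_I^+$. ${}_IS_J=b_{w_I}H\cap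 Hb_{w_J}$; for $x\in{}_IS_J$, $y\in{}_JS_K$, $x*y=\pi_J^{-1}xy\in{}_IS_K$. For $d$ of minimal length in $W_IdW_J$, with longest element $w_{IdJ}$: $h_{IdJ}=\sum_{w\in W_IdW_J}q^{\ell(w_{IdJ})-\ell(w)}h_w$ and $b_{IdJ}=b_{w_{IdJ}}$, both in ${}_IS_J$. $\gamma$ also denotes the induced automorphism of $H$, mapping ${}_IS_J$ to ${}_{\gamma(I)}S_{\gamma(J)}$. $V={}_{O+}S_{O+}\oplus s_0\,{}_{O-}S_{O+}$ ($s_0$ a formal symbol) is the $\mathbb Z[q,q^{-1}]$-algebra with $(x+s_0y)*(u+s_0v)=(x*u+\gamma(y)*v)+s_0(y*u+\gamma(x)*v)$ and identity $b_{w_{O+}}$. Bar on $V$: $\overline{x+s_0y}=\overline x+s_0\overline y$. In $V$, $b:=s_0b_{(O-)1(O+)}$. Form on $V$: $(x+s_0y,u+s_0v)=(x,u)+(y,v)$ where for $x,y\in{}_IS_J$, $(x,y)=\frac1{\pi_I^+}\mathrm{tr}(\rho(x)y)$ with $\mathrm{tr}(h_w)=\delta_{w,1}$. *)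

theory Defs
  imports
    "HOL-Library.Poly_Mapping"
    "HOL-Library.FuncSet"
    "HOL-Library.Product_Plus"
    "HOL-Combinatorics.Transposition"
    "HOL-Computational_Algebra.Polynomial"
    "HOL-Computational_Algebra.Polynomial_Factorial"
    "HOL-Number_Theory.Cong"
    "HOL-Algebra.QuotRing"
begin

section \<open>Laurent polynomials and free modules over them\<close>

text \<open>
  The ring of integral Laurent polynomials is the group ring of the integers: the coefficient
  of the \<open>k\<close>-th power of \<open>q\<close> in \<open>p\<close> is \<open>lookup p k\<close>. Its field of fractions, the rational
  functions in \<open>q\<close> over the rationals, is \<open>laurent fract\<close>.
\<close>

type_synonym laurent = "int \<Rightarrow>\<^sub>0 int"

definition qpow :: "int \<Rightarrow> laurent" where
  "qpow k = Poly_Mapping.single k 1"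

definition qbar :: "laurent \<Rightarrow> laurent" where
  "qbar p = Poly_Mapping.map_key uminus p"

definition qZq :: "laurent set" where
  "qZq = {p. Poly_Mapping.keys p \<subseteq> {1..}}"

text \<open>Division in the integral domain, used only where the divisor is nonzero and divides.\<close>

definition exact_quot :: "laurent \<Rightarrow> laurent \<Rightarrow> laurent" where
  "exact_quot a b = (THE c. b * c = a)"

lemma exact_quot_mult: "b \<noteq> 0 \<Longrightarrow> exact_quot (b * c) b = c"
  unfolding exact_quot_def by (rule the_equality) auto

definition qint :: "int \<Rightarrow> laurent" where
  "qint n = exact_quot (qpow n - qpow (- n)) (qpow 1 - qpow (- 1))"

definition qfact :: "nat \<Rightarrow> laurent" where
  "qfact n = (\<Prod>k = 1..n. qint (int k))"

definition qbinom :: "nat \<Rightarrow> nat \<Rightarrow> laurent" where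
  "qbinom l n = exact_quot (qfact l) (qfact n * qfact (l - n))"

lemma qpow_mult: "qpow a * qpow b = qpow (a + b)"
  by (simp add: qpow_def mult_single)

lemma qpow_diff_neq_0: "qpow 1 - qpow (- 1) \<noteq> 0"
proof
  assume "qpow 1 - qpow (- 1) = 0"
  then have "Poly_Mapping.lookup (qpow 1 - qpow (- 1)) 1 = 0" by simp
  then show False by (simp add: qpow_def lookup_minus lookup_single)
qed

lemma qint_eq_sum: "qint (int n) = (\<Sum>i<n. qpow (int n - 1 - 2 * int i))"
proof -
  let ?f = "\<lambda>i. qpow (int n - 2 * int i)"
  have "(qpow 1 - qpow (- 1)) * (\<Sum>i<n. qpow (int n - 1 - 2 * int i))
      = (\<Sum>i<n. ?f i - ?f (Suc i))"
    by (simp add: sum_distrib_left left_diff_distrib qpow_mult algebra_simps)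
  also have "\<dots> = qpow (int n) - qpow (- int n)"
    by (subst sum_lessThan_telescope') simp
  finally have "exact_quot (qpow (int n) - qpow (- int n)) (qpow 1 - qpow (- 1))
      = (\<Sum>i<n. qpow (int n - 1 - 2 * int i))"
    using exact_quot_mult[OF qpow_diff_neq_0] by metis
  then show ?thesis by (simp add: qint_def)
qed

text \<open>The free module on a set of basis elements of type \<open>'a\<close> consists of the finitely
  supported families of coefficients; the basis element at \<open>a\<close> is \<open>Poly_Mapping.single a 1\<close>.\<close>

definition smul :: "'r::mult_zero \<Rightarrow> ('a \<Rightarrow>\<^sub>0 'r) \<Rightarrow> 'a \<Rightarrow>\<^sub>0 'r" (infixr \<open>\<cdot>\<close> 75) where
  "c \<cdot> v = Poly_Mapping.map ((*) c) v"

lemma lookup_smul: "Poly_Mapping.lookup (c \<cdot> v) k = c * Poly_Mapping.lookup v k"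
  by (simp add: smul_def map.rep_eq when_def)

definition linear_ext :: "('a \<Rightarrow> 'b \<Rightarrow>\<^sub>0 laurent) \<Rightarrow> ('a \<Rightarrow>\<^sub>0 laurent) \<Rightarrow> 'b \<Rightarrow>\<^sub>0 laurent" where
  "linear_ext g v = (\<Sum>a\<in>Poly_Mapping.keys v. Poly_Mapping.lookup v a \<cdot> g a)"

definition antilinear_ext :: "('a \<Rightarrow> 'b \<Rightarrow>\<^sub>0 laurent) \<Rightarrow> ('a \<Rightarrow>\<^sub>0 laurent) \<Rightarrow> 'b \<Rightarrow>\<^sub>0 laurent" where
  "antilinear_ext g v = (\<Sum>a\<in>Poly_Mapping.keys v. qbar (Poly_Mapping.lookup v a) \<cdot> g a)"

text \<open>Division of a vector by a scalar, used only where it is possible.\<close>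

definition scalar_quot :: "('a \<Rightarrow>\<^sub>0 laurent) \<Rightarrow> laurent \<Rightarrow> 'a \<Rightarrow>\<^sub>0 laurent" where
  "scalar_quot x c = (THE z. c \<cdot> z = x)"

lemma scalar_quot_smul: "c \<noteq> 0 \<Longrightarrow> scalar_quot (c \<cdot> z) c = z"
  unfolding scalar_quot_def
proof (rule the_equality)
  fix z' assume "c \<noteq> 0" and eq: "c \<cdot> z' = c \<cdot> z"
  have "c * Poly_Mapping.lookup z' k = c * Poly_Mapping.lookup z k" for k
    using arg_cong[OF eq, of "\<lambda>x. Poly_Mapping.lookup x k"] by (simp add: lookup_smul)
  with \<open>c \<noteq> 0\<close> show "z' = z"
    by (intro poly_mapping_eqI) (metis mult_left_cancel)
qed simp


section \<open>The module \<open>V(l)\<close> and the algebra acting on it\<close>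

definition Vmod :: "nat \<Rightarrow> (nat \<Rightarrow>\<^sub>0 laurent) set" where
  "Vmod l = {v. Poly_Mapping.keys v \<subseteq> {..l}}"

text \<open>The divided power vectors, with value \<open>0\<close> when \<open>n < 0\<close> or \<open>n > l\<close>.\<close>

definition feta :: "nat \<Rightarrow> int \<Rightarrow> nat \<Rightarrow>\<^sub>0 laurent" where
  "feta l n = (if 0 \<le> n \<and> n \<le> int l then Poly_Mapping.single (nat n) 1 else 0)"

definition eta :: "nat \<Rightarrow> nat \<Rightarrow>\<^sub>0 laurent" where
  "eta l = feta l 0"

definition bop :: "nat \<Rightarrow> (nat \<Rightarrow>\<^sub>0 laurent) \<Rightarrow> nat \<Rightarrow>\<^sub>0 laurent" where
  "bop l = linear_ext (\<lambda>n.
     qint (int n + 1) \<cdot> feta l (int n + 1)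
     + (qpow (2 * int n - int l - 1) * qint (int l - int n + 1)) \<cdot> feta l (int n - 1))"

definition Vbar :: "nat \<Rightarrow> (nat \<Rightarrow>\<^sub>0 laurent) \<Rightarrow> nat \<Rightarrow>\<^sub>0 laurent" where
  "Vbar l = (THE \<psi>. \<psi> \<in> Vmod l \<rightarrow>\<^sub>E Vmod l
     \<and> (\<forall>v\<in>Vmod l. \<forall>w\<in>Vmod l. \<psi> (v + w) = \<psi> v + \<psi> w)
     \<and> (\<forall>c. \<forall>v\<in>Vmod l. \<psi> (c \<cdot> v) = qbar c \<cdot> \<psi> v)
     \<and> \<psi> (eta l) = eta l
     \<and> (\<forall>v\<in>Vmod l. \<psi> (bop l v) = bop l (\<psi> v)))"

definition Vform :: "nat \<Rightarrow> (nat \<Rightarrow>\<^sub>0 laurent) \<Rightarrow> (nat \<Rightarrow>\<^sub>0 laurent) \<Rightarrow> laurent" where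
  "Vform l v w = (\<Sum>n\<le>l. Poly_Mapping.lookup v n * Poly_Mapping.lookup w n
     * qbar (qpow (int n * (int l - int n)) * qbinom l n))"

text \<open>The divided powers \<open>b\<^sup>(\<^sup>n\<^sup>)\<close>, with \<open>b\<close> the polynomial variable.\<close>

definition bdiv :: "nat \<Rightarrow> nat \<Rightarrow> laurent fract poly" where
  "bdiv t n = (let b = [:0, 1:]; factor = (\<lambda>k. b ^ 2 - [: to_fract (qint (int k) ^ 2) :]) in
     if even n
     then smult (1 / to_fract (qfact n)) (\<Prod>k | k < n \<and> [k = t] (mod 2). factor k)
     else smult (1 / to_fract (qfact n)) (b * (\<Prod>k | 1 \<le> k \<and> k < n \<and> [k = t] (mod 2). factor k)))"

definition Ui :: "nat \<Rightarrow> laurent fract poly set" where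
  "Ui t = range (\<lambda>c :: nat \<Rightarrow>\<^sub>0 laurent.
     \<Sum>n\<in>Poly_Mapping.keys c. smult (to_fract (Poly_Mapping.lookup c n)) (bdiv t n))"

definition Ui_ring :: "nat \<Rightarrow> laurent fract poly ring" where
  "Ui_ring t = \<lparr>carrier = Ui t, monoid.mult = (*), one = 1, zero = 0, add = (+)\<rparr>"

text \<open>The action of a polynomial in \<open>b\<close> is computed in the scalar extension of \<open>V(l)\<close> to the
  field of rational functions; for elements of \<open>Ui t\<close> the result lies in \<open>V(l)\<close> again.\<close>

definition Ui_act :: "nat \<Rightarrow> laurent fract poly \<Rightarrow> (nat \<Rightarrow>\<^sub>0 laurent) \<Rightarrow> nat \<Rightarrow>\<^sub>0 laurent" where
  "Ui_act l u v = (THE w. w \<in> Vmod l \<and> Poly_Mapping.map to_fract w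
     = (\<Sum>i\<le>degree u. coeff u i \<cdot> Poly_Mapping.map to_fract ((bop l ^^ i) v)))"

definition Ann_eta :: "nat \<Rightarrow> nat \<Rightarrow> laurent fract poly set" where
  "Ann_eta t l = {u \<in> Ui t. Ui_act l u (eta l) = 0}"

text \<open>The identification of \<open>U/Ann(\<eta>)\<close> with \<open>V(l)\<close>, sending the coset of \<open>u\<close> to \<open>u \<eta>\<close>.\<close>

definition orbit_map :: "nat \<Rightarrow> laurent fract poly set \<Rightarrow> nat \<Rightarrow>\<^sub>0 laurent" where
  "orbit_map l X = the_elem ((\<lambda>u. Ui_act l u (eta l)) ` X)"


section \<open>The Weyl group of type D\<close>

text \<open>
  A signed permutation of the \<open>x\<^sub>i\<close> is encoded by the odd map \<open>w\<close> on the integers with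
  \<open>x\<^sub>i \<mapsto> x\<^bsub>w i\<^esub>\<close>, where \<open>x\<^bsub>-i\<^esub>\<close> stands for \<open>- x\<^sub>i\<close> and indices of absolute value
  greater than \<open>l\<close> are fixed. The group law is composition.
\<close>

type_synonym sperm = "int \<Rightarrow> int"

text \<open>\<open>srefl i\<close> is meant for \<open>i \<ge> -1\<close>.\<close>

definition srefl :: "int \<Rightarrow> sperm" where
  "srefl i =
     (if i = 0 then Transposition.transpose 1 (- 1)
      else if i = - 1 then Transposition.transpose 1 (- 2) \<circ> Transposition.transpose (- 1) 2
      else Transposition.transpose i (i + 1) \<circ> Transposition.transpose (- i) (- (i + 1)))"

definition Nset :: "nat \<Rightarrow> int set" where
  "Nset l = {1, - 1} \<union> {2..int l - 1}"

definition Oplus :: "nat \<Rightarrow> int set" where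
  "Oplus l = {2..int l - 1} \<union> {1}"

definition Ominus :: "nat \<Rightarrow> int set" where
  "Ominus l = {2..int l - 1} \<union> {- 1}"

definition gamma :: "int \<Rightarrow> int" where
  "gamma i = (if i = 1 then - 1 else if i = - 1 then 1 else i)"

definition word :: "int list \<Rightarrow> sperm" where
  "word js = foldr (\<lambda>i w. srefl i \<circ> w) js id"

text \<open>As the \<open>srefl i\<close> are involutions, the subgroup they generate consists of their products.\<close>

definition parab :: "int set \<Rightarrow> sperm set" where
  "parab I = word ` lists I"

definition Weyl :: "nat \<Rightarrow> sperm set" where
  "Weyl l = parab (Nset l)"

definition len :: "nat \<Rightarrow> sperm \<Rightarrow> nat" where
  "len l w = (LEAST k. \<exists>js\<in>lists (Nset l). word js = w \<and> length js = k)"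

definition longest :: "nat \<Rightarrow> sperm set \<Rightarrow> sperm" where
  "longest l D = (THE w. w \<in> D \<and> (\<forall>v\<in>D. len l v \<le> len l w))"

definition double_coset :: "int set \<Rightarrow> sperm \<Rightarrow> int set \<Rightarrow> sperm set" where
  "double_coset I d J = {u \<circ> d \<circ> v | u v. u \<in> parab I \<and> v \<in> parab J}"

text \<open>The Bruhat order is generated by multiplication with reflections, the conjugates of the
  simple ones, that increase the length.\<close>

definition bruhat_less :: "nat \<Rightarrow> sperm rel" where
  "bruhat_less l = {(v, v \<circ> r) | v r. v \<in> Weyl l
     \<and> (\<exists>u\<in>Weyl l. \<exists>i\<in>Nset l. r = u \<circ> srefl i \<circ> inv_into UNIV u)
     \<and> len l v < len l (v \<circ> r)}\<^sup>+"

definition dperm :: "nat \<Rightarrow> sperm" where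
  "dperm n i = (if 1 \<le> i \<and> i \<le> int n then - (int n + 1 - i)
     else if - int n \<le> i \<and> i \<le> - 1 then int n + 1 + i else i)"

text \<open>The automorphism of the Weyl group induced by the graph automorphism.\<close>

definition gamma_W :: "nat \<Rightarrow> sperm \<Rightarrow> sperm" where
  "gamma_W l w = (THE w'. \<exists>js\<in>lists (Nset l). word js = w \<and> w' = word (map gamma js))"

lemma srefl_0_conj:
  assumes "i \<ge> - 1" "i \<noteq> 0"
  shows "srefl (gamma i) = srefl 0 \<circ> srefl i \<circ> srefl 0"
proof
  fix x :: int
  consider "i = 1" | "i = - 1" | "i \<ge> 2" using assms by linarith
  then show "srefl (gamma i) x = (srefl 0 \<circ> srefl i \<circ> srefl 0) x"
  proof cases
    case 1
    then show ?thesis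
      by (cases "x = 1"; cases "x = - 1"; cases "x = 2"; cases "x = - 2")
        (simp_all add: srefl_def gamma_def Transposition.transpose_def)
  next
    case 2
    then show ?thesis
      by (cases "x = 1"; cases "x = - 1"; cases "x = 2"; cases "x = - 2")
        (simp_all add: srefl_def gamma_def Transposition.transpose_def)
  next
    case 3
    then have "x \<notin> {i, i + 1, - i, - (i + 1)} \<or> x \<notin> {1, - 1}" by auto
    with 3 show ?thesis
      by (cases "x = 1"; cases "x = - 1"; cases "x = i"; cases "x = i + 1"; cases "x = - i";
          cases "x = - (i + 1)")
        (simp_all add: srefl_def gamma_def Transposition.transpose_def)
  qed
qed

lemma word_map_gamma:
  assumes "js \<in> lists (Nset l)"
  shows "word (map gamma js) = srefl 0 \<circ> word js \<circ> srefl 0"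
  using assms
proof (induction js)
  case Nil
  show ?case by (simp add: word_def srefl_def)
next
  case (Cons i js)
  then have "i \<ge> - 1" "i \<noteq> 0" by (auto simp: Nset_def)
  moreover have "srefl 0 (srefl 0 x) = x" for x
    by (simp add: srefl_def)
  ultimately show ?case
    using Cons by (simp add: word_def srefl_0_conj fun_eq_iff)
qed

lemma gamma_W_eq:
  assumes "w \<in> Weyl l"
  shows "gamma_W l w = srefl 0 \<circ> w \<circ> srefl 0"
  unfolding gamma_W_def
  by (rule the_equality) (use assms word_map_gamma in \<open>auto simp: Weyl_def parab_def\<close>)


section \<open>The Hecke algebra\<close>

type_synonym hecke = "sperm \<Rightarrow>\<^sub>0 laurent"

definition Hecke :: "nat \<Rightarrow> hecke set" where
  "Hecke l = {x. Poly_Mapping.keys x \<subseteq> Weyl l}"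

definition hb :: "sperm \<Rightarrow> hecke" where
  "hb w = Poly_Mapping.single w 1"

text \<open>Left multiplication by the basis element of a simple reflection.\<close>

definition hgen_mult :: "nat \<Rightarrow> int \<Rightarrow> hecke \<Rightarrow> hecke" where
  "hgen_mult l i = linear_ext (\<lambda>w.
     if len l (srefl i \<circ> w) > len l w then hb (srefl i \<circ> w)
     else hb (srefl i \<circ> w) - (qpow 1 - qpow (- 1)) \<cdot> hb w)"

definition reduced_word :: "nat \<Rightarrow> sperm \<Rightarrow> int list" where
  "reduced_word l w = (SOME js. js \<in> lists (Nset l) \<and> word js = w \<and> length js = len l w)"

text \<open>
  By the multiplication rule the basis element \<open>hb w\<close> is the product of the generators along
  any reduced word of \<open>w\<close>; this determines the bilinear product. It does not depend on the
  reduced words chosen.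
\<close>

definition hmult :: "nat \<Rightarrow> hecke \<Rightarrow> hecke \<Rightarrow> hecke" where
  "hmult l x y = linear_ext (\<lambda>w. foldr (hgen_mult l) (reduced_word l w) y) x"

definition hinverse :: "nat \<Rightarrow> hecke \<Rightarrow> hecke" where
  "hinverse l x = (THE y. y \<in> Hecke l \<and> hmult l x y = hb id \<and> hmult l y x = hb id)"

definition hbar :: "nat \<Rightarrow> hecke \<Rightarrow> hecke" where
  "hbar l = antilinear_ext (\<lambda>w. hinverse l (hb (inv_into UNIV w)))"

definition hrho :: "hecke \<Rightarrow> hecke" where
  "hrho = linear_ext (\<lambda>w. hb (inv_into UNIV w))"

definition htr :: "hecke \<Rightarrow> laurent" where
  "htr x = Poly_Mapping.lookup x id"

definition hgamma :: "nat \<Rightarrow> hecke \<Rightarrow> hecke" where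
  "hgamma l = linear_ext (\<lambda>w. hb (gamma_W l w))"

text \<open>The Kazhdan--Lusztig basis element, with \<open>v < w\<close> in the Bruhat order.\<close>

definition klb :: "nat \<Rightarrow> sperm \<Rightarrow> hecke" where
  "klb l w = (THE y. y \<in> Hecke l \<and> hbar l y = y
     \<and> (\<exists>c. (\<forall>v. c v \<in> qZq) \<and> y = hb w + (\<Sum>v | (v, w) \<in> bruhat_less l. c v \<cdot> hb v)))"


section \<open>The \<open>q\<close>-Schur algebra and the algebra \<open>V\<close>\<close>

definition wmax :: "nat \<Rightarrow> int set \<Rightarrow> sperm" where
  "wmax l I = longest l (parab I)"

definition poinc_plus :: "nat \<Rightarrow> int set \<Rightarrow> laurent" where
  "poinc_plus l I = (\<Sum>w\<in>parab I. qpow (2 * int (len l w)))"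

definition poinc :: "nat \<Rightarrow> int set \<Rightarrow> laurent" where
  "poinc l I = qpow (- int (len l (wmax l I))) * poinc_plus l I"

definition Schur :: "nat \<Rightarrow> int set \<Rightarrow> int set \<Rightarrow> hecke set" where
  "Schur l I J = (\<lambda>a. hmult l (klb l (wmax l I)) a) ` Hecke l
     \<inter> (\<lambda>a. hmult l a (klb l (wmax l J))) ` Hecke l"

text \<open>The product \<open>x * y\<close> for \<open>x \<in> Schur l I J\<close> and \<open>y \<in> Schur l J K\<close>.\<close>

definition smult_at :: "nat \<Rightarrow> int set \<Rightarrow> hecke \<Rightarrow> hecke \<Rightarrow> hecke" where
  "smult_at l J x y = scalar_quot (hmult l x y) (poinc l J)"

definition hstd :: "nat \<Rightarrow> int set \<Rightarrow> sperm \<Rightarrow> int set \<Rightarrow> hecke" where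
  "hstd l I d J = (let D = double_coset I d J in
     \<Sum>w\<in>D. qpow (int (len l (longest l D)) - int (len l w)) \<cdot> hb w)"

definition bcan :: "nat \<Rightarrow> int set \<Rightarrow> sperm \<Rightarrow> int set \<Rightarrow> hecke" where
  "bcan l I d J = klb l (longest l (double_coset I d J))"

text \<open>The form on \<open>Schur l I J\<close>, which depends on \<open>I\<close> but not on \<open>J\<close>.\<close>

definition sform :: "nat \<Rightarrow> int set \<Rightarrow> hecke \<Rightarrow> hecke \<Rightarrow> laurent" where
  "sform l I x y = exact_quot (htr (hmult l (hrho x) y)) (poinc_plus l I)"

text \<open>The formal sum \<open>x + s\<^sub>0 y\<close> is the pair \<open>(x, y)\<close>; addition is componentwise.\<close>

definition Valg :: "nat \<Rightarrow> (hecke \<times> hecke) set" where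
  "Valg l = Schur l (Oplus l) (Oplus l) \<times> Schur l (Ominus l) (Oplus l)"

definition Valg_smul :: "laurent \<Rightarrow> hecke \<times> hecke \<Rightarrow> hecke \<times> hecke" where
  "Valg_smul c X = (c \<cdot> fst X, c \<cdot> snd X)"

definition Valg_mult :: "nat \<Rightarrow> hecke \<times> hecke \<Rightarrow> hecke \<times> hecke \<Rightarrow> hecke \<times> hecke" where
  "Valg_mult l X U = (case (X, U) of ((x, y), (u, v)) \<Rightarrow>
     (smult_at l (Oplus l) x u + smult_at l (Ominus l) (hgamma l y) v,
      smult_at l (Oplus l) y u + smult_at l (Ominus l) (hgamma l x) v))"

definition Valg_ring :: "nat \<Rightarrow> (hecke \<times> hecke) ring" where
  "Valg_ring l = \<lparr>carrier = Valg l, monoid.mult = Valg_mult l,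
     one = (klb l (wmax l (Oplus l)), 0), zero = 0, add = (+)\<rparr>"

definition Valg_bar :: "nat \<Rightarrow> hecke \<times> hecke \<Rightarrow> hecke \<times> hecke" where
  "Valg_bar l X = (hbar l (fst X), hbar l (snd X))"

definition Valg_b :: "nat \<Rightarrow> hecke \<times> hecke" where
  "Valg_b l = (0, bcan l (Ominus l) id (Oplus l))"

definition Valg_form :: "nat \<Rightarrow> hecke \<times> hecke \<Rightarrow> hecke \<times> hecke \<Rightarrow> laurent" where
  "Valg_form l X U = sform l (Oplus l) (fst X) (fst U) + sform l (Ominus l) (snd X) (snd U)"

definition Valg_std :: "nat \<Rightarrow> nat \<Rightarrow> hecke \<times> hecke" where
  "Valg_std l n = (if even n then (hstd l (Oplus l) (dperm n) (Oplus l), 0)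
     else (0, hstd l (Ominus l) (srefl 0 \<circ> dperm n) (Oplus l)))"

definition Valg_can :: "nat \<Rightarrow> nat \<Rightarrow> hecke \<times> hecke" where
  "Valg_can l n = (if even n then (bcan l (Oplus l) (dperm n) (Oplus l), 0)
     else (0, bcan l (Ominus l) (srefl 0 \<circ> dperm n) (Oplus l)))"

text \<open>Maps on \<open>V(l)\<close> are normalised to be undefined outside, so that uniqueness makes sense.\<close>

definition module_iso :: "nat \<Rightarrow> ((nat \<Rightarrow>\<^sub>0 laurent) \<Rightarrow> hecke \<times> hecke) \<Rightarrow> bool" where
  "module_iso l \<phi> \<longleftrightarrow> \<phi> \<in> extensional (Vmod l) \<and> bij_betw \<phi> (Vmod l) (Valg l)
     \<and> (\<forall>v\<in>Vmod l. \<forall>w\<in>Vmod l. \<phi> (v + w) = \<phi> v + \<phi> w)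
     \<and> (\<forall>c. \<forall>v\<in>Vmod l. \<phi> (c \<cdot> v) = Valg_smul c (\<phi> v))"

definition matches_bases :: "nat \<Rightarrow> nat \<Rightarrow> ((nat \<Rightarrow>\<^sub>0 laurent) \<Rightarrow> hecke \<times> hecke) \<Rightarrow> bool" where
  "matches_bases t l \<phi> \<longleftrightarrow> (\<forall>n\<le>l. \<phi> (Vbar l (feta l (int n))) = Valg_std l n
     \<and> \<phi> (Ui_act l (bdiv t n) (eta l)) = Valg_can l n)"

end

theory Submission
  imports Defs
begin

text \<open>
  The isomorphism is the composite of the bar involution of \<open>V(l)\<close> with the antilinear map
  \<open>\<psi>\<close> from \<open>V(l)\<close> to \<open>V\<close> that sends \<open>f\<^sup>(\<^sup>n\<^sup>)\<eta>\<close> to the standard element \<open>h\<^sub>n\<close> of the \<open>n\<close>-th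
  double coset. Everything rests on one computation in the Hecke algebra,
  \<open>b * h\<^sub>n = [n + 1] h\<^bsub>n+1\<^esub> + q\<^bsup>l+1-2n\<^esup> [l - n + 1] h\<^bsub>n-1\<^esub>\<close>
  (\<open>Afun_hfun\<close>, \<open>a_elt_hst\<close>). It is the bar conjugate of the action of \<open>b\<close> on \<open>V(l)\<close>, so \<open>\<psi>\<close>
  commutes with \<open>b\<close> (\<open>psi_bop\<close>).

  For this computation the Weyl group is placed in the group of all signed permutations, with
  the number of inversions of type D as length. There \<open>s\<^sub>0\<close> has length zero, and the double
  cosets become the classes of signed permutations with exactly \<open>n\<close> negative entries; the parity
  of \<open>n\<close> distinguishes the two summands of \<open>V\<close>. Multiplication by \<open>b\<close> is multiplication by the
  sum of the products \<open>s\<^sub>j \<dots> s\<^sub>1\<close> with suitable powers of \<open>q\<close>, preceded by \<open>s\<^sub>0\<close>.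
  Up to a power of \<open>q\<close> given by the length, the coefficients after \<open>j\<close> steps depend only on
  the positions of the negative signs (\<open>twf_s0_hfun\<close>).

  Canonical bases. The divided powers satisfy a three-term recursion (\<open>bdiv_rec\<close>). Its solution in
  \<open>V(l)\<close> is given by Gaussian binomials in \<open>q\<^sup>-\<^sup>4\<close> (\<open>bop_can_vec\<close>, \<open>Act_bdiv\<close>), from which one
  reads off that the \<open>b\<^sup>(\<^sup>n\<^sup>)\<eta>\<close> form a basis and that, after the bar, their lower
  coefficients lie in \<open>q\<int>[q]\<close>. Since \<open>b\<close> is a Kazhdan--Lusztig element, multiplication by it
  commutes with the bar involution of \<open>V\<close>, so by the recursion the images under \<open>\<psi>\<close> are
  bar-invariant (\<open>hbar_ps_can_vec\<close>). A bar-invariant element that is unitriangular in the standard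
  elements is a Kazhdan--Lusztig element (\<open>KL_cond_comb\<close>).

  Algebra structure. Because \<open>b * (X * Y) = (b * X) * Y\<close>, the map \<open>\<phi>\<close> turns the action of a
  polynomial \<open>u\<close> in \<open>b\<close> into multiplication by \<open>\<phi> (u \<eta>)\<close> (\<open>Phi_pact\<close>), and this is
  multiplicativity on \<open>U/Ann(\<eta>)\<close>.

  Form. The trace form is the standard inner product of coefficients, for which generators
  are self-adjoint and standard elements of different classes are orthogonal; moving \<open>s\<^sub>0\<close> to the
  other side of the form determines the norms recursively (\<open>norm_rec\<close>).

  The Hecke algebra is only given by its generators acting on the left. Its associativity and the
  independence of reduced words come from the fact that these operators commute with the
  analogous ones on the right (\<open>T_Rm_commute\<close>).
\<close>

section \<open>Free modules over the Laurent polynomials\<close>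

abbreviation lk :: "('a \<Rightarrow>\<^sub>0 'b::zero) \<Rightarrow> 'a \<Rightarrow> 'b" where
  "lk \<equiv> Poly_Mapping.lookup"

abbreviation zeta :: laurent where
  "zeta \<equiv> qpow 1 - qpow (- 1)"

lemma smul_add_right: "c \<cdot> (v + w) = c \<cdot> v + c \<cdot> (w :: 'a \<Rightarrow>\<^sub>0 'r::semiring_0)"
  by (rule poly_mapping_eqI) (simp add: lookup_smul lookup_add distrib_left)

lemma smul_add_left: "(c + d) \<cdot> v = c \<cdot> v + d \<cdot> (v :: 'a \<Rightarrow>\<^sub>0 'r::semiring_0)"
  by (rule poly_mapping_eqI) (simp add: lookup_smul lookup_add distrib_right)

lemma smul_smul [simp]: "c \<cdot> d \<cdot> v = (c * d) \<cdot> (v :: 'a \<Rightarrow>\<^sub>0 'r::semiring_0)"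
  by (rule poly_mapping_eqI) (simp add: lookup_smul mult.assoc)

lemma smul_zero_right [simp]: "c \<cdot> 0 = (0 :: 'a \<Rightarrow>\<^sub>0 'r::semiring_0)"
  by (rule poly_mapping_eqI) (simp add: lookup_smul)

lemma smul_zero_left [simp]: "0 \<cdot> v = (0 :: 'a \<Rightarrow>\<^sub>0 'r::semiring_0)"
  by (rule poly_mapping_eqI) (simp add: lookup_smul)

lemma smul_one [simp]: "1 \<cdot> v = (v :: 'a \<Rightarrow>\<^sub>0 'r::semiring_1)"
  by (rule poly_mapping_eqI) (simp add: lookup_smul)

lemma smul_minus_left: "(- c) \<cdot> v = - (c \<cdot> (v :: 'a \<Rightarrow>\<^sub>0 'r::ring))"
  by (rule poly_mapping_eqI) (simp add: lookup_smul)

lemma smul_sum_right: "c \<cdot> (\<Sum>a\<in>A. f a) = (\<Sum>a\<in>A. c \<cdot> (f a :: 'a \<Rightarrow>\<^sub>0 'r::semiring_0))"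
  by (rule poly_mapping_eqI) (simp add: lookup_smul lookup_sum sum_distrib_left)

lemma smul_sum_left: "(\<Sum>a\<in>A. f a) \<cdot> v = (\<Sum>a\<in>A. f a \<cdot> (v :: 'a \<Rightarrow>\<^sub>0 'r::semiring_0))"
  by (rule poly_mapping_eqI) (simp add: lookup_smul lookup_sum sum_distrib_right)

lemma smul_cancel:
  fixes v w :: "'a \<Rightarrow>\<^sub>0 'r::idom"
  assumes "c \<cdot> v = c \<cdot> w" "c \<noteq> 0"
  shows "v = w"
proof (rule poly_mapping_eqI)
  fix k
  have "c * lk v k = c * lk w k"
    using arg_cong[OF assms(1), of "\<lambda>x. lk x k"] by (simp add: lookup_smul)
  with assms(2) show "lk v k = lk w k" by simp
qed

lemma keys_smul: "Poly_Mapping.keys (c \<cdot> v) \<subseteq> Poly_Mapping.keys (v :: 'a \<Rightarrow>\<^sub>0 'r::semiring_0)"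
  by (auto simp: in_keys_iff lookup_smul)

lemma qbar_lookup: "lk (qbar p) k = lk p (- k)"
  by (simp add: qbar_def map_key.rep_eq)

lemma qbar_add: "qbar (p + r) = qbar p + qbar r"
  by (rule poly_mapping_eqI) (simp add: qbar_lookup lookup_add)

lemma qbar_zero [simp]: "qbar 0 = 0"
  by (rule poly_mapping_eqI) (simp add: qbar_lookup)

lemma qbar_diff: "qbar (p - r) = qbar p - qbar r"
  by (rule poly_mapping_eqI) (simp add: qbar_lookup lookup_minus)

lemma qbar_qbar [simp]: "qbar (qbar p) = p"
  by (rule poly_mapping_eqI) (simp add: qbar_lookup)

lemma qbar_sum: "qbar (sum f A) = (\<Sum>a\<in>A. qbar (f a))"
  by (rule poly_mapping_eqI) (simp add: qbar_lookup lookup_sum)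

lemma qbar_single: "qbar (Poly_Mapping.single k c) = Poly_Mapping.single (- k) c"
  by (rule poly_mapping_eqI) (auto simp: qbar_lookup lookup_single when_def)

lemma qbar_qpow [simp]: "qbar (qpow k) = qpow (- k)"
  by (simp add: qpow_def qbar_single)

lemma poly_mapping_sum_single:
  fixes v :: "'a \<Rightarrow>\<^sub>0 'b::comm_monoid_add"
  shows "(\<Sum>k\<in>Poly_Mapping.keys v. Poly_Mapping.single k (lk v k)) = v"
proof (rule poly_mapping_eqI)
  fix k
  have "lk (\<Sum>k\<in>Poly_Mapping.keys v. Poly_Mapping.single k (lk v k)) k
      = (\<Sum>j\<in>Poly_Mapping.keys v. if j = k then lk v j else 0)"
    by (simp add: lookup_sum lookup_single when_def)
  also have "\<dots> = lk v k"
    by (simp add: in_keys_iff)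
  finally show "lk (\<Sum>k\<in>Poly_Mapping.keys v. Poly_Mapping.single k (lk v k)) k = lk v k" .
qed

text \<open>Both sides are biadditive, so the claim reduces to a product of two monomials.\<close>

lemma qbar_mult: "qbar (p * r) = qbar p * qbar r"
proof -
  let ?S = "\<lambda>p. \<Sum>k\<in>Poly_Mapping.keys p. Poly_Mapping.single k (lk p k)"
  have "qbar (?S p * ?S r) = qbar (?S p) * qbar (?S r)"
    by (simp add: sum_product qbar_sum mult_single qbar_single add.commute)
  then show ?thesis by (simp only: poly_mapping_sum_single)
qed

lemma qbar_one [simp]: "qbar 1 = 1"
  by (rule poly_mapping_eqI) (auto simp: qbar_lookup lookup_one when_def)

lemma qbar_eq_0_iff [simp]: "qbar p = 0 \<longleftrightarrow> p = 0"
  by (metis qbar_qbar qbar_zero)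

lemma qpow_0 [simp]: "qpow 0 = 1"
  by (simp add: qpow_def)

lemma qpow_neq_0 [simp]: "qpow k \<noteq> 0"
  by (metis keys_single keys_zero qpow_def insert_not_empty zero_neq_one)

lemma qpow_mult_left: "qpow a * (qpow b * c) = qpow (a + b) * c"
  by (simp add: qpow_mult flip: mult.assoc)

lemma qZq_iff: "p \<in> qZq \<longleftrightarrow> (\<forall>k < 1. lk p k = 0)"
  by (force simp: qZq_def in_keys_iff not_le subset_iff)

lemma zero_in_qZq [simp]: "0 \<in> qZq"
  by (simp add: qZq_def)

lemma qpow_in_qZq: "k \<ge> 1 \<Longrightarrow> qpow k \<in> qZq"
  by (simp add: qZq_def qpow_def)

lemma qZq_mult_nonneg: "p \<in> qZq \<Longrightarrow> Poly_Mapping.keys r \<subseteq> {0..} \<Longrightarrow> p * r \<in> qZq"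
  unfolding qZq_def using keys_mult[of p r] by fastforce

lemma keys_qpow [simp]: "Poly_Mapping.keys (qpow k) = {k}"
  by (simp add: qpow_def)

text \<open>The bar exchanges positive and negative degrees, so invariance forbids a polynomial
  with positive degrees only: this is what makes canonical bases unique.\<close>

lemma qbar_invariant_qZq_eq_0:
  assumes "qbar p = p" "p \<in> qZq"
  shows "p = 0"
proof (rule poly_mapping_eqI)
  fix k
  have "lk p k = lk p (- k)" using assms(1) qbar_lookup[of p k] by simp
  moreover have "k < 1 \<or> - k < 1" by linarith
  ultimately show "lk p k = lk 0 k"
    using assms(2) by (auto simp: qZq_iff)
qed

subsection \<open>Linear and antilinear extension\<close>

lemma linear_ext_superset:
  assumes "finite A" "Poly_Mapping.keys v \<subseteq> A"
  shows "linear_ext g v = (\<Sum>a\<in>A. lk v a \<cdot> g a)"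
  unfolding linear_ext_def
  by (rule sum.mono_neutral_left) (use assms in \<open>auto simp: in_keys_iff\<close>)

lemma linear_ext_add: "linear_ext g (v + w) = linear_ext g v + linear_ext g w"
proof -
  let ?A = "Poly_Mapping.keys v \<union> Poly_Mapping.keys w"
  have "Poly_Mapping.keys (v + w) \<subseteq> ?A" by (rule Poly_Mapping.keys_add)
  then show ?thesis
    by (simp add: linear_ext_superset[of ?A] lookup_add smul_add_left sum.distrib)
qed

lemma linear_ext_smul: "linear_ext g (c \<cdot> v) = c \<cdot> linear_ext g v"
  by (subst linear_ext_superset[OF _ keys_smul[of c v]])
    (simp_all add: linear_ext_def lookup_smul smul_sum_right)

lemma linear_ext_zero [simp]: "linear_ext g 0 = 0"
  by (simp add: linear_ext_def)

lemma linear_ext_diff: "linear_ext g (v - w) = linear_ext g v - linear_ext g w"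
proof -
  have "linear_ext g (v - w) + linear_ext g w = linear_ext g v"
    by (simp flip: linear_ext_add)
  then show ?thesis by (simp add: algebra_simps)
qed

lemma linear_ext_sum: "linear_ext g (\<Sum>a\<in>A. f a) = (\<Sum>a\<in>A. linear_ext g (f a))"
  by (induction A rule: infinite_finite_induct) (simp_all add: linear_ext_add)

lemma linear_ext_single [simp]: "linear_ext g (Poly_Mapping.single a c) = c \<cdot> g a"
  by (cases "c = 0") (simp_all add: linear_ext_def)

lemma antilinear_ext_superset:
  assumes "finite A" "Poly_Mapping.keys v \<subseteq> A"
  shows "antilinear_ext g v = (\<Sum>a\<in>A. qbar (lk v a) \<cdot> g a)"
  unfolding antilinear_ext_def
  by (rule sum.mono_neutral_left) (use assms in \<open>auto simp: in_keys_iff\<close>)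

lemma antilinear_ext_add: "antilinear_ext g (v + w) = antilinear_ext g v + antilinear_ext g w"
proof -
  let ?A = "Poly_Mapping.keys v \<union> Poly_Mapping.keys w"
  have "Poly_Mapping.keys (v + w) \<subseteq> ?A" by (rule Poly_Mapping.keys_add)
  then show ?thesis
    by (simp add: antilinear_ext_superset[of ?A] lookup_add qbar_add smul_add_left sum.distrib)
qed

lemma antilinear_ext_smul: "antilinear_ext g (c \<cdot> v) = qbar c \<cdot> antilinear_ext g v"
  by (subst antilinear_ext_superset[OF _ keys_smul[of c v]])
    (simp_all add: antilinear_ext_def lookup_smul qbar_mult smul_sum_right)

lemma antilinear_ext_zero [simp]: "antilinear_ext g 0 = 0"
  by (simp add: antilinear_ext_def)

lemma antilinear_ext_diff: "antilinear_ext g (v - w) = antilinear_ext g v - antilinear_ext g w"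
proof -
  have "antilinear_ext g (v - w) + antilinear_ext g w = antilinear_ext g v"
    by (simp flip: antilinear_ext_add)
  then show ?thesis by (simp add: algebra_simps)
qed

lemma antilinear_ext_sum: "antilinear_ext g (\<Sum>a\<in>A. f a) = (\<Sum>a\<in>A. antilinear_ext g (f a))"
  by (induction A rule: infinite_finite_induct) (simp_all add: antilinear_ext_add)

lemma antilinear_ext_single [simp]:
  "antilinear_ext g (Poly_Mapping.single a c) = qbar c \<cdot> g a"
  by (cases "c = 0") (simp_all add: antilinear_ext_def)

section \<open>Quantum integers and binomials\<close>

lemma zeta_mult_qint: "zeta * qint (int n) = qpow (int n) - qpow (- int n)"
proof -
  let ?f = "\<lambda>i. qpow (int n - 2 * int i)"
  have "zeta * (\<Sum>i<n. qpow (int n - 1 - 2 * int i)) = (\<Sum>i<n. ?f i - ?f (Suc i))"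
    by (simp add: sum_distrib_left left_diff_distrib qpow_mult algebra_simps)
  also have "\<dots> = qpow (int n) - qpow (- int n)"
    by (subst sum_lessThan_telescope') simp
  finally show ?thesis by (simp add: qint_eq_sum)
qed

lemma zeta_cancel: "zeta * a = zeta * b \<Longrightarrow> a = b"
  using qpow_diff_neq_0 by simp

lemma qint_0 [simp]: "qint 0 = 0"
  using qint_eq_sum[of 0] by simp

lemma qint_1 [simp]: "qint 1 = 1"
  using qint_eq_sum[of 1] by simp

lemma qint_neq_0:
  assumes "n > 0"
  shows "qint n \<noteq> 0"
proof
  assume "qint n = 0"
  then have "qpow n - qpow (- n) = 0"
    using zeta_mult_qint[of "nat n"] assms by simp
  then have "lk (qpow n - qpow (- n)) n = 0" by simp
  with assms show False by (simp add: qpow_def lookup_minus lookup_single)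
qed

lemma qbar_qint [simp]: "qbar (qint (int n)) = qint (int n)"
proof (rule zeta_cancel)
  have "qbar (zeta * qint (int n)) = - (zeta * qint (int n))"
    by (simp only: zeta_mult_qint qbar_diff qbar_qpow) simp
  then show "zeta * qbar (qint (int n)) = zeta * qint (int n)"
    by (simp add: qbar_mult qbar_diff algebra_simps)
qed

lemma qbar_qint_pos [simp]: "n \<ge> 0 \<Longrightarrow> qbar (qint n) = qint n"
  using qbar_qint[of "nat n"] by simp

lemma qint_add:
  "qint (int m + int n) = qpow (int n) * qint (int m) + qpow (- int m) * qint (int n)"
proof (rule zeta_cancel)
  have *: "zeta * (a * b) = a * (zeta * b)" for a b by simp
  show "zeta * qint (int m + int n)
      = zeta * (qpow (int n) * qint (int m) + qpow (- int m) * qint (int n))"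
    unfolding distrib_left[of zeta] * zeta_mult_qint zeta_mult_qint[of "m + n", simplified]
    by (simp add: right_diff_distrib qpow_mult algebra_simps)
qed

lemma qfact_0 [simp]: "qfact 0 = 1"
  by (simp add: qfact_def)

lemma qfact_Suc: "qfact (Suc n) = qint (int n + 1) * qfact n"
  by (simp add: qfact_def add.commute)

lemma qfact_neq_0 [simp]: "qfact n \<noteq> 0"
  by (induction n) (auto simp: qfact_Suc qint_neq_0)

text \<open>Induction along the rule that writes \<open>[m + n]\<close> as a combination of \<open>[m]\<close> and \<open>[n]\<close>.
  The divisibility is what makes the quotient in the definition of \<open>qbinom\<close> an actual one.\<close>

lemma qfact_dvd: "qfact m * qfact n dvd qfact (m + n)"
proof (induction "m + n" arbitrary: m n)
  case (Suc k)
  show ?case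
  proof (cases "m = 0 \<or> n = 0")
    case False
    then obtain m' n' where mn: "m = Suc m'" "n = Suc n'"
      by (metis not0_implies_Suc)
    have "qfact m' * qfact n dvd qfact (m' + n)" "qfact m * qfact n' dvd qfact (m + n')"
      using Suc(1)[of m' n] Suc(1)[of m n'] Suc(2) mn by auto
    then have "qint (int m) * (qfact m' * qfact n) dvd qint (int m) * qfact k"
      "qint (int n) * (qfact m * qfact n') dvd qint (int n) * qfact k"
      using Suc(2) mn by (auto intro!: mult_dvd_mono)
    then have "qfact m * qfact n dvd qint (int m) * qfact k" "qfact m * qfact n dvd qint (int n) * qfact k"
      by (simp_all add: mn qfact_Suc ac_simps)
    then have "qfact m * qfact n
        dvd qpow (int n) * (qint (int m) * qfact k) + qpow (- int m) * (qint (int n) * qfact k)"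
      by (intro dvd_add) (auto intro: dvd_mult)
    also have "\<dots> = qint (int m + int n) * qfact k"
      by (simp add: qint_add distrib_right mult.assoc)
    also have "\<dots> = qfact (m + n)"
      using Suc(2) qfact_Suc[of k] by (simp flip: Suc(2) of_nat_add) (simp add: add.commute)
    finally show ?thesis .
  qed auto
qed auto

lemma qbinom_fact:
  assumes "n \<le> l"
  shows "qfact n * qfact (l - n) * qbinom l n = qfact l"
proof -
  obtain c where "qfact l = qfact n * qfact (l - n) * c"
    using qfact_dvd[of n "l - n"] assms by auto
  then show ?thesis
    by (simp add: qbinom_def exact_quot_mult)
qed

lemma qbinom_0: "qbinom l 0 = 1"
  using qbinom_fact[of 0 l] by simp

lemma qbinom_Suc:
  assumes "n < l"
  shows "qint (int n + 1) * qbinom l (Suc n) = qint (int l - int n) * qbinom l n"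
proof -
  have l: "qfact (l - n) = qint (int l - int n) * qfact (l - Suc n)"
    using qfact_Suc[of "l - Suc n"] assms by (simp add: Suc_diff_Suc of_nat_diff algebra_simps)
  have "qfact n * qfact (l - Suc n) * (qint (int n + 1) * qbinom l (Suc n)) = qfact l"
    using qbinom_fact[of "Suc n" l] assms by (simp add: qfact_Suc ac_simps)
  also have "\<dots> = qfact n * qfact (l - Suc n) * (qint (int l - int n) * qbinom l n)"
    using qbinom_fact[of n l] assms by (simp add: l ac_simps)
  finally show ?thesis by simp
qed

section \<open>The canonical basis of \<open>V(l)\<close>\<close>

lemma Vmod_zero [simp]: "0 \<in> Vmod l"
  and Vmod_add: "v \<in> Vmod l \<Longrightarrow> w \<in> Vmod l \<Longrightarrow> v + w \<in> Vmod l"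
  and Vmod_smul: "v \<in> Vmod l \<Longrightarrow> c \<cdot> v \<in> Vmod l"
  using Poly_Mapping.keys_add[of v w] keys_smul[of c v] by (auto simp: Vmod_def)

lemma Vmod_sum: "(\<And>a. a \<in> A \<Longrightarrow> f a \<in> Vmod l) \<Longrightarrow> sum f A \<in> Vmod l"
  by (induction A rule: infinite_finite_induct) (auto intro: Vmod_add)

lemma Vmod_lookup: "v \<in> Vmod l \<Longrightarrow> m > l \<Longrightarrow> lk v m = 0"
  by (force simp: Vmod_def in_keys_iff)

lemma feta_Vmod: "feta l n \<in> Vmod l"
  by (auto simp: feta_def Vmod_def)

lemma lookup_feta: "lk (feta l n) m = (if n = int m \<and> m \<le> l then 1 else 0)"
  by (auto simp: feta_def lookup_single when_def)

lemma eta_Vmod: "eta l \<in> Vmod l"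
  by (simp add: eta_def feta_Vmod)

lemma Vmod_expand: "v \<in> Vmod l \<Longrightarrow> v = (\<Sum>n\<le>l. lk v n \<cdot> feta l (int n))"
proof (rule poly_mapping_eqI)
  fix k assume v: "v \<in> Vmod l"
  have "lk (\<Sum>n\<le>l. lk v n \<cdot> feta l (int n)) k = (\<Sum>n\<le>l. if n = k then lk v k else 0)"
    unfolding lookup_sum by (rule sum.cong) (auto simp: lookup_smul lookup_feta)
  then show "lk v k = lk (\<Sum>n\<le>l. lk v n \<cdot> feta l (int n)) k"
    using v by (simp add: Vmod_lookup)
qed

lemma bop_zero [simp]: "bop l 0 = 0"
  by (simp add: bop_def)

lemma bop_smul: "bop l (c \<cdot> v) = c \<cdot> bop l v"
  by (simp add: bop_def linear_ext_smul)

lemma bop_sum: "bop l (sum f A) = (\<Sum>a\<in>A. bop l (f a))"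
  by (simp add: bop_def linear_ext_sum)

lemma bop_Vmod: "bop l v \<in> Vmod l"
  unfolding bop_def linear_ext_def
  by (intro Vmod_sum Vmod_smul Vmod_add feta_Vmod)

lemma bop_feta:
  assumes "n \<le> l"
  shows "bop l (feta l (int n)) = qint (int n + 1) \<cdot> feta l (int n + 1)
     + (qpow (2 * int n - int l - 1) * qint (int l - int n + 1)) \<cdot> feta l (int n - 1)"
  using assms by (simp add: bop_def feta_def)

lemma lookup_bop:
  assumes "v \<in> Vmod l" "m \<le> l"
  shows "lk (bop l v) m = (if m = 0 then 0 else qint (int m) * lk v (m - 1))
     + qpow (2 * int m + 1 - int l) * qint (int l - int m) * lk v (Suc m)"
proof -
  have "lk (bop l v) m = (\<Sum>n\<le>l. lk v n * (qint (int n + 1) * lk (feta l (int n + 1)) m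
     + qpow (2 * int n - int l - 1) * qint (int l - int n + 1) * lk (feta l (int n - 1)) m))"
    by (subst Vmod_expand[OF assms(1)])
      (simp add: bop_sum bop_smul bop_feta lookup_sum lookup_smul lookup_add)
  also have "\<dots> = (\<Sum>n\<le>l. if n + 1 = m then lk v n * qint (int n + 1) else 0)
     + (\<Sum>n\<le>l. if n = Suc m
         then lk v n * (qpow (2 * int n - int l - 1) * qint (int l - int n + 1)) else 0)"
    unfolding sum.distrib[symmetric]
    by (rule sum.cong) (use assms(2) in \<open>auto simp: lookup_feta algebra_simps\<close>)
  also have "(\<Sum>n\<le>l. if n + 1 = m then lk v n * qint (int n + 1) else 0)
      = (if m = 0 then 0 else qint (int m) * lk v (m - 1))"
    using assms(2) by (cases m) (auto simp: algebra_simps)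
  also have "(\<Sum>n\<le>l. if n = Suc m
         then lk v n * (qpow (2 * int n - int l - 1) * qint (int l - int n + 1)) else 0)
      = qpow (2 * int m + 1 - int l) * qint (int l - int m) * lk v (Suc m)"
    using assms Vmod_lookup[OF assms(1), of "Suc m"]
    by (auto simp: algebra_simps)
  finally show ?thesis .
qed

text \<open>\<open>gauss r k\<close> is the Gaussian binomial of \<open>r + k\<close> over \<open>k\<close> in the variable \<open>q\<^sup>-\<^sup>4\<close>, not
  made symmetric, so that it is a polynomial in that variable.\<close>

fun gauss :: "nat \<Rightarrow> nat \<Rightarrow> laurent" where
  "gauss 0 k = 1"
| "gauss (Suc r) 0 = 1"
| "gauss (Suc r) (Suc k) = gauss r (Suc k) + qpow (- 4 * int (Suc r)) * gauss (Suc r) k"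

lemma gauss_0 [simp]: "gauss r 0 = 1"
  by (cases r) auto

lemma keys_gauss: "Poly_Mapping.keys (gauss r k) \<subseteq> {..0}"
proof (induction r k rule: gauss.induct)
  case (3 r k)
  have "Poly_Mapping.keys (qpow (- 4 * int (Suc r)) * gauss (Suc r) k) \<subseteq> {..0}"
    using 3(2) keys_mult[of "qpow (- 4 * int (Suc r))" "gauss (Suc r) k"] by fastforce
  then show ?case
    using 3(1) Poly_Mapping.keys_add[of "gauss r (Suc k)"
        "qpow (- 4 * int (Suc r)) * gauss (Suc r) k"] by auto
qed auto

abbreviation xfac :: "nat \<Rightarrow> laurent" where
  "xfac k \<equiv> 1 - qpow (- 4 * int k)"

lemma xfac_neq_0: "k > 0 \<Longrightarrow> xfac k \<noteq> 0"
proof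
  assume "k > 0" "xfac k = 0"
  then have "lk (xfac k) 0 = 0" by simp
  with \<open>k > 0\<close> show False by (simp add: lookup_minus qpow_def lookup_single)
qed

lemma xfac_add: "xfac (a + b) = xfac a + qpow (- 4 * int a) * xfac b"
  by (simp add: algebra_simps qpow_mult)

text \<open>The absorption identities for Gaussian binomials. They are proved together because the
  induction step for each of them uses another one.\<close>

lemma gauss_absorb_aux:
  "xfac (Suc k) * gauss r (Suc k) = xfac (Suc r) * gauss (Suc r) k
   \<and> xfac (Suc k) * gauss r (Suc k) = xfac (r + Suc k) * gauss r k
   \<and> xfac (Suc r) * gauss (Suc r) k = xfac (r + Suc k) * gauss r k"
proof (induction r arbitrary: k)
  case 0
  have "xfac (Suc 0) * gauss (Suc 0) k = xfac (Suc k)" for k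
  proof (induction k)
    case (Suc k)
    have "xfac (Suc 0) * gauss (Suc 0) (Suc k)
        = xfac (Suc 0) + qpow (- 4 * int (Suc 0)) * (xfac (Suc 0) * gauss (Suc 0) k)"
      by (simp add: distrib_left mult.left_commute)
    also have "\<dots> = xfac (Suc 0 + Suc k)"
      unfolding Suc by (rule xfac_add[symmetric])
    finally show ?case by simp
  qed simp
  then show ?case by simp
next
  case (Suc r)
  have A1: "xfac (Suc k) * gauss (Suc r) (Suc k) = xfac (Suc r + Suc k) * gauss (Suc r) k" for k
  proof -
    have "xfac (Suc k) * gauss (Suc r) (Suc k)
        = xfac (Suc k) * gauss r (Suc k) + qpow (- 4 * int (Suc r)) * xfac (Suc k) * gauss (Suc r) k"
      by (simp only: gauss.simps distrib_left ac_simps)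
    also have "\<dots> = (xfac (Suc r) + qpow (- 4 * int (Suc r)) * xfac (Suc k)) * gauss (Suc r) k"
      using Suc[of k] by (simp only: distrib_right)
    finally show ?thesis by (simp only: xfac_add)
  qed
  have A3: "xfac (Suc (Suc r)) * gauss (Suc (Suc r)) k = xfac (Suc r + Suc k) * gauss (Suc r) k"
  proof (induction k)
    case (Suc k)
    have "xfac (Suc (Suc r)) * gauss (Suc (Suc r)) (Suc k)
      = xfac (Suc (Suc r)) * gauss (Suc r) (Suc k)
        + qpow (- 4 * int (Suc (Suc r))) * (xfac (Suc (Suc r)) * gauss (Suc (Suc r)) k)"
      by (simp only: gauss.simps distrib_left ac_simps)
    also have "xfac (Suc (Suc r)) * gauss (Suc (Suc r)) k = xfac (Suc k) * gauss (Suc r) (Suc k)"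
      by (simp only: Suc A1)
    also have "xfac (Suc (Suc r)) * gauss (Suc r) (Suc k)
          + qpow (- 4 * int (Suc (Suc r))) * (xfac (Suc k) * gauss (Suc r) (Suc k))
        = xfac (Suc (Suc r) + Suc k) * gauss (Suc r) (Suc k)"
      by (simp only: xfac_add[of "Suc (Suc r)" "Suc k"] distrib_right mult.assoc)
    finally show ?case by simp
  qed simp
  show ?case using A1[of k] A3 by simp
qed

lemma gauss_absorb: "xfac (Suc k) * gauss r (Suc k) = xfac (r + Suc k) * gauss r k"
  and gauss_absorb': "xfac (Suc k) * gauss r (Suc k) = xfac (Suc r) * gauss (Suc r) k"
  using gauss_absorb_aux by blast+

text \<open>The coefficient of \<open>f\<^sup>(\<^sup>n\<^sup>-\<^sup>2\<^sup>k\<^sup>)\<eta>\<close> in \<open>b\<^sup>(\<^sup>n\<^sup>)\<eta>\<close>.\<close>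

definition can_coeff :: "nat \<Rightarrow> nat \<Rightarrow> nat \<Rightarrow> laurent" where
  "can_coeff l n k = (if even (l - n) then qpow (- int k * (2 * int k - 1))
     else qpow (- int k * (2 * int k + 1))) * gauss ((l - n) div 2) k"

text \<open>The vector \<open>b\<^sup>(\<^sup>n\<^sup>)\<eta>\<close>, see \<open>Act_bdiv\<close> below. It is set to zero beyond \<open>l\<close>, where the
  divided powers do annihilate \<open>\<eta>\<close>.\<close>

definition can_vec :: "nat \<Rightarrow> nat \<Rightarrow> nat \<Rightarrow>\<^sub>0 laurent" where
  "can_vec l n = (if n \<le> l then \<Sum>k\<le>n div 2. can_coeff l n k \<cdot> feta l (int n - 2 * int k) else 0)"

lemma can_vec_Vmod: "can_vec l n \<in> Vmod l"
  by (simp add: can_vec_def Vmod_sum Vmod_smul feta_Vmod)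

lemma lookup_can_vec:
  assumes "n \<le> l"
  shows "lk (can_vec l n) m
    = (if m \<le> n \<and> even (n - m) then can_coeff l n ((n - m) div 2) else 0)"
proof -
  have "lk (can_vec l n) m
      = (\<Sum>k\<le>n div 2. if m + 2 * k = n then can_coeff l n k else 0)"
    using assms
    by (auto simp: can_vec_def lookup_sum lookup_smul lookup_feta intro!: sum.cong)
  also have "\<dots> = (if m \<le> n \<and> even (n - m) then can_coeff l n ((n - m) div 2) else 0)"
  proof (cases "m \<le> n \<and> even (n - m)")
    case True
    then obtain j where j: "n = m + 2 * j" by (metis evenE le_add_diff_inverse)
    then have "(\<Sum>k\<le>n div 2. if m + 2 * k = n then can_coeff l n k else 0)
        = (\<Sum>k\<le>n div 2. if k = j then can_coeff l n k else 0)"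
      by (intro sum.cong) auto
    also have "\<dots> = can_coeff l n j" using j by simp
    finally show ?thesis using True j by simp
  next
    case False
    then have "m + 2 * k \<noteq> n" for k by auto
    then show ?thesis unfolding if_not_P[OF False] by simp
  qed
  finally show ?thesis .
qed

lemma can_coeff_0 [simp]: "can_coeff l n 0 = 1"
  by (simp add: can_coeff_def)

lemma zeta_mult_qint_mult: "zeta * qint (int n) * c = (qpow (int n) - qpow (- int n)) * c"
  by (simp only: zeta_mult_qint)

lemma lookup_can_vec':
  "lk (can_vec l n) m
    = (if n \<le> l \<and> m \<le> n \<and> even (n - m) then can_coeff l n ((n - m) div 2) else 0)"
  by (cases "n \<le> l") (simp_all add: lookup_can_vec, simp add: can_vec_def)

text \<open>The next two lemmas compare, coefficient by coefficient, the two sides of the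
  recursion in \<open>bop_can_vec\<close>. The parity of \<open>l - n\<close> decides which formula holds for the
  coefficients and whether the first argument \<open>r\<close> of \<open>gauss\<close> drops from \<open>n\<close> to \<open>n + 1\<close>. Here
  it does not, and after multiplication by \<open>zeta\<close> absorption turns all terms into multiples
  of one Gaussian binomial.\<close>

lemma can_rec_odd:
  fixes n r j :: nat
  assumes "n + 1 \<ge> 2 * Suc j"
  defines "l \<equiv> n + 2 * r + 1" and "m \<equiv> n + 1 - 2 * Suc j"
  shows "qint (int n + 1) * can_coeff l (Suc n) (Suc j)
    = qint (int m) * can_coeff l n (Suc j)
      + qpow (2 * int m + 1 - int l) * qint (int l - int m) * can_coeff l n j"
proof (rule zeta_cancel)
  let ?g = "gauss r (Suc j)" and ?h = "gauss r j"
  have m: "int m = int n - 1 - 2 * int j" using assms by (simp add: m_def)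
  have lm: "int l - int m = int (2 * (r + Suc j))" using m by (simp add: l_def)
  have c: "can_coeff l (Suc n) (Suc j) = qpow (- int (Suc j) * (2 * int (Suc j) - 1)) * ?g"
    "can_coeff l n (Suc j) = qpow (- int (Suc j) * (2 * int (Suc j) + 1)) * ?g"
    "can_coeff l n j = qpow (- int j * (2 * int j + 1)) * ?h"
    by (simp_all add: can_coeff_def l_def)
  have "zeta * qint (int l - int m) * ?h = qpow (2 * int (r + Suc j)) * (xfac (r + Suc j) * ?h)"
    unfolding lm zeta_mult_qint_mult by (simp add: algebra_simps qpow_mult qpow_mult_left)
  also have "\<dots> = qpow (2 * int (r + Suc j)) * (xfac (Suc j) * ?g)"
    by (simp only: gauss_absorb)
  finally have h: "zeta * qint (int l - int m) * ?h
    = qpow (2 * int (r + Suc j)) * (xfac (Suc j) * ?g)" .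
  have "zeta * (qint (int m) * can_coeff l n (Suc j)
      + qpow (2 * int m + 1 - int l) * qint (int l - int m) * can_coeff l n j)
    = zeta * qint (int m) * (qpow (- int (Suc j) * (2 * int (Suc j) + 1)) * ?g)
      + qpow (2 * int m + 1 - int l) * qpow (- int j * (2 * int j + 1))
        * (zeta * qint (int l - int m) * ?h)"
    by (simp only: c distrib_left ac_simps)
  also have "\<dots> = (qpow (int m) - qpow (- int m)) * (qpow (- int (Suc j) * (2 * int (Suc j) + 1)) * ?g)
      + qpow (2 * int m + 1 - int l) * qpow (- int j * (2 * int j + 1))
        * (qpow (2 * int (r + Suc j)) * (xfac (Suc j) * ?g))"
    by (simp only: zeta_mult_qint_mult h)
  also have "\<dots> = (qpow (int (n + 1)) - qpow (- int (n + 1)))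
      * (qpow (- int (Suc j) * (2 * int (Suc j) - 1)) * ?g)"
    unfolding m by (simp add: l_def algebra_simps qpow_mult qpow_mult_left)
      (intro disjI2 arg_cong[where f = qpow], simp)
  also have "\<dots> = zeta * (qint (int n + 1) * can_coeff l (Suc n) (Suc j))"
    unfolding c using zeta_mult_qint_mult[of "n + 1"] by (simp only: of_nat_add of_nat_1 mult.assoc)
  finally show "zeta * (qint (int n + 1) * can_coeff l (Suc n) (Suc j))
    = zeta * (qint (int m) * can_coeff l n (Suc j)
      + qpow (2 * int m + 1 - int l) * qint (int l - int m) * can_coeff l n j)" ..
qed

text \<open>Here \<open>r\<close> drops, so that \<open>r = 0\<close> is the boundary case \<open>n = l\<close>. Both Gaussian binomials
  with second argument \<open>Suc j\<close> become multiples of \<open>gauss r j\<close> after multiplication by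
  \<open>xfac (Suc j)\<close>, which is cancelled at the end.\<close>

lemma can_rec_even:
  fixes n r j :: nat
  assumes "n + 1 \<ge> 2 * Suc j"
  defines "l \<equiv> n + 2 * r" and "m \<equiv> n + 1 - 2 * Suc j"
  shows "qint (int n + 1) * (if r = 0 then 0 else can_coeff l (Suc n) (Suc j))
      + qint (int n) * can_coeff l (n - 1) j
    = qint (int m) * can_coeff l n (Suc j)
      + qpow (2 * int m + 1 - int l) * qint (int l - int m) * can_coeff l n j"
proof -
  let ?h = "gauss r j" and ?x = "xfac (Suc j)"
  let ?f = "if r = 0 then 0 else gauss (r - 1) (Suc j)"
  have n: "n \<ge> 1" using assms by simp
  have m: "int m = int n - 1 - 2 * int j" using assms by (simp add: m_def)
  have lm: "int l - int m = int (2 * r + 2 * j + 1)" using m by (simp add: l_def)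
  have f: "?x * ?f = xfac r * ?h"
    using gauss_absorb'[of j "r - 1"] by (cases r) auto
  have c: "(if r = 0 then 0 else can_coeff l (Suc n) (Suc j))
      = qpow (- int (Suc j) * (2 * int (Suc j) + 1)) * ?f"
    "can_coeff l n (Suc j) = qpow (- int (Suc j) * (2 * int (Suc j) - 1)) * gauss r (Suc j)"
    "can_coeff l n j = qpow (- int j * (2 * int j - 1)) * ?h"
    "can_coeff l (n - 1) j = qpow (- int j * (2 * int j + 1)) * ?h"
    using n by (cases r; simp add: can_coeff_def l_def Suc_diff_le)+
  let ?L = "qint (int n + 1) * (if r = 0 then 0 else can_coeff l (Suc n) (Suc j))
      + qint (int n) * can_coeff l (n - 1) j"
  let ?R = "qint (int m) * can_coeff l n (Suc j)
      + qpow (2 * int m + 1 - int l) * qint (int l - int m) * can_coeff l n j"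
  have "zeta * (?x * ?L) = zeta * qint (int (n + 1)) * (qpow (- int (Suc j) * (2 * int (Suc j) + 1)) * (?x * ?f))
      + zeta * qint (int n) * (qpow (- int j * (2 * int j + 1)) * (?x * ?h))"
    by (simp only: c distrib_left ac_simps of_nat_add of_nat_1)
  also have "\<dots> = (qpow (int (n + 1)) - qpow (- int (n + 1)))
        * (qpow (- int (Suc j) * (2 * int (Suc j) + 1)) * (xfac r * ?h))
      + (qpow (int n) - qpow (- int n)) * (qpow (- int j * (2 * int j + 1)) * (?x * ?h))"
    by (simp only: f zeta_mult_qint_mult)
  also have "\<dots> = (qpow (int m) - qpow (- int m)) * (qpow (- int (Suc j) * (2 * int (Suc j) - 1))
        * (xfac (r + Suc j) * ?h))
      + (qpow (int (2 * r + 2 * j + 1)) - qpow (- int (2 * r + 2 * j + 1)))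
        * (qpow (2 * int m + 1 - int l) * qpow (- int j * (2 * int j - 1)) * (?x * ?h))"
    unfolding m by (simp add: l_def algebra_simps qpow_mult qpow_mult_left)
      (intro arg_cong2[where f = "(+)"] arg_cong2[where f = "(*)"] arg_cong[where f = qpow] refl;
        simp)
  also have "\<dots> = zeta * qint (int m) * (qpow (- int (Suc j) * (2 * int (Suc j) - 1))
        * (?x * gauss r (Suc j)))
      + zeta * qint (int l - int m)
        * (qpow (2 * int m + 1 - int l) * qpow (- int j * (2 * int j - 1)) * (?x * ?h))"
    by (simp only: gauss_absorb lm zeta_mult_qint_mult)
  also have "\<dots> = zeta * (?x * ?R)"
    by (simp only: c distrib_left ac_simps)
  finally have "?x * ?L = ?x * ?R" by (rule zeta_cancel)
  then show "?L = ?R" using xfac_neq_0[of "Suc j"] by simp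
qed

lemma bop_can_vec_aux:
  assumes "n \<le> l"
  shows "bop l (can_vec l n) = qint (int n + 1) \<cdot> can_vec l (Suc n)
    + (if even (l - n) \<and> n > 0 then qint (int n) \<cdot> can_vec l (n - 1) else 0)"
proof (rule poly_mapping_eqI)
  fix m
  let ?R = "qint (int n + 1) \<cdot> can_vec l (Suc n)
    + (if even (l - n) \<and> n > 0 then qint (int n) \<cdot> can_vec l (n - 1) else 0)"
  show "lk (bop l (can_vec l n)) m = lk ?R m"
  proof (cases "m \<le> l")
    case False
    have "?R \<in> Vmod l" by (auto intro!: Vmod_add Vmod_smul can_vec_Vmod)
    with False show ?thesis by (simp add: Vmod_lookup[OF bop_Vmod] Vmod_lookup)
  next
    case True
    have R: "lk ?R m = qint (int n + 1) * lk (can_vec l (Suc n)) m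
      + (if even (l - n) \<and> n > 0 then qint (int n) * lk (can_vec l (n - 1)) m else 0)"
      by (simp add: lookup_add lookup_smul)
    note L = lookup_bop[OF can_vec_Vmod True]
    consider "m > n + 1 \<or> odd (n + 1 - m)" | "m = n + 1"
      | j where "n + 1 \<ge> 2 * Suc j" "m = n + 1 - 2 * Suc j"
    proof (cases "m > n + 1 \<or> odd (n + 1 - m)")
      case False
      then have "even (n + 1 - m)" "m \<le> n + 1" by auto
      then obtain i where "n + 1 - m = 2 * i" by (metis evenE)
      then show ?thesis using that(2) that(3)[of "i - 1"] \<open>m \<le> n + 1\<close> by (cases i) auto
    qed (use that in blast)
    then show ?thesis
    proof cases
      case 1
      then have "lk (can_vec l (Suc n)) m = 0" "lk (can_vec l (n - 1)) m = 0 \<or> n = 0"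
        "lk (can_vec l n) (Suc m) = 0" "m = 0 \<or> lk (can_vec l n) (m - 1) = 0"
        by (auto simp: lookup_can_vec' not_le)
      then show ?thesis unfolding L R by auto
    next
      case 2
      with True assms show ?thesis unfolding L R by (auto simp: lookup_can_vec add.commute)
    next
      case (3 j)
      have nz: "n > 0" using 3 by auto
      have e1: "m = 0 \<or> lk (can_vec l n) (m - 1) = can_coeff l n (Suc j)"
      proof (cases "m = 0")
        case False
        then have "n - (m - 1) = 2 * Suc j" "m - 1 \<le> n" using 3 by auto
        then have "lk (can_vec l n) (m - 1) = can_coeff l n (2 * Suc j div 2)"
          by (simp only: lookup_can_vec[OF assms]) simp
        then show ?thesis by simp
      qed simp
      have e: "lk (can_vec l n) (Suc m) = can_coeff l n j"
        "lk (can_vec l (n - 1)) m = can_coeff l (n - 1) j"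
        "n < l \<Longrightarrow> lk (can_vec l (Suc n)) m = can_coeff l (Suc n) (Suc j)"
        using 3 assms by (auto simp: lookup_can_vec)
      have LL: "lk (bop l (can_vec l n)) m = qint (int m) * can_coeff l n (Suc j)
        + qpow (2 * int m + 1 - int l) * qint (int l - int m) * can_coeff l n j"
        unfolding L e(1) using e1 by auto
      show ?thesis
      proof (cases "even (l - n)")
        case ev: True
        then obtain r where r: "l = n + 2 * r" using assms by (metis evenE le_add_diff_inverse)
        have "lk (can_vec l (Suc n)) m = (if r = 0 then 0 else can_coeff l (Suc n) (Suc j))"
          using e(3) r by (auto simp: can_vec_def)
        then show ?thesis
          unfolding R LL e(2)
          using ev nz can_rec_even[OF 3(1), of r, folded 3(2) r]
          by (simp only: simp_thms if_True)
      next
        case od: False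
        then obtain r where r: "l = n + 2 * r + 1" using assms
          by (metis add.assoc le_add_diff_inverse oddE)
        then show ?thesis
          unfolding R LL using od e(3) can_rec_odd[OF 3(1), of r] 3(2) by simp
      qed
    qed
  qed
qed

text \<open>The recursion holds for every \<open>n\<close> because the vectors vanish beyond \<open>l\<close>.\<close>

lemma bop_can_vec:
  "bop l (can_vec l n) = qint (int n + 1) \<cdot> can_vec l (Suc n)
    + (if even (l + n) \<and> n > 0 then qint (int n) \<cdot> can_vec l (n - 1) else 0)"
proof (cases "n \<le> l")
  case True
  then show ?thesis using bop_can_vec_aux[OF True] by simp
next
  case False
  then have "can_vec l n = 0" "can_vec l (Suc n) = 0" by (auto simp: can_vec_def)
  moreover have "can_vec l (n - 1) = 0" if "even (l + n)"
  proof -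
    have "n \<noteq> l + 1" using that by auto
    with False show ?thesis by (auto simp: can_vec_def)
  qed
  ultimately show ?thesis by simp
qed

lemma can_vec_0: "can_vec l 0 = eta l"
  by (simp add: can_vec_def eta_def)

lemma can_vec_top: "n \<le> l \<Longrightarrow> lk (can_vec l n) n = 1"
  by (simp add: lookup_can_vec)

lemma can_vec_above: "n \<le> l \<Longrightarrow> m > n \<Longrightarrow> lk (can_vec l n) m = 0"
  by (simp add: lookup_can_vec)

text \<open>The Gaussian binomial has only nonpositive exponents, and the monomial in front of it
  has a negative one.\<close>

lemma can_coeff_qZq:
  assumes "k > 0"
  shows "qbar (can_coeff l n k) \<in> qZq"
proof -
  have g: "Poly_Mapping.keys (qbar (gauss r k)) \<subseteq> {0..}" for r
    using keys_gauss[of r k] by (force simp: in_keys_iff qbar_lookup)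
  have "int k * (2 * int k - 1) \<ge> 1" "int k * (2 * int k + 1) \<ge> 1"
    using assms by (auto simp: int_one_le_iff_zero_less)
  then show ?thesis
    using qZq_mult_nonneg[OF qpow_in_qZq g] by (auto simp: can_coeff_def qbar_mult)
qed

lemma lookup_can_vec_qZq:
  assumes "n \<le> l" "m \<noteq> n"
  shows "qbar (lk (can_vec l n) m) \<in> qZq" 
    and "lk (can_vec l n) m \<noteq> 0 \<Longrightarrow> m < n \<and> even (n - m)"
proof -
  have "(n - m) div 2 > 0" if nm: "m \<le> n" "even (n - m)"
  proof -
    obtain k where "n - m = 2 * k" using nm(2) by (rule evenE)
    then show ?thesis using nm(1) assms(2) by auto
  qed
  then show "qbar (lk (can_vec l n) m) \<in> qZq"
    using assms by (auto simp: lookup_can_vec intro!: can_coeff_qZq)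
  show "lk (can_vec l n) m \<noteq> 0 \<Longrightarrow> m < n \<and> even (n - m)"
    using assms by (auto simp: lookup_can_vec split: if_splits)
qed

text \<open>Unitriangularity with respect to the divided power vectors.\<close>

lemma can_vec_span:
  assumes "v \<in> Vmod l"
  shows "\<exists>a. v = (\<Sum>n\<le>l. a n \<cdot> can_vec l n)"
proof -
  have "\<exists>a. v = (\<Sum>n\<le>l. a n \<cdot> can_vec l n)" if "N \<le> Suc l" "\<forall>m\<ge>N. lk v m = 0" for N v
    using that
  proof (induction N arbitrary: v)
    case 0
    then have "v = (\<Sum>n\<le>l. 0 \<cdot> can_vec l n)" by (intro poly_mapping_eqI) simp
    then show ?case by (intro exI[of _ "\<lambda>_. 0"])
  next
    case (Suc N)
    let ?w = "v - lk v N \<cdot> can_vec l N"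
    have "lk ?w m = 0" if "m \<ge> N" for m
      using Suc.prems that can_vec_top[of N l] can_vec_above[of N l m]
      by (cases "m = N") (auto simp: lookup_minus lookup_smul)
    then obtain a where a: "?w = (\<Sum>n\<le>l. a n \<cdot> can_vec l n)"
      using Suc by (metis Suc_leD)
    have "v = ?w + lk v N \<cdot> can_vec l N" by simp
    also have "\<dots> = (\<Sum>n\<le>l. a n \<cdot> can_vec l n)
        + (\<Sum>n\<le>l. (if n = N then lk v N \<cdot> can_vec l n else 0))"
      unfolding a using Suc.prems(1) by simp
    also have "\<dots> = (\<Sum>n\<le>l. (a n + (if n = N then lk v N else 0)) \<cdot> can_vec l n)"
      unfolding sum.distrib[symmetric] by (rule sum.cong) (auto simp: smul_add_left)
    finally show ?case by (intro exI[of _ "\<lambda>n. a n + (if n = N then lk v N else 0)"])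
  qed
  from this[of "Suc l" v] assms show ?thesis by (auto simp: Vmod_lookup)
qed

lemma can_vec_indep:
  assumes "(\<Sum>n\<le>l. a n \<cdot> can_vec l n) = (\<Sum>n\<le>l. b n \<cdot> can_vec l n)" "n \<le> l"
  shows "a n = b n"
proof (rule ccontr)
  let ?D = "{n. n \<le> l \<and> a n \<noteq> b n}"
  assume "a n \<noteq> b n"
  with assms(2) have "?D \<noteq> {}" "finite ?D" by auto
  define N where "N = Max ?D"
  have N: "N \<le> l" "a N \<noteq> b N" using Max_in[of ?D] \<open>?D \<noteq> {}\<close> \<open>finite ?D\<close> N_def by auto
  have *: "a k = b k" if "k > N" "k \<le> l" for k
  proof (rule ccontr)
    assume "a k \<noteq> b k"
    with that \<open>finite ?D\<close> have "k \<le> Max ?D" by (intro Max_ge) auto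
    with that show False by (simp add: N_def)
  qed
  have "(\<Sum>n\<le>l. a n * lk (can_vec l n) N) = (\<Sum>n\<le>l. b n * lk (can_vec l n) N)"
    using arg_cong[OF assms(1), of "\<lambda>x. lk x N"] by (simp add: lookup_sum lookup_smul)
  then have "(\<Sum>n\<le>l. (a n - b n) * lk (can_vec l n) N) = 0"
    by (simp add: left_diff_distrib sum_subtractf)
  moreover have "(\<Sum>n\<le>l. (a n - b n) * lk (can_vec l n) N)
      = (\<Sum>n\<le>l. if n = N then a N - b N else 0)"
  proof (rule sum.cong[OF refl])
    fix n assume "n \<in> {..l}"
    then show "(a n - b n) * lk (can_vec l n) N = (if n = N then a N - b N else 0)"
      using * can_vec_top[of N l] can_vec_above[of n l N]
      by (cases n N rule: linorder_cases) auto
  qed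
  ultimately show False using N by simp
qed

subsection \<open>The bar involution\<close>

text \<open>The property that singles out \<open>Vbar l\<close> in its definition.\<close>

definition bar_conditions :: "nat \<Rightarrow> ((nat \<Rightarrow>\<^sub>0 laurent) \<Rightarrow> nat \<Rightarrow>\<^sub>0 laurent) \<Rightarrow> bool" where
  "bar_conditions l \<psi> \<longleftrightarrow> \<psi> \<in> Vmod l \<rightarrow>\<^sub>E Vmod l
     \<and> (\<forall>v\<in>Vmod l. \<forall>w\<in>Vmod l. \<psi> (v + w) = \<psi> v + \<psi> w)
     \<and> (\<forall>c. \<forall>v\<in>Vmod l. \<psi> (c \<cdot> v) = qbar c \<cdot> \<psi> v)
     \<and> \<psi> (eta l) = eta l
     \<and> (\<forall>v\<in>Vmod l. \<psi> (bop l v) = bop l (\<psi> v))"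

text \<open>The recursion determines these vectors from \<open>\<eta>\<close> and \<open>b\<close> with bar-invariant scalars;
  one can divide by \<open>[n + 1]\<close> because the module is torsion-free.\<close>

lemma bar_conditions_can_vec:
  assumes "bar_conditions l \<psi>" "n \<le> l"
  shows "\<psi> (can_vec l n) = can_vec l n"
  using assms(2)
proof (induction n rule: less_induct)
  case (less n)
  note \<psi> = assms(1)[unfolded bar_conditions_def]
  show ?case
  proof (cases n)
    case 0
    then show ?thesis using \<psi> by (simp add: can_vec_0)
  next
    case (Suc m)
    let ?r = "if even (l + m) \<and> m > 0 then qint (int m) \<cdot> can_vec l (m - 1) else 0"
    have m: "\<psi> (can_vec l m) = can_vec l m" using less Suc by simp
    have "\<psi> 0 = 0" using \<psi> Vmod_zero[of l] by (metis add_cancel_right_left)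
    moreover have "\<psi> (can_vec l (m - 1)) = can_vec l (m - 1)" using less Suc by simp
    ultimately have r: "\<psi> ?r = ?r" using \<psi> can_vec_Vmod[of l "m - 1"] by simp
    have rV: "?r \<in> Vmod l" by (simp add: Vmod_smul can_vec_Vmod)
    have cV: "can_vec l n \<in> Vmod l" by (rule can_vec_Vmod)
    have "\<psi> (bop l (can_vec l m)) = bop l (can_vec l m)"
      using \<psi> m can_vec_Vmod[of l m] by metis
    then have "\<psi> (qint (int m + 1) \<cdot> can_vec l n + ?r) = qint (int m + 1) \<cdot> can_vec l n + ?r"
      by (simp only: bop_can_vec Suc)
    moreover have "\<psi> (qint (int m + 1) \<cdot> can_vec l n + ?r)
        = qint (int m + 1) \<cdot> \<psi> (can_vec l n) + ?r"
      using \<psi> rV cV Vmod_smul[OF cV, of "qint (int m + 1)"] r by simp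
    ultimately have "qint (int m + 1) \<cdot> \<psi> (can_vec l n) + ?r = qint (int m + 1) \<cdot> can_vec l n + ?r"
      by (simp only:)
    then have "qint (int m + 1) \<cdot> \<psi> (can_vec l n) = qint (int m + 1) \<cdot> can_vec l n"
      by (rule add_right_imp_eq)
    then show ?thesis by (rule smul_cancel) (simp add: qint_neq_0)
  qed
qed

text \<open>The antilinear map fixing the basis of the \<open>can_vec l n\<close> commutes with \<open>b\<close>, because
  the matrix of \<open>b\<close> in this basis is bar-invariant.\<close>

lemma bar_conditions_exists: "\<exists>\<psi>. bar_conditions l \<psi>"
proof -
  define co where "co v = (SOME a. v = (\<Sum>n\<le>l. a n \<cdot> can_vec l n))" for v
  define \<psi> where "\<psi> = (\<lambda>v\<in>Vmod l. \<Sum>n\<le>l. qbar (co v n) \<cdot> can_vec l n)"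
  have \<psi>: "\<psi> (\<Sum>n\<le>l. a n \<cdot> can_vec l n) = (\<Sum>n\<le>l. qbar (a n) \<cdot> can_vec l n)" for a
  proof -
    define v where "v = (\<Sum>n\<le>l. a n \<cdot> can_vec l n)"
    have V: "v \<in> Vmod l" unfolding v_def by (intro Vmod_sum Vmod_smul can_vec_Vmod)
    have "v = (\<Sum>n\<le>l. co v n \<cdot> can_vec l n)"
      unfolding co_def by (rule someI[of "\<lambda>b. v = (\<Sum>n\<le>l. b n \<cdot> can_vec l n)" a]) (rule v_def)
    then have "co v n = a n" if "n \<le> l" for n
      using can_vec_indep[where a = "co v" and b = a and l = l and n = n] that by (simp add: v_def)
    then have "\<psi> v = (\<Sum>n\<le>l. qbar (a n) \<cdot> can_vec l n)"
      by (simp add: \<psi>_def V)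
    then show ?thesis by (simp only: v_def)
  qed
  have add: "\<psi> (v + w) = \<psi> v + \<psi> w" if vw: "v \<in> Vmod l" "w \<in> Vmod l" for v w
  proof -
    obtain a b where ab: "v = (\<Sum>n\<le>l. a n \<cdot> can_vec l n)" "w = (\<Sum>n\<le>l. b n \<cdot> can_vec l n)"
      using can_vec_span vw by blast
    have "v + w = (\<Sum>n\<le>l. (a n + b n) \<cdot> can_vec l n)"
      by (simp add: ab smul_add_left sum.distrib)
    then show ?thesis
      by (simp only: \<psi>) (simp add: ab \<psi> smul_add_left sum.distrib qbar_add)
  qed
  have smul: "\<psi> (c \<cdot> v) = qbar c \<cdot> \<psi> v" if v: "v \<in> Vmod l" for c v
  proof -
    obtain a where a: "v = (\<Sum>n\<le>l. a n \<cdot> can_vec l n)" using can_vec_span v by blast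
    have "c \<cdot> v = (\<Sum>n\<le>l. (c * a n) \<cdot> can_vec l n)" by (simp add: a smul_sum_right)
    then show ?thesis by (simp only: \<psi>) (simp add: a \<psi> smul_sum_right qbar_mult)
  qed
  have fixc: "\<psi> (can_vec l n) = can_vec l n" for n
  proof (cases "n \<le> l")
    case True
    have "can_vec l n = (\<Sum>k\<le>l. (if k = n then 1 else 0) \<cdot> can_vec l k)"
      using True by (simp add: if_distrib[of "\<lambda>c. c \<cdot> _"] cong: if_cong)
    moreover have "\<psi> (\<Sum>k\<le>l. (if k = n then 1 else 0) \<cdot> can_vec l k)
        = (\<Sum>k\<le>l. (if k = n then 1 else 0) \<cdot> can_vec l k)"
      unfolding \<psi> by (rule sum.cong) auto
    ultimately show ?thesis by simp
  next
    case False
    then show ?thesis using \<psi>[of "\<lambda>_. 0"] by (simp add: can_vec_def)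
  qed
  have fix_bop: "\<psi> (bop l (can_vec l n)) = bop l (can_vec l n)" for n
    using add smul fixc fixc[of "Suc l"]
    by (simp add: bop_can_vec Vmod_smul can_vec_Vmod can_vec_def[of l "Suc l"])
  have sum: "\<psi> (\<Sum>n\<in>A. f n) = (\<Sum>n\<in>A. \<psi> (f n))" if "finite A" "\<And>n. f n \<in> Vmod l" for A :: "nat set" and f
    using that fixc[of "Suc l"]
    by (induction A rule: finite_induct) (simp_all add: add Vmod_sum can_vec_def)
  have "\<psi> (bop l v) = bop l (\<psi> v)" if v: "v \<in> Vmod l" for v
  proof -
    obtain a where a: "v = (\<Sum>n\<le>l. a n \<cdot> can_vec l n)" using can_vec_span v by blast
    then show ?thesis
      by (simp add: bop_sum bop_smul sum smul Vmod_smul bop_Vmod fix_bop \<psi>)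
  qed
  moreover have "\<psi> \<in> Vmod l \<rightarrow>\<^sub>E Vmod l"
    by (auto simp: \<psi>_def intro!: Vmod_sum Vmod_smul can_vec_Vmod)
  ultimately have "bar_conditions l \<psi>"
    unfolding bar_conditions_def using add smul fixc[of 0] by (simp add: can_vec_0)
  then show ?thesis by blast
qed

lemma bar_conditions_sum:
  assumes "bar_conditions l \<psi>" "finite A" "\<And>n. n \<in> A \<Longrightarrow> f n \<in> Vmod l"
  shows "\<psi> (\<Sum>n\<in>A. f n) = (\<Sum>n\<in>A. \<psi> (f n))"
  using assms(2,3)
proof (induction A rule: finite_induct)
  case empty
  show ?case using assms(1) Vmod_zero[of l] unfolding bar_conditions_def sum.empty
    by (metis add_cancel_right_left)
next
  case (insert x A)
  moreover have "sum f A \<in> Vmod l" using insert by (intro Vmod_sum) auto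
  ultimately show ?case using assms(1) by (simp add: bar_conditions_def)
qed

lemma bar_conditions_unique:
  assumes "bar_conditions l \<psi>" "bar_conditions l \<psi>'"
  shows "\<psi> = \<psi>'"
proof (rule PiE_ext)
  show "\<psi> \<in> Vmod l \<rightarrow>\<^sub>E Vmod l" "\<psi>' \<in> Vmod l \<rightarrow>\<^sub>E Vmod l"
    using assms by (auto simp: bar_conditions_def)
  fix v assume "v \<in> Vmod l"
  then obtain a where a: "v = (\<Sum>n\<le>l. a n \<cdot> can_vec l n)" using can_vec_span by blast
  have *: "\<psi> v = (\<Sum>n\<le>l. qbar (a n) \<cdot> can_vec l n)" if "bar_conditions l \<psi>" for \<psi>
    unfolding a using bar_conditions_can_vec[OF that] that
    by (simp add: bar_conditions_sum[OF that] Vmod_smul can_vec_Vmod bar_conditions_def)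
  show "\<psi> v = \<psi>' v" using *[OF assms(1)] *[OF assms(2)] by simp
qed

lemma bar_conditions_Vbar: "bar_conditions l (Vbar l)"
proof -
  have "Vbar l = (THE \<psi>. bar_conditions l \<psi>)"
    by (simp add: Vbar_def bar_conditions_def)
  then show ?thesis
    using theI'[of "bar_conditions l"] bar_conditions_exists bar_conditions_unique by metis
qed

lemma Vbar_Vmod: "v \<in> Vmod l \<Longrightarrow> Vbar l v \<in> Vmod l"
  and Vbar_add: "v \<in> Vmod l \<Longrightarrow> w \<in> Vmod l \<Longrightarrow> Vbar l (v + w) = Vbar l v + Vbar l w"
  and Vbar_smul: "v \<in> Vmod l \<Longrightarrow> Vbar l (c \<cdot> v) = qbar c \<cdot> Vbar l v"
  and Vbar_bop: "v \<in> Vmod l \<Longrightarrow> Vbar l (bop l v) = bop l (Vbar l v)"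
  using bar_conditions_Vbar[of l] by (auto simp: bar_conditions_def)

lemma Vbar_can_vec: "n \<le> l \<Longrightarrow> Vbar l (can_vec l n) = can_vec l n"
  by (rule bar_conditions_can_vec[OF bar_conditions_Vbar])

lemma Vbar_sum:
  "finite A \<Longrightarrow> (\<And>n. n \<in> A \<Longrightarrow> f n \<in> Vmod l) \<Longrightarrow> Vbar l (\<Sum>n\<in>A. f n) = (\<Sum>n\<in>A. Vbar l (f n))"
  by (rule bar_conditions_sum[OF bar_conditions_Vbar])

lemma Vbar_Vbar:
  assumes "v \<in> Vmod l"
  shows "Vbar l (Vbar l v) = v"
proof -
  obtain a where a: "v = (\<Sum>n\<le>l. a n \<cdot> can_vec l n)" using can_vec_span assms by blast
  show ?thesis
    unfolding a by (simp add: Vbar_sum Vmod_smul can_vec_Vmod Vbar_smul Vbar_can_vec)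
qed

section \<open>The action of the divided powers on \<open>V(l)\<close>\<close>

text \<open>The action of integral polynomials in \<open>b\<close>.\<close>

definition pact :: "nat \<Rightarrow> laurent poly \<Rightarrow> (nat \<Rightarrow>\<^sub>0 laurent) \<Rightarrow> nat \<Rightarrow>\<^sub>0 laurent" where
  "pact l p v = (\<Sum>i\<le>degree p. coeff p i \<cdot> (bop l ^^ i) v)"

lemma pact_bound: "degree p \<le> N \<Longrightarrow> pact l p v = (\<Sum>i\<le>N. coeff p i \<cdot> (bop l ^^ i) v)"
  unfolding pact_def
  by (rule sum.mono_neutral_left) (auto simp: coeff_eq_0)

lemma pact_add: "pact l (p + r) v = pact l p v + pact l r v"
proof -
  let ?N = "max (degree p) (degree r)"
  have "degree (p + r) \<le> ?N" by (rule degree_add_le_max)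
  then show ?thesis
    by (simp add: pact_bound[of _ ?N] smul_add_left sum.distrib)
qed

lemma pact_smult: "pact l (smult c p) v = c \<cdot> pact l p v"
  using degree_smult_le[of c p]
  by (simp add: pact_bound[of _ "degree p"] smul_sum_right)

lemma pact_0 [simp]: "pact l 0 v = 0"
  by (simp add: pact_def)

lemma pact_pCons: "pact l (pCons a p) v = a \<cdot> v + bop l (pact l p v)"
proof -
  have "pact l (pCons a p) v = (\<Sum>i\<le>Suc (degree p). coeff (pCons a p) i \<cdot> (bop l ^^ i) v)"
    by (rule pact_bound) (rule degree_pCons_le)
  also have "\<dots> = a \<cdot> v + (\<Sum>i\<le>degree p. coeff p i \<cdot> (bop l ^^ Suc i) v)"
    by (subst sum.atMost_Suc_shift) simp
  finally show ?thesis by (simp add: pact_def bop_sum bop_smul)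
qed

lemma pact_smul_right: "pact l p (c \<cdot> v) = c \<cdot> pact l p v"
  by (induction p) (auto simp: pact_pCons smul_add_right bop_smul mult.commute)

lemma pact_mult: "pact l (p * r) v = pact l p (pact l r v)"
  by (induction p) (auto simp: pact_pCons pact_add pact_smult mult_pCons_left)

lemma pact_Vmod: "v \<in> Vmod l \<Longrightarrow> pact l p v \<in> Vmod l"
  by (induction p) (auto simp: pact_pCons intro!: Vmod_add Vmod_smul bop_Vmod)

text \<open>\<open>Act l u v w\<close> says that \<open>u v = w\<close>, in a form free of fractions: after clearing
  denominators \<open>u\<close> becomes a polynomial over the Laurent polynomials, which acts integrally.\<close>

definition Act :: "nat \<Rightarrow> laurent fract poly \<Rightarrow> (nat \<Rightarrow>\<^sub>0 laurent) \<Rightarrow> (nat \<Rightarrow>\<^sub>0 laurent) \<Rightarrow> bool" where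
  "Act l u v w \<longleftrightarrow> w \<in> Vmod l
     \<and> (\<exists>d p. d \<noteq> 0 \<and> smult (to_fract d) u = fract_poly p \<and> d \<cdot> w = pact l p v)"

lemma ActI: "w \<in> Vmod l \<Longrightarrow> d \<noteq> 0 \<Longrightarrow> smult (to_fract d) u = fract_poly p \<Longrightarrow> d \<cdot> w = pact l p v
    \<Longrightarrow> Act l u v w"
  unfolding Act_def by blast

lemma ActE:
  assumes "Act l u v w"
  obtains d p where "w \<in> Vmod l" "d \<noteq> 0" "smult (to_fract d) u = fract_poly p" "d \<cdot> w = pact l p v"
  using assms unfolding Act_def by blast

lemma lookup_map_to_fract: "lk (Poly_Mapping.map to_fract w) k = to_fract (lk w k)"
  by (simp add: map.rep_eq when_def)

lemma Ui_act_eq: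
  assumes "Act l u v w"
  shows "Ui_act l u v = w"
proof -
  from assms obtain d p where w: "w \<in> Vmod l" and d: "d \<noteq> 0"
    and u: "smult (to_fract d) u = fract_poly p" and dw: "d \<cdot> w = pact l p v" by (rule ActE)
  let ?S = "\<Sum>i\<le>degree u. coeff u i \<cdot> Poly_Mapping.map to_fract ((bop l ^^ i) v)"
  have deg: "degree p = degree u"
    using arg_cong[OF u, of degree] d by (simp add: degree_map_poly)
  have co: "to_fract d * coeff u i = to_fract (coeff p i)" for i
    using arg_cong[OF u, of "\<lambda>x. coeff x i"] by (simp add: coeff_map_poly)
  have E: "Poly_Mapping.map to_fract w = ?S"
  proof (rule poly_mapping_eqI)
    fix k
    have "to_fract d * lk ?S k
        = (\<Sum>i\<le>degree u. (to_fract d * coeff u i) * to_fract (lk ((bop l ^^ i) v) k))"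
      by (simp add: lookup_sum lookup_smul lookup_map_to_fract sum_distrib_left mult.assoc)
    also have "\<dots> = to_fract (lk (pact l p v) k)"
      by (simp add: co pact_def deg lookup_sum lookup_smul to_fract_sum)
    also have "\<dots> = to_fract d * to_fract (lk w k)"
      by (simp flip: dw add: lookup_smul)
    finally show "lk (Poly_Mapping.map to_fract w) k = lk ?S k"
      using d by (simp add: lookup_map_to_fract)
  qed
  have U: "w' = w" if "Poly_Mapping.map to_fract w' = Poly_Mapping.map to_fract w" for w'
  proof (rule poly_mapping_eqI)
    fix k
    show "lk w' k = lk w k"
      using arg_cong[OF that, of "\<lambda>x. lk x k"] by (simp add: lookup_map_to_fract)
  qed
  show ?thesis
    unfolding Ui_act_def
  proof (rule the_equality)
    show "w \<in> Vmod l \<and> Poly_Mapping.map to_fract w = ?S" using w E by (rule conjI)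
    fix w' assume "w' \<in> Vmod l \<and> Poly_Mapping.map to_fract w' = ?S"
    then show "w' = w" using U[OF trans[OF _ E[symmetric]]] by blast
  qed
qed

lemma Act_add:
  assumes "Act l u v w" "Act l u' v w'"
  shows "Act l (u + u') v (w + w')"
proof -
  obtain d p where 1: "w \<in> Vmod l" "d \<noteq> 0" "smult (to_fract d) u = fract_poly p" "d \<cdot> w = pact l p v"
    using assms(1) by (rule ActE)
  obtain d' p' where 2: "w' \<in> Vmod l" "d' \<noteq> 0" "smult (to_fract d') u' = fract_poly p'"
    "d' \<cdot> w' = pact l p' v"
    using assms(2) by (rule ActE)
  show ?thesis
  proof (rule ActI)
    show "d * d' \<noteq> 0" using 1 2 by simp
    show "w + w' \<in> Vmod l" using 1 2 by (simp add: Vmod_add)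
    have "smult (to_fract (d * d')) (u + u')
        = smult (to_fract d') (smult (to_fract d) u) + smult (to_fract d) (smult (to_fract d') u')"
      by (simp add: smult_add_right mult.commute)
    then show "smult (to_fract (d * d')) (u + u') = fract_poly (smult d' p + smult d p')"
      by (simp only: 1 2 fract_poly_add fract_poly_smult)
    have "(d * d') \<cdot> (w + w') = d' \<cdot> (d \<cdot> w) + d \<cdot> (d' \<cdot> w')"
      by (simp add: smul_add_right mult.commute)
    then show "(d * d') \<cdot> (w + w') = pact l (smult d' p + smult d p') v"
      by (simp only: 1 2 pact_add pact_smult)
  qed
qed

lemma Act_smult:
  assumes "Act l u v w"
  shows "Act l (smult (to_fract c) u) v (c \<cdot> w)"
proof -
  obtain d p where 1: "w \<in> Vmod l" "d \<noteq> 0" "smult (to_fract d) u = fract_poly p" "d \<cdot> w = pact l p v"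
    using assms(1) by (rule ActE)
  show ?thesis
  proof (rule ActI)
    show "d \<noteq> 0" "c \<cdot> w \<in> Vmod l" using 1 by (simp_all add: Vmod_smul)
    have "smult (to_fract d) (smult (to_fract c) u) = smult (to_fract c) (smult (to_fract d) u)"
      by (simp add: mult.commute)
    then show "smult (to_fract d) (smult (to_fract c) u) = fract_poly (smult c p)"
      by (simp only: 1 fract_poly_smult)
    have "d \<cdot> (c \<cdot> w) = c \<cdot> (d \<cdot> w)" by (simp add: mult.commute)
    then show "d \<cdot> (c \<cdot> w) = pact l (smult c p) v" by (simp only: 1 pact_smult)
  qed
qed

lemma Act_smult_cancel:
  assumes "Act l (smult (to_fract c) u) v (c \<cdot> w)" "c \<noteq> 0" "w \<in> Vmod l"
  shows "Act l u v w"
proof -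
  obtain d p where 1: "d \<noteq> 0" "smult (to_fract d) (smult (to_fract c) u) = fract_poly p"
    "d \<cdot> (c \<cdot> w) = pact l p v"
    using assms(1) by (rule ActE)
  show ?thesis
    using 1 assms by (intro ActI[of _ _ "d * c" _ p]) auto
qed

lemma Act_zero: "Act l 0 v 0"
  by (rule ActI[of _ _ 1 _ 0]) auto

lemma Act_mult:
  assumes "Act l u' v w'" "Act l u w' w"
  shows "Act l (u * u') v w"
proof -
  obtain d p where 1: "w \<in> Vmod l" "d \<noteq> 0" "smult (to_fract d) u = fract_poly p" "d \<cdot> w = pact l p w'"
    using assms(2) by (rule ActE)
  obtain d' p' where 2: "d' \<noteq> 0" "smult (to_fract d') u' = fract_poly p'" "d' \<cdot> w' = pact l p' v"
    using assms(1) by (rule ActE)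
  show ?thesis
  proof (rule ActI)
    show "d * d' \<noteq> 0" "w \<in> Vmod l" using 1 2 by simp_all
    have "smult (to_fract (d * d')) (u * u') = smult (to_fract d) u * smult (to_fract d') u'"
      by (simp add: mult.commute)
    then show "smult (to_fract (d * d')) (u * u') = fract_poly (p * p')"
      by (simp only: 1 2 fract_poly_mult)
    have "(d * d') \<cdot> w = d' \<cdot> (d \<cdot> w)" by (simp add: mult.commute)
    also have "\<dots> = pact l p (d' \<cdot> w')" by (simp only: 1 pact_smul_right)
    finally show "(d * d') \<cdot> w = pact l (p * p') v" by (simp only: 2 pact_mult)
  qed
qed

lemma Act_b: "v \<in> Vmod l \<Longrightarrow> Act l [:0, 1:] v (bop l v)"
  by (rule ActI[of _ _ 1 _ "[:0, 1:]"]) (auto simp: bop_Vmod pact_pCons map_poly_pCons)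

lemma Act_one: "v \<in> Vmod l \<Longrightarrow> Act l 1 v v"
  by (rule ActI[of _ _ 1 _ 1]) (auto simp: one_pCons pact_pCons map_poly_pCons)

lemma Act_sum:
  "finite A \<Longrightarrow> (\<And>a. a \<in> A \<Longrightarrow> Act l (f a) v (g a)) \<Longrightarrow> Act l (sum f A) v (sum g A)"
  by (induction A rule: finite_induct) (auto simp: Act_zero Act_add)

text \<open>If \<open>n\<close> has the parity of \<open>t\<close>, then the step from \<open>b b\<^sup>(\<^sup>n\<^sup>)\<close> to \<open>b\<^sup>(\<^sup>n\<^sup>+\<^sup>1\<^sup>)\<close> replaces
  a factor \<open>b\<^sup>2\<close> by \<open>b\<^sup>2 - [n]\<^sup>2\<close>, which accounts for the second term; otherwise the two
  agree up to \<open>[n + 1]\<close>.\<close>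

lemma bdiv_rec:
  assumes "t \<in> {0, 1}"
  shows "[:0, 1:] * bdiv t n = smult (to_fract (qint (int n + 1))) (bdiv t (Suc n))
    + (if [n = t] (mod 2) \<and> n > 0 then smult (to_fract (qint (int n))) (bdiv t (n - 1)) else 0)"
proof -
  define b :: "laurent fract poly" where "b = [:0, 1:]"
  define \<phi> where "\<phi> k = b ^ 2 - [: to_fract (qint (int k) ^ 2) :]" for k
  define F where "F n = (\<Prod>k | k < n \<and> [k = t] (mod 2). \<phi> k)" for n
  define G where "G n = (\<Prod>k | 1 \<le> k \<and> k < n \<and> [k = t] (mod 2). \<phi> k)" for n
  have bdiv: "bdiv t n = smult (1 / to_fract (qfact n)) (if even n then F n else b * G n)" for n
    by (simp add: bdiv_def Let_def F_def G_def \<phi>_def b_def)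
  have q: "to_fract (qint (int n + 1)) / to_fract (qfact (Suc n)) = 1 / to_fract (qfact n)" for n
    using qint_neq_0[of "int n + 1"] by (simp add: qfact_Suc)
  have q2: "to_fract (qint (int n)) * to_fract (qint (int n)) / to_fract (qfact n)
      = to_fract (qint (int n)) / to_fract (qfact (n - 1))" if "n > 0" for n
    using qint_neq_0[of "int n"] that qfact_Suc[of "n - 1"] by (simp add: of_nat_diff)
  let ?S = "\<lambda>m. {k. k < m \<and> [k = t] (mod 2)}" and ?S1 = "\<lambda>m. {k. 1 \<le> k \<and> k < m \<and> [k = t] (mod 2)}"
  have fin: "finite (?S m)" "finite (?S1 m)" for m by auto
  \<comment> \<open>the claim without the factorials\<close>
  have next_b: "(if even (Suc n) then F (Suc n) else b * G (Suc n))
     + (if [n = t] (mod 2) \<and> n > 0 then smult (to_fract (qint (int n)) ^ 2) (if even n then b * G (n - 1) else F (n - 1)) else 0)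
     = b * (if even n then F n else b * G n)"
  proof (cases "[n = t] (mod 2) \<and> n > 0")
    case False
    show ?thesis
    proof (cases "even n")
      case True
      have "?S1 (Suc n) = ?S n"
      proof (cases "n = 0")
        case n: False
        with False have "\<not> [n = t] (mod 2)" by simp
        with True assms have t: "t = 1" by (auto simp: cong_def)
        with True have "k \<noteq> 0" "k \<noteq> n" if "[k = t] (mod 2)" for k
          using that by (auto simp: cong_def)
        then show ?thesis using less_Suc_eq by (auto simp: Suc_le_eq)
      qed auto
      then have "G (Suc n) = F n" by (simp add: F_def G_def)
      with True show ?thesis unfolding if_not_P[OF False] by simp
    next
      case od: False
      with False have "n > 0" by (auto intro: Nat.gr0I)
      with od False assms have t: "t = 0" by (auto simp: cong_def odd_iff_mod_2_eq_one)
      have "k \<noteq> n" if "[k = t] (mod 2)" for k using that od t by (auto simp: cong_def)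
      then have "?S (Suc n) = insert 0 (?S1 n)" "0 \<notin> ?S1 n"
        using \<open>n > 0\<close> t od by (auto simp: cong_def less_Suc_eq Suc_le_eq)
      then have "F (Suc n) = \<phi> 0 * G n" by (simp add: F_def G_def)
      moreover have "\<phi> 0 = b * b" by (simp add: \<phi>_def power2_eq_square)
      ultimately show ?thesis unfolding if_not_P[OF False] using od by (simp add: mult.assoc)
    qed
  next
    case True
    then have n: "[n = t] (mod 2)" "n > 0" by auto
    have \<phi>n: "\<phi> n + [: to_fract (qint (int n)) ^ 2 :] = b * b"
      by (simp add: \<phi>_def power2_eq_square)
    show ?thesis
    proof (cases "even n")
      case ev: True
      then have t: "t = 0" using n assms by (auto simp: cong_def)
      have n2: "n \<ge> 2" using n ev by auto
      have "k \<noteq> n - 1" if "[k = t] (mod 2)" for k using that ev n2 t by (auto simp: cong_def)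
      then have *: "?S1 n = ?S1 (n - 1)" using n2 by force
      have e: "?S1 (Suc n) = insert n (?S1 n)" "n \<notin> ?S1 n"
        using n by (auto simp: less_Suc_eq Suc_le_eq)
      have g: "G (Suc n) = \<phi> n * G (n - 1)"
        by (simp only: G_def e(1) prod.insert[OF fin(2) e(2)]) (simp only: *)
      have e: "?S n = insert 0 (?S1 n)" "0 \<notin> ?S1 n"
        using n2 t by (auto simp: cong_def less_Suc_eq Suc_le_eq)
      have "F n = \<phi> 0 * G (n - 1)"
        by (simp only: F_def G_def e(1) prod.insert[OF fin(2) e(2)]) (simp only: *)
      then have f: "F n = (b * b) * G (n - 1)" by (simp add: \<phi>_def power2_eq_square)
      have "b * G (Suc n) + smult (to_fract (qint (int n)) ^ 2) (b * G (n - 1))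
          = (\<phi> n + [: to_fract (qint (int n)) ^ 2 :]) * (b * G (n - 1))"
        by (simp add: g algebra_simps)
      also have "\<dots> = b * F n" by (simp only: \<phi>n f ac_simps)
      finally show ?thesis using ev True by simp
    next
      case od: False
      then have t: "t = 1" using n assms by (auto simp: cong_def)
      have "k \<noteq> n - 1" if "[k = t] (mod 2)" for k
        using that od n t by (auto simp: cong_def elim!: oddE)
      then have *: "?S n = ?S (n - 1)" using n by force
      have e: "?S (Suc n) = insert n (?S n)" "n \<notin> ?S n"
        using n by (auto simp: less_Suc_eq)
      have f: "F (Suc n) = \<phi> n * F (n - 1)"
        by (simp only: F_def e(1) prod.insert[OF fin(1) e(2)]) (simp only: *)
      have e: "?S1 n = ?S n" using t by (auto simp: cong_def Suc_le_eq intro!: Nat.gr0I)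
      have g: "G n = F (n - 1)" by (simp only: F_def G_def e *)
      have "F (Suc n) + smult (to_fract (qint (int n)) ^ 2) (F (n - 1))
          = (\<phi> n + [: to_fract (qint (int n)) ^ 2 :]) * F (n - 1)"
        by (simp add: f algebra_simps)
      also have "\<dots> = b * (b * G n)" by (simp only: \<phi>n g ac_simps)
      finally show ?thesis using od True by simp
    qed
  qed
  have "smult (to_fract (qint (int n + 1))) (bdiv t (Suc n))
      = smult (1 / to_fract (qfact n)) (if even (Suc n) then F (Suc n) else b * G (Suc n))"
    by (simp only: bdiv smult_smult) (simp add: q)
  moreover have "smult (to_fract (qint (int n))) (bdiv t (n - 1))
      = smult (1 / to_fract (qfact n)) (smult (to_fract (qint (int n)) ^ 2)
          (if even n then b * G (n - 1) else F (n - 1)))" if "n > 0"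
    using that q2[OF that] by (auto simp: bdiv power2_eq_square)
  moreover have "b * bdiv t n = smult (1 / to_fract (qfact n)) (b * (if even n then F n else b * G n))"
    by (simp add: bdiv)
  ultimately show ?thesis
    unfolding b_def[symmetric] next_b[symmetric] by (simp add: smult_add_right)
qed

text \<open>The divided powers and the vectors \<open>can_vec l n\<close> satisfy the same recursion; this is
  where \<open>l \<equiv> t\<close> modulo 2 enters.\<close>

lemma Act_bdiv:
  assumes "t \<in> {0, 1}" "[l = t] (mod 2)"
  shows "Act l (bdiv t n) (eta l) (can_vec l n)"
proof (induction n rule: less_induct)
  case (less n)
  show ?case
  proof (cases n)
    case 0
    have "bdiv t 0 = 1" by (simp add: bdiv_def)
    then show ?thesis using 0 by (simp add: can_vec_0 Act_one eta_Vmod)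
  next
    case (Suc m)
    let ?c = "[m = t] (mod 2) \<and> m > 0"
    have c: "?c \<longleftrightarrow> even (l + m) \<and> m > 0"
    proof -
      have "l mod 2 = t" using assms by (auto simp: cong_def)
      then have "[m = t] (mod 2) \<longleftrightarrow> m mod 2 = l mod 2" by (simp add: cong_def)
      also have "\<dots> \<longleftrightarrow> even (l + m)" by presburger
      finally show ?thesis by blast
    qed
    have "Act l (bdiv t m) (eta l) (can_vec l m)" using less Suc by simp
    then have 1: "Act l ([:0, 1:] * bdiv t m) (eta l) (bop l (can_vec l m))"
      using Act_mult Act_b can_vec_Vmod by blast
    have 2: "Act l (if ?c then smult (to_fract (- qint (int m))) (bdiv t (m - 1)) else 0) (eta l)
        (if ?c then (- qint (int m)) \<cdot> can_vec l (m - 1) else 0)"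
      using less[of "m - 1"] Suc by (auto simp: Act_zero intro!: Act_smult simp del: to_fract_uminus)
    have "Act l (smult (to_fract (qint (int m + 1))) (bdiv t n)) (eta l)
        (qint (int m + 1) \<cdot> can_vec l n)"
      using Act_add[OF 1 2] unfolding bdiv_rec[OF assms(1)] bop_can_vec c Suc
      by (auto simp: smul_minus_left split: if_splits)
    then show ?thesis by (rule Act_smult_cancel) (auto simp: qint_neq_0 can_vec_Vmod)
  qed
qed

definition ucomb :: "nat \<Rightarrow> (nat \<Rightarrow>\<^sub>0 laurent) \<Rightarrow> laurent fract poly" where
  "ucomb t c = (\<Sum>n\<in>Poly_Mapping.keys c. smult (to_fract (lk c n)) (bdiv t n))"

lemma Ui_eq: "Ui t = range (ucomb t)"
  by (simp add: Ui_def ucomb_def)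

lemma ucomb_diff: "ucomb t (c - d) = ucomb t c - ucomb t d"
proof -
  let ?A = "Poly_Mapping.keys c \<union> Poly_Mapping.keys d"
  have *: "ucomb t e = (\<Sum>n\<in>?A. smult (to_fract (lk e n)) (bdiv t n))"
    if "Poly_Mapping.keys e \<subseteq> ?A" for e
    unfolding ucomb_def by (rule sum.mono_neutral_left) (use that in \<open>auto simp: in_keys_iff\<close>)
  have "Poly_Mapping.keys (c - d) \<subseteq> ?A" by (auto simp: in_keys_iff lookup_minus)
  then show ?thesis
    by (simp add: * lookup_minus sum_subtractf smult_diff_left)
qed

lemma ucomb_single: "ucomb t (Poly_Mapping.single n 1) = bdiv t n"
  by (simp add: ucomb_def)

lemma bdiv_0: "bdiv t 0 = 1"
  by (simp add: bdiv_def)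

lemma Ui_one: "1 \<in> Ui t"
  using rangeI[of "ucomb t" "Poly_Mapping.single 0 1"] by (simp only: Ui_eq ucomb_single bdiv_0)

lemma Ui_zero: "0 \<in> Ui t"
proof -
  have "ucomb t 0 = 0" by (simp add: ucomb_def)
  then show ?thesis using rangeI[of "ucomb t" 0] by (simp only: Ui_eq)
qed

lemma Ui_diff: "u \<in> Ui t \<Longrightarrow> u' \<in> Ui t \<Longrightarrow> u - u' \<in> Ui t"
  by (auto simp: Ui_eq simp flip: ucomb_diff)

lemma Ui_add: "u \<in> Ui t \<Longrightarrow> u' \<in> Ui t \<Longrightarrow> u + u' \<in> Ui t"
  using Ui_diff[of u t "0 - u'"] Ui_diff[of 0 t u'] Ui_zero[of t] by simp

lemma Act_ucomb:
  assumes "t \<in> {0, 1}" "[l = t] (mod 2)"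
  shows "Act l (ucomb t c) (eta l) (\<Sum>n\<in>Poly_Mapping.keys c. lk c n \<cdot> can_vec l n)"
  unfolding ucomb_def by (intro Act_sum Act_smult Act_bdiv assms finite_keys)

lemma Act_Ui_exists:
  assumes "t \<in> {0, 1}" "[l = t] (mod 2)" "u \<in> Ui t"
  shows "Act l u (eta l) (Ui_act l u (eta l))"
proof -
  obtain c where "u = ucomb t c" using assms(3) by (auto simp: Ui_eq)
  then show ?thesis using Act_ucomb[OF assms(1,2)] Ui_act_eq[OF Act_ucomb[OF assms(1,2)]] by simp
qed

lemma Ui_orbit:
  assumes "t \<in> {0, 1}" "[l = t] (mod 2)" "v \<in> Vmod l"
  shows "\<exists>u\<in>Ui t. Ui_act l u (eta l) = v"
proof -
  obtain a where a: "v = (\<Sum>n\<le>l. a n \<cdot> can_vec l n)" using can_vec_span assms(3) by blast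
  define c where "c = (\<Sum>n\<le>l. Poly_Mapping.single n (a n))"
  have c: "lk c n = (if n \<le> l then a n else 0)" for n
    by (simp add: c_def lookup_sum lookup_single when_def)
  have "(\<Sum>n\<in>Poly_Mapping.keys c. lk c n \<cdot> can_vec l n) = (\<Sum>n\<le>l. lk c n \<cdot> can_vec l n)"
    by (rule sum.mono_neutral_left) (auto simp: in_keys_iff c split: if_splits)
  also have "\<dots> = v" by (simp add: a c)
  finally have "Ui_act l (ucomb t c) (eta l) = v"
    using Ui_act_eq[OF Act_ucomb[OF assms(1,2)]] by metis
  then show ?thesis by (auto simp: Ui_eq)
qed

section \<open>Signed permutations and their inversions\<close>

abbreviation sinv :: "sperm \<Rightarrow> sperm" where
  "sinv \<equiv> inv_into UNIV"

definition SP :: "nat \<Rightarrow> sperm set" where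
  "SP l = {w. bij w \<and> (\<forall>x. w (- x) = - w x) \<and> (\<forall>x. \<bar>x\<bar> > int l \<longrightarrow> w x = x)}"

definition pairs :: "nat \<Rightarrow> (int \<times> int) set" where
  "pairs l = {(a, b). a < b \<and> a \<noteq> - b \<and> a \<noteq> 0 \<and> b \<noteq> 0 \<and> \<bar>a\<bar> \<le> int l \<and> \<bar>b\<bar> \<le> int l}"

definition inversions :: "nat \<Rightarrow> sperm \<Rightarrow> (int \<times> int) set" where
  "inversions l w = {(a, b) \<in> pairs l. w b < w a}"

text \<open>A pair \<open>(a, b)\<close> stands for the positive root \<open>x\<^sub>b - x\<^sub>a\<close>, which is also represented by
  \<open>(- b, - a)\<close>; this is why half of the inverted pairs are counted.\<close>

definition linv :: "nat \<Rightarrow> sperm \<Rightarrow> nat" where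
  "linv l w = card (inversions l w) div 2"

text \<open>The simple root of \<open>srefl i\<close> is the one represented by \<open>(i, hi i)\<close>.\<close>

definition hi :: "int \<Rightarrow> int" where
  "hi i = (if i = - 1 then 2 else i + 1)"

lemma SP_inj: "w \<in> SP l \<Longrightarrow> w x = w y \<longleftrightarrow> x = y"
  by (auto simp: SP_def dest: bij_is_inj injD)

lemma SP_odd: "w \<in> SP l \<Longrightarrow> w (- x) = - w x"
  by (simp add: SP_def)

lemma SP_0 [simp]: "w \<in> SP l \<Longrightarrow> w 0 = 0"
  using SP_odd[of w l 0] by simp

lemma SP_eq_0: "w \<in> SP l \<Longrightarrow> w x = 0 \<longleftrightarrow> x = 0"
  using SP_inj[of w l x 0] by simp

lemma SP_eq_neg: "w \<in> SP l \<Longrightarrow> w x = - w y \<longleftrightarrow> x = - y"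
  using SP_inj[of w l x "- y"] SP_odd[of w l y] by simp

lemma SP_le:
  assumes "w \<in> SP l" "\<bar>x\<bar> \<le> int l"
  shows "\<bar>w x\<bar> \<le> int l"
proof (rule ccontr)
  assume "\<not> \<bar>w x\<bar> \<le> int l"
  then have "w (w x) = w x" using assms(1) by (simp add: SP_def)
  then have "w x = x" using SP_inj[OF assms(1)] by blast
  with \<open>\<not> \<bar>w x\<bar> \<le> int l\<close> assms(2) show False by simp
qed

lemma SP_id: "id \<in> SP l"
  by (simp add: SP_def)

lemma SP_comp: "v \<in> SP l \<Longrightarrow> w \<in> SP l \<Longrightarrow> v \<circ> w \<in> SP l"
  by (auto simp: SP_def bij_comp)

lemma SP_inv_apply: "w \<in> SP l \<Longrightarrow> w (sinv w x) = x" "w \<in> SP l \<Longrightarrow> sinv w (w x) = x"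
  by (auto simp: SP_def bij_is_inj bij_is_surj surj_f_inv_f)

lemma SP_inv: "w \<in> SP l \<Longrightarrow> sinv w \<in> SP l"
proof -
  assume w: "w \<in> SP l"
  have "sinv w (- x) = - sinv w x" for x
    using SP_inj[OF w, of "sinv w (- x)" "- sinv w x"] SP_odd[OF w, of "sinv w x"]
    by (simp add: SP_inv_apply[OF w])
  moreover have "sinv w x = x" if "\<bar>x\<bar> > int l" for x
    using w that SP_inv_apply(2)[OF w, of x] by (simp add: SP_def)
  moreover have "bij (sinv w)" using w by (simp add: SP_def bij_imp_bij_inv)
  ultimately show ?thesis by (simp add: SP_def)
qed

lemma SP_inv_inv: "w \<in> SP l \<Longrightarrow> sinv (sinv w) = w"
  by (simp add: SP_def inv_inv_eq)

lemma SP_inv_comp: "v \<in> SP l \<Longrightarrow> w \<in> SP l \<Longrightarrow> sinv (v \<circ> w) = sinv w \<circ> sinv v"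
  by (simp add: SP_def o_inv_distrib)

lemma SP_ext:
  assumes "v \<in> SP l" "w \<in> SP l" "\<And>k. 1 \<le> k \<Longrightarrow> k \<le> int l \<Longrightarrow> v k = w k"
  shows "v = w"
proof
  fix x
  consider "x = 0" | "\<bar>x\<bar> > int l" | "1 \<le> x" "x \<le> int l" | "1 \<le> - x" "- x \<le> int l" by linarith
  then show "v x = w x"
  proof cases
    case 4
    then have "v (- x) = w (- x)" using assms(3) by blast
    then show ?thesis using assms(1,2) by (simp add: SP_odd)
  qed (use assms in \<open>auto simp: SP_def\<close>)
qed

lemma finite_pairs: "finite (pairs l)"
proof (rule finite_subset)
  show "pairs l \<subseteq> {- int l..int l} \<times> {- int l..int l}" by (auto simp: pairs_def)
qed simp

lemma finite_inversions: "finite (inversions l w)"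
  by (rule finite_subset[OF _ finite_pairs[of l]]) (auto simp: inversions_def)

lemma linv_le: "linv l w \<le> card (pairs l)"
proof -
  have "card (inversions l w) \<le> card (pairs l)"
    by (rule card_mono[OF finite_pairs]) (auto simp: inversions_def)
  then show ?thesis by (simp add: linv_def)
qed

lemma linv_id: "linv l id = 0"
proof -
  have "inversions l id = {}" by (auto simp: inversions_def pairs_def)
  then show ?thesis by (simp add: linv_def)
qed

text \<open>An inversion \<open>(a, b)\<close> of \<open>w\<close> corresponds to the inversion \<open>(w b, w a)\<close> of its inverse.\<close>

lemma linv_inv:
  assumes "w \<in> SP l"
  shows "linv l (sinv w) = linv l w"
proof -
  have "bij_betw (\<lambda>(a, b). (w b, w a)) (inversions l w) (inversions l (sinv w))"
  proof (rule bij_betw_byWitness[where f' = "\<lambda>(a, b). (sinv w b, sinv w a)"])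
    have "(w b, w a) \<in> inversions l (sinv w)" if "(a, b) \<in> inversions l w" for a b
      using that assms SP_le[OF assms, of a] SP_le[OF assms, of b] SP_eq_neg[OF assms, of b a]
      by (auto simp: inversions_def pairs_def SP_eq_0 SP_inv_apply)
    then show "(\<lambda>(a, b). (w b, w a)) ` inversions l w \<subseteq> inversions l (sinv w)" by auto
    note i = SP_inv[OF assms]
    have "(sinv w b, sinv w a) \<in> inversions l w" if "(a, b) \<in> inversions l (sinv w)" for a b
      using that assms SP_le[OF i, of a] SP_le[OF i, of b] SP_eq_neg[OF i, of b a]
      by (auto simp: inversions_def pairs_def SP_eq_0[OF i] SP_inv_apply)
    then show "(\<lambda>(a, b). (sinv w b, sinv w a)) ` inversions l (sinv w) \<subseteq> inversions l w" by auto
  qed (use assms in \<open>auto simp: SP_inv_apply\<close>)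
  then show ?thesis by (simp add: linv_def bij_betw_same_card)
qed

subsection \<open>Simple reflections\<close>

lemma srefl_0: "srefl 0 x = (if x = 1 then - 1 else if x = - 1 then 1 else x)"
  by (simp add: srefl_def Transposition.transpose_def)

lemma srefl_pos: "i \<ge> 1 \<Longrightarrow> srefl i x = (if x = i then i + 1 else if x = i + 1 then i
    else if x = - i then - i - 1 else if x = - i - 1 then - i else x)"
  by (auto simp: srefl_def Transposition.transpose_def)

lemma srefl_m1: "srefl (- 1) x = (if x = 1 then - 2 else if x = - 2 then 1
    else if x = - 1 then 2 else if x = 2 then - 1 else x)"
  by (simp add: srefl_def Transposition.transpose_def)

lemma srefl_srefl [simp]: "i \<ge> - 1 \<Longrightarrow> srefl i (srefl i x) = x"
proof -
  assume "i \<ge> - 1"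
  then consider "i = 0" | "i = - 1" | "i \<ge> 1" by linarith
  then show ?thesis by cases (auto simp: srefl_0 srefl_m1 srefl_pos)
qed

lemma srefl_comp_srefl: "i \<ge> - 1 \<Longrightarrow> srefl i \<circ> srefl i = id"
  by (simp add: fun_eq_iff)

lemma srefl_comp_srefl': "i \<ge> - 1 \<Longrightarrow> srefl i \<circ> (srefl i \<circ> w) = w"
  "i \<ge> - 1 \<Longrightarrow> w \<circ> srefl i \<circ> srefl i = w"
  by (simp_all add: fun_eq_iff)

lemma inv_srefl: "i \<ge> - 1 \<Longrightarrow> sinv (srefl i) = srefl i"
  by (rule inv_equality) simp_all

lemma bij_srefl: "i \<ge> - 1 \<Longrightarrow> bij (srefl i)"
  by (rule o_bij[of "srefl i"]) (simp_all add: srefl_comp_srefl)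

text \<open>In terms of their roots the simple reflections obey a single formula, including the
  exceptional one.\<close>

lemma srefl_hi: "i = - 1 \<or> i \<ge> 1 \<Longrightarrow> srefl i x = (if x = i then hi i else if x = hi i then i
    else if x = - i then - hi i else if x = - hi i then - i else x)"
proof (elim disjE)
  assume "1 \<le> i"
  then show ?thesis unfolding srefl_pos[OF \<open>1 \<le> i\<close>] hi_def by smt
qed (simp add: hi_def srefl_m1)

locale type_D =
  fixes l :: nat
  assumes l_ge_2: "l \<ge> 2"
begin

abbreviation "N \<equiv> Nset l"
abbreviation "il \<equiv> linv l"

lemma N_ge: "i \<in> N \<Longrightarrow> i \<ge> - 1" "i \<in> N \<Longrightarrow> i = - 1 \<or> i \<ge> 1" "i \<in> N \<Longrightarrow> hi i \<le> int l"
    "i \<in> N \<Longrightarrow> \<bar>i\<bar> \<le> int l" "i \<in> N \<Longrightarrow> i \<noteq> 0" "i \<in> N \<Longrightarrow> hi i \<ge> 2" "i \<in> N \<Longrightarrow> i < hi i"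
  using l_ge_2 by (auto simp: Nset_def hi_def)

lemma Oplus_iff: "i \<in> Oplus l \<longleftrightarrow> 1 \<le> i \<and> i < int l"
  using l_ge_2 by (auto simp: Oplus_def)

lemma Oplus_N: "i \<in> Oplus l \<Longrightarrow> i \<in> N"
  and Ominus_N: "i \<in> Ominus l \<Longrightarrow> i \<in> N"
  by (auto simp: Oplus_def Ominus_def Nset_def)

lemma N_Oplus: "i \<in> N \<longleftrightarrow> i \<in> Oplus l \<or> i = - 1"
  by (auto simp: Oplus_def Nset_def)

lemma srefl_SP: "i \<in> N \<Longrightarrow> srefl i \<in> SP l"
proof -
  assume i: "i \<in> N"
  from i have "srefl i (- x) = - srefl i x" for x
    using N_ge[OF i] by (auto simp: srefl_hi)
  moreover have "srefl i x = x" if "\<bar>x\<bar> > int l" for x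
    using that N_ge[OF i] by (auto simp: srefl_hi)
  ultimately show ?thesis using N_ge[OF i] by (simp add: SP_def bij_srefl)
qed

lemma srefl_0_SP: "srefl 0 \<in> SP l"
  using l_ge_2 by (auto simp: SP_def bij_srefl srefl_0)

text \<open>Only its own positive root is made negative by a simple reflection; that root is
  represented by two pairs.\<close>

lemma srefl_order:
  assumes i: "i \<in> N" and ab: "a < b" "a \<noteq> - b" "a \<noteq> 0" "b \<noteq> 0"
  shows "srefl i a < srefl i b \<longleftrightarrow> (a, b) \<notin> {(i, hi i), (- hi i, - i)}"
proof (cases "i = - 1")
  case True
  with ab show ?thesis by (auto simp: srefl_m1 hi_def)
next
  case False
  then have "i \<ge> 1" using N_ge[OF i] by auto
  with ab show ?thesis by (auto simp: srefl_pos hi_def)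
qed

text \<open>The inversions of type D do not see the sign of \<open>x\<^sub>1\<close> alone, so \<open>srefl 0\<close> has length
  zero and multiplication by it preserves all lengths.\<close>

lemma srefl_0_order: "a < b \<Longrightarrow> a \<noteq> - b \<Longrightarrow> a \<noteq> 0 \<Longrightarrow> b \<noteq> 0 \<Longrightarrow> srefl 0 a < srefl 0 b"
  by (auto simp: srefl_0)

text \<open>Away from the two pairs of its root, the reflection permutes the pairs and matches the
  inversions of both elements.\<close>

lemma card_inversions_right:
  assumes w: "w \<in> SP l" and i: "i \<in> N" and asc: "w i < w (hi i)"
  shows "card (inversions l (w \<circ> srefl i)) = card (inversions l w) + 2"
proof -
  let ?s = "srefl i" and ?\<tau> = "{(i, hi i), (- hi i, - i)}"
  note s = srefl_SP[OF i] and n = N_ge[OF i]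
  have ss: "?s (?s x) = x" for x using n by simp
  have \<tau>: "?\<tau> \<subseteq> pairs l" "card ?\<tau> = 2"
    using n by (auto simp: pairs_def)
  have pres: "(?s a, ?s b) \<in> pairs l - ?\<tau>" if "(a, b) \<in> pairs l - ?\<tau>" for a b
  proof -
    have ab: "a < b" "a \<noteq> - b" "a \<noteq> 0" "b \<noteq> 0" "\<bar>a\<bar> \<le> int l" "\<bar>b\<bar> \<le> int l" "(a, b) \<notin> ?\<tau>"
      using that by (auto simp: pairs_def)
    have lt: "?s a < ?s b" using srefl_order[OF i ab(1-4)] ab(7) by blast
    have ne: "?s a \<noteq> - ?s b" "?s a \<noteq> 0" "?s b \<noteq> 0"
      using ab SP_eq_neg[OF s] SP_eq_0[OF s] by auto
    have "(?s a, ?s b) \<notin> ?\<tau>" 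
      using srefl_order[OF i lt ne] ab(1) by (simp only: ss)
    then show ?thesis using lt ne SP_le[OF s ab(5)] SP_le[OF s ab(6)] by (auto simp: pairs_def)
  qed
  have "bij_betw (\<lambda>(a, b). (?s a, ?s b)) (inversions l (w \<circ> ?s) - ?\<tau>) (inversions l w - ?\<tau>)"
  proof (rule bij_betw_byWitness[where f' = "\<lambda>(a, b). (?s a, ?s b)"])
    show "(\<lambda>(a, b). (?s a, ?s b)) ` (inversions l (w \<circ> ?s) - ?\<tau>) \<subseteq> inversions l w - ?\<tau>"
      "(\<lambda>(a, b). (?s a, ?s b)) ` (inversions l w - ?\<tau>) \<subseteq> inversions l (w \<circ> ?s) - ?\<tau>"
      using pres by (fastforce simp: inversions_def ss)+
  qed (auto simp: ss)
  then have c: "card (inversions l (w \<circ> ?s) - ?\<tau>) = card (inversions l w - ?\<tau>)"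
    by (rule bij_betw_same_card)
  have "inversions l w - ?\<tau> = inversions l w"
    using asc SP_odd[OF w] by (auto simp: inversions_def)
  moreover have sub: "?\<tau> \<subseteq> inversions l (w \<circ> ?s)"
    using asc \<tau> n SP_odd[OF w] by (auto simp: inversions_def srefl_hi)
  ultimately show ?thesis
    using c card_Diff_subset[OF _ sub] card_mono[OF finite_inversions sub] \<tau>(2) by simp
qed

lemma linv_right_asc:
  "w \<in> SP l \<Longrightarrow> i \<in> N \<Longrightarrow> w i < w (hi i) \<Longrightarrow> il (w \<circ> srefl i) = Suc (il w)"
  by (simp add: linv_def card_inversions_right)

lemma linv_right_desc:
  assumes w: "w \<in> SP l" and i: "i \<in> N" and desc: "w (hi i) < w i"
  shows "il w = Suc (il (w \<circ> srefl i))"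
proof -
  have "(w \<circ> srefl i) i < (w \<circ> srefl i) (hi i)"
    using desc N_ge[OF i] by (simp add: srefl_hi)
  then have "il (w \<circ> srefl i \<circ> srefl i) = Suc (il (w \<circ> srefl i))"
    by (intro linv_right_asc SP_comp w srefl_SP i)
  then show ?thesis using N_ge[OF i] by (simp add: srefl_comp_srefl')
qed

lemma SP_hi_neq: "w \<in> SP l \<Longrightarrow> i \<in> N \<Longrightarrow> w i \<noteq> w (hi i)"
  using N_ge[of i] SP_inj[of w l i "hi i"] by auto

lemma linv_right_less_iff:
  assumes w: "w \<in> SP l" and i: "i \<in> N"
  shows "il (w \<circ> srefl i) < il w \<longleftrightarrow> w (hi i) < w i"
  using linv_right_asc[OF w i] linv_right_desc[OF w i] SP_hi_neq[OF w i]
  by (cases "w i" "w (hi i)" rule: linorder_cases) auto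

lemma left_mult_inv: "w \<in> SP l \<Longrightarrow> i \<in> N \<Longrightarrow> il (srefl i \<circ> w) = il (sinv w \<circ> srefl i)"
  using linv_inv[of "srefl i \<circ> w" l] N_ge[of i]
  by (simp add: SP_inv_comp[of _ l] srefl_SP SP_comp inv_srefl)

lemma linv_left_asc:
  "w \<in> SP l \<Longrightarrow> i \<in> N \<Longrightarrow> sinv w i < sinv w (hi i) \<Longrightarrow> il (srefl i \<circ> w) = Suc (il w)"
  by (simp add: left_mult_inv linv_right_asc SP_inv linv_inv)

lemma linv_left_desc:
  "w \<in> SP l \<Longrightarrow> i \<in> N \<Longrightarrow> sinv w (hi i) < sinv w i \<Longrightarrow> il w = Suc (il (srefl i \<circ> w))"
  using linv_right_desc[OF SP_inv, of w i] by (simp add: left_mult_inv linv_inv)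

lemma linv_left_less_iff:
  "w \<in> SP l \<Longrightarrow> i \<in> N \<Longrightarrow> il (srefl i \<circ> w) < il w \<longleftrightarrow> sinv w (hi i) < sinv w i"
  using linv_right_less_iff[OF SP_inv, of w i] by (simp add: left_mult_inv linv_inv)

lemma linv_left_cases:
  "w \<in> SP l \<Longrightarrow> i \<in> N \<Longrightarrow> il (srefl i \<circ> w) = Suc (il w) \<or> il w = Suc (il (srefl i \<circ> w))"
  using linv_left_asc[of w i] linv_left_desc[of w i] SP_hi_neq[OF SP_inv, of w i] by linarith

lemma linv_right_cases:
  "w \<in> SP l \<Longrightarrow> i \<in> N \<Longrightarrow> il (w \<circ> srefl i) = Suc (il w) \<or> il w = Suc (il (w \<circ> srefl i))"
  using linv_right_asc[of w i] linv_right_desc[of w i] SP_hi_neq[of w i] by linarith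

lemma linv_s0_right:
  assumes "w \<in> SP l"
  shows "il (w \<circ> srefl 0) = il w"
proof -
  let ?s = "srefl 0"
  note s = srefl_0_SP
  have pres: "(?s a, ?s b) \<in> pairs l" if "(a, b) \<in> pairs l" for a b
    using that srefl_0_order[of a b] SP_eq_neg[OF s, of a b] SP_eq_0[OF s] SP_le[OF s]
    by (auto simp: pairs_def)
  have "bij_betw (\<lambda>(a, b). (?s a, ?s b)) (inversions l (w \<circ> ?s)) (inversions l w)"
  proof (rule bij_betw_byWitness[where f' = "\<lambda>(a, b). (?s a, ?s b)"])
    show "(\<lambda>(a, b). (?s a, ?s b)) ` inversions l (w \<circ> ?s) \<subseteq> inversions l w"
      "(\<lambda>(a, b). (?s a, ?s b)) ` inversions l w \<subseteq> inversions l (w \<circ> ?s)"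
      using pres by (fastforce simp: inversions_def)+
  qed auto
  then show ?thesis by (simp add: linv_def bij_betw_same_card)
qed

lemma linv_s0_left: "w \<in> SP l \<Longrightarrow> il (srefl 0 \<circ> w) = il w"
  using linv_inv[of "srefl 0 \<circ> w" l] linv_s0_right[OF SP_inv, of w]
  by (simp add: SP_inv_comp[of _ l] srefl_0_SP SP_comp inv_srefl linv_inv)

text \<open>Whether \<open>srefl j\<close> is a right descent is decided by the order of the images of its
  root. Applying \<open>srefl i\<close> afterwards can reverse this order only if these images are the
  root of \<open>srefl i\<close>, and then both multiplications agree. This is what makes left and right
  multiplication in the Hecke algebra commute.\<close>

lemma linv_exchange:
  assumes w: "w \<in> SP l" and i: "i \<in> N" and j: "j \<in> N" and ne: "srefl i \<circ> w \<noteq> w \<circ> srefl j"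
  shows "il (srefl i \<circ> w \<circ> srefl j) < il (srefl i \<circ> w) \<longleftrightarrow> il (w \<circ> srefl j) < il w"
proof -
  let ?a = "w j" and ?b = "w (hi j)"
  note ni = N_ge[OF i] and nj = N_ge[OF j]
  have ab: "?a \<noteq> ?b" "?a \<noteq> - ?b" "?b \<noteq> - ?a" "?a \<noteq> 0" "?b \<noteq> 0"
    using nj SP_inj[OF w] SP_eq_neg[OF w] SP_eq_0[OF w] by auto
  have sab: "srefl i ?a \<noteq> srefl i ?b" using ab SP_inj[OF srefl_SP[OF i]] by blast
  have "\<not> ((?a, ?b) \<in> {(i, hi i), (- hi i, - i)} \<or> (?b, ?a) \<in> {(i, hi i), (- hi i, - i)})"
  proof
    assume *: "(?a, ?b) \<in> {(i, hi i), (- hi i, - i)} \<or> (?b, ?a) \<in> {(i, hi i), (- hi i, - i)}"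
    have "srefl i (w x) = w (srefl j x)" for x
    proof -
      have "srefl i y = (if y = a then b else if y = b then a
        else if y = - a then - b else if y = - b then - a else y)"
        if ab: "(a, b) \<in> {(i, hi i), (- hi i, - i)} \<or> (b, a) \<in> {(i, hi i), (- hi i, - i)}" for y a b
      proof -
        consider "a = i" "b = hi i" | "a = - hi i" "b = - i" | "b = i" "a = hi i" | "b = - hi i" "a = - i"
          using ab by auto
        then show ?thesis
          by cases (simp_all only: srefl_hi[OF ni(2)] minus_minus; use ni in smt)+
      qed
      from this[OF *] have "srefl i (w x) = (if w x = ?a then ?b else if w x = ?b then ?a
        else if w x = - ?a then - ?b else if w x = - ?b then - ?a else w x)" .
      also have "\<dots> = w (srefl j x)"
        using nj by (auto simp: srefl_hi SP_inj[OF w] SP_eq_neg[OF w] SP_odd[OF w])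
      finally show ?thesis .
    qed
    with ne show False by (auto simp: fun_eq_iff)
  qed
  then have "srefl i ?b < srefl i ?a \<longleftrightarrow> ?b < ?a"
    using srefl_order[OF i, of ?a ?b] srefl_order[OF i, of ?b ?a] ab sab
    by (cases ?a ?b rule: linorder_cases) auto
  then show ?thesis
    by (simp add: linv_right_less_iff SP_comp w srefl_SP i j)
qed

lemma linv_exchange':
  assumes w: "w \<in> SP l" and i: "i \<in> N" and j: "j \<in> N" and ne: "srefl i \<circ> w \<noteq> w \<circ> srefl j"
  shows "il (srefl i \<circ> w \<circ> srefl j) < il (w \<circ> srefl j) \<longleftrightarrow> il (srefl i \<circ> w) < il w"
proof -
  note S = SP_comp srefl_SP[OF i] srefl_SP[OF j] w SP_inv
  have sinv: "sinv (srefl i \<circ> w) = sinv w \<circ> srefl i" "sinv (w \<circ> srefl j) = srefl j \<circ> sinv w"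
    "sinv (srefl i \<circ> w \<circ> srefl j) = srefl j \<circ> sinv w \<circ> srefl i"
    using i j N_ge by (simp_all add: SP_inv_comp[of _ l] S inv_srefl comp_assoc)
  have "srefl j \<circ> sinv w \<noteq> sinv w \<circ> srefl i"
  proof
    assume "srefl j \<circ> sinv w = sinv w \<circ> srefl i"
    then have "sinv (sinv (w \<circ> srefl j)) = sinv (sinv (srefl i \<circ> w))" by (simp add: sinv)
    with ne show False by (simp add: SP_inv_inv[of _ l] S)
  qed
  note ex = linv_exchange[OF SP_inv[OF w] j i this]
  have m: "srefl i \<circ> w \<in> SP l" "w \<circ> srefl j \<in> SP l" "srefl i \<circ> w \<circ> srefl j \<in> SP l"
    by (simp_all add: S)
  show ?thesis
    using ex linv_inv[OF m(1)] linv_inv[OF m(2)] linv_inv[OF m(3)] linv_inv[OF w]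
    unfolding sinv by (simp only:)
qed

end

section \<open>Sign classes: the double cosets of the symmetric group\<close>

text \<open>The values that occur with a negative sign. Left multiplication by an unsigned
  permutation permutes them, and right multiplication by one does not change them.\<close>

definition negs :: "nat \<Rightarrow> sperm \<Rightarrow> int set" where
  "negs l w = {k. 1 \<le> k \<and> k \<le> int l \<and> sinv w k < 0}"

definition Dn :: "nat \<Rightarrow> nat \<Rightarrow> sperm set" where
  "Dn l n = {w \<in> SP l. card (negs l w) = n}"

text \<open>The longest element of the class.\<close>

definition wlong :: "nat \<Rightarrow> nat \<Rightarrow> sperm" where
  "wlong l n i = (let m = int l - int n in
     if 1 \<le> i \<and> i \<le> m then m + 1 - i else if - m \<le> i \<and> i \<le> - 1 then - m - 1 - i
     else if \<bar>i\<bar> \<le> int l then - i else i)"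

lemma SP_involI:
  assumes "\<And>x. w (w x) = x" "\<And>x. w (- x) = - w x" "\<And>x. \<bar>x\<bar> > int l \<Longrightarrow> w x = x"
  shows "w \<in> SP l" "sinv w = w"
proof -
  have "bij w" by (rule o_bij[of w]) (simp_all add: fun_eq_iff assms(1))
  then show "w \<in> SP l" using assms by (simp add: SP_def)
  show "sinv w = w" by (rule inv_equality) (simp_all add: assms(1))
qed

lemma dperm_SP: "n \<le> l \<Longrightarrow> dperm n \<in> SP l"
  and sinv_dperm: "n \<le> l \<Longrightarrow> sinv (dperm n) = dperm n"
proof -
  assume n: "n \<le> l"
  have *: "dperm n (dperm n x) = x" "dperm n (- x) = - dperm n x" "\<bar>x\<bar> > int l \<Longrightarrow> dperm n x = x" for x
    using n by (auto simp: dperm_def)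
  show "dperm n \<in> SP l" "sinv (dperm n) = dperm n"
    by (rule SP_involI[of "dperm n" l, OF *]; assumption)+
qed

lemma wlong_SP: "n \<le> l \<Longrightarrow> wlong l n \<in> SP l"
  and sinv_wlong: "n \<le> l \<Longrightarrow> sinv (wlong l n) = wlong l n"
proof -
  assume n: "n \<le> l"
  have *: "wlong l n (wlong l n x) = x" "wlong l n (- x) = - wlong l n x"
    "\<bar>x\<bar> > int l \<Longrightarrow> wlong l n x = x" for x
    using n by (auto simp: wlong_def Let_def)
  show "wlong l n \<in> SP l" "sinv (wlong l n) = wlong l n"
    by (rule SP_involI[of "wlong l n" l, OF *]; assumption)+
qed

lemma dperm_Dn: "n \<le> l \<Longrightarrow> dperm n \<in> Dn l n"
proof -
  assume n: "n \<le> l"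
  then have "negs l (dperm n) = {1..int n}"
    by (auto simp: negs_def sinv_dperm[OF n] dperm_def split: if_splits)
  with n show ?thesis by (simp add: Dn_def dperm_SP)
qed

lemma wlong_Dn: "n \<le> l \<Longrightarrow> wlong l n \<in> Dn l n"
proof -
  assume n: "n \<le> l"
  then have "negs l (wlong l n) = {int l - int n + 1..int l}"
    by (auto simp: negs_def sinv_wlong[OF n] wlong_def Let_def split: if_splits)
  with n show ?thesis by (simp add: Dn_def wlong_SP)
qed

lemma Dn_SP: "w \<in> Dn l n \<Longrightarrow> w \<in> SP l"
  by (simp add: Dn_def)

lemma negs_subset: "negs l w \<subseteq> {1..int l}"
  by (auto simp: negs_def)

lemma finite_negs: "finite (negs l w)"
  by (rule finite_subset[OF negs_subset]) simp

lemma card_negs_le: "card (negs l w) \<le> l"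
  using card_mono[OF _ negs_subset[of l w]] by simp

lemma Dn_le: "w \<in> Dn l n \<Longrightarrow> n \<le> l"
  using card_negs_le by (auto simp: Dn_def)

lemma card_negs_eq:
  assumes w: "w \<in> SP l"
  shows "card {k. 1 \<le> k \<and> k \<le> int l \<and> w k < 0} = card (negs l w)"
proof (rule sym, rule bij_betw_same_card)
  note i = SP_inv[OF w]
  show "bij_betw (\<lambda>k. - sinv w k) (negs l w) {k. 1 \<le> k \<and> k \<le> int l \<and> w k < 0}"
  proof (rule bij_betw_byWitness[where f' = "\<lambda>k. - w k"])
    show "(\<lambda>k. - sinv w k) ` negs l w \<subseteq> {k. 1 \<le> k \<and> k \<le> int l \<and> w k < 0}"
    proof (rule image_subsetI)
      fix k assume "k \<in> negs l w"
      then show "- sinv w k \<in> {k. 1 \<le> k \<and> k \<le> int l \<and> w k < 0}"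
        using SP_le[OF i, of k] by (auto simp: negs_def SP_odd[OF w] SP_inv_apply[OF w])
    qed
    show "(\<lambda>k. - w k) ` {k. 1 \<le> k \<and> k \<le> int l \<and> w k < 0} \<subseteq> negs l w"
    proof (rule image_subsetI)
      fix k assume "k \<in> {k. 1 \<le> k \<and> k \<le> int l \<and> w k < 0}"
      then show "- w k \<in> negs l w"
        using SP_le[OF w, of k] by (auto simp: negs_def SP_odd[OF i] SP_inv_apply[OF w])
    qed
  qed (simp_all add: SP_odd[OF w] SP_odd[OF i] SP_inv_apply[OF w])
qed

lemma down_closed_interval:
  fixes K :: "int set"
  assumes K: "K \<subseteq> {1..int l}" and down: "\<And>k. k \<in> K \<Longrightarrow> 1 < k \<Longrightarrow> k - 1 \<in> K"
  shows "K = {1..int (card K)}"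
proof (cases "K = {}")
  case False
  have fin: "finite K" using K by (rule finite_subset) simp
  have m: "Max K \<in> K" using fin False by simp
  have "1 \<le> k \<longrightarrow> k \<in> K" if "k \<le> Max K" for k
    using that
  proof (induction k rule: int_le_induct)
    case (step i)
    then show ?case using down[of i] by auto
  qed (use m in auto)
  then have KM: "K = {1..Max K}" using K fin by auto
  obtain M where M: "M = Max K" by simp
  have "1 \<le> M" using m K M by auto
  then show ?thesis unfolding KM[folded M] by simp
qed simp

lemma up_closed_interval:
  fixes K :: "int set"
  assumes K: "K \<subseteq> {1..int l}" and up: "\<And>k. k \<in> K \<Longrightarrow> k < int l \<Longrightarrow> k + 1 \<in> K"
  shows "K = {int l - int (card K) + 1..int l}"
proof -
  let ?f = "\<lambda>k. int l + 1 - k"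
  have "?f ` K = {1..int (card (?f ` K))}"
  proof (rule down_closed_interval[of _ l])
    show "?f ` K \<subseteq> {1..int l}" using K by auto
    fix k assume "k \<in> ?f ` K" "1 < k"
    then obtain j where j: "j \<in> K" "k = ?f j" by auto
    then have "j + 1 \<in> K" using up \<open>1 < k\<close> by auto
    then show "k - 1 \<in> ?f ` K" using j by (intro image_eqI[of _ _ "j + 1"]) auto
  qed
  moreover have "card (?f ` K) = card K" by (intro card_image inj_onI) simp
  ultimately have "?f ` K = {1..int (card K)}" by simp
  then have "?f ` ?f ` K = ?f ` {1..int (card K)}" by simp
  also have "?f ` ?f ` K = K" by (auto simp: image_image)
  also have "?f ` {1..int (card K)} = {int l - int (card K) + 1..int l}"
    by (auto intro!: image_eqI[of _ _ "int l + 1 - _"])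
  finally show ?thesis .
qed

text \<open>For an increasing function on integers \<open>f k - k\<close> is nondecreasing, and the two end
  conditions bound it by zero from both sides.\<close>

lemma increasing_fixed:
  fixes f :: "int \<Rightarrow> int"
  assumes inc: "\<And>k. a \<le> k \<Longrightarrow> k < b \<Longrightarrow> f k < f (k + 1)" and a: "a \<le> f a" and b: "f b \<le> b"
    and k: "a \<le> k" "k \<le> b"
  shows "f k = k"
proof -
  have "k \<le> b \<longrightarrow> k \<le> f k" using k(1)
  proof (induction k rule: int_ge_induct)
    case (step i)
    then show ?case using inc[of i] by auto
  qed (use a in simp)
  moreover have "a \<le> k \<longrightarrow> f k \<le> k" using k(2)
  proof (induction k rule: int_le_induct)
    case (step i)
    then show ?case using inc[of "i - 1"] by auto
  qed (use b in simp)
  ultimately show ?thesis using k by simp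
qed

context type_D
begin

lemma hi_Oplus: "i \<in> Oplus l \<Longrightarrow> hi i = i + 1"
  by (auto simp: Oplus_iff hi_def)

text \<open>Without descents on either side, the negative signs occupy initial segments, both as
  positions and as values, and the entries increase; this determines the element.\<close>

lemma minimal_unique:
  assumes w: "w \<in> Dn l n"
    and r: "\<And>i. i \<in> Oplus l \<Longrightarrow> w i < w (i + 1)"
    and s: "\<And>i. i \<in> Oplus l \<Longrightarrow> sinv w i < sinv w (i + 1)"
  shows "w = dperm n"
proof -
  have W: "w \<in> SP l" and n: "card (negs l w) = n" using w by (auto simp: Dn_def)
  have nl: "n \<le> l" using Dn_le[OF w] .
  have K: "negs l w = {1..int n}"
    unfolding n[symmetric]
  proof (rule down_closed_interval[OF negs_subset])
    fix k assume "k \<in> negs l w" "1 < k"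
    then show "k - 1 \<in> negs l w" using s[of "k - 1"] by (auto simp: negs_def Oplus_iff)
  qed
  let ?K = "{k. 1 \<le> k \<and> k \<le> int l \<and> w k < 0}"
  have K': "?K = {1..int n}"
    unfolding n[symmetric] card_negs_eq[OF W, symmetric]
  proof (rule down_closed_interval[of _ l])
    fix k assume "k \<in> ?K" "1 < k"
    then show "k - 1 \<in> ?K" using r[of "k - 1"] by (auto simp: Oplus_iff)
  qed auto
  show ?thesis
  proof (rule SP_ext[OF W dperm_SP[OF nl]])
    fix k assume k: "1 \<le> k" "k \<le> int l"
    show "w k = dperm n k"
    proof (cases "k \<le> int n")
      case True
      have "w k + int n + 1 = k"
      proof (rule increasing_fixed[of 1 "int n" "\<lambda>k. w k + int n + 1"])
        have n1: "1 \<in> ?K" using True k by (simp only: K') simp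
        then have "- w 1 \<in> negs l w"
          using SP_le[OF W, of 1] SP_odd[OF SP_inv[OF W], of "w 1"] SP_inv_apply(2)[OF W, of 1]
          by (auto simp: negs_def)
        then show "1 \<le> w 1 + int n + 1" by (simp only: K) simp
        have "int n \<in> ?K" using True k by (simp only: K') simp
        then show "w (int n) + int n + 1 \<le> int n" by auto
        fix j assume "1 \<le> j" "j < int n"
        then show "w j + int n + 1 < w (j + 1) + int n + 1"
          using r[of j] nl by (simp add: Oplus_iff)
      qed (use True k in auto)
      then show ?thesis using True k by (simp add: dperm_def)
    next
      case False
      have "w k = k"
      proof (rule increasing_fixed[of "int n + 1" "int l" w])
        have "int n + 1 \<notin> ?K" by (simp only: K') simp
        then have "w (int n + 1) > 0"
          using False k SP_eq_0[OF W, of "int n + 1"] by auto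
        moreover have "w (int n + 1) \<notin> negs l w"
          by (simp add: negs_def SP_inv_apply(2)[OF W])
        ultimately show "int n + 1 \<le> w (int n + 1)" by (simp add: K)
        show "w (int l) \<le> int l" using SP_le[OF W, of "int l"] by simp
        fix j assume "int n + 1 \<le> j" "j < int l"
        then show "w j < w (j + 1)" using r[of j] by (simp add: Oplus_iff)
      qed (use False k in auto)
      then show ?thesis using False k by (simp add: dperm_def)
    qed
  qed
qed

text \<open>The same argument with all inequalities reversed: the negative signs occupy final
  segments and the entries decrease.\<close>

lemma maximal_unique:
  assumes w: "w \<in> Dn l n"
    and r: "\<And>i. i \<in> Oplus l \<Longrightarrow> w (i + 1) < w i"
    and s: "\<And>i. i \<in> Oplus l \<Longrightarrow> sinv w (i + 1) < sinv w i"
  shows "w = wlong l n"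
proof -
  have W: "w \<in> SP l" and n: "card (negs l w) = n" using w by (auto simp: Dn_def)
  have nl: "n \<le> l" using Dn_le[OF w] .
  define m where "m = int l - int n"
  have K: "negs l w = {m + 1..int l}"
    unfolding m_def n[symmetric]
  proof (rule up_closed_interval[OF negs_subset])
    fix k assume "k \<in> negs l w" "k < int l"
    then show "k + 1 \<in> negs l w" using s[of k] by (auto simp: negs_def Oplus_iff)
  qed
  let ?K = "{k. 1 \<le> k \<and> k \<le> int l \<and> w k < 0}"
  have K': "?K = {m + 1..int l}"
    unfolding m_def n[symmetric] card_negs_eq[OF W, symmetric]
  proof (rule up_closed_interval)
    fix k assume "k \<in> ?K" "k < int l"
    then show "k + 1 \<in> ?K" using r[of k] by (auto simp: Oplus_iff)
  qed auto
  show ?thesis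
  proof (rule SP_ext[OF W wlong_SP[OF nl]])
    fix k assume k: "1 \<le> k" "k \<le> int l"
    show "w k = wlong l n k"
    proof (cases "k \<le> m")
      case True
      have "m + 1 - w k = k"
      proof (rule increasing_fixed[of 1 m "\<lambda>k. m + 1 - w k"])
        have "1 \<notin> ?K" using True k by (simp only: K') simp
        then have "w 1 > 0" using k SP_eq_0[OF W, of 1] by auto
        moreover have "w 1 \<notin> negs l w"
          by (simp add: negs_def SP_inv_apply(2)[OF W])
        moreover have "w 1 \<le> int l" using SP_le[OF W, of 1] l_ge_2 by simp
        ultimately have "w 1 \<le> m" by (simp add: K)
        then show "1 \<le> m + 1 - w 1" by simp
        have "m \<notin> ?K" by (simp only: K') simp
        then have "w m > 0" using True k SP_eq_0[OF W, of m] by (auto simp: m_def)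
        then show "m + 1 - w m \<le> m" by simp
        fix j assume "1 \<le> j" "j < m"
        then show "m + 1 - w j < m + 1 - w (j + 1)"
          using r[of j] by (simp add: Oplus_iff m_def)
      qed (use True k in auto)
      then show ?thesis using True k by (simp add: wlong_def Let_def m_def)
    next
      case False
      have "- w k = k"
      proof (rule increasing_fixed[of "m + 1" "int l" "\<lambda>k. - w k"])
        have "m + 1 \<in> ?K" using False k by (simp only: K') simp
        then have "- w (m + 1) \<in> negs l w"
          using SP_le[OF W, of "m + 1"] SP_odd[OF SP_inv[OF W], of "w (m + 1)"]
            SP_inv_apply(2)[OF W, of "m + 1"]
          by (auto simp: negs_def)
        then show "m + 1 \<le> - w (m + 1)" by (simp only: K) simp
        show "- w (int l) \<le> int l" using SP_le[OF W, of "int l"] by simp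
        fix j assume "m + 1 \<le> j" "j < int l"
        then show "- w j < - w (j + 1)" using r[of j] nl by (simp add: Oplus_iff m_def)
      qed (use False k in auto)
      then show ?thesis using False k by (simp add: wlong_def Let_def m_def)
    qed
  qed
qed

lemma srefl_sign: "i \<in> Oplus l \<Longrightarrow> srefl i x < 0 \<longleftrightarrow> x < 0"
  by (auto simp: Oplus_iff srefl_pos)

lemma srefl_range: "i \<in> Oplus l \<Longrightarrow> 1 \<le> srefl i k \<and> srefl i k \<le> int l \<longleftrightarrow> 1 \<le> k \<and> k \<le> int l"
  by (auto simp: Oplus_iff srefl_pos)

lemma sinv_srefl_left: "w \<in> SP l \<Longrightarrow> i \<in> N \<Longrightarrow> sinv (srefl i \<circ> w) = sinv w \<circ> srefl i"
  and sinv_srefl_right: "w \<in> SP l \<Longrightarrow> i \<in> N \<Longrightarrow> sinv (w \<circ> srefl i) = srefl i \<circ> sinv w"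
  and sinv_s0_left: "w \<in> SP l \<Longrightarrow> sinv (srefl 0 \<circ> w) = sinv w \<circ> srefl 0"
  using N_ge[of i] by (simp_all add: SP_inv_comp[of _ l] srefl_SP srefl_0_SP inv_srefl)

lemma Dn_left:
  assumes w: "w \<in> Dn l n" and i: "i \<in> Oplus l"
  shows "srefl i \<circ> w \<in> Dn l n"
proof -
  have W: "w \<in> SP l" using w by (rule Dn_SP)
  have ge: "i \<ge> - 1" using i by (simp add: Oplus_iff)
  have mem: "k \<in> negs l (srefl i \<circ> w) \<longleftrightarrow> srefl i k \<in> negs l w" for k
    using srefl_range[OF i, of k] by (auto simp: negs_def sinv_srefl_left W Oplus_N[OF i])
  have "bij_betw (srefl i) (negs l (srefl i \<circ> w)) (negs l w)"
    by (rule bij_betw_byWitness[where f' = "srefl i"]) (use ge in \<open>auto simp: mem\<close>)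
  then have "card (negs l (srefl i \<circ> w)) = card (negs l w)" by (rule bij_betw_same_card)
  with w show ?thesis by (simp add: Dn_def SP_comp srefl_SP Oplus_N[OF i])
qed

lemma negs_right: "w \<in> SP l \<Longrightarrow> i \<in> Oplus l \<Longrightarrow> negs l (w \<circ> srefl i) = negs l w"
  by (simp add: negs_def sinv_srefl_right Oplus_N srefl_sign)

lemma Dn_right: "w \<in> Dn l n \<Longrightarrow> i \<in> Oplus l \<Longrightarrow> w \<circ> srefl i \<in> Dn l n"
  by (simp add: Dn_def negs_right SP_comp srefl_SP Oplus_N)

lemma negs_s0:
  assumes "w \<in> SP l"
  shows "negs l (srefl 0 \<circ> w) = (if 1 \<in> negs l w then negs l w - {1} else insert 1 (negs l w))"
proof -
  have "sinv w (- 1) = - sinv w 1" "sinv w 1 \<noteq> 0"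
    using SP_odd[OF SP_inv] SP_eq_0[OF SP_inv] assms by auto
  then show ?thesis
    using l_ge_2 by (auto simp: negs_def sinv_s0_left assms srefl_0)
qed

lemma Dn_s0:
  assumes w: "w \<in> Dn l n"
  shows "1 \<in> negs l w \<Longrightarrow> n > 0 \<and> srefl 0 \<circ> w \<in> Dn l (n - 1)"
    and "1 \<notin> negs l w \<Longrightarrow> srefl 0 \<circ> w \<in> Dn l (Suc n)"
  using w finite_negs[of l w]
  by (auto simp: Dn_def negs_s0 SP_comp srefl_0_SP card_gt_0_iff)

lemma even_negs_s0: "w \<in> SP l \<Longrightarrow> even (card (negs l (srefl 0 \<circ> w))) \<longleftrightarrow> odd (card (negs l w))"
  using Dn_s0[of w "card (negs l w)"]
  by (cases "1 \<in> negs l w") (auto simp: Dn_def)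

lemma gamma_Oplus: "i \<in> Ominus l \<longleftrightarrow> gamma i \<in> Oplus l"
  and gamma_Ominus: "i \<in> Oplus l \<longleftrightarrow> gamma i \<in> Ominus l"
  using l_ge_2 by (auto simp: Oplus_def Ominus_def gamma_def)

lemma gamma_N: "i \<in> N \<Longrightarrow> gamma i \<in> N"
  and gamma_gamma: "i \<in> N \<Longrightarrow> gamma (gamma i) = i"
  by (auto simp: Nset_def gamma_def)

text \<open>Conjugation by \<open>srefl 0\<close> realises the graph automorphism.\<close>

lemma srefl_s0: "i \<in> N \<Longrightarrow> srefl i \<circ> srefl 0 = srefl 0 \<circ> srefl (gamma i)"
  using srefl_0_conj[of i] N_ge[of i] by (simp add: fun_eq_iff)

lemma srefl_s0': "i \<in> N \<Longrightarrow> srefl i \<circ> (srefl 0 \<circ> w) = srefl 0 \<circ> (srefl (gamma i) \<circ> w)"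
  using srefl_s0[of i] by (simp add: fun_eq_iff)

lemma even_negs_left:
  assumes w: "w \<in> SP l" and i: "i \<in> N"
  shows "even (card (negs l (srefl i \<circ> w))) \<longleftrightarrow> even (card (negs l w))"
proof (cases "i \<in> Oplus l")
  case True
  then show ?thesis using Dn_left[of w "card (negs l w)" i] w by (simp add: Dn_def)
next
  case False
  then have i: "i = - 1" "gamma i = 1" "1 \<in> Oplus l" "i \<in> N"
    using i N_Oplus[of i] l_ge_2 by (auto simp: gamma_def Oplus_iff)
  let ?v = "srefl 0 \<circ> w"
  have v: "?v \<in> SP l" by (simp add: SP_comp srefl_0_SP w)
  have "srefl i \<circ> w = srefl i \<circ> (srefl 0 \<circ> ?v)" by (simp add: fun_eq_iff)
  also have "\<dots> = srefl 0 \<circ> (srefl 1 \<circ> ?v)" by (simp only: srefl_s0'[OF i(4)] i(2))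
  finally have e: "srefl i \<circ> w = srefl 0 \<circ> (srefl 1 \<circ> ?v)" .
  have "card (negs l (srefl 1 \<circ> ?v)) = card (negs l ?v)"
    using Dn_left[of ?v "card (negs l ?v)" 1] v i by (simp add: Dn_def)
  moreover have "even (card (negs l (srefl 0 \<circ> (srefl 1 \<circ> ?v)))) \<longleftrightarrow> odd (card (negs l (srefl 1 \<circ> ?v)))"
    by (intro even_negs_s0 SP_comp srefl_SP Oplus_N i v)
  ultimately show ?thesis
    unfolding e using even_negs_s0[OF w] by simp
qed

subsection \<open>Climbing up and down inside a class\<close>

lemma Dn_ascend:
  assumes w: "w \<in> Dn l n" and ne: "w \<noteq> wlong l n"
  shows "\<exists>i\<in>Oplus l. il (srefl i \<circ> w) = Suc (il w) \<or> il (w \<circ> srefl i) = Suc (il w)"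
proof (rule ccontr)
  note W = Dn_SP[OF w]
  assume c: "\<not> ?thesis"
  have "w = wlong l n"
  proof (rule maximal_unique[OF w])
    fix i assume i: "i \<in> Oplus l"
    have "\<not> w i < w (i + 1)" "\<not> sinv w i < sinv w (i + 1)"
      using linv_right_asc[OF W Oplus_N[OF i]] linv_left_asc[OF W Oplus_N[OF i]] c i
      by (auto simp: hi_Oplus)
    moreover have "w i \<noteq> w (i + 1)" "sinv w i \<noteq> sinv w (i + 1)"
      using SP_hi_neq[OF W Oplus_N[OF i]] SP_hi_neq[OF SP_inv[OF W] Oplus_N[OF i]] i
      by (auto simp: hi_Oplus)
    ultimately show "w (i + 1) < w i" "sinv w (i + 1) < sinv w i" by auto
  qed
  with ne show False by simp
qed

lemma Dn_descend:
  assumes w: "w \<in> Dn l n" and ne: "w \<noteq> dperm n"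
  shows "\<exists>i\<in>Oplus l. il w = Suc (il (srefl i \<circ> w)) \<or> il w = Suc (il (w \<circ> srefl i))"
proof (rule ccontr)
  note W = Dn_SP[OF w]
  assume c: "\<not> ?thesis"
  have "w = dperm n"
  proof (rule minimal_unique[OF w])
    fix i assume i: "i \<in> Oplus l"
    have "\<not> w (i + 1) < w i" "\<not> sinv w (i + 1) < sinv w i"
      using linv_right_desc[OF W Oplus_N[OF i]] linv_left_desc[OF W Oplus_N[OF i]] c i
      by (auto simp: hi_Oplus)
    moreover have "w i \<noteq> w (i + 1)" "sinv w i \<noteq> sinv w (i + 1)"
      using SP_hi_neq[OF W Oplus_N[OF i]] SP_hi_neq[OF SP_inv[OF W] Oplus_N[OF i]] i
      by (auto simp: hi_Oplus)
    ultimately show "w i < w (i + 1)" "sinv w i < sinv w (i + 1)" by auto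
  qed
  with ne show False by simp
qed

text \<open>The class is generated from its longest element by multiplications, on either side,
  that decrease the length.\<close>

lemma Dn_ascend_induct [consumes 1, case_names top left right]:
  assumes w: "w \<in> Dn l n" and top: "P (wlong l n)"
    and left: "\<And>v i. v \<in> Dn l n \<Longrightarrow> i \<in> Oplus l \<Longrightarrow> il (srefl i \<circ> v) = Suc (il v) \<Longrightarrow>
      P (srefl i \<circ> v) \<Longrightarrow> P v"
    and right: "\<And>v i. v \<in> Dn l n \<Longrightarrow> i \<in> Oplus l \<Longrightarrow> il (v \<circ> srefl i) = Suc (il v) \<Longrightarrow>
      P (v \<circ> srefl i) \<Longrightarrow> P v"
  shows "P w"
  using w
proof (induction "card (pairs l) - il w" arbitrary: w rule: less_induct)
  case less
  show ?case
  proof (cases "w = wlong l n")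
    case False
    then obtain i where i: "i \<in> Oplus l" "il (srefl i \<circ> w) = Suc (il w) \<or> il (w \<circ> srefl i) = Suc (il w)"
      using Dn_ascend[OF less.prems] by blast
    then consider "il (srefl i \<circ> w) = Suc (il w)" | "il (w \<circ> srefl i) = Suc (il w)" by blast
    then show ?thesis
    proof cases
      case 1
      then show ?thesis
        using left[OF less.prems i(1) 1] less.hyps[of "srefl i \<circ> w"] Dn_left[OF less.prems i(1)]
          linv_le[of l "srefl i \<circ> w"] by simp
    next
      case 2
      then show ?thesis
        using right[OF less.prems i(1) 2] less.hyps[of "w \<circ> srefl i"] Dn_right[OF less.prems i(1)]
          linv_le[of l "w \<circ> srefl i"] by simp
    qed
  qed (use top in simp)
qed

text \<open>Likewise from its shortest element.\<close>

lemma Dn_descend_induct [consumes 1, case_names bot left right]: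
  assumes w: "w \<in> Dn l n" and bot: "P (dperm n)"
    and left: "\<And>v i. v \<in> Dn l n \<Longrightarrow> i \<in> Oplus l \<Longrightarrow> il v = Suc (il (srefl i \<circ> v)) \<Longrightarrow>
      P (srefl i \<circ> v) \<Longrightarrow> P v"
    and right: "\<And>v i. v \<in> Dn l n \<Longrightarrow> i \<in> Oplus l \<Longrightarrow> il v = Suc (il (v \<circ> srefl i)) \<Longrightarrow>
      P (v \<circ> srefl i) \<Longrightarrow> P v"
  shows "P w"
  using w
proof (induction "il w" arbitrary: w rule: less_induct)
  case less
  show ?case
  proof (cases "w = dperm n")
    case False
    then obtain i where i: "i \<in> Oplus l" "il w = Suc (il (srefl i \<circ> w)) \<or> il w = Suc (il (w \<circ> srefl i))"
      using Dn_descend[OF less.prems] by blast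
    then show ?thesis
      using left[OF less.prems i(1)] less.hyps[of "srefl i \<circ> w"] Dn_left[OF less.prems i(1)]
        right[OF less.prems i(1)] less.hyps[of "w \<circ> srefl i"] Dn_right[OF less.prems i(1)]
      by auto
  qed (use bot in simp)
qed

lemma il_wlong_greatest: "w \<in> Dn l n \<Longrightarrow> w \<noteq> wlong l n \<Longrightarrow> il w < il (wlong l n)"
proof -
  assume "w \<in> Dn l n"
  then have "w = wlong l n \<or> il w < il (wlong l n)"
  proof (induction rule: Dn_ascend_induct)
    case (left v i)
    from left(4) have "il (srefl i \<circ> v) \<le> il (wlong l n)" unfolding o_def by auto
    with left(3) show ?case by simp
  next
    case (right v i)
    from right(4) have "il (v \<circ> srefl i) \<le> il (wlong l n)" unfolding o_def by auto
    with right(3) show ?case by simp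
  qed simp
  then show "w \<noteq> wlong l n \<Longrightarrow> il w < il (wlong l n)" by simp
qed

lemma il_wlong_ge: "w \<in> Dn l n \<Longrightarrow> il w \<le> il (wlong l n)"
  using il_wlong_greatest by fastforce

text \<open>Multiplying the longest element of one class by \<open>srefl 0\<close> and then by the first simple
  reflections, in order, moves the new sign to its place at a cost of one in length per
  step.\<close>

lemma il_wlong_Suc:
  assumes n: "n < l"
  shows "il (wlong l (Suc n)) = il (wlong l n) + (l - n - 1)"
proof -
  let ?w = "wlong l n"
  \<comment> \<open>\<open>v j\<close> is the element after \<open>j\<close> such steps, described through its inverse below.\<close>
  define v where "v = rec_nat (srefl 0 \<circ> ?w) (\<lambda>j u. srefl (int (Suc j)) \<circ> u)"
  have v0: "v 0 = srefl 0 \<circ> ?w" and vS: "v (Suc j) = srefl (int (Suc j)) \<circ> v j" for j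
    by (simp_all add: v_def)
  have W: "?w \<in> SP l" and iW: "sinv ?w = ?w" using n by (simp_all add: wlong_SP sinv_wlong)
  have *: "v j \<in> SP l \<and> il (v j) = il ?w + j \<and> (\<forall>x\<ge>1. sinv (v j) x = (if x \<le> int j then int l - int n - x
      else if x = int j + 1 then - (int l - int n) else ?w x))" if "j \<le> l - n - 1" for j
    using that
  proof (induction j)
    case 0
    have "?w (- 1) = - (int l - int n)" using n by (simp add: wlong_def Let_def)
    moreover have "sinv (v 0) = ?w \<circ> srefl 0" unfolding v0 sinv_s0_left[OF W] iW ..
    moreover have "v 0 \<in> SP l" "il (v 0) = il ?w"
      unfolding v0 by (intro SP_comp srefl_0_SP W linv_s0_left)+
    ultimately show ?case by (simp add: srefl_0)
  next
    case (Suc j)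
    let ?i = "int (Suc j)"
    have i: "?i \<in> Oplus l" using Suc.prems n by (auto simp: Oplus_iff)
    have j: "int j + 2 \<le> int l - int n" using Suc.prems n by linarith
    have IH: "v j \<in> SP l" "il (v j) = il ?w + j" "\<And>x. x \<ge> 1 \<Longrightarrow> sinv (v j) x
      = (if x \<le> int j then int l - int n - x
      else if x = int j + 1 then - (int l - int n) else ?w x)"
      using Suc by simp_all
    have w: "?w (int j + 2) = int l - int n - (int j + 1)"
      using j by (simp add: wlong_def Let_def)
    have A: "il (v (Suc j)) = Suc (il (v j))"
      unfolding vS
      by (rule linv_left_asc[OF IH(1) Oplus_N[OF i]]) (use j w in \<open>simp add: hi_def IH(3) add.commute\<close>)
    have B: "sinv (v (Suc j)) x = (if x \<le> ?i then int l - int n - x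
      else if x = ?i + 1 then - (int l - int n) else ?w x)" if "x \<ge> 1" for x
    proof -
      have "sinv (v (Suc j)) x = sinv (v j) (srefl ?i x)"
        by (simp only: vS sinv_srefl_left[OF IH(1) Oplus_N[OF i]] o_apply)
      moreover have "srefl ?i x = (if x = ?i then ?i + 1 else if x = ?i + 1 then ?i else x)"
        using that by (simp add: srefl_pos)
      ultimately show ?thesis
        using that w w[unfolded add.commute[of "int j" 2]] by (auto simp: IH(3))
    qed
    show ?case
    proof (intro conjI allI impI)
      show "v (Suc j) \<in> SP l" unfolding vS by (intro SP_comp srefl_SP Oplus_N i IH)
      show "il (v (Suc j)) = il ?w + Suc j" using A IH(2) by simp
    qed (rule B)
  qed
  let ?v = "v (l - n - 1)"
  have V: "?v \<in> SP l" "il ?v = il ?w + (l - n - 1)" using * by simp_all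
  have "sinv ?v = wlong l (Suc n)"
  proof (rule SP_ext)
    show "sinv ?v \<in> SP l" "wlong l (Suc n) \<in> SP l" using V n by (simp_all add: SP_inv wlong_SP)
    fix k assume k: "1 \<le> k" "k \<le> int l"
    have "sinv ?v k = (if k \<le> int (l - n - 1) then int l - int n - k
      else if k = int (l - n - 1) + 1 then - (int l - int n) else ?w k)"
      using *[OF order_refl] k(1) by blast
    then show "sinv ?v k = wlong l (Suc n) k"
      using n k by (auto simp: wlong_def Let_def)
  qed
  then have "?v = wlong l (Suc n)"
    using SP_inv_inv[OF V(1)] n by (simp add: sinv_wlong)
  with V show ?thesis by simp
qed

lemma il_wlong_mono: "m \<le> n \<Longrightarrow> n \<le> l \<Longrightarrow> il (wlong l m) \<le> il (wlong l n)"
proof (induction n rule: dec_induct)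
  case (step n)
  then show ?case using il_wlong_Suc[of n] by simp
qed simp

end

section \<open>The Weyl group of type D\<close>

context type_D
begin

lemma word_Nil: "word [] = id"
  and word_Cons: "word (i # js) = srefl i \<circ> word js"
  by (simp_all add: word_def)

lemma word_append: "word (js @ ks) = word js \<circ> word ks"
  by (induction js) (simp_all add: word_Nil word_Cons comp_assoc)

lemma word_snoc: "word (js @ [i]) = word js \<circ> srefl i"
  by (simp add: word_append word_Cons word_Nil)

lemma word_SP: "js \<in> lists N \<Longrightarrow> word js \<in> SP l"
  by (induction js) (simp_all add: word_Nil word_Cons SP_id SP_comp srefl_SP)

lemma il_word_le: "js \<in> lists N \<Longrightarrow> il (word js) \<le> length js"
proof (induction js)
  case (Cons i js)
  then show ?case
    unfolding word_Cons using linv_left_cases[of "word js" i] word_SP[of js]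
    by (auto simp del: o_apply)
qed (simp add: word_Nil linv_id)

lemma card_negs_id: "card (negs l id) = 0"
proof -
  have "negs l id = {}" by (auto simp: negs_def)
  then show ?thesis by simp
qed

lemma even_negs_word: "js \<in> lists N \<Longrightarrow> even (card (negs l (word js)))"
  by (induction js) (simp_all add: word_Nil word_Cons card_negs_id even_negs_left word_SP)

lemma word_rev: "js \<in> lists N \<Longrightarrow> sinv (word js) = word (rev js)"
proof (induction js)
  case (Cons i js)
  then show ?case
    by (simp only: word_Cons rev.simps word_snoc) (simp add: sinv_srefl_left word_SP del: o_apply)
qed (simp add: word_Nil)

text \<open>The condition for \<open>i = - 1\<close> says that \<open>- w 1 < w 2\<close>. Hence the absolute values
  increase, and only the sign of \<open>w 1\<close> remains free.\<close>

lemma no_descent: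
  assumes w: "w \<in> SP l" and asc: "\<And>i. i \<in> N \<Longrightarrow> w i < w (hi i)"
  shows "w = id \<or> w = srefl 0"
proof -
  have inc: "w i < w (i + 1)" if "1 \<le> i" "i < int l" for i
    using asc[of i] that hi_Oplus[of i] Oplus_N[of i] by (simp add: Oplus_iff)
  have m1: "- w 1 < w 2" using asc[of "- 1"] SP_odd[OF w, of 1] by (simp add: Nset_def hi_def)
  have fixed: "(if k = 1 then \<bar>w 1\<bar> else w k) = k" if "1 \<le> k" "k \<le> int l" for k
  proof (rule increasing_fixed[OF _ _ _ that, of "\<lambda>k. if k = 1 then \<bar>w 1\<bar> else w k"])
    fix k assume "1 \<le> k" "k < int l"
    then show "(if k = 1 then \<bar>w 1\<bar> else w k) < (if k + 1 = 1 then \<bar>w 1\<bar> else w (k + 1))"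
      using inc[of k] m1 by auto
  next
    show "1 \<le> (if (1::int) = 1 then \<bar>w 1\<bar> else w 1)" using SP_eq_0[OF w, of 1] by auto
    show "(if int l = 1 then \<bar>w 1\<bar> else w (int l)) \<le> int l"
      using SP_le[OF w, of "int l"] l_ge_2 by auto
  qed
  have "\<bar>w 1\<bar> = 1" using fixed[of 1] l_ge_2 by simp
  then consider "w 1 = 1" | "w 1 = - 1" by linarith
  then show ?thesis
  proof cases
    case 1
    have "w = id"
      by (rule SP_ext[OF w SP_id]) (use fixed 1 in \<open>metis id_apply\<close>)
    then show ?thesis ..
  next
    case 2
    have "w = srefl 0"
    proof (rule SP_ext[OF w srefl_0_SP])
      fix k assume "1 \<le> k" "k \<le> int l"
      then show "w k = srefl 0 k" using fixed[of k] 2 by (auto simp: srefl_0 split: if_splits)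
    qed
    then show ?thesis ..
  qed
qed

text \<open>Removing right descents one at a time ends at an element without descents.\<close>

lemma SP_word:
  assumes "w \<in> SP l"
  shows "\<exists>js\<in>lists N. (w = word js \<or> w = srefl 0 \<circ> word js) \<and> length js = il w"
  using assms
proof (induction "il w" arbitrary: w rule: less_induct)
  case less
  show ?case
  proof (cases "\<exists>i\<in>N. w (hi i) < w i")
    case True
    then obtain i where i: "i \<in> N" "w (hi i) < w i" by blast
    note d = linv_right_desc[OF less.prems i]
    have "w \<circ> srefl i \<in> SP l" by (intro SP_comp less.prems srefl_SP i)
    then obtain js where js: "js \<in> lists N" "w \<circ> srefl i = word js \<or> w \<circ> srefl i = srefl 0 \<circ> word js"
      "length js = il (w \<circ> srefl i)"
      using less.hyps[of "w \<circ> srefl i"] d by auto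
    have "w = w \<circ> srefl i \<circ> srefl i" using N_ge[OF i(1)] by (simp add: srefl_comp_srefl')
    then have "w = word (js @ [i]) \<or> w = srefl 0 \<circ> word (js @ [i])"
      using js(2) by (metis word_snoc comp_assoc)
    then show ?thesis using js i d by (intro bexI[of _ "js @ [i]"]) auto
  next
    case False
    then have "w = id \<or> w = srefl 0"
      using SP_hi_neq[OF less.prems] by (intro no_descent[OF less.prems]) force
    then show ?thesis
      using linv_id linv_s0_left[OF SP_id] by (intro bexI[of _ "[]"]) (auto simp: word_Nil)
  qed
qed

lemma Weyl_word:
  assumes "w \<in> SP l" "even (card (negs l w))"
  shows "\<exists>js\<in>lists N. w = word js \<and> length js = il w"
proof -
  obtain js where js: "js \<in> lists N" "w = word js \<or> w = srefl 0 \<circ> word js" "length js = il w"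
    using SP_word[OF assms(1)] by blast
  moreover have "w \<noteq> srefl 0 \<circ> word js"
    using even_negs_s0[OF word_SP[OF js(1)]] even_negs_word[OF js(1)] assms(2) by auto
  ultimately show ?thesis by blast
qed

lemma Weyl_iff: "w \<in> Weyl l \<longleftrightarrow> w \<in> SP l \<and> even (card (negs l w))"
  using Weyl_word[of w] word_SP even_negs_word by (auto simp: Weyl_def parab_def)

lemma Weyl_SP: "w \<in> Weyl l \<Longrightarrow> w \<in> SP l"
  by (simp add: Weyl_iff)

lemma len_eq:
  assumes "w \<in> Weyl l"
  shows "len l w = il w"
  unfolding len_def
proof (rule Least_equality)
  show "\<exists>js\<in>lists N. word js = w \<and> length js = il w"
    using Weyl_word[of w] assms by (auto simp: Weyl_iff)
qed (use il_word_le in auto)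

lemma Weyl_id: "id \<in> Weyl l"
  by (simp add: Weyl_iff SP_id card_negs_id)

lemma Weyl_left: "w \<in> Weyl l \<Longrightarrow> i \<in> N \<Longrightarrow> srefl i \<circ> w \<in> Weyl l"
  by (simp add: Weyl_iff SP_comp srefl_SP even_negs_left)

lemma Weyl_left_iff: "i \<in> N \<Longrightarrow> srefl i \<circ> w \<in> Weyl l \<longleftrightarrow> w \<in> Weyl l"
  using Weyl_left[of w i] Weyl_left[of "srefl i \<circ> w" i] N_ge[of i]
  by (auto simp: srefl_comp_srefl')

lemma parab_mult: 
  assumes "u \<in> parab I" "v \<in> parab I"
  shows "u \<circ> v \<in> parab I"
proof -
  from assms obtain js ks where "js \<in> lists I" "u = word js" "ks \<in> lists I" "v = word ks"
    unfolding parab_def by blast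
  moreover from this have "word (js @ ks) \<in> word ` lists I" by (intro imageI) simp
  ultimately show ?thesis by (simp only: parab_def word_append)
qed

lemma Weyl_comp: "v \<in> Weyl l \<Longrightarrow> w \<in> Weyl l \<Longrightarrow> v \<circ> w \<in> Weyl l"
  unfolding Weyl_def by (rule parab_mult)

lemma Weyl_srefl: "i \<in> N \<Longrightarrow> srefl i \<in> Weyl l"
  using Weyl_left[OF Weyl_id, of i] by simp

lemma Weyl_inv:
  assumes "w \<in> Weyl l"
  shows "sinv w \<in> Weyl l"
proof -
  from assms obtain js where js: "js \<in> lists N" "w = word js"
    unfolding Weyl_def parab_def by blast
  then have "word (rev js) \<in> word ` lists N" by (intro imageI) auto
  then show ?thesis by (simp only: js(2) Weyl_def parab_def word_rev[OF js(1)])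
qed

lemma finite_Weyl: "finite (Weyl l)"
proof (rule finite_subset)
  show "Weyl l \<subseteq> word ` {js. set js \<subseteq> N \<and> length js \<le> card (pairs l)}"
  proof
    fix w assume "w \<in> Weyl l"
    then obtain js where "js \<in> lists N" "w = word js" "length js = il w"
      using Weyl_word by (auto simp: Weyl_iff)
    then show "w \<in> word ` {js. set js \<subseteq> N \<and> length js \<le> card (pairs l)}"
      using linv_le[of l w] by auto
  qed
  have "finite N" by (simp add: Nset_def)
  then show "finite (word ` {js. set js \<subseteq> N \<and> length js \<le> card (pairs l)})"
    by (intro finite_imageI finite_lists_length_le)
qed

lemma s0_Weyl: "w \<in> SP l \<Longrightarrow> srefl 0 \<circ> w \<in> Weyl l \<longleftrightarrow> w \<notin> Weyl l"
  by (simp add: Weyl_iff even_negs_s0 SP_comp srefl_0_SP)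

lemma s0_s0: "srefl 0 \<circ> (srefl 0 \<circ> w) = w" "w \<circ> srefl 0 \<circ> srefl 0 = w"
  by (simp_all add: fun_eq_iff)

lemma finite_SP: "finite (SP l)"
proof (rule finite_subset)
  show "SP l \<subseteq> Weyl l \<union> (\<circ>) (srefl 0) ` Weyl l"
  proof
    fix w assume w: "w \<in> SP l"
    then have "w \<in> Weyl l \<or> srefl 0 \<circ> w \<in> Weyl l" by (simp add: s0_Weyl)
    then show "w \<in> Weyl l \<union> (\<circ>) (srefl 0) ` Weyl l"
      using s0_s0(1)[of w] by (metis UnCI imageI)
  qed
qed (simp add: finite_Weyl)

lemma finite_Dn: "finite (Dn l n)"
  by (rule finite_subset[OF _ finite_SP]) (auto simp: Dn_def)

lemma gamma_W_SP: "w \<in> Weyl l \<Longrightarrow> gamma_W l w = srefl 0 \<circ> w \<circ> srefl 0"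
  by (rule gamma_W_eq)

lemma s0_conj_Weyl: "w \<in> Weyl l \<Longrightarrow> srefl 0 \<circ> w \<circ> srefl 0 \<in> Weyl l"
proof -
  assume "w \<in> Weyl l"
  then obtain js where js: "js \<in> lists N" "w = word js" by (auto simp: Weyl_def parab_def)
  have "map gamma js \<in> lists N" using js(1) gamma_N by fastforce
  then have "word (map gamma js) \<in> word ` lists N" by (rule imageI)
  then show ?thesis using word_map_gamma[OF js(1)] js(2) by (simp add: Weyl_def parab_def)
qed

text \<open>The class of \<open>n\<close> signs lies in the Weyl group after a shift by \<open>srefl 0\<close> when \<open>n\<close> is
  odd.\<close>

definition shift :: "nat \<Rightarrow> sperm \<Rightarrow> sperm" where
  "shift n w = (if even n then w else srefl 0 \<circ> w)"

lemma shift_Weyl: "w \<in> SP l \<Longrightarrow> shift n w \<in> Weyl l \<longleftrightarrow> even (n + card (negs l w))"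
proof (cases "even n")
  case False
  assume w: "w \<in> SP l"
  have "shift n w \<in> Weyl l \<longleftrightarrow> w \<notin> Weyl l" unfolding shift_def using False s0_Weyl[OF w] by simp
  then show ?thesis using False w by (simp add: Weyl_iff[of w])
qed (simp add: shift_def Weyl_iff)

lemma shift_SP: "w \<in> SP l \<Longrightarrow> shift n w \<in> SP l"
  by (simp add: shift_def SP_comp srefl_0_SP)

lemma il_shift: "w \<in> SP l \<Longrightarrow> il (shift n w) = il w"
  by (simp add: shift_def linv_s0_left)

lemma shift_shift [simp]: "shift n (shift n w) = w"
  by (simp add: shift_def s0_s0)

lemma shift_inj: "shift n v = shift n w \<longleftrightarrow> v = w"
  by (metis shift_shift)

lemma shift_Dn_Weyl: "w \<in> Dn l m \<Longrightarrow> even (m + n) \<Longrightarrow> shift n w \<in> Weyl l"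
  by (simp add: Dn_def shift_Weyl add.commute)

subsection \<open>Double cosets and their longest elements\<close>

lemma parab_induct [consumes 1, case_names id step]:
  assumes "u \<in> parab I" "P id" "\<And>u i. u \<in> parab I \<Longrightarrow> i \<in> I \<Longrightarrow> P u \<Longrightarrow> P (srefl i \<circ> u)"
  shows "P u"
proof -
  from assms(1) obtain js where "js \<in> lists I" "u = word js" by (auto simp: parab_def)
  moreover have "js \<in> lists I \<Longrightarrow> P (word js)"
  proof (induction js)
    case (Cons i js)
    then have "word js \<in> parab I" by (simp add: parab_def)
    with Cons show ?case using assms(3)[of "word js" i] by (simp add: word_Cons del: o_apply)
  qed (simp add: word_Nil assms(2))
  ultimately show ?thesis by simp
qed

lemma parab_id: "id \<in> parab I"
  by (auto simp: parab_def word_Nil intro!: image_eqI[of _ word "[]"])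

lemma parab_left: "u \<in> parab I \<Longrightarrow> i \<in> I \<Longrightarrow> srefl i \<circ> u \<in> parab I"
  by (auto simp: parab_def word_Cons intro!: image_eqI[of _ word "_ # _"])

lemma parab_right: "u \<in> parab I \<Longrightarrow> i \<in> I \<Longrightarrow> u \<circ> srefl i \<in> parab I"
  by (auto simp: parab_def word_snoc intro!: image_eqI[of _ word "_ @ [_]"])

lemma parab_Oplus_Dn:
  assumes "u \<in> parab (Oplus l)" "w \<in> Dn l n"
  shows "u \<circ> w \<in> Dn l n"
  using assms(1)
proof (induction rule: parab_induct)
  case (step u i)
  then show ?case using Dn_left[of "u \<circ> w" n i] by (simp add: comp_assoc del: o_apply)
qed (use assms(2) in simp)

lemma Dn_parab_Oplus:
  assumes "u \<in> parab (Oplus l)" "w \<in> Dn l n"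
  shows "w \<circ> u \<in> Dn l n"
  using assms
proof (induction arbitrary: w rule: parab_induct)
  case (step u i)
  then show ?case using step(3)[OF Dn_right[OF step(4,2)]]
    by (simp add: comp_assoc del: o_apply)
qed simp

text \<open>A class is stable under both multiplications, and descending inside it always ends at
  \<open>dperm n\<close>.\<close>

lemma double_coset_Oplus:
  assumes n: "n \<le> l"
  shows "double_coset (Oplus l) (dperm n) (Oplus l) = Dn l n"
proof (intro equalityI subsetI)
  fix w assume "w \<in> double_coset (Oplus l) (dperm n) (Oplus l)"
  then show "w \<in> Dn l n"
    using parab_Oplus_Dn Dn_parab_Oplus dperm_Dn[OF n] by (auto simp: double_coset_def)
next
  fix w assume "w \<in> Dn l n"
  then have "\<exists>u v. w = u \<circ> dperm n \<circ> v \<and> u \<in> parab (Oplus l) \<and> v \<in> parab (Oplus l)"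
  proof (induction rule: Dn_descend_induct)
    case bot
    have "dperm n = id \<circ> dperm n \<circ> id" by simp
    then show ?case using parab_id by blast
  next
    case (left x i)
    then obtain u v where uv: "srefl i \<circ> x = u \<circ> dperm n \<circ> v" "u \<in> parab (Oplus l)" "v \<in> parab (Oplus l)"
      by blast
    have "x = srefl i \<circ> (srefl i \<circ> x)" using left(2) by (simp add: srefl_comp_srefl' Oplus_iff)
    then have "x = srefl i \<circ> u \<circ> dperm n \<circ> v" by (simp only: uv(1) comp_assoc)
    then show ?case using parab_left[OF uv(2) left(2)] uv(3) by blast
  next
    case (right x i)
    then obtain u v where uv: "x \<circ> srefl i = u \<circ> dperm n \<circ> v" "u \<in> parab (Oplus l)" "v \<in> parab (Oplus l)"
      by blast
    have "x = x \<circ> srefl i \<circ> srefl i" using right(2) by (simp add: srefl_comp_srefl' Oplus_iff)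
    then have "x = u \<circ> dperm n \<circ> (v \<circ> srefl i)" by (simp only: uv(1) comp_assoc)
    then show ?case using parab_right[OF uv(3) right(2)] uv(2) by blast
  qed
  then show "w \<in> double_coset (Oplus l) (dperm n) (Oplus l)"
    unfolding double_coset_def by blast
qed

lemma dperm_0: "dperm 0 = id"
  by (auto simp: dperm_def fun_eq_iff)

lemma parab_Oplus: "parab (Oplus l) = Dn l 0"
proof
  show "parab (Oplus l) \<subseteq> Dn l 0"
    using parab_Oplus_Dn[of _ "dperm 0" 0] dperm_Dn[of 0 l] by (auto simp: dperm_0)
  show "Dn l 0 \<subseteq> parab (Oplus l)"
  proof
    fix w assume "w \<in> Dn l 0"
    then have "w \<in> double_coset (Oplus l) id (Oplus l)"
      using double_coset_Oplus[of 0] by (simp add: dperm_0)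
    then obtain u v where uv: "w = u \<circ> id \<circ> v" "u \<in> parab (Oplus l)" "v \<in> parab (Oplus l)"
      unfolding double_coset_def by blast
    from parab_mult[OF uv(2,3)] show "w \<in> parab (Oplus l)" by (simp add: uv(1))
  qed
qed

lemma parab_Ominus: "parab (Ominus l) = (\<lambda>w. srefl 0 \<circ> w \<circ> srefl 0) ` parab (Oplus l)"
proof (intro equalityI subsetI)
  fix w assume "w \<in> parab (Ominus l)"
  then obtain js where js: "js \<in> lists (Ominus l)" "w = word js" by (auto simp: parab_def)
  have N: "js \<in> lists N" using js(1) Ominus_N by auto
  have "map gamma js \<in> lists (Oplus l)" using js(1) by (auto simp: gamma_Oplus)
  then have "srefl 0 \<circ> word js \<circ> srefl 0 \<in> parab (Oplus l)"
    by (auto simp: parab_def word_map_gamma[OF N, symmetric])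
  moreover have "w = srefl 0 \<circ> (srefl 0 \<circ> word js \<circ> srefl 0) \<circ> srefl 0"
    using js by (simp add: fun_eq_iff)
  ultimately show "w \<in> (\<lambda>w. srefl 0 \<circ> w \<circ> srefl 0) ` parab (Oplus l)" by blast
next
  fix w assume "w \<in> (\<lambda>w. srefl 0 \<circ> w \<circ> srefl 0) ` parab (Oplus l)"
  then obtain js where js: "js \<in> lists (Oplus l)" "w = srefl 0 \<circ> word js \<circ> srefl 0"
    by (auto simp: parab_def)
  have N: "js \<in> lists N" using js(1) Oplus_N by auto
  have "map gamma js \<in> lists (Ominus l)" using js(1) by (auto simp: gamma_Ominus)
  then show "w \<in> parab (Ominus l)"
    using js by (auto simp: parab_def word_map_gamma[OF N, symmetric])
qed

lemma double_coset_Ominus: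
  assumes n: "n \<le> l"
  shows "double_coset (Ominus l) (srefl 0 \<circ> dperm n) (Oplus l) = (\<circ>) (srefl 0) ` Dn l n"
proof -
  have "double_coset (Ominus l) (srefl 0 \<circ> dperm n) (Oplus l)
      = {srefl 0 \<circ> u \<circ> srefl 0 \<circ> (srefl 0 \<circ> dperm n) \<circ> v | u v. u \<in> parab (Oplus l) \<and> v \<in> parab (Oplus l)}"
    unfolding double_coset_def parab_Ominus by blast
  also have "\<dots> = {srefl 0 \<circ> (u \<circ> dperm n \<circ> v) | u v. u \<in> parab (Oplus l) \<and> v \<in> parab (Oplus l)}"
    by (simp only: comp_assoc s0_s0)
  also have "\<dots> = (\<circ>) (srefl 0) ` double_coset (Oplus l) (dperm n) (Oplus l)"
    unfolding double_coset_def by blast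
  finally show ?thesis by (simp only: double_coset_Oplus[OF n])
qed

lemma longest_eq:
  assumes "w \<in> D" "D \<subseteq> Weyl l" "\<And>v. v \<in> D \<Longrightarrow> v \<noteq> w \<Longrightarrow> il v < il w"
  shows "longest l D = w"
  unfolding longest_def
proof (rule the_equality)
  have le: "len l v = il v" if "v \<in> D" for v using len_eq assms(2) that by blast
  show "w \<in> D \<and> (\<forall>v\<in>D. len l v \<le> len l w)"
    using assms(1,3) le by (metis le_refl less_imp_le)
  fix v assume "v \<in> D \<and> (\<forall>u\<in>D. len l u \<le> len l v)"
  then show "v = w" using assms(3)[of v] assms(1) le by fastforce
qed

lemma longest_shift:
  assumes n: "n \<le> l"
  shows "longest l (shift n ` Dn l n) = shift n (wlong l n)"
proof (rule longest_eq)
  show "shift n ` Dn l n \<subseteq> Weyl l" by (auto intro: shift_Dn_Weyl)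
  show "il v < il (shift n (wlong l n))" if "v \<in> shift n ` Dn l n" "v \<noteq> shift n (wlong l n)" for v
    using that il_wlong_greatest[of _ n] by (auto simp: il_shift Dn_SP wlong_SP n shift_inj)
qed (use wlong_Dn[OF n] in simp)

lemma double_coset_shift:
  "n \<le> l \<Longrightarrow> double_coset (if even n then Oplus l else Ominus l) (shift n (dperm n)) (Oplus l)
    = shift n ` Dn l n"
  by (simp add: double_coset_Oplus double_coset_Ominus shift_def)

lemma wmax_Oplus: "wmax l (Oplus l) = wlong l 0"
  using longest_shift[of 0] by (simp add: wmax_def parab_Oplus shift_def)

lemma wmax_Ominus: "wmax l (Ominus l) = srefl 0 \<circ> wlong l 0 \<circ> srefl 0"
  unfolding wmax_def parab_Ominus parab_Oplus
proof (rule longest_eq)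
  have W: "w \<in> Weyl l" if "w \<in> Dn l 0" for w using that by (simp add: Dn_def Weyl_iff)
  then show "(\<lambda>w. srefl 0 \<circ> w \<circ> srefl 0) ` Dn l 0 \<subseteq> Weyl l"
    using s0_conj_Weyl by auto
  have il: "il (srefl 0 \<circ> w \<circ> srefl 0) = il w" if "w \<in> SP l" for w
    using that by (simp add: linv_s0_right linv_s0_left SP_comp srefl_0_SP)
  show "il v < il (srefl 0 \<circ> wlong l 0 \<circ> srefl 0)"
    if "v \<in> (\<lambda>w. srefl 0 \<circ> w \<circ> srefl 0) ` Dn l 0" "v \<noteq> srefl 0 \<circ> wlong l 0 \<circ> srefl 0" for v
  proof -
    from that obtain w where w: "w \<in> Dn l 0" "v = srefl 0 \<circ> w \<circ> srefl 0" by blast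
    with that(2) have "w \<noteq> wlong l 0" by blast
    then show ?thesis
      using il_wlong_greatest[OF w(1)] w il[OF Dn_SP[OF w(1)]] il[OF wlong_SP[of 0 l]] by simp
  qed
qed (use wlong_Dn[of 0 l] in simp)

subsection \<open>Bruhat order\<close>

lemma bruhat_less_Weyl:
  assumes "(v, w) \<in> bruhat_less l"
  shows "v \<in> Weyl l \<and> w \<in> Weyl l \<and> il v < il w"
proof -
  have step: "x \<in> Weyl l \<and> y \<in> Weyl l \<and> il x < il y"
    if xy: "(x, y) \<in> {(v, v \<circ> r) | v r. v \<in> Weyl l
     \<and> (\<exists>u\<in>Weyl l. \<exists>i\<in>Nset l. r = u \<circ> srefl i \<circ> sinv u) \<and> len l v < len l (v \<circ> r)}" for x y
  proof -
    from xy obtain r u i where r: "y = x \<circ> r" "x \<in> Weyl l" "u \<in> Weyl l" "i \<in> N"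
      "r = u \<circ> srefl i \<circ> sinv u" "len l x < len l (x \<circ> r)" by blast
    have "x \<circ> r \<in> Weyl l" unfolding r(5) by (intro Weyl_comp Weyl_srefl Weyl_inv r)
    with r show ?thesis by (simp only: len_eq)
  qed
  from assms show ?thesis
    unfolding bruhat_less_def
  proof (induction rule: trancl_induct)
    case (base y)
    then show ?case by (rule step)
  next
    case (step y z)
    from step(3) \<open>\<And>x y. _ \<Longrightarrow> x \<in> Weyl l \<and> y \<in> Weyl l \<and> il x < il y\<close>[OF step(2)]
    show ?case by auto
  qed
qed

lemma bruhat_trans: "(u, v) \<in> bruhat_less l \<Longrightarrow> (v, w) \<in> bruhat_less l \<Longrightarrow> (u, w) \<in> bruhat_less l"
  unfolding bruhat_less_def by (rule trancl_trans)

lemma bruhat_reflection: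
  assumes "v \<in> Weyl l" "u \<in> Weyl l" "i \<in> N" "r = u \<circ> srefl i \<circ> sinv u" "il v < il (v \<circ> r)"
  shows "(v, v \<circ> r) \<in> bruhat_less l"
proof -
  have "v \<circ> r \<in> Weyl l" unfolding assms(4) by (intro Weyl_comp Weyl_srefl Weyl_inv assms)
  then have "len l v < len l (v \<circ> r)" using assms by (simp only: len_eq)
  then show ?thesis
    unfolding bruhat_less_def using assms(1-4) by (intro r_into_trancl) blast
qed

lemma bruhat_left:
  assumes v: "v \<in> Weyl l" and i: "i \<in> N" and "il v < il (srefl i \<circ> v)"
  shows "(v, srefl i \<circ> v) \<in> bruhat_less l"
proof -
  let ?r = "sinv v \<circ> srefl i \<circ> v"
  have "v \<circ> ?r = srefl i \<circ> v"
    using SP_inv_apply(1)[OF Weyl_SP[OF v]] by (simp add: fun_eq_iff)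
  moreover have "?r = sinv v \<circ> srefl i \<circ> sinv (sinv v)" using SP_inv_inv[OF Weyl_SP[OF v]] by simp
  ultimately show ?thesis
    using bruhat_reflection[OF v Weyl_inv[OF v] i, of ?r] assms(3) by simp
qed

lemma bruhat_right:
  assumes v: "v \<in> Weyl l" and i: "i \<in> N" and "il v < il (v \<circ> srefl i)"
  shows "(v, v \<circ> srefl i) \<in> bruhat_less l"
  using bruhat_reflection[OF v Weyl_id i, of "srefl i"] assms(3) by simp

lemma shift_left:
  assumes "i \<in> N"
  shows "\<exists>j\<in>N. shift n (srefl i \<circ> v) = srefl j \<circ> shift n v"
proof (cases "even n")
  case False
  then show ?thesis
    using srefl_s0'[of "gamma i" v] gamma_gamma[OF assms] gamma_N[OF assms]
    by (intro bexI[of _ "gamma i"]) (simp_all add: shift_def)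
qed (use assms in \<open>auto simp: shift_def\<close>)

lemma shift_right: "shift n (v \<circ> srefl i) = shift n v \<circ> srefl i"
  by (simp add: shift_def comp_assoc)

text \<open>Climbing in the class to its longest element is a chain of Bruhat relations.\<close>

lemma bruhat_Dn:
  assumes v: "v \<in> Dn l n" and e: "even (n + p)" and ne: "v \<noteq> wlong l n"
  shows "(shift p v, shift p (wlong l n)) \<in> bruhat_less l"
proof -
  let ?P = "\<lambda>v. v = wlong l n \<or> (shift p v, shift p (wlong l n)) \<in> bruhat_less l"
  from v have "?P v"
  proof (induction rule: Dn_ascend_induct)
    case (left v i)
    note V = Dn_SP[OF left(1)] Dn_SP[OF Dn_left[OF left(1,2)]]
    obtain j where j: "j \<in> N" "shift p (srefl i \<circ> v) = srefl j \<circ> shift p v"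
      using shift_left Oplus_N[OF left(2)] by blast
    have "(shift p v, srefl j \<circ> shift p v) \<in> bruhat_less l"
      by (rule bruhat_left[OF shift_Dn_Weyl[OF left(1) e] j(1)])
        (use il_shift[OF V(1), of p] il_shift[OF V(2), of p] left(3) j(2) in simp)
    then have 1: "(shift p v, shift p (srefl i \<circ> v)) \<in> bruhat_less l" by (simp only: j(2))
    from left(4) consider "srefl i \<circ> v = wlong l n"
      | "(shift p (srefl i \<circ> v), shift p (wlong l n)) \<in> bruhat_less l" unfolding o_def by blast
    then show ?case using 1 bruhat_trans[OF 1] by cases (simp_all only:, simp_all)
  next
    case (right v i)
    note V = Dn_SP[OF right(1)] Dn_SP[OF Dn_right[OF right(1,2)]]
    have "(shift p v, shift p v \<circ> srefl i) \<in> bruhat_less l"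
      by (rule bruhat_right[OF shift_Dn_Weyl[OF right(1) e] Oplus_N[OF right(2)]])
        (use il_shift[OF V(1), of p] il_shift[OF V(2), of p] right(3) in \<open>simp add: shift_right\<close>)
    then have 1: "(shift p v, shift p (v \<circ> srefl i)) \<in> bruhat_less l" by (simp only: shift_right)
    from right(4) consider "v \<circ> srefl i = wlong l n"
      | "(shift p (v \<circ> srefl i), shift p (wlong l n)) \<in> bruhat_less l" unfolding o_def by blast
    then show ?case using 1 bruhat_trans[OF 1] by cases (simp_all only:, simp_all)
  qed simp
  with ne show ?thesis by blast
qed

text \<open>Left multiplication by the exceptional reflection creates two negative signs and
  increases the length; the rest is climbing in the new class.\<close>

lemma bruhat_wlong_step:
  assumes n: "n + 2 \<le> l" and e: "even (n + p)"
  shows "(shift p (wlong l n), shift p (wlong l (n + 2))) \<in> bruhat_less l"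
proof -
  let ?w = "wlong l n" and ?v = "srefl (- 1) \<circ> wlong l n"
  have W: "?w \<in> Dn l n" "?w \<in> SP l" "sinv ?w = ?w"
    using n by (simp_all add: wlong_Dn wlong_SP sinv_wlong)
  have N: "- 1 \<in> N" by (simp add: Nset_def)
  have V: "?v \<in> SP l" by (intro SP_comp srefl_SP N W)
  have w12: "?w 1 > 0" "?w 2 > 0" "?w (- 1) < 0" "?w (- 2) < 0"
    using n by (auto simp: wlong_def Let_def)
  have "il ?v = Suc (il ?w)"
    by (rule linv_left_asc[OF W(2) N]) (use w12 W(3) in \<open>simp add: hi_def\<close>)
  moreover obtain j where j: "j \<in> N" "shift p ?v = srefl j \<circ> shift p ?w"
    using shift_left[OF N] by blast
  moreover have "il (shift p ?v) = il ?v" "il (shift p ?w) = il ?w" using V W by (simp_all add: il_shift)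
  ultimately have 1: "(shift p ?w, shift p ?v) \<in> bruhat_less l"
    using bruhat_left[OF shift_Dn_Weyl[OF W(1) e] j(1)] by simp
  have "negs l ?v = insert 1 (insert 2 (negs l ?w))"
    using n w12 by (auto simp: negs_def sinv_srefl_left[OF W(2) N] W(3) srefl_m1)
  moreover have "1 \<notin> negs l ?w" "2 \<notin> negs l ?w" using w12 by (auto simp: negs_def W(3))
  ultimately have "?v \<in> Dn l (n + 2)"
    using W(1) V finite_negs[of l ?w] by (simp add: Dn_def)
  then have "?v = wlong l (n + 2) \<or> (shift p ?v, shift p (wlong l (n + 2))) \<in> bruhat_less l"
    using bruhat_Dn[of ?v "n + 2" p] e by auto
  then show ?thesis using 1 bruhat_trans[OF 1] by metis
qed

lemma bruhat_wlong:
  assumes "m < n" "n \<le> l" "even (m + n)" "even (n + p)"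
  shows "(shift p (wlong l m), shift p (wlong l n)) \<in> bruhat_less l"
proof -
  have "(shift p (wlong l m), shift p (wlong l (m + 2 * Suc k))) \<in> bruhat_less l"
    if "m + 2 * Suc k \<le> l" "even (m + p)" for k
    using that
  proof (induction k)
    case 0
    then show ?case using bruhat_wlong_step[of m p] by (simp add: numeral_2_eq_2)
  next
    case (Suc k)
    then show ?case
      using bruhat_wlong_step[of "m + 2 * Suc k" p] by (auto intro: bruhat_trans)
  qed
  moreover obtain k where "n = m + 2 * Suc k"
  proof -
    have "even (n - m)" using assms by simp
    then obtain i where "n - m = 2 * i" by (rule evenE)
    then show ?thesis using that[of "i - 1"] assms(1) by (cases i) auto
  qed
  ultimately show ?thesis using assms by auto
qed

lemma bruhat_Dn_wlong:
  assumes v: "v \<in> Dn l m" and "m \<le> n" "n \<le> l" "even (m + n)" "even (n + p)" "v \<noteq> wlong l n"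
  shows "(shift p v, shift p (wlong l n)) \<in> bruhat_less l"
proof -
  have "even (m + p)" using assms(4,5) by simp
  then have "v = wlong l m \<or> (shift p v, shift p (wlong l m)) \<in> bruhat_less l"
    using bruhat_Dn[OF v] by blast
  moreover have "m = n \<or> (shift p (wlong l m), shift p (wlong l n)) \<in> bruhat_less l"
    using bruhat_wlong[of m n p] assms by (cases "m = n") auto
  ultimately show ?thesis using assms(6) bruhat_trans by metis
qed

lemma bruhat_s0_conj:
  assumes "(v, w) \<in> bruhat_less l"
  shows "(srefl 0 \<circ> v \<circ> srefl 0, srefl 0 \<circ> w \<circ> srefl 0) \<in> bruhat_less l"
proof -
  let ?c = "\<lambda>w. srefl 0 \<circ> w \<circ> srefl 0"
  have il: "il (?c w) = il w" if "w \<in> SP l" for w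
    using that by (simp add: linv_s0_right linv_s0_left SP_comp srefl_0_SP)
  have "(?c v, ?c (v \<circ> r)) \<in> bruhat_less l"
    if v: "v \<in> Weyl l" and u: "u \<in> Weyl l" and i: "i \<in> N" and r: "r = u \<circ> srefl i \<circ> sinv u"
      and lt: "len l v < len l (v \<circ> r)" for v r u i
  proof -
    have vr: "v \<circ> r \<in> Weyl l" using v u i r by (auto intro!: Weyl_comp Weyl_srefl Weyl_inv)
    have "sinv (?c u) = ?c (sinv u)"
      using Weyl_SP[OF u] by (simp add: SP_inv_comp[of _ l] SP_comp srefl_0_SP inv_srefl comp_assoc)
    moreover have "srefl (gamma i) = ?c (srefl i)" using srefl_0_conj N_ge[OF i] by simp
    ultimately have "?c r = ?c u \<circ> srefl (gamma i) \<circ> sinv (?c u)"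
      by (simp add: r comp_assoc s0_s0)
    moreover have "?c (v \<circ> r) = ?c v \<circ> ?c r" by (simp add: comp_assoc s0_s0)
    moreover have "il (?c v) < il (?c (v \<circ> r))"
      using lt v vr by (simp add: il Weyl_SP len_eq)
    ultimately show ?thesis
      using bruhat_reflection[OF s0_conj_Weyl[OF v] s0_conj_Weyl[OF u] gamma_N[OF i]] by metis
  qed
  then have step: "(?c v, ?c w) \<in> bruhat_less l" if "(v, w) \<in> {(v, v \<circ> r) | v r. v \<in> Weyl l
     \<and> (\<exists>u\<in>Weyl l. \<exists>i\<in>Nset l. r = u \<circ> srefl i \<circ> sinv u) \<and> len l v < len l (v \<circ> r)}" for v w
    using that by blast
  from assms show ?thesis
    unfolding bruhat_less_def[of l]
  proof (induction rule: trancl_induct)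
    case (base y)
    then show ?case using step unfolding bruhat_less_def[of l] by blast
  next
    case (step y z)
    have "(?c y, ?c z) \<in> bruhat_less l" using \<open>\<And>v w. _ \<Longrightarrow> (?c v, ?c w) \<in> bruhat_less l\<close> step(2) by blast
    then show ?case using step(3) unfolding bruhat_less_def[of l] by (rule trancl_trans[rotated])
  qed
qed

end

section \<open>The Hecke algebra\<close>

context type_D
begin

lemma Hecke_zero [simp]: "0 \<in> Hecke l"
  by (simp add: Hecke_def)

lemma Hecke_add: "x \<in> Hecke l \<Longrightarrow> y \<in> Hecke l \<Longrightarrow> x + y \<in> Hecke l"
  using Poly_Mapping.keys_add[of x y] by (auto simp: Hecke_def)

lemma Hecke_smul: "x \<in> Hecke l \<Longrightarrow> c \<cdot> x \<in> Hecke l"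
  using keys_smul[of c x] by (auto simp: Hecke_def)

lemma Hecke_sum: "(\<And>a. a \<in> A \<Longrightarrow> f a \<in> Hecke l) \<Longrightarrow> sum f A \<in> Hecke l"
  by (induction A rule: infinite_finite_induct) (auto intro: Hecke_add)

lemma Hecke_hb: "hb w \<in> Hecke l \<longleftrightarrow> w \<in> Weyl l"
  by (simp add: Hecke_def hb_def)

lemma Hecke_lookup: "x \<in> Hecke l \<Longrightarrow> w \<notin> Weyl l \<Longrightarrow> lk x w = 0"
  by (force simp: Hecke_def in_keys_iff)

lemma HeckeI: "(\<And>w. w \<notin> Weyl l \<Longrightarrow> lk x w = 0) \<Longrightarrow> x \<in> Hecke l"
  by (auto simp: Hecke_def in_keys_iff)

lemma Hecke_diff: "x \<in> Hecke l \<Longrightarrow> y \<in> Hecke l \<Longrightarrow> x - y \<in> Hecke l"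
  by (rule HeckeI) (simp add: lookup_minus Hecke_lookup)

lemma Hecke_eqI: "x \<in> Hecke l \<Longrightarrow> y \<in> Hecke l \<Longrightarrow> (\<And>w. w \<in> Weyl l \<Longrightarrow> lk x w = lk y w) \<Longrightarrow> x = y"
  by (rule poly_mapping_eqI) (metis Hecke_lookup)

lemma lookup_hb: "lk (hb w) v = (if v = w then 1 else 0)"
  by (auto simp: hb_def lookup_single when_def)

lemma Hecke_expand: "x \<in> Hecke l \<Longrightarrow> x = (\<Sum>w\<in>Weyl l. lk x w \<cdot> hb w)"
proof (rule poly_mapping_eqI)
  fix v assume x: "x \<in> Hecke l"
  have "lk (\<Sum>w\<in>Weyl l. lk x w \<cdot> hb w) v = (\<Sum>w\<in>Weyl l. if w = v then lk x w else 0)"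
    unfolding lookup_sum by (rule sum.cong) (auto simp: lookup_smul lookup_hb)
  then show "lk x v = lk (\<Sum>w\<in>Weyl l. lk x w \<cdot> hb w) v"
    using x finite_Weyl by (simp add: Hecke_lookup)
qed

abbreviation "T \<equiv> hgen_mult l"

text \<open>The action of a generator on coefficient functions; it makes sense for functions on
  all signed permutations.\<close>

definition tf :: "int \<Rightarrow> (sperm \<Rightarrow> laurent) \<Rightarrow> sperm \<Rightarrow> laurent" where
  "tf i X w = X (srefl i \<circ> w) - (if il (srefl i \<circ> w) < il w then zeta * X w else 0)"

lemma T_add: "T i (x + y) = T i x + T i y"
  and T_smul: "T i (c \<cdot> x) = c \<cdot> T i x"
  and T_zero [simp]: "T i 0 = 0"
  and T_sum: "T i (sum f A) = (\<Sum>a\<in>A. T i (f a))"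
  by (simp_all add: hgen_mult_def linear_ext_add linear_ext_smul linear_ext_sum)

lemma T_hb:
  assumes "w \<in> Weyl l" "i \<in> N"
  shows "T i (hb w) = (if il w < il (srefl i \<circ> w) then hb (srefl i \<circ> w)
    else hb (srefl i \<circ> w) - zeta \<cdot> hb w)"
  using assms len_eq[of w] len_eq[of "srefl i \<circ> w"] Weyl_left[of w i]
  by (simp add: hgen_mult_def hb_def)

lemma srefl_comp_eq: "i \<in> N \<Longrightarrow> srefl i \<circ> v = (w :: sperm) \<longleftrightarrow> v = srefl i \<circ> w"
proof
  assume i: "i \<in> N"
  show "srefl i \<circ> v = w \<Longrightarrow> v = srefl i \<circ> w"
    using srefl_comp_srefl'(1)[OF N_ge(1)[OF i], of v] by (simp only:)
  show "v = srefl i \<circ> w \<Longrightarrow> srefl i \<circ> v = w"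
    using srefl_comp_srefl'(1)[OF N_ge(1)[OF i], of w] by (simp only:)
qed

lemma T_Hecke: "x \<in> Hecke l \<Longrightarrow> i \<in> N \<Longrightarrow> T i x \<in> Hecke l"
proof -
  assume x: "x \<in> Hecke l" and i: "i \<in> N"
  have "T i (hb w) \<in> Hecke l" if "w \<in> Weyl l" for w
    using that i by (auto simp: T_hb Hecke_hb Weyl_left intro!: Hecke_diff Hecke_smul)
  then have "T i (\<Sum>w\<in>Weyl l. lk x w \<cdot> hb w) \<in> Hecke l"
    by (simp add: T_sum T_smul Hecke_sum Hecke_smul)
  then show ?thesis by (simp only: Hecke_expand[OF x, symmetric])
qed

lemma lookup_T_hb:
  assumes v: "v \<in> Weyl l" and i: "i \<in> N"
  shows "lk (T i (hb v)) w = tf i (lk (hb v)) w"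
proof -
  have "srefl i \<circ> w = v \<longleftrightarrow> w = srefl i \<circ> v" using srefl_comp_eq[OF i, of w v] .
  then show ?thesis
    using linv_left_cases[OF Weyl_SP[OF v] i]
    by (auto simp: T_hb v i tf_def lookup_hb lookup_minus lookup_smul)
qed

lemma tf_add: "tf i (\<lambda>w. X w + Y w) v = tf i X v + tf i Y v"
  and tf_cmul: "tf i (\<lambda>w. c * X w) v = c * tf i X v"
  by (simp_all add: tf_def algebra_simps)

lemma tf_sum: "tf i (\<lambda>w. \<Sum>a\<in>A. f a w) v = (\<Sum>a\<in>A. tf i (f a) v)"
  by (induction A rule: infinite_finite_induct) (simp_all add: tf_add, simp_all add: tf_def)

lemma lookup_T:
  assumes x: "x \<in> Hecke l" and i: "i \<in> N"
  shows "lk (T i x) w = tf i (lk x) w"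
proof -
  have "lk (T i x) w = (\<Sum>v\<in>Weyl l. lk x v * tf i (lk (hb v)) w)"
    by (subst Hecke_expand[OF x]) (simp add: T_sum T_smul lookup_sum lookup_smul lookup_T_hb i)
  also have "\<dots> = tf i (\<lambda>w. \<Sum>v\<in>Weyl l. lk x v * lk (hb v) w) w"
    by (simp add: tf_sum tf_cmul)
  also have "(\<lambda>w. \<Sum>v\<in>Weyl l. lk x v * lk (hb v) w) = lk x"
  proof
    fix w
    show "(\<Sum>v\<in>Weyl l. lk x v * lk (hb v) w) = lk x w"
      using arg_cong[OF Hecke_expand[OF x, symmetric], of "\<lambda>x. lk x w"]
      by (simp only: lookup_sum lookup_smul)
  qed
  finally show ?thesis .
qed

lemma T_T:
  assumes x: "x \<in> Hecke l" and i: "i \<in> N"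
  shows "T i (T i x) = x - zeta \<cdot> T i x"
proof (rule Hecke_eqI)
  fix w assume w: "w \<in> Weyl l"
  have "srefl i \<circ> (srefl i \<circ> w) = w" by (rule srefl_comp_srefl'(1)[OF N_ge(1)[OF i]])
  note e = this
  define z where "z = zeta"
  have z: "lk (T i x) v = lk x (srefl i \<circ> v) - (if il (srefl i \<circ> v) < il v then z * lk x v else 0)"
    "lk (T i (T i x)) v = lk (T i x) (srefl i \<circ> v)
      - (if il (srefl i \<circ> v) < il v then z * lk (T i x) v else 0)" for v
    by (simp_all only: lookup_T[OF x i] lookup_T[OF T_Hecke[OF x i] i] tf_def z_def)
  from linv_left_cases[OF Weyl_SP[OF w] i]
  show "lk (T i (T i x)) w = lk (x - zeta \<cdot> T i x) w"
    unfolding z_def[symmetric] lookup_minus lookup_smul z e by (elim disjE) simp_all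
qed (simp_all add: T_Hecke x i Hecke_diff Hecke_smul)

lemma Hecke_basis_induct [consumes 1, case_names add smul basis]:
  assumes x: "x \<in> Hecke l"
    and add: "\<And>x y. x \<in> Hecke l \<Longrightarrow> y \<in> Hecke l \<Longrightarrow> P x \<Longrightarrow> P y \<Longrightarrow> P (x + y)"
    and smul: "\<And>c x. x \<in> Hecke l \<Longrightarrow> P x \<Longrightarrow> P (c \<cdot> x)"
    and basis: "\<And>w. w \<in> Weyl l \<Longrightarrow> P (hb w)"
  shows "P x"
proof -
  have "P (0 \<cdot> hb id)" by (intro smul basis) (simp_all add: Hecke_hb Weyl_id)
  then have P0: "P 0" by simp
  have "P (\<Sum>w\<in>A. lk x w \<cdot> hb w)" if "finite A" "A \<subseteq> Weyl l" for A
    using that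
  proof (induction A rule: finite_induct)
    case (insert w A)
    then show ?case
      by (simp add: add smul basis Hecke_hb Hecke_smul Hecke_sum subset_iff)
  qed (simp add: P0)
  from this[OF finite_Weyl order_refl] show ?thesis by (simp only: Hecke_expand[OF x, symmetric])
qed

lemma left_descent_exists:
  assumes w: "w \<in> Weyl l" "w \<noteq> id"
  obtains i where "i \<in> N" "il w = Suc (il (srefl i \<circ> w))"
proof -
  obtain js where js: "js \<in> lists N" "w = word js" "length js = il w"
    using Weyl_word w(1) by (auto simp: Weyl_iff)
  with w(2) obtain i ks where ks: "js = i # ks" by (cases js) (auto simp: word_Nil)
  have i: "i \<in> N" using js ks by simp
  have "srefl i \<circ> w = word ks"
    using srefl_comp_srefl'(1)[OF N_ge(1)[OF i], of "word ks"] by (simp only: js(2) ks word_Cons)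
  then have "il (srefl i \<circ> w) < il w" using il_word_le[of ks] js ks by simp
  with linv_left_cases[OF Weyl_SP[OF w(1)] i] that[OF i] show ?thesis by auto
qed

text \<open>The Hecke algebra is spanned by the products of generators.\<close>

lemma Hecke_induct [consumes 1, case_names add smul one T]:
  assumes x: "x \<in> Hecke l"
    and add: "\<And>x y. x \<in> Hecke l \<Longrightarrow> y \<in> Hecke l \<Longrightarrow> P x \<Longrightarrow> P y \<Longrightarrow> P (x + y)"
    and smul: "\<And>c x. x \<in> Hecke l \<Longrightarrow> P x \<Longrightarrow> P (c \<cdot> x)"
    and one: "P (hb id)"
    and T: "\<And>i x. i \<in> N \<Longrightarrow> x \<in> Hecke l \<Longrightarrow> P x \<Longrightarrow> P (T i x)"
  shows "P x"
  using x add smul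
proof (rule Hecke_basis_induct)
  fix w assume "w \<in> Weyl l"
  then show "P (hb w)"
  proof (induction "il w" arbitrary: w rule: less_induct)
    case less
    show ?case
    proof (cases "w = id")
      case False
      then obtain i where i: "i \<in> N" "il w = Suc (il (srefl i \<circ> w))"
        using left_descent_exists[OF less.prems] by blast
      let ?v = "srefl i \<circ> w"
      have v: "?v \<in> Weyl l" "srefl i \<circ> ?v = w"
        using Weyl_left[OF less.prems i(1)] N_ge[OF i(1)] by (simp_all add: srefl_comp_srefl')
      have "P (hb ?v)" using less.hyps[of ?v] i v by simp
      then have "P (T i (hb ?v))" using T[OF i(1)] v by (simp add: Hecke_hb)
      also have "T i (hb ?v) = hb w" using T_hb[OF v(1) i(1)] i(2) v(2) by simp
      finally show ?thesis .
    qed (use one in simp)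
  qed
qed

subsection \<open>The anti-involution and right multiplication\<close>

lemma hrho_add: "hrho (x + y) = hrho x + hrho y"
  and hrho_smul: "hrho (c \<cdot> x) = c \<cdot> hrho x"
  and hrho_hb: "hrho (hb w) = hb (sinv w)"
  by (simp_all add: hrho_def linear_ext_add linear_ext_smul)
    (simp add: hb_def)

lemma lookup_hrho:
  assumes x: "x \<in> Hecke l" and w: "w \<in> SP l"
  shows "lk (hrho x) w = lk x (sinv w)"
  using x
proof (induction rule: Hecke_basis_induct)
  case (basis v)
  have "w = sinv v \<longleftrightarrow> sinv w = v" using SP_inv_inv Weyl_SP[OF basis] w by metis
  then show ?case by (auto simp: hrho_hb lookup_hb)
qed (simp_all add: hrho_add hrho_smul lookup_add lookup_smul)

lemma hrho_Hecke: "x \<in> Hecke l \<Longrightarrow> hrho x \<in> Hecke l"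
  by (induction rule: Hecke_basis_induct)
    (simp_all add: hrho_add hrho_smul hrho_hb Hecke_add Hecke_smul Hecke_hb Weyl_inv)

lemma hrho_hrho: "x \<in> Hecke l \<Longrightarrow> hrho (hrho x) = x"
  by (rule Hecke_eqI) (simp_all add: hrho_Hecke lookup_hrho Weyl_SP SP_inv SP_inv_inv[of _ l])

text \<open>Right multiplication by a generator, see \<open>hmult_Rm\<close>.\<close>

definition Rm :: "int \<Rightarrow> hecke \<Rightarrow> hecke" where
  "Rm i x = hrho (T i (hrho x))"

lemma Rm_Hecke: "x \<in> Hecke l \<Longrightarrow> i \<in> N \<Longrightarrow> Rm i x \<in> Hecke l"
  by (simp add: Rm_def hrho_Hecke T_Hecke)

lemma Rm_add: "Rm i (x + y) = Rm i x + Rm i y"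
  and Rm_smul: "Rm i (c \<cdot> x) = c \<cdot> Rm i x"
  by (simp_all add: Rm_def hrho_add hrho_smul T_add T_smul)

lemma hrho_T: "x \<in> Hecke l \<Longrightarrow> hrho (T i x) = Rm i (hrho x)"
  by (simp add: Rm_def hrho_hrho)

lemma hrho_Rm: "x \<in> Hecke l \<Longrightarrow> i \<in> N \<Longrightarrow> hrho (Rm i x) = T i (hrho x)"
  by (simp add: Rm_def hrho_hrho T_Hecke hrho_Hecke)

lemma lookup_Rm:
  assumes x: "x \<in> Hecke l" and i: "i \<in> N" and w: "w \<in> SP l"
  shows "lk (Rm i x) w = lk x (w \<circ> srefl i) - (if il (w \<circ> srefl i) < il w then zeta * lk x w else 0)"
proof -
  have "sinv (srefl i \<circ> sinv w) = w \<circ> srefl i"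
    using w i by (simp add: sinv_srefl_left SP_inv SP_inv_inv)
  moreover have "il (srefl i \<circ> sinv w) = il (w \<circ> srefl i)"
    using linv_inv[of "w \<circ> srefl i" l] w i by (simp add: sinv_srefl_right SP_comp srefl_SP)
  ultimately show ?thesis
    using x i w
    by (simp add: Rm_def lookup_hrho lookup_T T_Hecke hrho_Hecke tf_def SP_inv SP_comp srefl_SP
        SP_inv_inv linv_inv)
qed

text \<open>Left and right multiplication by generators commute; this is the associativity of the
  Hecke algebra in disguise, and it gives the independence of reduced words without the
  braid relations.\<close>

lemma T_Rm_commute:
  assumes x: "x \<in> Hecke l" and i: "i \<in> N" and j: "j \<in> N"
  shows "T i (Rm j x) = Rm j (T i x)"
proof (rule Hecke_eqI)
  fix w assume W: "w \<in> Weyl l"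
  note w = Weyl_SP[OF W]
  have S: "srefl i \<circ> w \<in> SP l" "w \<circ> srefl j \<in> SP l" "srefl i \<circ> w \<circ> srefl j \<in> SP l"
    by (simp_all add: SP_comp srefl_SP i j w)
  have a: "srefl i \<circ> (w \<circ> srefl j) = srefl i \<circ> w \<circ> srefl j" by (simp add: comp_assoc)
  show "lk (T i (Rm j x)) w = lk (Rm j (T i x)) w"
  proof (cases "srefl i \<circ> w = w \<circ> srefl j")
    case False
    have "lk (T i (Rm j x)) w = lk (Rm j x) (srefl i \<circ> w)
        - (if il (srefl i \<circ> w) < il w then zeta * lk (Rm j x) w else 0)"
      by (simp only: lookup_T[OF Rm_Hecke[OF x j] i] tf_def)
    also have "\<dots> = lk (T i x) (w \<circ> srefl j)
        - (if il (w \<circ> srefl j) < il w then zeta * lk (T i x) w else 0)"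
      unfolding lookup_Rm[OF x j S(1)] lookup_Rm[OF x j w] lookup_T[OF x i] tf_def a
        linv_exchange[OF w i j False] linv_exchange'[OF w i j False]
      by (simp add: algebra_simps)
    finally show ?thesis by (simp only: lookup_Rm[OF T_Hecke[OF x i] j w])
  next
    case True
    then have b: "srefl i \<circ> w \<circ> srefl j = w" using N_ge[OF j] by (simp add: srefl_comp_srefl')
    have "lk (T i (Rm j x)) w = lk (Rm j x) (srefl i \<circ> w)
        - (if il (srefl i \<circ> w) < il w then zeta * lk (Rm j x) w else 0)"
      by (simp only: lookup_T[OF Rm_Hecke[OF x j] i] tf_def)
    also have "\<dots> = lk (T i x) (w \<circ> srefl j)
        - (if il (w \<circ> srefl j) < il w then zeta * lk (T i x) w else 0)"
      unfolding lookup_Rm[OF x j S(1)] lookup_Rm[OF x j w] lookup_T[OF x i] tf_def a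
      unfolding b unfolding True
      by (simp add: algebra_simps)
    finally show ?thesis by (simp only: lookup_Rm[OF T_Hecke[OF x i] j w])
  qed
qed (simp_all add: T_Hecke Rm_Hecke x i j)

lemma Hecke_right_induct [consumes 1, case_names add smul one Rm]:
  assumes x: "x \<in> Hecke l"
    and add: "\<And>x y. x \<in> Hecke l \<Longrightarrow> y \<in> Hecke l \<Longrightarrow> P x \<Longrightarrow> P y \<Longrightarrow> P (x + y)"
    and smul: "\<And>c x. x \<in> Hecke l \<Longrightarrow> P x \<Longrightarrow> P (c \<cdot> x)"
    and one: "P (hb id)"
    and Rm: "\<And>i x. i \<in> N \<Longrightarrow> x \<in> Hecke l \<Longrightarrow> P x \<Longrightarrow> P (Rm i x)"
  shows "P x"
proof -
  from hrho_Hecke[OF x] have "P (hrho (hrho x))"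
  proof (induction rule: Hecke_induct)
    case one
    then show ?case using assms(4) by (simp add: hrho_hb)
  qed (simp_all add: hrho_add hrho_smul add smul hrho_Hecke hrho_T Rm)
  then show ?thesis by (simp add: hrho_hrho x)
qed

subsection \<open>Multiplication\<close>

abbreviation "Tws \<equiv> foldr T"

lemma Tws_Hecke: "js \<in> lists N \<Longrightarrow> y \<in> Hecke l \<Longrightarrow> Tws js y \<in> Hecke l"
  by (induction js) (simp_all add: T_Hecke)

lemma Tws_add: "Tws js (x + y) = Tws js x + Tws js y"
  and Tws_smul: "Tws js (c \<cdot> x) = c \<cdot> Tws js x"
  by (induction js) (simp_all add: T_add T_smul)

lemma Tws_Rm: "js \<in> lists N \<Longrightarrow> y \<in> Hecke l \<Longrightarrow> i \<in> N \<Longrightarrow> Tws js (Rm i y) = Rm i (Tws js y)"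
  by (induction js) (simp_all add: T_Rm_commute Tws_Hecke)

definition reduced :: "int list \<Rightarrow> sperm \<Rightarrow> bool" where
  "reduced js w \<longleftrightarrow> js \<in> lists N \<and> word js = w \<and> length js = il w"

lemma reduced_Weyl: "reduced js w \<Longrightarrow> w \<in> Weyl l"
  by (auto simp: reduced_def Weyl_def parab_def)

lemma reduced_Cons:
  assumes "reduced (i # js) w"
  shows "i \<in> N" "reduced js (srefl i \<circ> w)" "il w = Suc (il (srefl i \<circ> w))" "w = srefl i \<circ> (srefl i \<circ> w)"
proof -
  have js: "i \<in> N" "js \<in> lists N" "w = srefl i \<circ> word js" "il w = Suc (length js)"
    using assms by (auto simp: reduced_def word_Cons simp del: o_apply)
  then have e: "srefl i \<circ> w = word js" using N_ge[of i] by (simp add: srefl_comp_srefl')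
  have "il (word js) = length js"
    using il_word_le[OF js(2)] linv_left_cases[OF word_SP[OF js(2)] js(1)] js(3,4) by auto
  then show "i \<in> N" "reduced js (srefl i \<circ> w)" "il w = Suc (il (srefl i \<circ> w))"
    "w = srefl i \<circ> (srefl i \<circ> w)"
    using js e by (auto simp: reduced_def)
qed

lemma Tws_one: "reduced js w \<Longrightarrow> Tws js (hb id) = hb w"
proof (induction js arbitrary: w)
  case (Cons i js)
  note r = reduced_Cons[OF Cons.prems]
  have "Tws js (hb id) = hb (srefl i \<circ> w)" by (rule Cons.IH[OF r(2)])
  moreover have "il (srefl i \<circ> w) < il (srefl i \<circ> (srefl i \<circ> w))" using r(3,4) by simp
  ultimately have "T i (Tws js (hb id)) = hb w"
    using T_hb[OF reduced_Weyl[OF r(2)] r(1)] r(4) by simp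
  then show ?case by (simp del: id_apply)
qed (simp add: reduced_def word_Nil)

text \<open>Both words give \<open>hb w\<close> at the identity, and what commutes with all right
  multiplications is determined by its value there.\<close>

lemma Tws_unique:
  assumes "reduced js w" "reduced ks w" "x \<in> Hecke l"
  shows "Tws js x = Tws ks x"
  using assms(3)
proof (induction rule: Hecke_right_induct)
  case one
  then show ?case using assms by (simp add: Tws_one)
qed (use assms in \<open>simp_all add: Tws_add Tws_smul Tws_Rm reduced_def\<close>)

lemma reduced_word_reduced:
  assumes "w \<in> Weyl l"
  shows "reduced (reduced_word l w) w"
proof -
  have "\<exists>js. js \<in> lists N \<and> word js = w \<and> length js = len l w"
    using Weyl_word assms len_eq[OF assms] by (auto simp: Weyl_iff)
  from someI_ex[OF this] show ?thesis
    using len_eq[OF assms] by (simp add: reduced_word_def reduced_def)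
qed

lemma reduced_rev: "reduced js w \<Longrightarrow> reduced (rev js) (sinv w)"
  using word_rev[of js] linv_inv[of w l] word_SP[of js] by (auto simp: reduced_def)

lemma hmult_add_left: "hmult l (x + y) z = hmult l x z + hmult l y z"
  and hmult_smul_left: "hmult l (c \<cdot> x) z = c \<cdot> hmult l x z"
  and hmult_zero_left [simp]: "hmult l 0 z = 0"
  and hmult_diff_left: "hmult l (x - y) z = hmult l x z - hmult l y z"
  and hmult_sum_left: "hmult l (sum f A) z = (\<Sum>a\<in>A. hmult l (f a) z)"
  by (simp_all add: hmult_def linear_ext_add linear_ext_smul linear_ext_diff linear_ext_sum)

lemma hmult_hb: "reduced js w \<Longrightarrow> y \<in> Hecke l \<Longrightarrow> hmult l (hb w) y = Tws js y"
  using Tws_unique[OF reduced_word_reduced[OF reduced_Weyl]] by (simp add: hmult_def hb_def)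

lemma hmult_one_left: "y \<in> Hecke l \<Longrightarrow> hmult l (hb id) y = y"
  using hmult_hb[of "[]" id y] by (simp add: reduced_def word_Nil linv_id)

lemma hmult_T_hb:
  assumes w: "w \<in> Weyl l" and i: "i \<in> N" and y: "y \<in> Hecke l"
  shows "hmult l (T i (hb w)) y = T i (hmult l (hb w) y)"
proof -
  have up: "hmult l (hb (srefl i \<circ> v)) y = T i (hmult l (hb v) y)"
    if "v \<in> Weyl l" "il (srefl i \<circ> v) = Suc (il v)" for v
  proof -
    let ?js = "reduced_word l v"
    have js: "reduced ?js v" by (rule reduced_word_reduced[OF that(1)])
    then have "reduced (i # ?js) (srefl i \<circ> v)"
      using that i by (simp add: reduced_def word_Cons)
    then show ?thesis using hmult_hb[OF js y] hmult_hb[of "i # ?js" _ y] y by simp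
  qed
  show ?thesis
  proof (cases "il (srefl i \<circ> w) = Suc (il w)")
    case True
    then show ?thesis using up[OF w True] by (simp add: T_hb w i)
  next
    case False
    then have d: "il w = Suc (il (srefl i \<circ> w))" using linv_left_cases[OF Weyl_SP[OF w] i] by simp
    let ?v = "srefl i \<circ> w"
    have v: "?v \<in> Weyl l" "srefl i \<circ> ?v = w"
      using Weyl_left[OF w i] N_ge[OF i] by (simp_all add: srefl_comp_srefl')
    have vH: "hmult l (hb ?v) y \<in> Hecke l"
      using hmult_hb[OF reduced_word_reduced[OF v(1)] y] reduced_word_reduced[OF v(1)] y
      by (simp add: Tws_Hecke reduced_def)
    have e: "hmult l (hb w) y = T i (hmult l (hb ?v) y)" using up[OF v(1)] d v(2) by simp
    have "hmult l (T i (hb w)) y = hmult l (hb ?v) y - zeta \<cdot> hmult l (hb w) y"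
      using d by (simp add: T_hb[OF w i] hmult_diff_left hmult_smul_left)
    also have "\<dots> = T i (hmult l (hb w) y)" by (simp add: e T_T[OF vH i])
    finally show ?thesis .
  qed
qed

lemma hmult_T: "x \<in> Hecke l \<Longrightarrow> y \<in> Hecke l \<Longrightarrow> i \<in> N \<Longrightarrow> hmult l (T i x) y = T i (hmult l x y)"
  by (induction rule: Hecke_basis_induct)
    (simp_all add: T_add T_smul hmult_add_left hmult_smul_left hmult_T_hb)

lemma hmult_Hecke: "x \<in> Hecke l \<Longrightarrow> y \<in> Hecke l \<Longrightarrow> hmult l x y \<in> Hecke l"
  by (induction rule: Hecke_induct)
    (simp_all add: hmult_add_left hmult_smul_left Hecke_add Hecke_smul hmult_one_left hmult_T T_Hecke)

lemma hmult_add_right: "x \<in> Hecke l \<Longrightarrow> y \<in> Hecke l \<Longrightarrow> z \<in> Hecke l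
    \<Longrightarrow> hmult l x (y + z) = hmult l x y + hmult l x z"
  by (induction rule: Hecke_induct)
    (simp_all add: hmult_add_left hmult_smul_left hmult_one_left hmult_T Hecke_add T_add
      smul_add_right)

lemma hmult_smul_right: "x \<in> Hecke l \<Longrightarrow> y \<in> Hecke l \<Longrightarrow> hmult l x (c \<cdot> y) = c \<cdot> hmult l x y"
  by (induction rule: Hecke_induct)
    (simp_all add: hmult_add_left hmult_smul_left hmult_one_left hmult_T Hecke_smul T_smul
      smul_add_right mult.commute)

lemma hmult_zero_right [simp]: "x \<in> Hecke l \<Longrightarrow> hmult l x 0 = 0"
  using hmult_smul_right[of x 0 0] by simp

lemma hmult_one_right: "x \<in> Hecke l \<Longrightarrow> hmult l x (hb id) = x"
  by (induction rule: Hecke_induct)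
    (simp_all add: hmult_add_left hmult_smul_left hmult_one_left hmult_T Hecke_hb Weyl_id
      del: id_apply)

lemma hmult_Rm: "x \<in> Hecke l \<Longrightarrow> y \<in> Hecke l \<Longrightarrow> i \<in> N \<Longrightarrow> hmult l x (Rm i y) = Rm i (hmult l x y)"
  by (induction rule: Hecke_induct)
    (simp_all add: hmult_add_left hmult_smul_left hmult_one_left hmult_T Rm_Hecke Rm_add Rm_smul
      T_Rm_commute hmult_Hecke)

lemma hmult_assoc: "x \<in> Hecke l \<Longrightarrow> y \<in> Hecke l \<Longrightarrow> z \<in> Hecke l
    \<Longrightarrow> hmult l (hmult l x y) z = hmult l x (hmult l y z)"
  by (induction rule: Hecke_induct)
    (simp_all add: hmult_add_left hmult_smul_left hmult_one_left hmult_T hmult_Hecke)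

lemma hrho_hmult: "x \<in> Hecke l \<Longrightarrow> y \<in> Hecke l \<Longrightarrow> hrho (hmult l x y) = hmult l (hrho y) (hrho x)"
proof (induction rule: Hecke_induct)
  case one
  then show ?case by (simp add: hrho_hb hmult_one_left hmult_one_right hrho_Hecke)
qed (simp_all add: hmult_add_left hmult_smul_left hmult_add_right hmult_smul_right hrho_add
      hrho_smul hrho_Hecke hmult_T hrho_T hmult_Hecke hmult_Rm)

text \<open>The trace form in coordinates, see \<open>htr_hmult_hrho\<close>. The sum extends over all signed
  permutations, so that it also applies to functions supported on a class with an odd number
  of signs.\<close>

definition pairing :: "(sperm \<Rightarrow> laurent) \<Rightarrow> (sperm \<Rightarrow> laurent) \<Rightarrow> laurent" where
  "pairing X Y = (\<Sum>w\<in>SP l. X w * Y w)"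

lemma bij_left_SP: "i \<in> N \<or> i = 0 \<Longrightarrow> bij_betw ((\<circ>) (srefl i)) (SP l) (SP l)"
proof -
  assume i: "i \<in> N \<or> i = 0"
  then have "srefl i \<in> SP l" "i \<ge> - 1" using srefl_SP srefl_0_SP N_ge(1) by auto
  then show ?thesis
    by (intro bij_betw_byWitness[where f' = "(\<circ>) (srefl i)"])
      (auto simp: srefl_comp_srefl' SP_comp simp del: o_apply)
qed

lemma pairing_reindex: "i \<in> N \<or> i = 0 \<Longrightarrow> (\<Sum>w\<in>SP l. F (srefl i \<circ> w)) = (\<Sum>w\<in>SP l. F w)"
  using sum.reindex_bij_betw[OF bij_left_SP] by blast

text \<open>The translation part of \<open>tf i\<close> is symmetric since \<open>srefl i\<close> is an involution, and the
  rest is diagonal.\<close>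

lemma pairing_tf:
  assumes i: "i \<in> N"
  shows "pairing (tf i X) Y = pairing X (tf i Y)"
proof -
  have ii: "srefl i \<circ> (srefl i \<circ> w) = w" for w :: sperm
    by (rule srefl_comp_srefl'(1)[OF N_ge(1)[OF i]])
  have "(\<Sum>w\<in>SP l. X (srefl i \<circ> w) * Y w) = (\<Sum>w\<in>SP l. X w * Y (srefl i \<circ> w))"
    using pairing_reindex[of i "\<lambda>w. X w * Y (srefl i \<circ> w)"] i by (simp add: ii)
  moreover have "pairing (tf i X) Y = (\<Sum>w\<in>SP l. X (srefl i \<circ> w) * Y w)
      - (\<Sum>w\<in>SP l. if il (srefl i \<circ> w) < il w then zeta * X w * Y w else 0)"
    "pairing X (tf i Y) = (\<Sum>w\<in>SP l. X w * Y (srefl i \<circ> w))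
      - (\<Sum>w\<in>SP l. if il (srefl i \<circ> w) < il w then zeta * X w * Y w else 0)"
    unfolding pairing_def tf_def sum_subtractf[symmetric]
    by (intro sum.cong refl; simp add: algebra_simps)+
  ultimately show ?thesis by simp
qed

lemma htr_hmult_hrho:
  assumes "x \<in> Hecke l" "y \<in> Hecke l"
  shows "htr (hmult l (hrho x) y) = pairing (lk x) (lk y)"
  using assms
proof (induction arbitrary: y rule: Hecke_induct)
  case (add x x')
  then show ?case
    by (simp add: hrho_add hmult_add_left htr_def lookup_add pairing_def distrib_right sum.distrib)
next
  case (smul c x)
  then show ?case
    by (simp add: hrho_smul hmult_smul_left htr_def lookup_smul pairing_def sum_distrib_left mult.assoc)
next
  case one
  have "pairing (lk (hb id)) (lk y) = (\<Sum>w\<in>SP l. if w = id then lk y id else 0)"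
    unfolding pairing_def by (rule sum.cong) (auto simp: lookup_hb)
  then show ?case
    using one by (simp add: hrho_hb hmult_one_left htr_def finite_SP SP_id)
next
  case (T i x)
  have "hmult l (hrho (T i x)) y = hmult l (hmult l (hrho x) (T i (hb id))) y"
  proof -
    have "hrho (T i x) = Rm i (hmult l (hrho x) (hb id))"
      using T by (simp add: hrho_T hmult_one_right hrho_Hecke)
    also have "\<dots> = hmult l (hrho x) (Rm i (hb id))"
      using T by (simp add: hmult_Rm hrho_Hecke Hecke_hb Weyl_id)
    also have "Rm i (hb id) = T i (hb id)"
      using T(1) N_ge[OF T(1)] linv_left_asc[OF SP_id T(1)]
      by (simp add: Rm_def hrho_hb T_hb Weyl_id inv_srefl)
    finally show ?thesis by simp
  qed
  also have "\<dots> = hmult l (hrho x) (T i y)"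
    using T by (simp add: hmult_assoc hmult_T hmult_one_left hrho_Hecke T_Hecke Hecke_hb Weyl_id)
  finally have "htr (hmult l (hrho (T i x)) y) = pairing (lk x) (lk (T i y))"
    using T by (simp add: T_Hecke)
  also have "lk (T i y) = tf i (lk y)" using T by (simp add: lookup_T fun_eq_iff)
  also have "pairing (lk x) (tf i (lk y)) = pairing (tf i (lk x)) (lk y)"
    using pairing_tf[OF T(1)] by simp
  also have "tf i (lk x) = lk (T i x)" using T by (simp add: lookup_T fun_eq_iff)
  finally show ?case .
qed

end

section \<open>The bar involution and Kazhdan--Lusztig elements\<close>

context type_D
begin

text \<open>The inverse of \<open>T i\<close>, by the quadratic relation.\<close>

definition Ti :: "int \<Rightarrow> hecke \<Rightarrow> hecke" where
  "Ti i x = T i x + zeta \<cdot> x"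

lemma Ti_Hecke: "x \<in> Hecke l \<Longrightarrow> i \<in> N \<Longrightarrow> Ti i x \<in> Hecke l"
  by (simp add: Ti_def Hecke_add T_Hecke Hecke_smul)

lemma Ti_add: "Ti i (x + y) = Ti i x + Ti i y"
  and Ti_smul: "Ti i (c \<cdot> x) = c \<cdot> Ti i x"
  by (simp_all add: Ti_def T_add T_smul smul_add_right mult.commute)

lemma T_Ti: "x \<in> Hecke l \<Longrightarrow> i \<in> N \<Longrightarrow> T i (Ti i x) = x"
  and Ti_T: "x \<in> Hecke l \<Longrightarrow> i \<in> N \<Longrightarrow> Ti i (T i x) = x"
  by (simp_all add: Ti_def T_add T_smul T_T)

lemma hmult_Ti: "x \<in> Hecke l \<Longrightarrow> y \<in> Hecke l \<Longrightarrow> i \<in> N \<Longrightarrow> hmult l (Ti i x) y = Ti i (hmult l x y)"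
  by (simp add: Ti_def hmult_add_left hmult_smul_left hmult_T)

lemma Tis_Hecke: "js \<in> lists N \<Longrightarrow> y \<in> Hecke l \<Longrightarrow> foldr Ti js y \<in> Hecke l"
  by (induction js) (simp_all add: Ti_Hecke)

lemma Tws_Tis: "js \<in> lists N \<Longrightarrow> y \<in> Hecke l \<Longrightarrow> Tws (rev js) (foldr Ti js y) = y"
  by (induction js) (simp_all add: T_Ti Tis_Hecke)

lemma Tis_Tws: "js \<in> lists N \<Longrightarrow> y \<in> Hecke l \<Longrightarrow> foldr Ti js (Tws (rev js) y) = y"
  by (induction js arbitrary: y) (simp_all add: T_Hecke Ti_T)

lemma hmult_Tis: "js \<in> lists N \<Longrightarrow> y \<in> Hecke l \<Longrightarrow> hmult l (foldr Ti js (hb id)) y = foldr Ti js y"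
proof (induction js)
  case (Cons i js)
  then have "hmult l (Ti i (foldr Ti js (hb id))) y = Ti i (foldr Ti js y)"
    by (simp add: hmult_Ti Tis_Hecke Hecke_hb Weyl_id del: id_apply)
  then show ?case by (simp del: id_apply)
qed (use hmult_one_left in simp)

lemma hb_id_Hecke [simp]: "hb id \<in> Hecke l"
  by (simp add: Hecke_hb Weyl_id)

lemma hinverse_reduced:
  assumes js: "reduced js w"
  shows "hinverse l (hb (sinv w)) = foldr Ti js (hb id)"
  unfolding hinverse_def
proof (rule the_equality)
  let ?y = "foldr Ti js (hb id)" and ?x = "hb (sinv w)"
  have r: "reduced (rev js) (sinv w)" by (rule reduced_rev[OF js])
  have L: "js \<in> lists N" using js by (simp add: reduced_def)
  have y: "?y \<in> Hecke l" by (rule Tis_Hecke[OF L hb_id_Hecke])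
  have x: "?x \<in> Hecke l" using reduced_Weyl[OF r] by (simp add: Hecke_hb)
  have xy: "hmult l ?x ?y = hb id"
    unfolding hmult_hb[OF r y] by (rule Tws_Tis[OF L hb_id_Hecke])
  have "hmult l ?y ?x = foldr Ti js (Tws (rev js) (hb id))"
    unfolding hmult_Tis[OF L x] Tws_one[OF r] ..
  then have yx: "hmult l ?y ?x = hb id" by (simp only: Tis_Tws[OF L hb_id_Hecke])
  show "?y \<in> Hecke l \<and> hmult l ?x ?y = hb id \<and> hmult l ?y ?x = hb id" using y xy yx by blast
  fix z assume z: "z \<in> Hecke l \<and> hmult l ?x z = hb id \<and> hmult l z ?x = hb id"
  have "z = hmult l (hmult l ?y ?x) z" using z yx by (simp add: hmult_one_left)
  also have "\<dots> = ?y" using z x y by (simp add: hmult_assoc hmult_one_right)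
  finally show "z = ?y" .
qed

lemma hbar_add: "hbar l (x + y) = hbar l x + hbar l y"
  and hbar_smul: "hbar l (c \<cdot> x) = qbar c \<cdot> hbar l x"
  and hbar_sum: "hbar l (sum f A) = (\<Sum>a\<in>A. hbar l (f a))"
  and hbar_diff: "hbar l (x - y) = hbar l x - hbar l y"
  and hbar_zero [simp]: "hbar l 0 = 0"
  by (simp_all add: hbar_def antilinear_ext_add antilinear_ext_smul antilinear_ext_sum
      antilinear_ext_diff)

lemma hbar_hb: "reduced js w \<Longrightarrow> hbar l (hb w) = foldr Ti js (hb id)"
  by (simp add: hbar_def hb_def[of w] hinverse_reduced)

lemma hbar_one: "hbar l (hb id) = hb id"
proof -
  have "reduced [] id" by (simp add: reduced_def word_Nil linv_id)
  from hbar_hb[OF this] show ?thesis by (simp only: foldr.simps id_apply)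
qed

lemma hbar_hb_Hecke: "w \<in> Weyl l \<Longrightarrow> hbar l (hb w) \<in> Hecke l"
  using hbar_hb[OF reduced_word_reduced] Tis_Hecke[OF _ hb_id_Hecke] reduced_word_reduced[of w]
  by (simp add: reduced_def)

lemma hbar_Hecke: "x \<in> Hecke l \<Longrightarrow> hbar l x \<in> Hecke l"
  by (induction rule: Hecke_basis_induct)
    (simp_all add: hbar_add hbar_smul Hecke_add Hecke_smul hbar_hb_Hecke)

lemma qbar_zeta: "qbar zeta = - zeta"
  by (simp add: qbar_diff)

lemma hbar_T_hb:
  assumes w: "w \<in> Weyl l" and i: "i \<in> N"
  shows "hbar l (T i (hb w)) = Ti i (hbar l (hb w))"
proof -
  have up: "hbar l (hb (srefl i \<circ> v)) = Ti i (hbar l (hb v))"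
    if "v \<in> Weyl l" "il (srefl i \<circ> v) = Suc (il v)" for v
  proof -
    let ?js = "reduced_word l v"
    have js: "reduced ?js v" by (rule reduced_word_reduced[OF that(1)])
    then have "reduced (i # ?js) (srefl i \<circ> v)"
      using that i by (simp add: reduced_def word_Cons)
    then show ?thesis using hbar_hb[OF js] hbar_hb[of "i # ?js" "srefl i \<circ> v"] by simp
  qed
  show ?thesis
  proof (cases "il (srefl i \<circ> w) = Suc (il w)")
    case True
    then show ?thesis using up[OF w True] by (simp add: T_hb w i)
  next
    case False
    then have d: "il w = Suc (il (srefl i \<circ> w))" using linv_left_cases[OF Weyl_SP[OF w] i] by simp
    let ?v = "srefl i \<circ> w"
    have v: "?v \<in> Weyl l" "srefl i \<circ> ?v = w"
      using Weyl_left[OF w i] srefl_comp_srefl'(1)[OF N_ge(1)[OF i]] by auto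
    have e: "hbar l (hb w) = Ti i (hbar l (hb ?v))" using up[OF v(1)] d v(2) by simp
    have "hbar l (T i (hb w)) = hbar l (hb ?v) + zeta \<cdot> hbar l (hb w)"
      using d by (simp add: T_hb[OF w i] hbar_diff hbar_smul qbar_zeta smul_minus_left del: minus_diff_eq)
    also have "hbar l (hb ?v) = T i (hbar l (hb w))"
      unfolding e using T_Ti[OF hbar_hb_Hecke[OF v(1)] i] by simp
    finally show ?thesis by (simp only: Ti_def)
  qed
qed

lemma hbar_T: "x \<in> Hecke l \<Longrightarrow> i \<in> N \<Longrightarrow> hbar l (T i x) = Ti i (hbar l x)"
  by (induction rule: Hecke_basis_induct)
    (simp_all add: T_add T_smul hbar_add hbar_smul hbar_T_hb Ti_add Ti_smul)

lemma hbar_hmult: "x \<in> Hecke l \<Longrightarrow> y \<in> Hecke l \<Longrightarrow> hbar l (hmult l x y) = hmult l (hbar l x) (hbar l y)"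
proof (induction rule: Hecke_induct)
  case one
  then show ?case by (simp only: hmult_one_left hbar_one hbar_Hecke)
qed (simp_all add: hmult_add_left hmult_smul_left hbar_add hbar_smul hmult_T hbar_T hmult_Hecke
      hmult_Ti hbar_Hecke)

text \<open>Along a reduced word, each inverse generator raises the length of a term by at most
  one, so only the full product reaches \<open>w\<close>.\<close>

lemma hbar_hb_triangular:
  assumes "w \<in> Weyl l"
  shows "lk (hbar l (hb w)) w = 1 \<and> (\<forall>v. v \<noteq> w \<longrightarrow> lk (hbar l (hb w)) v \<noteq> 0 \<longrightarrow> il v < il w)"
  using assms
proof (induction "il w" arbitrary: w rule: less_induct)
  case less
  show ?case
  proof (cases "w = id")
    case True
    then show ?thesis by (simp only: hbar_one lookup_hb) simp
  next
    case False
    then obtain i where i: "i \<in> N" "il w = Suc (il (srefl i \<circ> w))"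
      using left_descent_exists[OF less.prems] by blast
    let ?w = "srefl i \<circ> w" and ?y = "hbar l (hb (srefl i \<circ> w))"
    have ww: "?w \<in> Weyl l" "srefl i \<circ> ?w = w"
      using Weyl_left[OF less.prems i(1)] srefl_comp_srefl'(1)[OF N_ge(1)[OF i(1)]] by auto
    have IH: "lk ?y ?w = 1" "\<And>v. v \<noteq> ?w \<Longrightarrow> lk ?y v \<noteq> 0 \<Longrightarrow> il v < il ?w"
      using less.hyps[of ?w] i(2) ww(1) by auto
    have yH: "?y \<in> Hecke l" by (rule hbar_hb_Hecke[OF ww(1)])
    have "hb w = T i (hb ?w)" using T_hb[OF ww(1) i(1)] i(2) ww(2) by simp
    then have "hbar l (hb w) = Ti i ?y" using hbar_T_hb[OF ww(1) i(1)] by simp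
    then have lk: "lk (hbar l (hb w)) v = lk ?y (srefl i \<circ> v)
        + (if il (srefl i \<circ> v) < il v then 0 else zeta * lk ?y v)" for v
      by (simp add: Ti_def lookup_add lookup_smul lookup_T[OF yH i(1)] tf_def)
    have "lk (hbar l (hb w)) w = 1" using IH(1) i(2) by (simp add: lk)
    moreover have "il v < il w" if v: "v \<noteq> w" "lk (hbar l (hb w)) v \<noteq> 0" for v
    proof -
      have nz: "lk ?y (srefl i \<circ> v) \<noteq> 0 \<or> lk ?y v \<noteq> 0" using v(2) by (auto simp: lk split: if_splits)
      have ne: "srefl i \<circ> v \<noteq> ?w"
      proof
        assume "srefl i \<circ> v = ?w"
        then have "srefl i \<circ> (srefl i \<circ> v) = srefl i \<circ> ?w" by simp
        then show False using v(1) srefl_comp_srefl'(1)[OF N_ge(1)[OF i(1)]] by metis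
      qed
      have "v \<in> Weyl l"
      proof (rule ccontr)
        assume "v \<notin> Weyl l"
        moreover from this have "srefl i \<circ> v \<notin> Weyl l" using Weyl_left_iff[OF i(1)] by blast
        ultimately show False using nz Hecke_lookup[OF yH] by blast
      qed
      then have "il v \<le> Suc (il (srefl i \<circ> v))"
        using linv_left_cases[OF Weyl_SP i(1)] by fastforce
      then show ?thesis
        using nz IH(2)[of v] IH(2)[OF ne] IH(1) i(2) v(1) by (cases "v = ?w") auto
    qed
    ultimately show ?thesis by blast
  qed
qed

lemma lookup_hbar_top:
  assumes x: "x \<in> Hecke l" and v: "v \<in> Weyl l" and top: "\<And>w. lk x w \<noteq> 0 \<Longrightarrow> w \<noteq> v \<Longrightarrow> il w \<le> il v"
  shows "lk (hbar l x) v = qbar (lk x v)"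
proof -
  have "lk (hbar l x) v = (\<Sum>w\<in>Weyl l. qbar (lk x w) * lk (hbar l (hb w)) v)"
    by (subst Hecke_expand[OF x]) (simp add: hbar_sum hbar_smul lookup_sum lookup_smul)
  also have "\<dots> = (\<Sum>w\<in>Weyl l. if w = v then qbar (lk x v) else 0)"
  proof (rule sum.cong[OF refl])
    fix w assume "w \<in> Weyl l"
    then show "qbar (lk x w) * lk (hbar l (hb w)) v = (if w = v then qbar (lk x v) else 0)"
      using hbar_hb_triangular[of w] top[of w] by force
  qed
  finally show ?thesis using v finite_Weyl by simp
qed

text \<open>At an element of maximal length in the support, the bar involution acts on the
  coefficient by conjugation.\<close>

lemma bar_invariant_qZq_zero:
  assumes z: "z \<in> Hecke l" and bar: "hbar l z = z" and q: "\<And>v. lk z v \<in> qZq"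
  shows "z = 0"
proof (rule ccontr)
  assume "z \<noteq> 0"
  then obtain v0 where v0: "lk z v0 \<noteq> 0" by (metis lookup_zero poly_mapping_eqI)
  let ?K = "Poly_Mapping.keys z"
  have K: "finite ?K" "?K \<noteq> {}" using v0 by (auto simp: in_keys_iff)
  have "Max (il ` ?K) \<in> il ` ?K" using K by (intro Max_in) auto
  then obtain v where "v \<in> ?K" "Max (il ` ?K) = il v" by auto
  then have v: "v \<in> ?K" "\<And>w. w \<in> ?K \<Longrightarrow> il w \<le> il v"
    using Max_ge[of "il ` ?K"] K(1) by auto
  have "v \<in> Weyl l" using v(1) z by (auto simp: Hecke_def)
  then have "lk z v = qbar (lk z v)"
    using lookup_hbar_top[OF z, of v] v(2) bar by (simp add: in_keys_iff)
  then have "lk z v = 0" using qbar_invariant_qZq_eq_0[OF _ q, of v] by simp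
  with v(1) show False by (simp add: in_keys_iff)
qed

text \<open>The characterisation of the Kazhdan--Lusztig element by its coefficients.\<close>

definition KL_cond :: "hecke \<Rightarrow> sperm \<Rightarrow> bool" where
  "KL_cond y w \<longleftrightarrow> y \<in> Hecke l \<and> hbar l y = y \<and> lk y w = 1
     \<and> (\<forall>v. v \<noteq> w \<longrightarrow> lk y v \<noteq> 0 \<longrightarrow> (v, w) \<in> bruhat_less l \<and> lk y v \<in> qZq)"

lemma klb_eqI:
  assumes "KL_cond y w"
  shows "klb l w = y"
  unfolding klb_def
proof (rule the_equality)
  let ?B = "{v. (v, w) \<in> bruhat_less l}"
  have fin: "finite ?B"
    by (rule finite_subset[OF _ finite_Weyl]) (use bruhat_less_Weyl in blast)
  have irr: "(w, w) \<notin> bruhat_less l" using bruhat_less_Weyl by blast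
  have lookup: "lk (hb w + (\<Sum>v\<in>?B. c v \<cdot> hb v)) u = (if u = w then 1 else if u \<in> ?B then c u else 0)"
    for c u
  proof -
    have "lk (\<Sum>v\<in>?B. c v \<cdot> hb v) u = (\<Sum>v\<in>?B. if v = u then c u else 0)"
      unfolding lookup_sum by (rule sum.cong) (auto simp: lookup_smul lookup_hb)
    then show ?thesis using fin irr by (auto simp: lookup_add lookup_hb)
  qed
  define c where "c v = (if v \<in> ?B then lk y v else 0)" for v
  have y: "y \<in> Hecke l" "hbar l y = y" "lk y w = 1"
    "\<And>v. v \<noteq> w \<Longrightarrow> lk y v \<noteq> 0 \<Longrightarrow> v \<in> ?B \<and> lk y v \<in> qZq"
    using assms by (auto simp: KL_cond_def)
  have "y = hb w + (\<Sum>v\<in>?B. c v \<cdot> hb v)"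
  proof (rule poly_mapping_eqI)
    fix u show "lk y u = lk (hb w + (\<Sum>v\<in>?B. c v \<cdot> hb v)) u"
      unfolding lookup using y(3) y(4)[of u] by (auto simp: c_def)
  qed
  moreover have "c v \<in> qZq" for v
    using y(4)[of v] irr by (cases "v = w"; cases "lk y v = 0") (auto simp: c_def)
  ultimately show "y \<in> Hecke l \<and> hbar l y = y
     \<and> (\<exists>c. (\<forall>v. c v \<in> qZq) \<and> y = hb w + (\<Sum>v | (v, w) \<in> bruhat_less l. c v \<cdot> hb v))"
    using y by blast
  fix y' assume "y' \<in> Hecke l \<and> hbar l y' = y'
     \<and> (\<exists>c. (\<forall>v. c v \<in> qZq) \<and> y' = hb w + (\<Sum>v | (v, w) \<in> bruhat_less l. c v \<cdot> hb v))"
  then obtain d where y': "y' \<in> Hecke l" "hbar l y' = y'" "\<And>v. d v \<in> qZq"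
    "y' = hb w + (\<Sum>v\<in>?B. d v \<cdot> hb v)" by blast
  have "y' - y = 0"
  proof (rule bar_invariant_qZq_zero)
    show "y' - y \<in> Hecke l" "hbar l (y' - y) = y' - y"
      using y y' by (simp_all add: Hecke_diff hbar_diff)
    fix v
    have "lk y' v = (if v = w then 1 else if v \<in> ?B then d v else 0)"
      using lookup[of d v] y'(4) by simp
    then show "lk (y' - y) v \<in> qZq"
      using y(3) y(4)[of v] y'(3)[of v]
      by (cases "lk y v = 0") (auto simp: lookup_minus qZq_iff)
  qed
  then show "y' = y" by simp
qed

subsection \<open>The graph automorphism\<close>

lemma hgamma_add: "hgamma l (x + y) = hgamma l x + hgamma l y"
  and hgamma_smul: "hgamma l (c \<cdot> x) = c \<cdot> hgamma l x"
  and hgamma_zero [simp]: "hgamma l 0 = 0"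
  by (simp_all add: hgamma_def linear_ext_add linear_ext_smul)

lemma hgamma_hb: "w \<in> Weyl l \<Longrightarrow> hgamma l (hb w) = hb (srefl 0 \<circ> w \<circ> srefl 0)"
  by (simp add: hgamma_def hb_def gamma_W_SP)

lemma hgamma_Hecke: "x \<in> Hecke l \<Longrightarrow> hgamma l x \<in> Hecke l"
  by (induction rule: Hecke_basis_induct)
    (simp_all add: hgamma_add hgamma_smul hgamma_hb Hecke_add Hecke_smul Hecke_hb s0_conj_Weyl)

lemma s0_conj_conj: "srefl 0 \<circ> (srefl 0 \<circ> v \<circ> srefl 0) \<circ> srefl 0 = (v :: sperm)"
  by (simp add: fun_eq_iff)

lemma s0_conj_eq: "srefl 0 \<circ> v \<circ> srefl 0 = (w :: sperm) \<longleftrightarrow> v = srefl 0 \<circ> w \<circ> srefl 0"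
  by (metis s0_conj_conj)

lemma lookup_hgamma: "x \<in> Hecke l \<Longrightarrow> lk (hgamma l x) w = lk x (srefl 0 \<circ> w \<circ> srefl 0)"
proof (induction rule: Hecke_basis_induct)
  case (basis v)
  have "w = srefl 0 \<circ> v \<circ> srefl 0 \<longleftrightarrow> srefl 0 \<circ> w \<circ> srefl 0 = v" using s0_conj_eq[of w v] by auto
  then show ?case by (simp add: hgamma_hb basis lookup_hb del: o_apply)
qed (simp_all add: hgamma_add hgamma_smul lookup_add lookup_smul)

lemma hgamma_hgamma: "x \<in> Hecke l \<Longrightarrow> hgamma l (hgamma l x) = x"
  by (rule poly_mapping_eqI) (simp only: lookup_hgamma hgamma_Hecke s0_conj_conj)

lemma il_s0_conj: "w \<in> SP l \<Longrightarrow> il (srefl 0 \<circ> w \<circ> srefl 0) = il w"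
  by (simp add: linv_s0_right linv_s0_left SP_comp srefl_0_SP)

lemma srefl_s0_conj:
  assumes "i \<in> N"
  shows "srefl (gamma i) \<circ> (srefl 0 \<circ> w \<circ> srefl 0) = srefl 0 \<circ> (srefl i \<circ> w) \<circ> srefl 0"
  using srefl_s0'[OF gamma_N[OF assms], of "w \<circ> srefl 0"] gamma_gamma[OF assms]
  by (simp add: comp_assoc)

lemma hgamma_T:
  assumes x: "x \<in> Hecke l" and i: "i \<in> N"
  shows "hgamma l (T i x) = T (gamma i) (hgamma l x)"
proof (rule Hecke_eqI)
  fix w assume W: "w \<in> Weyl l"
  let ?c = "\<lambda>w. srefl 0 \<circ> w \<circ> srefl 0"
  have c: "srefl i \<circ> ?c w = ?c (srefl (gamma i) \<circ> w)"
    using srefl_s0_conj[OF gamma_N[OF i], of w] gamma_gamma[OF i] by simp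
  have "srefl (gamma i) \<circ> w \<in> SP l" "w \<in> SP l" using W Weyl_left[OF W gamma_N[OF i]] Weyl_SP by auto
  then have il: "il (?c (srefl (gamma i) \<circ> w)) = il (srefl (gamma i) \<circ> w)" "il (?c w) = il w"
    by (simp_all only: il_s0_conj)
  show "lk (hgamma l (T i x)) w = lk (T (gamma i) (hgamma l x)) w"
    unfolding lookup_hgamma[OF T_Hecke[OF x i]] lookup_T[OF x i] lookup_T[OF hgamma_Hecke[OF x] gamma_N[OF i]]
      tf_def c il lookup_hgamma[OF x] ..
qed (simp_all add: hgamma_Hecke T_Hecke x i gamma_N)

lemma hgamma_one: "hgamma l (hb id) = hb id"
  using hgamma_hb[OF Weyl_id] s0_s0(2)[of id] by simp

lemma hgamma_hmult: "x \<in> Hecke l \<Longrightarrow> y \<in> Hecke l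
    \<Longrightarrow> hgamma l (hmult l x y) = hmult l (hgamma l x) (hgamma l y)"
proof (induction rule: Hecke_induct)
  case one
  then show ?case by (simp only: hmult_one_left hgamma_one hgamma_Hecke)
qed (simp_all add: hmult_add_left hmult_smul_left hgamma_add hgamma_smul hmult_T hgamma_T hmult_Hecke
      hgamma_Hecke gamma_N)

lemma hgamma_hbar: "x \<in> Hecke l \<Longrightarrow> hgamma l (hbar l x) = hbar l (hgamma l x)"
proof (induction rule: Hecke_induct)
  case one
  then show ?case by (simp only: hbar_one hgamma_one)
qed (simp_all add: hbar_add hbar_smul hgamma_add hgamma_smul hbar_T hgamma_T Ti_def hgamma_Hecke
      hbar_Hecke gamma_N)

lemma KL_cond_hgamma:
  assumes "KL_cond y w"
  shows "KL_cond (hgamma l y) (srefl 0 \<circ> w \<circ> srefl 0)"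
proof -
  have y: "y \<in> Hecke l" "hbar l y = y" "lk y w = 1"
    "\<And>v. v \<noteq> w \<Longrightarrow> lk y v \<noteq> 0 \<Longrightarrow> (v, w) \<in> bruhat_less l \<and> lk y v \<in> qZq"
    using assms by (auto simp: KL_cond_def)
  let ?c = "\<lambda>w. srefl 0 \<circ> w \<circ> srefl 0"
  have cc: "?c (?c v) = v" for v by (rule s0_conj_conj)
  have "(v, ?c w) \<in> bruhat_less l \<and> lk (hgamma l y) v \<in> qZq"
    if v: "v \<noteq> ?c w" "lk (hgamma l y) v \<noteq> 0" for v
  proof -
    have "?c v \<noteq> w" using v(1) cc by metis
    moreover have "lk y (?c v) \<noteq> 0" using v(2) by (simp only: lookup_hgamma[OF y(1)]) simp
    ultimately have "(?c v, w) \<in> bruhat_less l" "lk y (?c v) \<in> qZq" using y(4) by auto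
    then show ?thesis
      using bruhat_s0_conj[of "?c v" w] by (simp only: lookup_hgamma[OF y(1)] cc)
  qed
  moreover have "hbar l (hgamma l y) = hgamma l y" using hgamma_hbar[OF y(1)] y(2) by simp
  moreover have "lk (hgamma l y) (?c w) = 1" by (simp only: lookup_hgamma[OF y(1)] cc y(3))
  ultimately show ?thesis unfolding KL_cond_def using hgamma_Hecke[OF y(1)] by blast
qed

end

section \<open>Bi-invariant elements\<close>

context type_D
begin

text \<open>The coefficient function of the standard element of a class, on all signed
  permutations.\<close>

definition hfun :: "nat \<Rightarrow> sperm \<Rightarrow> laurent" where
  "hfun n w = (if w \<in> Dn l n then qpow (int (il (wlong l n)) - int (il w)) else 0)"

definition hst :: "nat \<Rightarrow> hecke" where
  "hst n = (\<Sum>w\<in>Dn l n. qpow (int (il (wlong l n)) - int (il w)) \<cdot> hb (shift n w))"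

lemma lookup_hst: "lk (hst n) w = hfun n (shift n w)"
proof -
  have "lk (hst n) w = (\<Sum>v\<in>Dn l n. if v = shift n w then qpow (int (il (wlong l n)) - int (il v)) else 0)"
    unfolding hst_def lookup_sum
    by (rule sum.cong) (auto simp: lookup_smul lookup_hb)
  then show ?thesis using finite_Dn by (simp add: hfun_def)
qed

lemma hst_Hecke: "hst n \<in> Hecke l"
  unfolding hst_def by (intro Hecke_sum Hecke_smul) (simp add: Hecke_hb shift_Dn_Weyl)

lemma shift_parity: "even (m + n) \<Longrightarrow> shift m w = shift n w"
  by (auto simp: shift_def)

text \<open>On the component of parity \<open>p\<close>, the generator that corresponds to \<open>srefl j\<close> under the
  shift.\<close>

definition gm :: "nat \<Rightarrow> int \<Rightarrow> int" where
  "gm p j = (if even p then j else gamma j)"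

lemma gm_N: "j \<in> N \<Longrightarrow> gm p j \<in> N"
  by (simp add: gm_def gamma_N)

lemma gm_shift: "j \<in> N \<Longrightarrow> srefl (gm p j) \<circ> shift p w = shift p (srefl j \<circ> w)"
  using srefl_s0'[OF gamma_N, of j w] gamma_gamma[of j] by (simp add: gm_def shift_def)

lemma lookup_T_shift:
  assumes x: "x \<in> Hecke l" and j: "j \<in> N" and w: "w \<in> SP l"
  shows "lk (T (gm p j) x) (shift p w) = tf j (\<lambda>v. lk x (shift p v)) w"
proof -
  have "srefl j \<circ> w \<in> SP l" by (intro SP_comp srefl_SP j w)
  then show ?thesis
    unfolding lookup_T[OF x gm_N[OF j]] tf_def gm_shift[OF j] by (simp only: il_shift w)
qed

text \<open>On the two-dimensional space of functions on \<open>w\<close> and \<open>srefl i \<circ> w\<close>, the ratio of the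
  two values decides between the eigenvalues.\<close>

lemma tf_eigen:
  assumes i: "i \<in> N" and w: "w \<in> SP l"
    and X: "\<And>w. w \<in> SP l \<Longrightarrow> il (srefl i \<circ> w) = Suc (il w) \<Longrightarrow> X (srefl i \<circ> w) = qpow (- 1) * X w"
  shows "tf i X w = qpow (- 1) * X w"
  using linv_left_cases[OF w i]
proof
  assume "il (srefl i \<circ> w) = Suc (il w)"
  then show ?thesis using X[OF w] by (simp add: tf_def)
next
  assume d: "il w = Suc (il (srefl i \<circ> w))"
  let ?v = "srefl i \<circ> w"
  have v: "?v \<in> SP l" by (intro SP_comp srefl_SP i w)
  have e: "srefl i \<circ> ?v = w" by (rule srefl_comp_srefl'(1)[OF N_ge(1)[OF i]])
  have "X (srefl i \<circ> ?v) = qpow (- 1) * X ?v" by (rule X[OF v]) (simp only: e d)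
  then have "X w = qpow (- 1) * X ?v" by (simp only: e)
  then have "qpow 1 * X w = X ?v" by (simp add: qpow_mult_left)
  then show ?thesis using d by (simp add: tf_def left_diff_distrib)
qed

lemma hfun_left:
  assumes w: "w \<in> SP l" and i: "i \<in> Oplus l" and up: "il (srefl i \<circ> w) = Suc (il w)"
  shows "hfun n (srefl i \<circ> w) = qpow (- 1) * hfun n w"
proof -
  have "srefl i \<circ> w \<in> Dn l n \<longleftrightarrow> w \<in> Dn l n"
    using Dn_left[of w n i] Dn_left[of "srefl i \<circ> w" n i] i
      srefl_comp_srefl'(1)[OF N_ge(1)[OF Oplus_N[OF i]], of w] by auto
  then show ?thesis using up by (simp add: hfun_def qpow_mult algebra_simps del: o_apply)
qed

lemma hfun_right:
  assumes w: "w \<in> SP l" and i: "i \<in> Oplus l" and up: "il (w \<circ> srefl i) = Suc (il w)"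
  shows "hfun n (w \<circ> srefl i) = qpow (- 1) * hfun n w"
proof -
  have "w \<circ> srefl i \<in> Dn l n \<longleftrightarrow> w \<in> Dn l n"
    using Dn_right[of w n i] Dn_right[of "w \<circ> srefl i" n i] i
      srefl_comp_srefl'(2)[OF N_ge(1)[OF Oplus_N[OF i]], of w] by auto
  then show ?thesis using up by (simp add: hfun_def qpow_mult algebra_simps del: o_apply)
qed

text \<open>The generators of the parabolic subgroup act by their eigenvalue \<open>q\<^sup>-\<^sup>1\<close>; the parity
  tells which of the two parabolic subgroups acts from the left.\<close>

definition left_inv :: "nat \<Rightarrow> hecke \<Rightarrow> bool" where
  "left_inv p x \<longleftrightarrow> x \<in> Hecke l \<and> (\<forall>j\<in>Oplus l. T (gm p j) x = qpow (- 1) \<cdot> x)"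

definition right_inv :: "hecke \<Rightarrow> bool" where
  "right_inv x \<longleftrightarrow> x \<in> Hecke l \<and> (\<forall>j\<in>Oplus l. Rm j x = qpow (- 1) \<cdot> x)"

definition biinv :: "nat \<Rightarrow> hecke \<Rightarrow> bool" where
  "biinv p x \<longleftrightarrow> left_inv p x \<and> right_inv x"

lemma left_inv_add: "left_inv p x \<Longrightarrow> left_inv p y \<Longrightarrow> left_inv p (x + y)"
  and left_inv_smul: "left_inv p x \<Longrightarrow> left_inv p (c \<cdot> x)"
  by (simp_all add: left_inv_def Hecke_add Hecke_smul T_add T_smul smul_add_right mult.commute)

lemma right_inv_add: "right_inv x \<Longrightarrow> right_inv y \<Longrightarrow> right_inv (x + y)"
  and right_inv_smul: "right_inv x \<Longrightarrow> right_inv (c \<cdot> x)"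
  by (simp_all add: right_inv_def Hecke_add Hecke_smul Rm_add Rm_smul smul_add_right mult.commute)

lemma biinv_zero: "biinv p 0"
  by (simp add: biinv_def left_inv_def right_inv_def Rm_def hrho_def)

lemma biinv_add: "biinv p x \<Longrightarrow> biinv p y \<Longrightarrow> biinv p (x + y)"
  and biinv_smul: "biinv p x \<Longrightarrow> biinv p (c \<cdot> x)"
  by (simp_all add: biinv_def left_inv_add left_inv_smul right_inv_add right_inv_smul)

lemma biinv_sum: "(\<And>a. a \<in> A \<Longrightarrow> biinv p (f a)) \<Longrightarrow> biinv p (sum f A)"
  by (induction A rule: infinite_finite_induct) (auto intro: biinv_add biinv_zero)

lemma biinv_Hecke: "biinv p x \<Longrightarrow> x \<in> Hecke l"
  by (simp add: biinv_def left_inv_def)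

lemma Weyl_shift: "w \<in> Weyl l \<Longrightarrow> shift p w \<in> SP l"
  by (simp add: shift_SP Weyl_SP)

lemma hst_biinv:
  assumes "even (n + p)"
  shows "biinv p (hst n)"
proof -
  have lkh: "lk (hst n) (shift p v) = hfun n v" for v
    by (simp add: lookup_hst shift_parity[OF assms])
  have "T (gm p j) (hst n) = qpow (- 1) \<cdot> hst n" if j: "j \<in> Oplus l" for j
  proof (rule Hecke_eqI)
    fix w assume "w \<in> Weyl l"
    then have v: "shift p w \<in> SP l" by (rule Weyl_shift)
    have "lk (T (gm p j) (hst n)) (shift p (shift p w)) = qpow (- 1) * hfun n (shift p w)"
      unfolding lookup_T_shift[OF hst_Hecke Oplus_N[OF j] v] lkh
      by (intro tf_eigen[where X = "hfun n"] Oplus_N j v hfun_left)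
    then show "lk (T (gm p j) (hst n)) w = lk (qpow (- 1) \<cdot> hst n) w"
      by (simp add: lookup_smul flip: lkh)
  qed (simp_all add: T_Hecke hst_Hecke gm_N Oplus_N j Hecke_smul)
  moreover have "Rm j (hst n) = qpow (- 1) \<cdot> hst n" if j: "j \<in> Oplus l" for j
  proof (rule Hecke_eqI)
    fix w assume W: "w \<in> Weyl l"
    let ?v = "shift p w"
    have v: "?v \<in> SP l" "?v \<circ> srefl j \<in> SP l"
      using Weyl_shift[OF W] by (simp_all add: SP_comp srefl_SP Oplus_N j)
    have w: "w = shift p ?v" by simp
    have s: "w \<circ> srefl j = shift p (?v \<circ> srefl j)" by (simp add: shift_right)
    have il: "il (w \<circ> srefl j) = il (?v \<circ> srefl j)" "il w = il ?v"
      using il_shift[OF v(1), of p] il_shift[OF v(2), of p] by (simp_all only: s shift_shift)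
    have "lk (Rm j (hst n)) w = hfun n (?v \<circ> srefl j)
      - (if il (?v \<circ> srefl j) < il ?v then zeta * hfun n ?v else 0)"
      unfolding lookup_Rm[OF hst_Hecke Oplus_N[OF j] Weyl_SP[OF W]] il
      by (simp only: s lkh) (simp add: lkh[of ?v, simplified])
    also have "\<dots> = qpow (- 1) * hfun n ?v"
      using linv_right_cases[OF v(1) Oplus_N[OF j]]
    proof
      assume up: "il (?v \<circ> srefl j) = Suc (il ?v)"
      then show ?thesis using hfun_right[OF v(1) j up] by simp
    next
      assume d: "il ?v = Suc (il (?v \<circ> srefl j))"
      have e: "?v \<circ> srefl j \<circ> srefl j = ?v"
        by (rule srefl_comp_srefl'(2)[OF N_ge(1)[OF Oplus_N[OF j]]])
      have "hfun n ?v = qpow (- 1) * hfun n (?v \<circ> srefl j)"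
        using hfun_right[OF v(2) j, of n] d by (simp only: e)
      then have "qpow 1 * hfun n ?v = hfun n (?v \<circ> srefl j)" by (simp add: qpow_mult_left)
      then show ?thesis using d by (simp add: left_diff_distrib)
    qed
    finally show "lk (Rm j (hst n)) w = lk (qpow (- 1) \<cdot> hst n) w"
      using lkh[of ?v] by (simp add: lookup_smul)
  qed (simp_all add: Rm_Hecke hst_Hecke Oplus_N j Hecke_smul)
  ultimately show ?thesis by (simp add: biinv_def left_inv_def right_inv_def hst_Hecke)
qed

text \<open>Each step of the climb to the longest element of the class divides the coefficient by
  \<open>q\<close>.\<close>

lemma biinv_value:
  assumes x: "biinv p x" and w: "w \<in> Dn l n"
  shows "lk x (shift p w) = hfun n w * lk x (shift p (wlong l n))"
proof -
  have xH: "x \<in> Hecke l" using x by (rule biinv_Hecke)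
  have "lk x (shift p w)
      = qpow (int (il (wlong l n)) - int (il w)) * lk x (shift p (wlong l n))"
    using w
  proof (induction rule: Dn_ascend_induct)
    case (left v i)
    have v: "v \<in> SP l" using left(1) by (rule Dn_SP)
    have "lk (T (gm p i) x) (shift p v) = qpow (- 1) * lk x (shift p v)"
      using x left(2) by (simp add: biinv_def left_inv_def lookup_smul)
    then have "lk x (shift p (srefl i \<circ> v)) = qpow (- 1) * lk x (shift p v)"
      using left(3) by (simp add: lookup_T_shift[OF xH Oplus_N[OF left(2)] v] tf_def)
    then have "lk x (shift p v) = qpow 1 * lk x (shift p (srefl i \<circ> v))"
      by (simp add: qpow_mult_left)
    also have "\<dots> = qpow 1 * (qpow (int (il (wlong l n)) - int (il (srefl i \<circ> v)))
        * lk x (shift p (wlong l n)))"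
      using left(4) unfolding o_def by simp
    finally show ?case using left(3) by (simp add: qpow_mult_left)
  next
    case (right v i)
    have v: "v \<in> SP l" "v \<circ> srefl i \<in> SP l"
      using right(1) Dn_right[OF right(1,2)] by (simp_all add: Dn_SP)
    have "lk (Rm i x) (shift p v) = qpow (- 1) * lk x (shift p v)"
      using x right(2) by (simp add: biinv_def right_inv_def lookup_smul)
    then have "lk x (shift p (v \<circ> srefl i)) = qpow (- 1) * lk x (shift p v)"
      using right(3) il_shift[OF v(1), of p] il_shift[OF v(2), of p]
      by (simp add: lookup_Rm[OF xH Oplus_N[OF right(2)] shift_SP[OF v(1)]] shift_right del: o_apply)
    then have "lk x (shift p v) = qpow 1 * lk x (shift p (v \<circ> srefl i))"
      by (simp add: qpow_mult_left)
    also have "\<dots> = qpow 1 * (qpow (int (il (wlong l n)) - int (il (v \<circ> srefl i)))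
        * lk x (shift p (wlong l n)))"
      using right(4) unfolding o_def by simp
    finally show ?case using right(3) by (simp add: qpow_mult_left)
  qed simp
  then show ?thesis using w by (simp add: hfun_def)
qed

lemma hfun_other: "w \<in> Dn l m \<Longrightarrow> hfun n w = (if n = m then hfun m w else 0)"
  by (auto simp: hfun_def Dn_def)

lemma hfun_wlong: "n \<le> l \<Longrightarrow> hfun n (wlong l n) = 1"
  by (simp add: hfun_def wlong_Dn)

lemma SP_Dn: "w \<in> SP l \<Longrightarrow> w \<in> Dn l (card (negs l w))"
  by (simp add: Dn_def)

text \<open>The classes partition the signed permutations, and on each of them \<open>biinv_value\<close> fixes
  the element up to its value at the longest one.\<close>

lemma biinv_expand:
  assumes x: "biinv p x"
  shows "x = (\<Sum>n | n \<le> l \<and> even (n + p). lk x (shift p (wlong l n)) \<cdot> hst n)"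
proof (rule Hecke_eqI[OF biinv_Hecke[OF x]])
  let ?A = "{n. n \<le> l \<and> even (n + p)}"
  show "(\<Sum>n\<in>?A. lk x (shift p (wlong l n)) \<cdot> hst n) \<in> Hecke l"
    by (intro Hecke_sum Hecke_smul hst_Hecke)
  fix w assume W: "w \<in> Weyl l"
  let ?v = "shift p w"
  define m where "m = card (negs l ?v)"
  have v: "?v \<in> Dn l m" unfolding m_def by (rule SP_Dn[OF Weyl_shift[OF W]])
  have m: "m \<in> ?A"
    using Dn_le[OF v] shift_Weyl[OF Weyl_shift[OF W], of p p] W by (simp add: m_def add.commute)
  have "lk (\<Sum>n\<in>?A. lk x (shift p (wlong l n)) \<cdot> hst n) w
      = (\<Sum>n\<in>?A. if n = m then lk x (shift p (wlong l m)) * hfun m ?v else 0)"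
    unfolding lookup_sum
  proof (rule sum.cong[OF refl])
    fix n assume "n \<in> ?A"
    then have "shift n w = ?v" by (intro shift_parity) simp
    then show "lk (lk x (shift p (wlong l n)) \<cdot> hst n) w
        = (if n = m then lk x (shift p (wlong l m)) * hfun m ?v else 0)"
      using hfun_other[OF v, of n] by (simp add: lookup_smul lookup_hst)
  qed
  also have "\<dots> = lk x (shift p (wlong l m)) * hfun m ?v" using m by simp
  also have "\<dots> = lk x w" using biinv_value[OF x v] by (simp add: mult.commute)
  finally show "lk x w = lk (\<Sum>n\<in>?A. lk x (shift p (wlong l n)) \<cdot> hst n) w" ..
qed

lemma hbar_Rm:
  assumes x: "x \<in> Hecke l" and j: "j \<in> N"
  shows "hbar l (Rm j x) = Rm j (hbar l x) + zeta \<cdot> hbar l x"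
proof -
  have s: "T j (hb id) = Rm j (hb id)"
    using linv_left_asc[OF SP_id j] N_ge[OF j]
    by (simp add: Rm_def hrho_hb T_hb Weyl_id j inv_srefl)
  have "hbar l (Rm j x) = hbar l (hmult l x (T j (hb id)))"
    using hmult_Rm[OF x hb_id_Hecke j] by (simp only: s hmult_one_right[OF x])
  also have "\<dots> = hmult l (hbar l x) (Ti j (hb id))"
    by (simp only: hbar_hmult[OF x T_Hecke[OF hb_id_Hecke j]] hbar_T[OF hb_id_Hecke j] hbar_one)
  also have "\<dots> = hmult l (hbar l x) (Rm j (hb id)) + zeta \<cdot> hbar l x"
    by (simp only: Ti_def s hmult_add_right[OF hbar_Hecke[OF x] Rm_Hecke[OF hb_id_Hecke j]
        Hecke_smul[OF hb_id_Hecke]] hmult_smul_right[OF hbar_Hecke[OF x] hb_id_Hecke]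
        hmult_one_right[OF hbar_Hecke[OF x]])
  finally show ?thesis
    by (simp only: hmult_Rm[OF hbar_Hecke[OF x] hb_id_Hecke j] hmult_one_right[OF hbar_Hecke[OF x]])
qed

text \<open>The eigenvalue equation for a generator is equivalent to the conjugate one for its
  inverse.\<close>

lemma biinv_hbar:
  assumes x: "biinv p x"
  shows "biinv p (hbar l x)"
proof -
  have xH: "x \<in> Hecke l" by (rule biinv_Hecke[OF x])
  have q: "y = qpow (- 1) \<cdot> z" if "y + zeta \<cdot> z = qpow 1 \<cdot> z" for y z :: hecke
  proof -
    have "y = qpow 1 \<cdot> z - zeta \<cdot> z" using that by (simp add: algebra_simps)
    also have "\<dots> = (qpow 1 + - zeta) \<cdot> z" by (simp only: smul_add_left smul_minus_left) simp
    finally show ?thesis by simp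
  qed
  have "T (gm p j) (hbar l x) = qpow (- 1) \<cdot> hbar l x" if j: "j \<in> Oplus l" for j
  proof (rule q)
    have "hbar l (T (gm p j) x) = qpow 1 \<cdot> hbar l x"
      using x j by (simp add: biinv_def left_inv_def hbar_smul)
    then show "T (gm p j) (hbar l x) + zeta \<cdot> hbar l x = qpow 1 \<cdot> hbar l x"
      by (simp only: hbar_T[OF xH gm_N[OF Oplus_N[OF j]]] Ti_def)
  qed
  moreover have "Rm j (hbar l x) = qpow (- 1) \<cdot> hbar l x" if j: "j \<in> Oplus l" for j
  proof (rule q)
    have "hbar l (Rm j x) = qpow 1 \<cdot> hbar l x"
      using x j by (simp add: biinv_def right_inv_def hbar_smul)
    then show "Rm j (hbar l x) + zeta \<cdot> hbar l x = qpow 1 \<cdot> hbar l x"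
      by (simp only: hbar_Rm[OF xH Oplus_N[OF j]])
  qed
  ultimately show ?thesis by (simp add: biinv_def left_inv_def right_inv_def hbar_Hecke xH)
qed

text \<open>The minimal standard elements are bar-invariant: their images are again bi-invariant,
  and the standard elements of larger classes would contribute terms that are too long.\<close>

lemma hbar_hst_minimal:
  assumes n: "n \<in> {0, 1}"
  shows "hbar l (hst n) = hst n"
proof -
  let ?x = "hbar l (hst n)"
  have nl: "n \<le> l" using n l_ge_2 by auto
  have b: "biinv n ?x" by (rule biinv_hbar[OF hst_biinv]) simp
  have co: "lk ?x (shift n (wlong l m)) = (if m = n then 1 else 0)"
    if m: "m \<le> l" "even (m + n)" for m
  proof -
    have "lk ?x (shift n (wlong l m)) = qbar (lk (hst n) (shift n (wlong l m)))"
    proof (rule lookup_hbar_top[OF hst_Hecke shift_Dn_Weyl[OF wlong_Dn[OF m(1)] m(2)]])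
      fix w assume "lk (hst n) w \<noteq> 0"
      then have w: "shift n w \<in> Dn l n" by (simp add: lookup_hst hfun_def split: if_splits)
      have "il w = il (shift n w)" using il_shift[OF Dn_SP[OF w], of n] by simp
      also have "\<dots> \<le> il (wlong l n)" by (rule il_wlong_ge[OF w])
      also have "\<dots> \<le> il (wlong l m)"
        using m n by (intro il_wlong_mono) (auto elim: oddE)
      finally show "il w \<le> il (shift n (wlong l m))" by (simp add: il_shift wlong_SP m)
    qed
    also have "\<dots> = qbar (hfun n (wlong l m))" by (simp add: lookup_hst)
    finally show ?thesis
      using hfun_other[OF wlong_Dn[OF m(1)], of n] hfun_wlong[OF nl] by simp
  qed
  have "?x = (\<Sum>m | m \<le> l \<and> even (m + n). lk ?x (shift n (wlong l m)) \<cdot> hst m)"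
    by (rule biinv_expand[OF b])
  also have "\<dots> = (\<Sum>m | m \<le> l \<and> even (m + n). if m = n then hst n else 0)"
    by (rule sum.cong) (use co in auto)
  also have "\<dots> = hst n" using nl by simp
  finally show ?thesis .
qed

text \<open>The coefficients of a standard element off the longest element of its class are
  positive powers of \<open>q\<close>, so unitriangularity in the standard elements passes to the basis
  of the Hecke algebra. The Bruhat relations come from \<open>bruhat_Dn_wlong\<close>.\<close>

lemma KL_cond_comb:
  assumes n: "n \<le> l" and y: "y = (\<Sum>m\<le>n. a m \<cdot> hst m)" and bar: "hbar l y = y"
    and a: "a n = 1" "\<And>m. m < n \<Longrightarrow> a m \<in> qZq" "\<And>m. m \<le> n \<Longrightarrow> odd (m + n) \<Longrightarrow> a m = 0"
  shows "KL_cond y (shift n (wlong l n))"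
proof -
  have co: "lk y (shift n v) = (if k \<le> n \<and> even (k + n) then a k * hfun k v else 0)"
    if v: "v \<in> Dn l k" for v k
  proof -
    have "lk y (shift n v) = (\<Sum>m\<le>n. if m = k \<and> even (k + n) then a k * hfun k v else 0)"
      unfolding y lookup_sum
    proof (rule sum.cong[OF refl])
      fix m assume m: "m \<in> {..n}"
      show "lk (a m \<cdot> hst m) (shift n v) = (if m = k \<and> even (k + n) then a k * hfun k v else 0)"
      proof (cases "even (m + n)")
        case True
        then have "shift m (shift n v) = v" using shift_parity[of m n] by simp
        then show ?thesis using hfun_other[OF v, of m] True by (auto simp: lookup_smul lookup_hst)
      next
        case False
        then show ?thesis using a(3)[of m] m by (auto simp: lookup_smul)
      qed
    qed
    then show ?thesis by (cases "even (k + n)") simp_all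
  qed
  have yH: "y \<in> Hecke l" unfolding y by (intro Hecke_sum Hecke_smul hst_Hecke)
  moreover have "lk y (shift n (wlong l n)) = 1"
    using co[OF wlong_Dn[OF n]] hfun_wlong[OF n] a(1) by simp
  moreover have "(v, shift n (wlong l n)) \<in> bruhat_less l \<and> lk y v \<in> qZq"
    if v: "v \<noteq> shift n (wlong l n)" "lk y v \<noteq> 0" for v
  proof -
    have "v \<in> Weyl l" using Hecke_lookup[OF yH] v(2) by blast
    define u where "u = shift n v"
    have vu: "v = shift n u" by (simp add: u_def)
    obtain k where u: "u \<in> Dn l k" using SP_Dn[OF Weyl_shift[OF \<open>v \<in> Weyl l\<close>]] u_def by blast
    have k: "k \<le> n" "even (k + n)" and lkv: "lk y v = a k * hfun k u"
      using co[OF u] v(2) by (auto simp: vu split: if_splits)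
    have ne: "u \<noteq> wlong l n" using v(1) vu by auto
    have hf: "hfun k u = qpow (int (il (wlong l k)) - int (il u))" using u by (simp add: hfun_def)
    have le: "il u \<le> il (wlong l k)" by (rule il_wlong_ge[OF u])
    have "lk y v \<in> qZq"
    proof (cases "k = n")
      case True
      then have "il u < il (wlong l n)" using il_wlong_greatest[OF u] ne by simp
      then show ?thesis using lkv hf a(1) True by (simp add: qpow_in_qZq)
    next
      case False
      then show ?thesis
        unfolding lkv hf using a(2)[of k] k le by (intro qZq_mult_nonneg) auto
    qed
    then show ?thesis
      using bruhat_Dn_wlong[OF u k(1) n k(2) _ ne, of n] vu by simp
  qed
  ultimately show ?thesis unfolding KL_cond_def using bar by blast
qed

lemma KL_cond_hst_minimal:
  assumes n: "n \<in> {0, 1}"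
  shows "KL_cond (hst n) (shift n (wlong l n))"
proof (rule KL_cond_comb[where a = "\<lambda>m. if m = n then 1 else 0"])
  show "n \<le> l" using n l_ge_2 by auto
  show "hst n = (\<Sum>m\<le>n. (if m = n then 1 else 0) \<cdot> hst m)"
    by (simp add: if_distrib[of "\<lambda>c. c \<cdot> _"] cong: if_cong)
  show "hbar l (hst n) = hst n" by (rule hbar_hst_minimal[OF n])
qed auto

section \<open>The \<open>q\<close>-Schur algebra\<close>

text \<open>The Kazhdan--Lusztig elements of the two parabolic subgroups, see \<open>klb_wmax\<close>.\<close>

definition eI :: "nat \<Rightarrow> hecke" where
  "eI p = (if even p then hst 0 else hgamma l (hst 0))"

definition Opm :: "nat \<Rightarrow> int set" where
  "Opm p = (if even p then Oplus l else Ominus l)"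

lemma klb_wmax: "klb l (wmax l (Opm p)) = eI p"
proof -
  have "KL_cond (hst 0) (wlong l 0)" using KL_cond_hst_minimal[of 0] by (simp add: shift_def)
  then show ?thesis
    using klb_eqI KL_cond_hgamma by (simp add: Opm_def eI_def wmax_Oplus wmax_Ominus)
qed

text \<open>The symmetric Poincare polynomial that both parabolic subgroups have in common, see
  \<open>poinc_sigma\<close>.\<close>

definition sigma :: laurent where
  "sigma = (\<Sum>w\<in>Dn l 0. qpow (int (il (wlong l 0)) - 2 * int (il w)))"

lemma Dn0_Weyl: "w \<in> Dn l 0 \<Longrightarrow> w \<in> Weyl l"
  by (simp add: Dn_def Weyl_iff)

lemma Dn0_pos: "w \<in> Dn l 0 \<Longrightarrow> 1 \<le> k \<Longrightarrow> k \<le> int l \<Longrightarrow> 1 \<le> sinv w k \<and> sinv w k \<le> int l"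
proof -
  assume w: "w \<in> Dn l 0" and k: "1 \<le> k" "k \<le> int l"
  have W: "sinv w \<in> SP l" using Dn_SP[OF w] by (rule SP_inv)
  have "negs l w = {}" using w finite_negs by (simp add: Dn_def)
  then have "\<not> sinv w k < 0" using k by (auto simp: negs_def)
  then show ?thesis using SP_eq_0[OF W, of k] SP_le[OF W, of k] k by auto
qed

lemma Dn0_left_descent:
  assumes w: "w \<in> Dn l 0" "w \<noteq> id"
  obtains i where "i \<in> Oplus l" "il w = Suc (il (srefl i \<circ> w))" "srefl i \<circ> w \<in> Dn l 0"
proof -
  obtain i where i: "i \<in> N" "il w = Suc (il (srefl i \<circ> w))"
    using left_descent_exists[OF Dn0_Weyl[OF w(1)] w(2)] .
  have "i \<noteq> - 1"
  proof
    assume m1: "i = - 1"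
    have "sinv w (hi i) < sinv w i"
      using linv_left_less_iff[OF Dn_SP[OF w(1)] i(1)] i(2) by simp
    then have "sinv w 2 < - sinv w 1"
      using SP_odd[OF SP_inv[OF Dn_SP[OF w(1)]], of 1] by (simp add: m1 hi_def)
    then show False using Dn0_pos[OF w(1), of 1] Dn0_pos[OF w(1), of 2] l_ge_2 by simp
  qed
  then have "i \<in> Oplus l" using i(1) N_Oplus by blast
  then show ?thesis using that i(2) Dn_left[OF w(1)] by blast
qed

lemma Dn0_induct [consumes 1, case_names id left]:
  assumes "w \<in> Dn l 0" "P id"
    "\<And>v i. v \<in> Dn l 0 \<Longrightarrow> i \<in> Oplus l \<Longrightarrow> il (srefl i \<circ> v) = Suc (il v) \<Longrightarrow> P v \<Longrightarrow> P (srefl i \<circ> v)"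
  shows "P w"
  using assms(1)
proof (induction "il w" arbitrary: w rule: less_induct)
  case less
  show ?case
  proof (cases "w = id")
    case False
    then obtain i where i: "i \<in> Oplus l" "il w = Suc (il (srefl i \<circ> w))" "srefl i \<circ> w \<in> Dn l 0"
      using Dn0_left_descent[OF less.prems] by blast
    have e: "srefl i \<circ> (srefl i \<circ> w) = w"
      by (rule srefl_comp_srefl'(1)[OF N_ge(1)[OF Oplus_N[OF i(1)]]])
    have P: "P (srefl i \<circ> w)" by (rule less.hyps) (use i in auto)
    have "il (srefl i \<circ> (srefl i \<circ> w)) = Suc (il (srefl i \<circ> w))"
      unfolding e by (rule i(2))
    from assms(3)[OF i(3,1) this P] show ?thesis unfolding e .
  qed (use assms(2) in simp)
qed

lemma hmult_hb_up:
  assumes "v \<in> Weyl l" "i \<in> N" "il (srefl i \<circ> v) = Suc (il v)" "y \<in> Hecke l"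
  shows "hmult l (hb (srefl i \<circ> v)) y = T i (hmult l (hb v) y)"
proof -
  have "T i (hb v) = hb (srefl i \<circ> v)" using assms by (simp add: T_hb)
  then show ?thesis using hmult_T[of "hb v" y i] assms by (simp add: Hecke_hb)
qed

lemma hmult_hb_left_inv:
  assumes "w \<in> Dn l 0" "left_inv 0 x"
  shows "hmult l (hb w) x = qpow (- int (il w)) \<cdot> x"
  using assms(1)
proof (induction rule: Dn0_induct)
  case id
  have "x \<in> Hecke l" using assms(2) by (simp add: left_inv_def)
  then show ?case by (simp only: hmult_one_left linv_id) simp
next
  case (left v i)
  have x: "x \<in> Hecke l" "T i x = qpow (- 1) \<cdot> x"
    using assms(2) left(2) by (auto simp: left_inv_def gm_def)
  have "hmult l (hb (srefl i \<circ> v)) x = T i (hmult l (hb v) x)"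
    by (rule hmult_hb_up[OF Dn0_Weyl[OF left(1)] Oplus_N[OF left(2)] left(3) x(1)])
  also have "\<dots> = qpow (- int (il (srefl i \<circ> v))) \<cdot> x"
    by (simp only: left(3,4) T_smul x(2)) (simp add: qpow_mult algebra_simps)
  finally show ?case .
qed

lemma hst_0: "hst 0 = (\<Sum>w\<in>Dn l 0. qpow (int (il (wlong l 0)) - int (il w)) \<cdot> hb w)"
  by (simp add: hst_def shift_def)

lemma hst_0_mult: "left_inv 0 x \<Longrightarrow> hmult l (hst 0) x = sigma \<cdot> x"
  by (simp add: hst_0 hmult_sum_left hmult_smul_left hmult_hb_left_inv qpow_mult sigma_def
      smul_sum_left)

lemma hst_0_left_inv: "left_inv 0 (hst 0)"
  using hst_biinv[of 0 0] by (simp add: biinv_def)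

lemma qbar_sigma: "qbar sigma = sigma"
proof -
  have e: "hmult l (hst 0) (hst 0) = sigma \<cdot> hst 0" by (rule hst_0_mult[OF hst_0_left_inv])
  have "hbar l (hmult l (hst 0) (hst 0)) = hmult l (hst 0) (hst 0)"
    using hbar_hst_minimal[of 0] by (simp add: hbar_hmult hst_Hecke)
  then have *: "qbar sigma \<cdot> hst 0 = sigma \<cdot> hst 0"
    using hbar_hst_minimal[of 0] by (simp add: e hbar_smul)
  have "lk (qbar sigma \<cdot> hst 0) (wlong l 0) = lk (sigma \<cdot> hst 0) (wlong l 0)" by (simp only: *)
  then show ?thesis using hfun_wlong[of 0] by (simp add: lookup_smul lookup_hst shift_def)
qed

lemma poinc_plus_Oplus: "poinc_plus l (Oplus l) = (\<Sum>w\<in>Dn l 0. qpow (2 * int (il w)))"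
  unfolding poinc_plus_def parab_Oplus by (rule sum.cong) (simp_all add: len_eq Dn0_Weyl)

lemma poinc_plus_Ominus: "poinc_plus l (Ominus l) = poinc_plus l (Oplus l)"
proof -
  let ?c = "\<lambda>w. srefl 0 \<circ> w \<circ> srefl 0"
  have "poinc_plus l (Ominus l) = (\<Sum>w\<in>Dn l 0. qpow (2 * int (len l (?c w))))"
  proof -
    have "inj_on ?c (Dn l 0)" by (rule inj_onI) (metis s0_conj_conj)
    then show ?thesis
      unfolding poinc_plus_def parab_Ominus parab_Oplus by (simp only: sum.reindex o_def)
  qed
  also have "\<dots> = (\<Sum>w\<in>Dn l 0. qpow (2 * int (il w)))"
    by (rule sum.cong) (simp_all add: len_eq s0_conj_Weyl Dn0_Weyl il_s0_conj Dn_SP)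
  finally show ?thesis by (simp only: poinc_plus_Oplus)
qed

lemma poinc_plus_sigma: "poinc_plus l (Opm p) = qpow (int (il (wlong l 0))) * sigma"
proof -
  have "poinc_plus l (Opm p) = qpow (int (il (wlong l 0))) * qbar sigma"
    by (simp add: Opm_def poinc_plus_Ominus poinc_plus_Oplus sigma_def qbar_sum sum_distrib_left
        qpow_mult)
  then show ?thesis by (simp only: qbar_sigma)
qed

lemma poinc_sigma: "poinc l (Opm p) = sigma"
proof -
  have "len l (wmax l (Opm p)) = il (wlong l 0)"
    using wlong_Dn[of 0 l]
    by (simp add: Opm_def wmax_Oplus wmax_Ominus len_eq Dn0_Weyl s0_conj_Weyl il_s0_conj Dn_SP)
  then show ?thesis by (simp add: poinc_def poinc_plus_sigma qpow_mult_left)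
qed

lemma sigma_neq_0: "sigma \<noteq> 0"
proof
  assume "sigma = 0"
  then have "poinc_plus l (Opm 0) = 0" by (simp add: poinc_plus_sigma)
  then have "(\<Sum>w\<in>Dn l 0. qpow (2 * int (il w))) = 0" by (simp add: Opm_def poinc_plus_Oplus)
  then have "lk (\<Sum>w\<in>Dn l 0. qpow (2 * int (il w))) 0 = 0" by simp
  then have "(\<Sum>w\<in>Dn l 0. if il w = 0 then 1 else 0 :: int) = 0"
    by (simp add: lookup_sum qpow_def lookup_single when_def)
  then have "\<forall>w\<in>Dn l 0. (if il w = 0 then 1 else 0 :: int) = 0"
    by (subst (asm) sum_nonneg_eq_0_iff) (auto simp: finite_Dn)
  moreover have "id \<in> Dn l 0" using dperm_Dn[of 0 l] by (simp add: dperm_0)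
  ultimately have "(if il id = 0 then 1 else 0 :: int) = 0" by blast
  then show False by (simp only: linv_id) simp
qed

lemma sinv_increasing:
  assumes d: "\<forall>i\<in>Oplus l. sinv d i < sinv d (i + 1)" and "1 \<le> a" "a < b" "b \<le> int l"
  shows "sinv d a < sinv d b"
proof -
  have "b \<le> int l \<longrightarrow> sinv d a < sinv d b" using assms(3)
  proof (induction b rule: int_gr_induct)
    case base
    show ?case using d assms(2) by (auto simp: Oplus_iff)
  next
    case (step b)
    have "sinv d b < sinv d (b + 1)" if "b < int l"
      using d[rule_format, of b] step.hyps assms(2) that by (simp add: Oplus_iff)
    with step.IH show ?case by auto
  qed
  with assms(4) show ?thesis by simp
qed

text \<open>The lengths add up because \<open>d\<close> keeps the order of the values that \<open>u\<close> permutes.\<close>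

lemma hmult_minimal:
  assumes u: "u \<in> Dn l 0" and d: "d \<in> Weyl l" "\<forall>i\<in>Oplus l. sinv d i < sinv d (i + 1)"
  shows "hmult l (hb u) (hb d) = hb (u \<circ> d) \<and> il (u \<circ> d) = il u + il d"
  using u
proof (induction rule: Dn0_induct)
  case id
  have "hmult l (hb id) (hb d) = hb d" by (rule hmult_one_left) (simp add: Hecke_hb d)
  then show ?case by (simp add: linv_id del: id_apply)
next
  case (left v i)
  have V: "v \<in> SP l" "d \<in> SP l" "v \<circ> d \<in> Weyl l"
    using Dn_SP[OF left(1)] Weyl_SP[OF d(1)] Weyl_comp[OF Dn0_Weyl[OF left(1)] d(1)] by auto
  have i: "1 \<le> i" "i < int l" "hi i = i + 1" using left(2) by (auto simp: Oplus_iff hi_def)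
  have "sinv v i < sinv v (i + 1)"
    using linv_left_less_iff[OF V(1) Oplus_N[OF left(2)]] left(3) i(3)
      SP_hi_neq[OF SP_inv[OF V(1)] Oplus_N[OF left(2)]] by force
  then have "sinv d (sinv v i) < sinv d (sinv v (i + 1))"
    using Dn0_pos[OF left(1), of i] Dn0_pos[OF left(1), of "i + 1"] i
    by (intro sinv_increasing[OF d(2)]) auto
  then have up: "il (srefl i \<circ> (v \<circ> d)) = Suc (il (v \<circ> d))"
    using linv_left_asc[OF Weyl_SP[OF V(3)] Oplus_N[OF left(2)]] i(3)
    by (simp add: SP_inv_comp[OF V(1,2)] del: o_apply) (simp add: o_apply)
  have "hmult l (hb (srefl i \<circ> v)) (hb d) = T i (hmult l (hb v) (hb d))"
    by (rule hmult_hb_up[OF Dn0_Weyl[OF left(1)] Oplus_N[OF left(2)] left(3)])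
      (simp add: Hecke_hb d)
  also have "\<dots> = T i (hb (v \<circ> d))" using left(4) by (simp add: o_def)
  also have "\<dots> = hb (srefl i \<circ> (v \<circ> d))"
    using up by (simp add: T_hb[OF V(3) Oplus_N[OF left(2)]])
  finally have "hmult l (hb (srefl i \<circ> v)) (hb d) = hb (srefl i \<circ> v \<circ> d)"
    by (simp only: comp_assoc)
  moreover have "il (srefl i \<circ> v \<circ> d) = il (srefl i \<circ> v) + il d"
    using up left(3,4) unfolding comp_assoc by (simp add: o_def)
  ultimately show ?case by blast
qed

lemma left_inv_hmult: "left_inv p x \<Longrightarrow> a \<in> Hecke l \<Longrightarrow> left_inv p (hmult l x a)"
  using hmult_T[of x a "gm p _"] by (auto simp: left_inv_def hmult_Hecke gm_N Oplus_N hmult_smul_left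
      simp flip: hmult_T)

text \<open>A left invariant element is determined by its coefficients at the minimal coset
  representatives, since any other element can be shortened from the left. A combination of
  the products \<open>hst 0 \<cdot> hb d\<close> has the same coefficients there.\<close>

lemma left_inv_factor:
  assumes x: "left_inv 0 x"
  shows "\<exists>a\<in>Hecke l. x = hmult l (hst 0) a"
proof -
  \<comment> \<open>the minimal representatives of the orbits of the parabolic subgroup acting on the left\<close>
  define D where "D = {d \<in> Weyl l. \<forall>i\<in>Oplus l. sinv d i < sinv d (i + 1)}"
  define a where "a = (\<Sum>d\<in>D. (lk x d * qpow (- int (il (wlong l 0)))) \<cdot> hb d)"
  have finD: "finite D" by (rule finite_subset[OF _ finite_Weyl]) (auto simp: D_def)
  have aH: "a \<in> Hecke l" unfolding a_def by (intro Hecke_sum Hecke_smul) (simp add: D_def Hecke_hb)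
  have xH: "x \<in> Hecke l" using x by (simp add: left_inv_def)
  \<comment> \<open>among these, the product with \<open>hb d\<close> only involves \<open>d\<close>\<close>
  have hd: "lk (hmult l (hst 0) (hb d)) w = (if w = d then qpow (int (il (wlong l 0))) else 0)"
    if d: "d \<in> D" and w: "w \<in> D" for d w
  proof -
    have eq: "u \<circ> d = w \<longleftrightarrow> u = id \<and> w = d" if u: "u \<in> Dn l 0" for u
    proof
      assume ud: "u \<circ> d = w"
      have U: "u \<in> SP l" by (rule Dn_SP[OF u])
      have "sinv u \<circ> w = d" using SP_inv_apply(2)[OF U] by (simp add: ud[symmetric] fun_eq_iff)
      moreover have "sinv u \<in> Dn l 0"
      proof -
        have "card {k. 1 \<le> k \<and> k \<le> int l \<and> u k < 0} = 0"
          using card_negs_eq[OF U] u by (simp add: Dn_def)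
        then show ?thesis
          using SP_inv[OF U] SP_inv_inv[OF U] by (simp add: Dn_def negs_def)
      qed
      ultimately have "il d = il (sinv u) + il w"
        using hmult_minimal[of "sinv u" w] w by (auto simp: D_def)
      moreover have "il w = il u + il d"
        using hmult_minimal[OF u, of d] d ud by (auto simp: D_def)
      ultimately have "il u = 0" by simp
      then have "u = id" using Dn0_left_descent[OF u] by (metis nat.distinct(1))
      then show "u = id \<and> w = d" using ud by simp
    qed (auto simp: fun_eq_iff)
    have id0: "id \<in> Dn l 0" using dperm_Dn[of 0 l] by (simp add: dperm_0)
    have "lk (hmult l (hst 0) (hb d)) w
        = (\<Sum>u\<in>Dn l 0. qpow (int (il (wlong l 0)) - int (il u)) * lk (hb (u \<circ> d)) w)"
      unfolding hst_0 hmult_sum_left hmult_smul_left lookup_sum lookup_smul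
      by (rule sum.cong) (use hmult_minimal d in \<open>auto simp: D_def\<close>)
    also have "\<dots> = (\<Sum>u\<in>Dn l 0. if u = id then (if w = d then qpow (int (il (wlong l 0))) else 0) else 0)"
    proof (rule sum.cong[OF refl])
      fix u assume "u \<in> Dn l 0"
      from eq[OF this] show "qpow (int (il (wlong l 0)) - int (il u)) * lk (hb (u \<circ> d)) w
        = (if u = id then (if w = d then qpow (int (il (wlong l 0))) else 0) else 0)"
        by (auto simp: lookup_hb linv_id simp del: o_apply id_apply)
    qed
    also have "\<dots> = (if w = d then qpow (int (il (wlong l 0))) else 0)"
      using id0 finite_Dn by simp
    finally show ?thesis .
  qed
  let ?y = "x - hmult l (hst 0) a"
  have y: "left_inv 0 ?y"
  proof -
    have "left_inv 0 (hmult l (hst 0) a)" by (rule left_inv_hmult[OF hst_0_left_inv aH])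
    then have "left_inv 0 (x + (- 1) \<cdot> hmult l (hst 0) a)" by (intro left_inv_add left_inv_smul x)
    then show ?thesis by (simp add: smul_minus_left)
  qed
  have yD: "lk ?y w = 0" if w: "w \<in> D" for w
  proof -
    have "hmult l (hst 0) a = (\<Sum>d\<in>D. (lk x d * qpow (- int (il (wlong l 0)))) \<cdot> hmult l (hst 0) (hb d))"
      unfolding a_def
    proof -
      have "hmult l (hst 0) (\<Sum>d\<in>B. c d \<cdot> hb d) = (\<Sum>d\<in>B. c d \<cdot> hmult l (hst 0) (hb d))"
        if "finite B" "B \<subseteq> Weyl l" for B c
        using that
      proof (induction B rule: finite_induct)
        case (insert d B)
        have "(\<Sum>d\<in>B. c d \<cdot> hb d) \<in> Hecke l"
          using insert by (intro Hecke_sum Hecke_smul) (auto simp: Hecke_hb)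
        then show ?case
          using insert by (simp add: hmult_add_right hmult_smul_right hst_Hecke Hecke_smul Hecke_hb)
      qed (simp add: hst_Hecke)
      then show "hmult l (hst 0) (\<Sum>d\<in>D. (lk x d * qpow (- int (il (wlong l 0)))) \<cdot> hb d)
        = (\<Sum>d\<in>D. (lk x d * qpow (- int (il (wlong l 0)))) \<cdot> hmult l (hst 0) (hb d))"
        using finD by (auto simp: D_def)
    qed
    then have "lk (hmult l (hst 0) a) w = (\<Sum>d\<in>D. if d = w then lk x w else 0)"
      using hd[OF _ w] by (auto simp: lookup_sum lookup_smul mult.assoc qpow_mult intro!: sum.cong)
    then show ?thesis using w finD by (simp add: lookup_minus)
  qed
  have "lk ?y w = 0" if "w \<in> Weyl l" for w
    using that
  proof (induction "il w" arbitrary: w rule: less_induct)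
    case less
    show ?case
    proof (cases "w \<in> D")
      case False
      then obtain i where i: "i \<in> Oplus l" "\<not> sinv w i < sinv w (i + 1)"
        using less.prems by (auto simp: D_def)
      have W: "w \<in> SP l" by (rule Weyl_SP[OF less.prems])
      have iN: "i \<in> N" by (rule Oplus_N[OF i(1)])
      have "sinv w (hi i) < sinv w i"
        using i SP_hi_neq[OF SP_inv[OF W] iN] hi_Oplus[OF i(1)] by auto
      then have d: "il w = Suc (il (srefl i \<circ> w))" by (rule linv_left_desc[OF W iN])
      have e: "srefl i \<circ> (srefl i \<circ> w) = w" by (rule srefl_comp_srefl'(1)[OF N_ge(1)[OF iN]])
      have v: "srefl i \<circ> w \<in> Weyl l" by (rule Weyl_left[OF less.prems iN])
      have 0: "lk ?y (srefl i \<circ> w) = 0" by (rule less.hyps) (use d v in auto)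
      have yH: "?y \<in> Hecke l" "T i ?y = qpow (- 1) \<cdot> ?y"
        using y i(1) by (simp_all add: left_inv_def gm_def)
      have "lk (T i ?y) (srefl i \<circ> w) = lk ?y w"
        unfolding lookup_T[OF yH(1) iN] tf_def e using d by simp
      then show ?thesis using 0 by (simp add: yH(2) lookup_smul)
    qed (use yD in simp)
  qed
  then have "?y = 0"
    using y by (intro Hecke_eqI) (simp_all add: left_inv_def)
  then show ?thesis using aH by (intro bexI[of _ a]) simp_all
qed

end

context type_D
begin

lemma gm_Suc: "j \<in> N \<Longrightarrow> gamma (gm p j) = gm (Suc p) j"
  by (simp add: gm_def gamma_gamma)

lemma left_inv_parity: "even (p + r) \<Longrightarrow> left_inv p x \<longleftrightarrow> left_inv r x"
  by (simp add: left_inv_def gm_def)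

lemma left_inv_hgamma: "left_inv p x \<Longrightarrow> left_inv (Suc p) (hgamma l x)"
  using hgamma_T[of x "gm p _"]
  by (auto simp: left_inv_def hgamma_Hecke hgamma_smul gm_N Oplus_N
      simp flip: gm_Suc hgamma_T)

lemma eI_Hecke: "eI p \<in> Hecke l"
  by (simp add: eI_def hst_Hecke hgamma_Hecke)

lemma left_inv_Hecke: "left_inv p x \<Longrightarrow> x \<in> Hecke l"
  and right_inv_Hecke: "right_inv x \<Longrightarrow> x \<in> Hecke l"
  by (simp_all add: left_inv_def right_inv_def)

lemma eI_mult:
  assumes x: "left_inv p x"
  shows "hmult l (eI p) x = sigma \<cdot> x"
proof (cases "even p")
  case True
  then show ?thesis using hst_0_mult[of x] x left_inv_parity[of p 0] by (simp add: eI_def)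
next
  case False
  have xH: "x \<in> Hecke l" by (rule left_inv_Hecke[OF x])
  have "left_inv 0 (hgamma l x)"
    using left_inv_hgamma[OF x] False left_inv_parity[of "Suc p" 0] by simp
  then have "hgamma l (hmult l (hst 0) (hgamma l x)) = hgamma l (sigma \<cdot> hgamma l x)"
    by (simp only: hst_0_mult)
  then show ?thesis
    using False by (simp add: eI_def hgamma_hmult hst_Hecke hgamma_Hecke xH hgamma_hgamma hgamma_smul)
qed

lemma left_inv_eI: "left_inv p (eI p)"
proof (cases "even p")
  case True
  then show ?thesis using hst_0_left_inv left_inv_parity[of p 0] by (simp add: eI_def)
next
  case False
  then show ?thesis
    using left_inv_hgamma[OF hst_0_left_inv] left_inv_parity[of p 1] by (simp add: eI_def)
qed

lemma left_inv_iff: "left_inv p x \<longleftrightarrow> (\<exists>a\<in>Hecke l. x = hmult l (eI p) a)"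
proof
  assume x: "left_inv p x"
  show "\<exists>a\<in>Hecke l. x = hmult l (eI p) a"
  proof (cases "even p")
    case True
    then show ?thesis using left_inv_factor[of x] x left_inv_parity[of p 0] by (simp add: eI_def)
  next
    case False
    then have "left_inv 0 (hgamma l x)"
      using left_inv_hgamma[OF x] left_inv_parity[of "Suc p" 0] by simp
    then obtain a where a: "a \<in> Hecke l" "hgamma l x = hmult l (hst 0) a"
      using left_inv_factor by blast
    have "hgamma l (hgamma l x) = hmult l (eI p) (hgamma l a)"
      using False by (simp add: a eI_def hgamma_hmult hst_Hecke)
    then show ?thesis using hgamma_Hecke[OF a(1)] hgamma_hgamma[OF left_inv_Hecke[OF x]] by auto
  qed
qed (use left_inv_hmult[OF left_inv_eI] in blast)

lemma hrho_hst_0: "hrho (hst 0) = hst 0"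
proof (rule Hecke_eqI)
  fix w assume W: "w \<in> Weyl l"
  have w: "w \<in> SP l" "sinv w \<in> SP l" using W by (simp_all add: Weyl_SP SP_inv)
  have "card (negs l (sinv w)) = card {k. 1 \<le> k \<and> k \<le> int l \<and> w k < 0}"
    using SP_inv_inv[OF w(1)] by (simp add: negs_def)
  then have "sinv w \<in> Dn l 0 \<longleftrightarrow> w \<in> Dn l 0"
    using card_negs_eq[OF w(1)] w by (simp add: Dn_def)
  then show "lk (hrho (hst 0)) w = lk (hst 0) w"
    using linv_inv[OF w(1)] by (simp add: lookup_hrho hst_Hecke w lookup_hst shift_def hfun_def)
qed (simp_all add: hrho_Hecke hst_Hecke)

lemma right_inv_hrho: "x \<in> Hecke l \<Longrightarrow> right_inv x \<longleftrightarrow> left_inv 0 (hrho x)"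
proof -
  assume x: "x \<in> Hecke l"
  have "Rm j x = qpow (- 1) \<cdot> x \<longleftrightarrow> T j (hrho x) = qpow (- 1) \<cdot> hrho x" if j: "j \<in> Oplus l" for j
  proof
    assume "Rm j x = qpow (- 1) \<cdot> x"
    then have "hrho (Rm j x) = hrho (qpow (- 1) \<cdot> x)" by simp
    then show "T j (hrho x) = qpow (- 1) \<cdot> hrho x"
      by (simp only: hrho_Rm[OF x Oplus_N[OF j]] hrho_smul)
  next
    assume "T j (hrho x) = qpow (- 1) \<cdot> hrho x"
    then show "Rm j x = qpow (- 1) \<cdot> x" by (simp add: Rm_def hrho_smul hrho_hrho x)
  qed
  then show ?thesis by (simp add: right_inv_def left_inv_def x hrho_Hecke gm_def)
qed

lemma right_inv_mult: "right_inv x \<Longrightarrow> hmult l x (hst 0) = sigma \<cdot> x"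
proof -
  assume x: "right_inv x"
  then have xH: "x \<in> Hecke l" by (rule right_inv_Hecke)
  have "hrho (hmult l (hst 0) (hrho x)) = hrho (sigma \<cdot> hrho x)"
    using hst_0_mult[of "hrho x"] x xH right_inv_hrho by simp
  then show ?thesis
    by (simp add: hrho_hmult hst_Hecke hrho_Hecke xH hrho_hrho hrho_hst_0 hrho_smul)
qed

lemma right_inv_iff: "right_inv x \<longleftrightarrow> (\<exists>a\<in>Hecke l. x = hmult l a (hst 0))"
proof
  assume x: "right_inv x"
  then have xH: "x \<in> Hecke l" by (rule right_inv_Hecke)
  obtain a where a: "a \<in> Hecke l" "hrho x = hmult l (hst 0) a"
    using left_inv_factor[of "hrho x"] x xH right_inv_hrho by blast
  have "hrho (hrho x) = hmult l (hrho a) (hst 0)"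
    by (simp add: a hrho_hmult hst_Hecke hrho_hst_0)
  then show "\<exists>a\<in>Hecke l. x = hmult l a (hst 0)"
    using hrho_hrho[OF xH] hrho_Hecke[OF a(1)] by auto
next
  assume "\<exists>a\<in>Hecke l. x = hmult l a (hst 0)"
  then obtain a where a: "a \<in> Hecke l" "x = hmult l a (hst 0)" by blast
  then have "hrho x = hmult l (hst 0) (hrho a)" by (simp add: hrho_hmult hst_Hecke hrho_hst_0)
  then have "left_inv 0 (hrho x)" using left_inv_hmult[OF hst_0_left_inv] a(1) by (simp add: hrho_Hecke)
  then show "right_inv x" using a by (simp add: right_inv_hrho hmult_Hecke hst_Hecke)
qed

text \<open>The two-sided ideal conditions become eigenvalue equations, with which one can
  compute.\<close>

lemma Schur_iff: "x \<in> Schur l (Opm p) (Oplus l) \<longleftrightarrow> biinv p x"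
proof -
  have "klb l (wmax l (Oplus l)) = hst 0" using klb_wmax[of 0] by (simp add: Opm_def eI_def)
  then show ?thesis
    unfolding Schur_def biinv_def left_inv_iff right_inv_iff klb_wmax by auto
qed

text \<open>Right invariance on the inner side, in the form that allows the division by \<open>sigma\<close>.\<close>

definition inner_inv :: "nat \<Rightarrow> hecke \<Rightarrow> bool" where
  "inner_inv p x \<longleftrightarrow> x \<in> Hecke l \<and> hmult l x (eI p) = sigma \<cdot> x"

lemma right_inv_inner: "right_inv x \<Longrightarrow> inner_inv 0 x"
  by (simp add: inner_inv_def right_inv_Hecke right_inv_mult eI_def)

lemma right_inv_hgamma_inner: "right_inv x \<Longrightarrow> inner_inv 1 (hgamma l x)"
proof -
  assume x: "right_inv x"
  have "hgamma l (hmult l x (hst 0)) = hgamma l (sigma \<cdot> x)" using right_inv_mult[OF x] by simp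
  then show ?thesis
    using right_inv_Hecke[OF x]
    by (simp add: inner_inv_def hgamma_Hecke eI_def hgamma_hmult hst_Hecke hgamma_smul)
qed

lemma smult_at_eqI: "hmult l x y = sigma \<cdot> z \<Longrightarrow> smult_at l (Opm p) x y = z"
  using scalar_quot_smul[OF sigma_neq_0] by (simp add: smult_at_def poinc_sigma)

text \<open>If \<open>y\<close> is \<open>eI p\<close> times \<open>a\<close>, then the product with \<open>x\<close> is \<open>sigma\<close> times \<open>x\<close> times \<open>a\<close>.\<close>

lemma smult_at_ok:
  assumes x: "inner_inv p x" and y: "left_inv p y"
  shows "smult_at l (Opm p) x y \<in> Hecke l" "hmult l x y = sigma \<cdot> smult_at l (Opm p) x y"
proof -
  obtain a where a: "a \<in> Hecke l" "y = hmult l (eI p) a" using y left_inv_iff by blast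
  have "hmult l x y = hmult l (hmult l x (eI p)) a"
  proof -
    have "x \<in> Hecke l" using x by (simp add: inner_inv_def)
    then show ?thesis by (simp only: a(2) hmult_assoc[OF _ eI_Hecke a(1)])
  qed
  also have "\<dots> = sigma \<cdot> hmult l x a" using x by (simp add: inner_inv_def hmult_smul_left)
  finally have *: "hmult l x y = sigma \<cdot> hmult l x a" .
  then have "smult_at l (Opm p) x y = hmult l x a" by (rule smult_at_eqI)
  then show "smult_at l (Opm p) x y \<in> Hecke l" "hmult l x y = sigma \<cdot> smult_at l (Opm p) x y"
    using * x a by (simp_all add: hmult_Hecke inner_inv_def)
qed

lemma smult_at_biinv:
  assumes x: "inner_inv p x" "left_inv r x" and y: "left_inv p y" "right_inv y"
  shows "biinv r (smult_at l (Opm p) x y)"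
proof -
  let ?z = "smult_at l (Opm p) x y"
  note z = smult_at_ok[OF x(1) y(1)]
  have H: "x \<in> Hecke l" "y \<in> Hecke l" using x y by (simp_all add: left_inv_Hecke)
  have "T (gm r j) ?z = qpow (- 1) \<cdot> ?z" if j: "j \<in> Oplus l" for j
  proof (rule smul_cancel[OF _ sigma_neq_0])
    have "T (gm r j) (hmult l x y) = qpow (- 1) \<cdot> hmult l x y"
      using hmult_T[OF H gm_N[OF Oplus_N[OF j]], of r] x(2) j
      by (simp add: left_inv_def hmult_smul_left)
    then show "sigma \<cdot> T (gm r j) ?z = sigma \<cdot> (qpow (- 1) \<cdot> ?z)"
      by (simp add: z(2) T_smul mult.commute)
  qed
  moreover have "Rm j ?z = qpow (- 1) \<cdot> ?z" if j: "j \<in> Oplus l" for j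
  proof (rule smul_cancel[OF _ sigma_neq_0])
    have "Rm j (hmult l x y) = qpow (- 1) \<cdot> hmult l x y"
      using hmult_Rm[OF H Oplus_N[OF j]] y(2) j H by (simp add: right_inv_def hmult_smul_right)
    then show "sigma \<cdot> Rm j ?z = sigma \<cdot> (qpow (- 1) \<cdot> ?z)"
      by (simp add: z(2) Rm_smul mult.commute)
  qed
  ultimately show ?thesis using z(1) by (simp add: biinv_def left_inv_def right_inv_def)
qed

section \<open>Multiplication by \<open>b\<close> on standard elements\<close>

primrec down_word :: "nat \<Rightarrow> int list" where
  "down_word 0 = []"
| "down_word (Suc j) = int (Suc j) # down_word j"

text \<open>Left multiplication by \<open>b\<close> is, up to the shift by \<open>srefl 0\<close>, left multiplication by
  this sum over the minimal coset representatives of the symmetric group modulo the one that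
  fixes the first point.\<close>

definition a_elt :: hecke where
  "a_elt = (\<Sum>j<l. qpow (int l - 1 - int j) \<cdot> Tws (down_word j) (hb id))"

text \<open>The action of \<open>down_word j\<close> on coefficient functions.\<close>

fun twf :: "nat \<Rightarrow> (sperm \<Rightarrow> laurent) \<Rightarrow> sperm \<Rightarrow> laurent" where
  "twf 0 X = X"
| "twf (Suc j) X = tf (int (Suc j)) (twf j X)"

definition Afun :: "(sperm \<Rightarrow> laurent) \<Rightarrow> sperm \<Rightarrow> laurent" where
  "Afun X w = (\<Sum>j<l. qpow (int l - 1 - int j) * twf j X w)"

lemma down_word_N: "j < l \<Longrightarrow> down_word j \<in> lists N"
proof (induction j)
  case (Suc j)
  then have "int (Suc j) \<in> Oplus l" by (simp add: Oplus_iff)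
  with Suc show ?case using Oplus_N[of "int (Suc j)"] by simp
qed simp

lemma lookup_down_word: "x \<in> Hecke l \<Longrightarrow> j < l \<Longrightarrow> lk (Tws (down_word j) x) = twf j (lk x)"
proof (induction j)
  case (Suc j)
  have i: "int (Suc j) \<in> N" using Suc.prems by (intro Oplus_N) (simp add: Oplus_iff)
  have "lk (T (int (Suc j)) (Tws (down_word j) x)) = tf (int (Suc j)) (lk (Tws (down_word j) x))"
    using lookup_T[OF Tws_Hecke[OF down_word_N Suc.prems(1)] i, of j] Suc.prems by auto
  then show ?case using Suc by simp
qed simp

lemma Tws_hmult: "js \<in> lists N \<Longrightarrow> x \<in> Hecke l \<Longrightarrow> hmult l (Tws js (hb id)) x = Tws js x"
proof (induction js)
  case (Cons i js)
  then have "hmult l (T i (Tws js (hb id))) x = T i (Tws js x)"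
    by (simp add: hmult_T Tws_Hecke del: id_apply)
  then show ?case by (simp del: id_apply)
qed (use hmult_one_left in simp)

lemma a_elt_Hecke: "a_elt \<in> Hecke l"
  unfolding a_elt_def by (intro Hecke_sum Hecke_smul Tws_Hecke hb_id_Hecke down_word_N) simp

lemma lookup_a_elt: "x \<in> Hecke l \<Longrightarrow> lk (hmult l a_elt x) w = Afun (lk x) w"
  by (simp add: a_elt_def hmult_sum_left hmult_smul_left lookup_sum lookup_smul Tws_hmult
      down_word_N lookup_down_word Afun_def del: id_apply)

lemma twf_right_s0:
  assumes "w \<in> SP l" "j < l"
  shows "twf j (\<lambda>v. X (v \<circ> srefl 0)) w = twf j X (w \<circ> srefl 0)"
  using assms
proof (induction j arbitrary: w)
  case (Suc j)
  let ?i = "int (Suc j)"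
  have "?i \<in> N" using Suc.prems by (intro Oplus_N) (simp add: Oplus_iff)
  then have s: "srefl ?i \<circ> w \<in> SP l" by (intro SP_comp srefl_SP Suc.prems)
  have "il (srefl ?i \<circ> w \<circ> srefl 0) = il (srefl ?i \<circ> w)" "il (w \<circ> srefl 0) = il w"
    by (rule linv_s0_right[OF s], rule linv_s0_right[OF Suc.prems(1)])
  then show ?case
    using Suc.IH[OF s] Suc.IH[OF Suc.prems(1)] Suc.prems
    by (simp only: twf.simps tf_def comp_assoc Suc_lessD)
qed simp

lemma lookup_gamma_a_elt:
  assumes x: "x \<in> Hecke l" and w: "w \<in> SP l"
  shows "lk (hmult l (hgamma l a_elt) x) w = Afun (\<lambda>v. lk x (srefl 0 \<circ> v)) (srefl 0 \<circ> w)"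
proof -
  let ?c = "\<lambda>w. srefl 0 \<circ> w \<circ> srefl 0"
  have cw: "srefl 0 \<circ> w \<in> SP l" "?c w \<in> SP l" by (intro SP_comp srefl_0_SP w)+
  have "hmult l (hgamma l a_elt) x = hgamma l (hmult l a_elt (hgamma l x))"
    by (simp add: hgamma_hmult a_elt_Hecke hgamma_Hecke x hgamma_hgamma)
  then have "lk (hmult l (hgamma l a_elt) x) w = lk (hmult l a_elt (hgamma l x)) (?c w)"
    by (simp add: lookup_hgamma hmult_Hecke a_elt_Hecke hgamma_Hecke x del: o_apply)
  also have "\<dots> = Afun (lk (hgamma l x)) (?c w)"
    by (rule lookup_a_elt[OF hgamma_Hecke[OF x]])
  also have "lk (hgamma l x) = (\<lambda>v. (\<lambda>v. lk x (srefl 0 \<circ> v)) (v \<circ> srefl 0))"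
    by (rule ext) (simp only: lookup_hgamma[OF x] comp_assoc)
  also have "Afun (\<lambda>v. (\<lambda>v. lk x (srefl 0 \<circ> v)) (v \<circ> srefl 0)) (?c w)
      = Afun (\<lambda>v. lk x (srefl 0 \<circ> v)) (?c w \<circ> srefl 0)"
    unfolding Afun_def
    by (intro sum.cong refl arg_cong2[where f = "(*)"] twf_right_s0 cw(2)) simp
  also have "?c w \<circ> srefl 0 = srefl 0 \<circ> w" by (rule s0_s0(2))
  finally show ?thesis .
qed

subsection \<open>The coefficients of the partial products\<close>

abbreviation cnt :: "sperm \<Rightarrow> nat \<Rightarrow> nat" where
  "cnt w j \<equiv> card (negs l w \<inter> {1..int j})"

text \<open>The coefficient of \<open>w\<close> after \<open>j\<close> steps, up to a power of \<open>q\<close> fixed by the length of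
  \<open>w\<close>, depends only on the signs of \<open>w\<close>: on the number \<open>c\<close> of those up to \<open>j\<close>, and on
  whether \<open>j + 1\<close> is among them. The two cases are the classes with one sign more and with
  one sign less.\<close>

definition step_coeff :: "bool \<Rightarrow> nat \<Rightarrow> nat \<Rightarrow> bool \<Rightarrow> laurent" where
  "step_coeff up j c s = (if up then if s then qpow (int j - 2 * int c) else 0
     else qpow (- int j) * (1 - (if s then qpow (2 * (int j - int c)) else 0)))"

lemma step_coeff_same: "step_coeff up (Suc j) (if s then Suc c else c) s = qpow (- 1) * step_coeff up j c s"
  by (auto simp: step_coeff_def qpow_mult qpow_mult_left right_diff_distrib algebra_simps)

lemma step_coeff_down: "step_coeff up (Suc j) (Suc c) False = qpow (- 1) * step_coeff up j c False"
  by (auto simp: step_coeff_def qpow_mult algebra_simps)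

lemma step_coeff_up: "step_coeff up (Suc j) c True = qpow 1 * step_coeff up j c True - zeta * step_coeff up j c False"
  by (auto simp: step_coeff_def qpow_mult qpow_mult_left algebra_simps)

lemma cnt_Suc: "cnt w (Suc j) = (if int (Suc j) \<in> negs l w then Suc (cnt w j) else cnt w j)"
proof -
  have "{1..int (Suc j)} = insert (int (Suc j)) {1..int j}" by auto
  then show ?thesis using finite_negs[of l w] by (simp add: Int_insert_right)
qed

text \<open>Induction on \<open>j\<close>. The step reflects the values \<open>j + 1\<close> and \<open>j + 2\<close>. If they carry the
  same sign, the function is an eigenvector for this step; otherwise their signs show
  whether the reflection is a descent.\<close>

lemma twf_s0_hfun:
  assumes n: "w \<in> Dn l (if up then Suc n else n - 1)" "up \<or> n > 0" and j: "j < l"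
  shows "twf j (\<lambda>v. hfun n (srefl 0 \<circ> v)) w
    = qpow (int (il (wlong l n)) - int (il w)) * step_coeff up j (cnt w j) (int j + 1 \<in> negs l w)"
  using n(1) j
proof (induction j arbitrary: w)
  case 0
  have w: "w \<in> SP l" by (rule Dn_SP[OF 0(1)])
  have m: "srefl 0 \<circ> w \<in> Dn l n \<longleftrightarrow> (if up then 1 \<in> negs l w else 1 \<notin> negs l w)"
  proof (cases "1 \<in> negs l w")
    case True
    then show ?thesis using Dn_s0(1)[OF 0(1) True] n(2) by (auto simp: Dn_def split: if_splits)
  next
    case False
    then show ?thesis using Dn_s0(2)[OF 0(1) False] n(2) by (auto simp: Dn_def split: if_splits)
  qed
  have "il (srefl 0 \<circ> w) = il w" by (rule linv_s0_left[OF w])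
  then show ?case using m by (auto simp: hfun_def step_coeff_def simp del: o_apply)
next
  case (Suc j)
  let ?i = "int (Suc j)" and ?E = "\<lambda>w. qpow (int (il (wlong l n)) - int (il w))"
  let ?s = "srefl ?i \<circ> w" and ?K = "negs l w" and ?c = "cnt w j"
  have iO: "?i \<in> Oplus l" using Suc.prems by (simp add: Oplus_iff)
  have iN: "?i \<in> N" by (rule Oplus_N[OF iO])
  have hi: "hi ?i = ?i + 1" by (rule hi_Oplus[OF iO])
  have w: "w \<in> SP l" by (rule Dn_SP[OF Suc.prems(1)])
  have s: "?s \<in> Dn l (if up then Suc n else n - 1)" by (rule Dn_left[OF Suc.prems(1) iO])
  have mem: "k \<in> negs l ?s \<longleftrightarrow> srefl ?i k \<in> ?K" for k
    using srefl_range[OF iO, of k]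
    unfolding negs_def mem_Collect_eq sinv_srefl_left[OF w iN] o_apply by blast
  have "negs l ?s \<inter> {1..int j} = ?K \<inter> {1..int j}"
  proof -
    have "k \<in> negs l ?s \<longleftrightarrow> k \<in> ?K" if "k \<in> {1..int j}" for k
    proof -
      have "srefl ?i k = k" using that by (simp add: srefl_pos)
      then show ?thesis by (simp only: mem)
    qed
    then show ?thesis by blast
  qed
  then have c: "cnt ?s j = ?c" by simp
  have sK: "int j + 1 \<in> negs l ?s \<longleftrightarrow> ?i + 1 \<in> ?K"
  proof -
    have "int j + 1 = ?i" by simp
    moreover have "srefl ?i ?i = ?i + 1" by (simp add: srefl_pos)
    ultimately show ?thesis by (simp only: mem)
  qed
  have IH: "twf j (\<lambda>v. hfun n (srefl 0 \<circ> v)) w = ?E w * step_coeff up j ?c (?i \<in> ?K)"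
    using Suc.IH[OF Suc.prems(1)] Suc.prems(2) by (simp add: add.commute del: o_apply)
  have IHs: "twf j (\<lambda>v. hfun n (srefl 0 \<circ> v)) ?s = ?E ?s * step_coeff up j ?c (?i + 1 \<in> ?K)"
    using Suc.IH[OF s] Suc.prems(2) by (simp only: c sK Suc_lessD)
  have tf: "twf (Suc j) (\<lambda>v. hfun n (srefl 0 \<circ> v)) w = ?E ?s * step_coeff up j ?c (?i + 1 \<in> ?K)
      - (if il ?s < il w then zeta * (?E w * step_coeff up j ?c (?i \<in> ?K)) else 0)"
    by (simp only: twf.simps tf_def IH IHs)
  have desc: "il ?s < il w \<longleftrightarrow> sinv w (?i + 1) < sinv w ?i"
    using linv_left_less_iff[OF w iN] by (simp only: hi)
  have K: "?i \<in> ?K \<longleftrightarrow> sinv w ?i < 0" "?i + 1 \<in> ?K \<longleftrightarrow> sinv w (?i + 1) < 0"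
    using Suc.prems(2) by (auto simp: negs_def)
  have asc_E: "?E ?s = qpow (- 1) * ?E w" if "\<not> il ?s < il w"
    using linv_left_cases[OF w iN] that by (auto simp: qpow_mult algebra_simps simp del: o_apply)
  have desc_E: "?E ?s = qpow 1 * ?E w" if "il ?s < il w"
    using linv_left_cases[OF w iN] that by (auto simp: qpow_mult algebra_simps simp del: o_apply)
  have "twf (Suc j) (\<lambda>v. hfun n (srefl 0 \<circ> v)) w
      = ?E w * step_coeff up (Suc j) (cnt w (Suc j)) (?i + 1 \<in> ?K)"
  proof (cases "?i \<in> ?K \<longleftrightarrow> ?i + 1 \<in> ?K")
    case True
    have "twf (Suc j) (\<lambda>v. hfun n (srefl 0 \<circ> v)) w
        = ?E w * (qpow (- 1) * step_coeff up j ?c (?i + 1 \<in> ?K))"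
    proof (cases "il ?s < il w")
      case d: True
      show ?thesis unfolding tf desc_E[OF d] True using d by (simp add: algebra_simps del: o_apply)
    next
      case False
      show ?thesis unfolding tf asc_E[OF False] using False by (simp add: ac_simps del: o_apply)
    qed
    also have "qpow (- 1) * step_coeff up j ?c (?i + 1 \<in> ?K)
        = step_coeff up (Suc j) (cnt w (Suc j)) (?i + 1 \<in> ?K)"
      using step_coeff_same[of up j "?i + 1 \<in> ?K" ?c] True by (simp only: cnt_Suc)
    finally show ?thesis .
  next
    case False
    show ?thesis
    proof (cases "?i \<in> ?K")
      case iK: True
      then have nd: "\<not> il ?s < il w" and iK': "?i + 1 \<notin> ?K" using False K desc by auto
      have "twf (Suc j) (\<lambda>v. hfun n (srefl 0 \<circ> v)) w = ?E w * (qpow (- 1) * step_coeff up j ?c False)"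
        unfolding tf asc_E[OF nd] using nd iK' by (simp add: ac_simps del: o_apply)
      then show ?thesis using iK iK' by (simp only: cnt_Suc step_coeff_down if_True)
    next
      case iK: False
      then have iK': "?i + 1 \<in> ?K" using False by simp
      then have d: "il ?s < il w" using iK K desc by auto
      have "twf (Suc j) (\<lambda>v. hfun n (srefl 0 \<circ> v)) w
          = ?E w * (qpow 1 * step_coeff up j ?c True - zeta * step_coeff up j ?c False)"
        unfolding tf desc_E[OF d] using d iK iK' by (simp add: algebra_simps del: o_apply)
      then show ?thesis using iK iK' by (simp only: cnt_Suc step_coeff_up if_False)
    qed
  qed
  then show ?case by (simp add: add.commute del: o_apply)
qed

lemma twf_s0_hfun_other:
  assumes "w \<in> Dn l m" "m \<noteq> Suc n" "n = 0 \<or> m \<noteq> n - 1" "j < l"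
  shows "twf j (\<lambda>v. hfun n (srefl 0 \<circ> v)) w = 0"
  using assms(1,4)
proof (induction j arbitrary: w)
  case 0
  have "srefl 0 \<circ> w \<notin> Dn l n"
    using Dn_s0[OF 0(1)] assms(2,3) by (cases "1 \<in> negs l w") (auto simp: Dn_def)
  then show ?case by (simp add: hfun_def del: o_apply)
next
  case (Suc j)
  have "int (Suc j) \<in> Oplus l" using Suc.prems by (simp add: Oplus_iff)
  then have "srefl (int (Suc j)) \<circ> w \<in> Dn l m" by (rule Dn_left[OF Suc.prems(1)])
  then show ?case using Suc by (simp only: twf.simps tf_def Suc_lessD) simp
qed

lemma sum_over_signs:
  "(\<Sum>j<L. if int j + 1 \<in> negs l w then F (cnt w j) else (0::laurent)) = (\<Sum>r<cnt w L. F r)"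
proof (induction L)
  case (Suc L)
  then show ?case using cnt_Suc[of w L] by (simp add: add.commute)
qed simp

text \<open>Telescoping: each summand is the difference of the right hand sides at \<open>j + 1\<close> and
  \<open>j\<close>.\<close>

lemma sum_over_nonsigns:
  assumes "\<And>j. cnt w j \<le> j"
  shows "(\<Sum>j<L. qpow (- 2 * int j) * (1 - (if int j + 1 \<in> negs l w then qpow (2 * (int j - int (cnt w j))) else 0)))
    = qpow (int (L - cnt w L) + 1 - 2 * int L) * qint (int (L - cnt w L))"
proof (induction L)
  case (Suc L)
  let ?D = "L - cnt w L"
  have D: "int ?D = int L - int (cnt w L)" using assms[of L] by simp
  show ?case
  proof (cases "int L + 1 \<in> negs l w")
    case True
    then have DS: "Suc L - cnt w (Suc L) = ?D" using cnt_Suc[of w L] by (simp add: add.commute)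
    have "qpow (int ?D + 1 - 2 * int L) * qint (int ?D) + qpow (- 2 * int L) * (1 - qpow (2 * int ?D))
        = qpow (int ?D + 1 - 2 * int (Suc L)) * qint (int ?D)"
    proof (rule zeta_cancel)
      have "zeta * (qpow (int ?D + 1 - 2 * int L) * qint (int ?D) + qpow (- 2 * int L) * (1 - qpow (2 * int ?D)))
        = qpow (int ?D + 1 - 2 * int L) * (zeta * qint (int ?D))
          + zeta * (qpow (- 2 * int L) * (1 - qpow (2 * int ?D)))"
        by (simp only: distrib_left ac_simps)
      also have "\<dots> = qpow (int ?D + 1 - 2 * int (Suc L)) * (zeta * qint (int ?D))"
        unfolding zeta_mult_qint by (simp add: algebra_simps qpow_mult)
      finally show "zeta * (qpow (int ?D + 1 - 2 * int L) * qint (int ?D) + qpow (- 2 * int L) * (1 - qpow (2 * int ?D)))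
        = zeta * (qpow (int ?D + 1 - 2 * int (Suc L)) * qint (int ?D))"
        by (simp only: ac_simps)
    qed
    then show ?thesis using Suc True D by (simp only: sum.lessThan_Suc DS if_True)
  next
    case False
    then have DS: "Suc L - cnt w (Suc L) = Suc ?D" using cnt_Suc[of w L] assms[of L]
      by (simp add: add.commute Suc_diff_le)
    have "qint (int (Suc ?D)) = qpow 1 * qint (int ?D) + qpow (- int ?D)"
      using qint_add[of ?D 1] by (simp add: add.commute)
    then have "qpow (int (Suc ?D) + 1 - 2 * int (Suc L)) * qint (int (Suc ?D))
        = qpow (int ?D + 1 - 2 * int L) * qint (int ?D) + qpow (- 2 * int L)"
      by (simp add: distrib_left qpow_mult qpow_mult_left algebra_simps)
    then show ?thesis using Suc False by (simp only: sum.lessThan_Suc DS if_False) simp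
  qed
qed simp

lemma cnt_le: "cnt w j \<le> j"
  using card_mono[of "{1..int j}" "negs l w \<inter> {1..int j}"] by simp

lemma cnt_l: "cnt w l = card (negs l w)"
  using negs_subset[of l w] by (simp add: Int_absorb2)

lemma Dn_empty: "n > l \<Longrightarrow> w \<notin> Dn l n"
  using Dn_le[of w l n] by auto

text \<open>Summing the coefficients of the partial products over all steps gives a quantum
  integer that counts the signs of \<open>w\<close> in one class and its positive entries in the other.\<close>

lemma Afun_hfun:
  assumes n: "n \<le> l" and w: "w \<in> SP l"
  shows "Afun (\<lambda>v. hfun n (srefl 0 \<circ> v)) w = qint (int n + 1) * hfun (Suc n) w
    + (if n = 0 then 0 else qpow (int l + 1 - 2 * int n) * qint (int l - int n + 1) * hfun (n - 1) w)"
proof -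
  let ?X = "\<lambda>v. hfun n (srefl 0 \<circ> v)" and ?E = "qpow (int (il (wlong l n)) - int (il w))"
  define m where "m = card (negs l w)"
  have m: "w \<in> Dn l m" unfolding m_def by (rule SP_Dn[OF w])
  consider "m = Suc n" | "n > 0" "m = n - 1" | "m \<noteq> Suc n" "n = 0 \<or> m \<noteq> n - 1" by blast
  then show ?thesis
  proof cases
    case 1
    have "Afun ?X w = (\<Sum>j<l. ?E * (if int j + 1 \<in> negs l w then qpow (int l - 1 - 2 * int (cnt w j)) else 0))"
      unfolding Afun_def
    proof (rule sum.cong[OF refl])
      fix j assume "j \<in> {..<l}"
      then have "twf j ?X w = ?E * step_coeff True j (cnt w j) (int j + 1 \<in> negs l w)"
        using twf_s0_hfun[of w True n j] m 1 by simp
      then show "qpow (int l - 1 - int j) * twf j ?X w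
          = ?E * (if int j + 1 \<in> negs l w then qpow (int l - 1 - 2 * int (cnt w j)) else 0)"
        by (auto simp: step_coeff_def qpow_mult algebra_simps)
    qed
    also have "\<dots> = ?E * (\<Sum>r<Suc n. qpow (int l - 1 - 2 * int r))"
      using sum_over_signs[of w "\<lambda>c. qpow (int l - 1 - 2 * int c)" l] 1
      by (simp add: cnt_l m_def flip: sum_distrib_left)
    also have "(\<Sum>r<Suc n. qpow (int l - 1 - 2 * int r)) = qpow (int l - 1 - int n) * qint (int (Suc n))"
      unfolding qint_eq_sum sum_distrib_left by (rule sum.cong) (simp_all add: qpow_mult algebra_simps)
    also have "?E * (qpow (int l - 1 - int n) * qint (int (Suc n))) = qint (int n + 1) * hfun (Suc n) w"
    proof -
      have "n < l" using Dn_le[OF m] 1 by simp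
      then have e: "int (il (wlong l (Suc n))) - int (il w)
          = (int (il (wlong l n)) - int (il w)) + (int l - 1 - int n)"
        using il_wlong_Suc[of n] by simp
      have "hfun (Suc n) w = ?E * qpow (int l - 1 - int n)"
        unfolding qpow_mult e[symmetric] using m 1 by (simp add: hfun_def)
      then show ?thesis by (simp add: ac_simps)
    qed
    finally show ?thesis using hfun_other[OF m, of "n - 1"] 1 by (simp del: o_apply)
  next
    case 2
    have "Afun ?X w = (\<Sum>j<l. ?E * qpow (int l - 1) * (qpow (- 2 * int j)
        * (1 - (if int j + 1 \<in> negs l w then qpow (2 * (int j - int (cnt w j))) else 0))))"
      unfolding Afun_def
    proof (rule sum.cong[OF refl])
      fix j assume "j \<in> {..<l}"
      then have t: "twf j ?X w = ?E * step_coeff False j (cnt w j) (int j + 1 \<in> negs l w)"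
        using twf_s0_hfun[of w False n j] m 2 by simp
      have gen: "a * (e * (s * t)) = e * q * (r * t)" if "a * s = q * r" for a e s t q r :: laurent
      proof -
        have "a * (e * (s * t)) = (a * s) * (e * t)" by (simp only: ac_simps)
        also have "\<dots> = e * q * (r * t)" unfolding that by (simp only: ac_simps)
        finally show ?thesis .
      qed
      have "qpow (int l - 1 - int j) * qpow (- int j) = qpow (int l - 1) * qpow (- 2 * int j)"
        by (simp add: qpow_mult algebra_simps)
      then show "qpow (int l - 1 - int j) * twf j ?X w
          = ?E * qpow (int l - 1) * (qpow (- 2 * int j)
        * (1 - (if int j + 1 \<in> negs l w then qpow (2 * (int j - int (cnt w j))) else 0)))"
        unfolding t step_coeff_def if_False by (rule gen)
    qed
    also have "\<dots> = ?E * qpow (int l - 1) * (qpow (int (l - m) + 1 - 2 * int l) * qint (int (l - m)))"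
      using sum_over_nonsigns[of w l, OF cnt_le] by (simp only: cnt_l m_def flip: sum_distrib_left)
    also have "\<dots> = qpow (int l + 1 - 2 * int n) * qint (int l - int n + 1) * hfun (n - 1) w"
    proof -
      have lm: "int (l - m) = int l - int n + 1" using 2 n by simp
      have "int (il (wlong l n)) = int (il (wlong l (n - 1))) + (int l - int n)"
        using il_wlong_Suc[of "n - 1"] 2 n by simp
      then have "hfun (n - 1) w = ?E * qpow (int n - int l)"
        using m 2 by (simp add: hfun_def qpow_mult algebra_simps)
      then show ?thesis unfolding lm by (simp add: qpow_mult qpow_mult_left algebra_simps)
    qed
    finally show ?thesis using hfun_other[OF m, of "Suc n"] 2 by (simp del: o_apply)
  next
    case 3
    have "Afun ?X w = 0"
      unfolding Afun_def by (rule sum.neutral) (use twf_s0_hfun_other[OF m 3] in auto)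
    then show ?thesis
      using 3 hfun_other[OF m, of "Suc n"] hfun_other[OF m, of "n - 1"] by (auto simp del: o_apply)
  qed
qed

lemma a_elt_hst:
  assumes n: "n \<le> l"
  shows "odd n \<Longrightarrow> hmult l a_elt (hst n) = qint (int n + 1) \<cdot> hst (Suc n)
      + (qpow (int l + 1 - 2 * int n) * qint (int l - int n + 1)) \<cdot> hst (n - 1)"
    and "even n \<Longrightarrow> hmult l (hgamma l a_elt) (hst n) = qint (int n + 1) \<cdot> hst (Suc n)
      + (if n = 0 then 0 else (qpow (int l + 1 - 2 * int n) * qint (int l - int n + 1)) \<cdot> hst (n - 1))"
proof -
  assume od: "odd n"
  show "hmult l a_elt (hst n) = qint (int n + 1) \<cdot> hst (Suc n)
      + (qpow (int l + 1 - 2 * int n) * qint (int l - int n + 1)) \<cdot> hst (n - 1)"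
  proof (rule Hecke_eqI)
    fix w assume "w \<in> Weyl l"
    then have w: "w \<in> SP l" by (rule Weyl_SP)
    have "lk (hst n) = (\<lambda>v. hfun n (srefl 0 \<circ> v))"
      using od by (simp add: fun_eq_iff lookup_hst shift_def)
    then have "lk (hmult l a_elt (hst n)) w = Afun (\<lambda>v. hfun n (srefl 0 \<circ> v)) w"
      by (simp only: lookup_a_elt[OF hst_Hecke])
    moreover have "n \<noteq> 0" "lk (hst (Suc n)) w = hfun (Suc n) w" "lk (hst (n - 1)) w = hfun (n - 1) w"
      using od by (auto simp: lookup_hst shift_def elim: oddE)
    ultimately show "lk (hmult l a_elt (hst n)) w = lk (qint (int n + 1) \<cdot> hst (Suc n)
      + (qpow (int l + 1 - 2 * int n) * qint (int l - int n + 1)) \<cdot> hst (n - 1)) w"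
      by (simp add: Afun_hfun[OF n w] lookup_add lookup_smul)
  qed (simp_all add: hmult_Hecke a_elt_Hecke hst_Hecke Hecke_add Hecke_smul)
next
  assume ev: "even n"
  show "hmult l (hgamma l a_elt) (hst n) = qint (int n + 1) \<cdot> hst (Suc n)
      + (if n = 0 then 0 else (qpow (int l + 1 - 2 * int n) * qint (int l - int n + 1)) \<cdot> hst (n - 1))"
  proof (rule Hecke_eqI)
    fix w assume "w \<in> Weyl l"
    then have w: "w \<in> SP l" "srefl 0 \<circ> w \<in> SP l" by (simp_all add: Weyl_SP SP_comp srefl_0_SP)
    have "lk (hst n) v = hfun n v" for v using ev by (simp add: lookup_hst shift_def)
    then have "lk (hmult l (hgamma l a_elt) (hst n)) w
        = Afun (\<lambda>v. hfun n (srefl 0 \<circ> v)) (srefl 0 \<circ> w)"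
      by (simp only: lookup_gamma_a_elt[OF hst_Hecke w(1)])
    moreover have "lk (hst (Suc n)) w = hfun (Suc n) (srefl 0 \<circ> w)"
      "n \<noteq> 0 \<Longrightarrow> lk (hst (n - 1)) w = hfun (n - 1) (srefl 0 \<circ> w)"
      using ev by (auto simp: lookup_hst shift_def simp del: o_apply)
    ultimately show "lk (hmult l (hgamma l a_elt) (hst n)) w = lk (qint (int n + 1) \<cdot> hst (Suc n)
      + (if n = 0 then 0 else (qpow (int l + 1 - 2 * int n) * qint (int l - int n + 1)) \<cdot> hst (n - 1))) w"
      by (simp only: Afun_hfun[OF n w(2)]) (simp add: lookup_add lookup_smul del: o_apply)
  qed (simp_all add: hmult_Hecke a_elt_Hecke hgamma_Hecke hst_Hecke Hecke_add Hecke_smul)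
qed

lemma hst_1: "hst 1 = hmult l (hgamma l a_elt) (hst 0)"
  using a_elt_hst(2)[of 0] by simp

subsection \<open>Norms of the standard elements\<close>

lemma pairing_commute: "pairing X Y = pairing Y X"
  by (simp add: pairing_def mult.commute)

lemma pairing_cong: "(\<And>w. w \<in> SP l \<Longrightarrow> X w = X' w) \<Longrightarrow> (\<And>w. w \<in> SP l \<Longrightarrow> Y w = Y' w)
    \<Longrightarrow> pairing X Y = pairing X' Y'"
  by (simp add: pairing_def)

lemma pairing_linear: "pairing (\<lambda>w. a * X w + b * Y w) Z = a * pairing X Z + b * pairing Y Z"
  by (simp add: pairing_def sum_distrib_left distrib_right sum.distrib mult.assoc)

lemma pairing_hfun_neq: "m \<noteq> n \<Longrightarrow> pairing (hfun m) (hfun n) = 0"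
  unfolding pairing_def by (rule sum.neutral) (auto simp: hfun_def Dn_def)

lemma pairing_s0: "pairing (\<lambda>v. X (srefl 0 \<circ> v)) Y = pairing X (\<lambda>v. Y (srefl 0 \<circ> v))"
  using pairing_reindex[of 0 "\<lambda>w. X w * Y (srefl 0 \<circ> w)"]
  by (simp add: pairing_def s0_s0 del: o_apply)

lemma pairing_twf: "j < l \<Longrightarrow> pairing (twf j X) (hfun n) = qpow (- int j) * pairing X (hfun n)"
proof (induction j)
  case (Suc j)
  have i: "int (Suc j) \<in> Oplus l" using Suc.prems by (simp add: Oplus_iff)
  have "pairing (twf (Suc j) X) (hfun n) = pairing (twf j X) (tf (int (Suc j)) (hfun n))"
    by (simp only: twf.simps pairing_tf[OF Oplus_N[OF i]])
  also have "\<dots> = pairing (twf j X) (\<lambda>w. qpow (- 1) * hfun n w)"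
    by (intro pairing_cong refl tf_eigen[where X = "hfun n"] Oplus_N i hfun_left)
  also have "\<dots> = qpow (- 1) * pairing (twf j X) (hfun n)"
    by (simp add: pairing_def sum_distrib_left ac_simps)
  also have "\<dots> = qpow (- int (Suc j)) * pairing X (hfun n)"
    using Suc by (simp add: qpow_mult_left)
  finally show ?case .
qed simp

text \<open>The generators are self-adjoint and multiply \<open>hfun n\<close> by \<open>q\<^sup>-\<^sup>1\<close>, so the sum over the
  coset representatives acts on this side by the scalar \<open>[l]\<close>.\<close>

lemma pairing_Afun: "pairing (Afun X) (hfun n) = qint (int l) * pairing X (hfun n)"
proof -
  have "pairing (Afun X) (hfun n) = (\<Sum>j<l. qpow (int l - 1 - int j) * pairing (twf j X) (hfun n))"
    unfolding pairing_def Afun_def sum_distrib_right sum_distrib_left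
    by (subst sum.swap) (simp add: mult.assoc)
  also have "\<dots> = (\<Sum>j<l. qpow (int l - 1 - 2 * int j) * pairing X (hfun n))"
    by (rule sum.cong) (simp_all add: pairing_twf qpow_mult_left)
  finally show ?thesis by (simp add: qint_eq_sum sum_distrib_right)
qed

text \<open>Both sides compute \<open>[l]\<close> times the pairing of \<open>h\<^bsub>n+1\<^esub>\<close> with the translate of \<open>h\<^sub>n\<close> by
  \<open>srefl 0\<close>, which may be put on either argument.\<close>

lemma norm_rec:
  assumes n: "n < l"
  shows "qint (int n + 1) * pairing (hfun (Suc n)) (hfun (Suc n))
    = qpow (int l - 1 - 2 * int n) * qint (int l - int n) * pairing (hfun n) (hfun n)"
proof -
  let ?s = "\<lambda>n v. hfun n (srefl 0 \<circ> v)"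
  have A: "pairing (Afun (?s k)) (hfun m) = qint (int k + 1) * pairing (hfun (Suc k)) (hfun m)
      + (if k = 0 then 0 else qpow (int l + 1 - 2 * int k) * qint (int l - int k + 1))
        * pairing (hfun (k - 1)) (hfun m)" if "k \<le> l" for k m
    unfolding pairing_linear[symmetric]
    by (rule pairing_cong) (simp_all add: Afun_hfun[OF that])
  have "qint (int n + 1) * pairing (hfun (Suc n)) (hfun (Suc n)) = pairing (Afun (?s n)) (hfun (Suc n))"
    using A[of n "Suc n"] n pairing_hfun_neq[of "n - 1" "Suc n"] by simp
  also have "\<dots> = qint (int l) * pairing (?s n) (hfun (Suc n))" by (rule pairing_Afun)
  also have "pairing (?s n) (hfun (Suc n)) = pairing (?s (Suc n)) (hfun n)"
    by (subst pairing_s0) (rule pairing_commute)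
  also have "qint (int l) * pairing (?s (Suc n)) (hfun n) = pairing (Afun (?s (Suc n))) (hfun n)"
    by (rule pairing_Afun[symmetric])
  also have "\<dots> = qpow (int l - 1 - 2 * int n) * qint (int l - int n) * pairing (hfun n) (hfun n)"
    using A[of "Suc n" n] n pairing_hfun_neq[of "Suc (Suc n)" n] by (simp add: algebra_simps)
  finally show ?thesis .
qed

lemma norm_hfun:
  assumes "n \<le> l"
  shows "pairing (hfun n) (hfun n)
    = poinc_plus l (Opm p) * (qpow (int n * (int l - int n)) * qbinom l n)"
  using assms
proof (induction n)
  case 0
  have "pairing (hfun 0) (hfun 0) = (\<Sum>w\<in>Dn l 0. hfun 0 w * hfun 0 w)"
    unfolding pairing_def
    by (rule sum.mono_neutral_right) (auto simp: finite_SP Dn_SP hfun_def)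
  also have "\<dots> = qpow (int (il (wlong l 0))) * sigma"
    unfolding sigma_def sum_distrib_left
    by (rule sum.cong) (simp_all add: hfun_def qpow_mult algebra_simps)
  finally show ?case by (simp add: poinc_plus_sigma qbinom_0)
next
  case (Suc n)
  let ?P = "poinc_plus l (Opm p)"
  have n: "n < l" using Suc.prems by simp
  have "qint (int n + 1) * pairing (hfun (Suc n)) (hfun (Suc n))
      = qpow (int l - 1 - 2 * int n) * qint (int l - int n)
        * (?P * (qpow (int n * (int l - int n)) * qbinom l n))"
    using norm_rec[OF n] Suc by simp
  also have "\<dots> = ?P * (qpow (int l - 1 - 2 * int n) * qpow (int n * (int l - int n)))
      * (qint (int l - int n) * qbinom l n)"
    by (simp only: ac_simps)
  also have "\<dots> = ?P * qpow (int (Suc n) * (int l - int (Suc n))) * (qint (int n + 1) * qbinom l (Suc n))"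
    unfolding qbinom_Suc[OF n] by (simp add: qpow_mult algebra_simps)
  finally have "qint (int n + 1) * pairing (hfun (Suc n)) (hfun (Suc n))
    = qint (int n + 1) * (?P * (qpow (int (Suc n) * (int l - int (Suc n))) * qbinom l (Suc n)))"
    by (simp only: ac_simps)
  then show ?case using qint_neq_0[of "int n + 1"] by simp
qed

end

section \<open>The algebra \<open>V\<close> and the isomorphism\<close>

text \<open>The parity index of the second component is to stay in the form \<open>1\<close> in which it occurs
  in the lemmas.\<close>

declare One_nat_def [simp del]

context type_D
begin

lemma Opm_simps: "Opm 0 = Oplus l" "Opm 1 = Ominus l"
  by (simp_all add: Opm_def)

lemma Valg_iff: "X \<in> Valg l \<longleftrightarrow> biinv 0 (fst X) \<and> biinv 1 (snd X)"
  using Schur_iff[of _ 0] Schur_iff[of _ 1] by (cases X) (simp add: Valg_def Opm_simps)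

lemma dperm_1: "shift 1 (dperm 1) = id"
  by (auto simp: shift_def dperm_def srefl_0 fun_eq_iff)

lemma hstd_eq:
  assumes n: "n \<le> l"
  shows "hstd l (if even n then Oplus l else Ominus l) (shift n (dperm n)) (Oplus l) = hst n"
proof -
  have inj: "inj_on (shift n) (Dn l n)" by (rule inj_onI) (simp add: shift_inj)
  have W: "shift n w \<in> Weyl l" if "w \<in> Dn l n" for w by (rule shift_Dn_Weyl[OF that]) simp
  have len: "len l (shift n w) = il w" if "w \<in> Dn l n" for w
    using len_eq[OF W[OF that]] il_shift[OF Dn_SP[OF that]] by simp
  show ?thesis
    unfolding hstd_def Let_def double_coset_shift[OF n] longest_shift[OF n] hst_def
      sum.reindex[OF inj] o_apply
    by (rule sum.cong) (simp_all add: len wlong_Dn[OF n])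
qed

lemma bcan_eq:
  assumes n: "n \<le> l"
  shows "bcan l (if even n then Oplus l else Ominus l) (shift n (dperm n)) (Oplus l)
    = klb l (shift n (wlong l n))"
  unfolding bcan_def double_coset_shift[OF n] longest_shift[OF n] ..

lemma Valg_std_eq: "n \<le> l \<Longrightarrow> Valg_std l n = (if even n then (hst n, 0) else (0, hst n))"
  using hstd_eq[of n] by (simp add: Valg_std_def shift_def split: if_splits)

lemma Valg_can_eq: "n \<le> l \<Longrightarrow> Valg_can l n
    = (if even n then (klb l (shift n (wlong l n)), 0) else (0, klb l (shift n (wlong l n))))"
  using bcan_eq[of n] by (simp add: Valg_can_def shift_def split: if_splits)

lemma Valg_b_eq: "Valg_b l = (0, hst 1)"
  using bcan_eq[of 1] klb_eqI[OF KL_cond_hst_minimal[of 1]] l_ge_2 dperm_1 by (simp add: Valg_b_def)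

subsection \<open>Algebra structure\<close>

lemma smult_at_add:
  assumes "inner_inv p x" "inner_inv p x'" "left_inv p y"
  shows "smult_at l (Opm p) (x + x') y = smult_at l (Opm p) x y + smult_at l (Opm p) x' y"
  by (rule smult_at_eqI)
    (simp add: hmult_add_left smult_at_ok(2)[OF assms(1,3)] smult_at_ok(2)[OF assms(2,3)] smul_add_right)

lemma smult_at_smul:
  assumes "inner_inv p x" "left_inv p y"
  shows "smult_at l (Opm p) (c \<cdot> x) y = c \<cdot> smult_at l (Opm p) x y"
  by (rule smult_at_eqI) (simp add: hmult_smul_left smult_at_ok(2)[OF assms] mult.commute)

lemma smult_at_zero: "smult_at l (Opm p) 0 y = 0"
  by (rule smult_at_eqI) simp

lemma smult_at_eI: "left_inv p y \<Longrightarrow> smult_at l (Opm p) (eI p) y = y"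
  by (rule smult_at_eqI) (rule eI_mult)

lemma smult_at_hmult:
  assumes a: "a \<in> Hecke l" and x: "inner_inv p x" and y: "left_inv p y"
  shows "smult_at l (Opm p) (hmult l a x) y = hmult l a (smult_at l (Opm p) x y)"
proof (rule smult_at_eqI)
  have H: "x \<in> Hecke l" "y \<in> Hecke l" using x y by (simp_all add: inner_inv_def left_inv_Hecke)
  show "hmult l (hmult l a x) y = sigma \<cdot> hmult l a (smult_at l (Opm p) x y)"
    using smult_at_ok[OF x y] by (simp add: hmult_assoc a H hmult_smul_right)
qed

lemma biinv_D: "biinv p x \<Longrightarrow> left_inv p x" "biinv p x \<Longrightarrow> right_inv x"
  by (simp_all add: biinv_def)

lemma Valg_mult_eq: "Valg_mult l X U =
   (smult_at l (Opm 0) (fst X) (fst U) + smult_at l (Opm 1) (hgamma l (snd X)) (snd U),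
    smult_at l (Opm 0) (snd X) (fst U) + smult_at l (Opm 1) (hgamma l (fst X)) (snd U))"
  by (simp add: Valg_mult_def Opm_simps split: prod.split)

context
  fixes X assumes X: "X \<in> Valg l"
begin

lemma Valg_inner: "inner_inv 0 (fst X)" "inner_inv 0 (snd X)"
    "inner_inv 1 (hgamma l (fst X))" "inner_inv 1 (hgamma l (snd X))"
  using X by (simp_all add: Valg_iff biinv_def right_inv_inner right_inv_hgamma_inner)

lemma Valg_left: "left_inv 0 (fst X)" "left_inv 1 (snd X)"
  using X by (simp_all add: Valg_iff biinv_def)

lemma Valg_right: "right_inv (fst X)" "right_inv (snd X)"
  using X by (simp_all add: Valg_iff biinv_def)

lemma Valg_gamma_left: "left_inv 1 (hgamma l (fst X))" "left_inv 0 (hgamma l (snd X))"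
  using left_inv_hgamma[OF Valg_left(1)] left_inv_hgamma[OF Valg_left(2)]
    left_inv_parity[of "Suc 1" 0] by (simp_all add: One_nat_def)

lemma Valg_Hecke: "fst X \<in> Hecke l" "snd X \<in> Hecke l"
  using Valg_left by (simp_all add: left_inv_Hecke)

end

lemma Valg_add: "X \<in> Valg l \<Longrightarrow> Y \<in> Valg l \<Longrightarrow> X + Y \<in> Valg l"
  and Valg_smul_closed: "X \<in> Valg l \<Longrightarrow> Valg_smul c X \<in> Valg l"
  by (simp_all add: Valg_iff biinv_add biinv_smul Valg_smul_def)

lemma Valg_mult_closed:
  assumes X: "X \<in> Valg l" and U: "U \<in> Valg l"
  shows "Valg_mult l X U \<in> Valg l"
  unfolding Valg_mult_eq Valg_iff fst_conv snd_conv
  by (intro conjI biinv_add smult_at_biinv Valg_inner[OF X] Valg_left[OF X] Valg_gamma_left[OF X]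
      Valg_left[OF U] Valg_right[OF U])

lemma Valg_mult_add_left:
  assumes "X \<in> Valg l" "X' \<in> Valg l" "U \<in> Valg l"
  shows "Valg_mult l (X + X') U = Valg_mult l X U + Valg_mult l X' U"
  by (simp add: Valg_mult_eq hgamma_add smult_at_add Valg_inner Valg_left assms)

lemma Valg_mult_smul_left:
  assumes "X \<in> Valg l" "U \<in> Valg l"
  shows "Valg_mult l (Valg_smul c X) U = Valg_smul c (Valg_mult l X U)"
  by (simp add: Valg_mult_eq Valg_smul_def hgamma_smul smult_at_smul Valg_inner Valg_left assms
      smul_add_right)

lemma Valg_one: "(klb l (wmax l (Oplus l)), 0) = (hst 0, 0)"
  using klb_wmax[of 0] by (simp add: Opm_def eI_def)

lemma Valg_mult_one: "U \<in> Valg l \<Longrightarrow> Valg_mult l (hst 0, 0) U = U"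
  using smult_at_eI[of 0 "fst U"] smult_at_eI[of 1 "snd U"] Valg_left[of U]
  by (simp add: Valg_mult_eq smult_at_zero eI_def)

text \<open>As \<open>b\<close> is the product of the graph conjugate of \<open>a_elt\<close> with the unit of the inner
  parabolic, the division by \<open>sigma\<close> removes the latter.\<close>

lemma Valg_b_mult:
  assumes U: "U \<in> Valg l"
  shows "Valg_mult l (Valg_b l) U = (hmult l a_elt (snd U), hmult l (hgamma l a_elt) (fst U))"
proof -
  have g: "hgamma l (hst 1) = hmult l a_elt (eI 1)"
    by (simp add: hst_1 hgamma_hmult hgamma_Hecke a_elt_Hecke hst_Hecke hgamma_hgamma eI_def)
  have e: "inner_inv p (eI p)" for p
    by (simp add: inner_inv_def eI_Hecke eI_mult left_inv_eI)
  have "smult_at l (Opm 1) (hgamma l (hst 1)) (snd U) = hmult l a_elt (snd U)"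
    unfolding g using smult_at_hmult[OF a_elt_Hecke e Valg_left(2)[OF U]]
      smult_at_eI[OF Valg_left(2)[OF U]] by simp
  moreover have "smult_at l (Opm 0) (hst 1) (fst U) = hmult l (hgamma l a_elt) (fst U)"
    using smult_at_hmult[OF hgamma_Hecke[OF a_elt_Hecke] e Valg_left(1)[OF U]]
      smult_at_eI[OF Valg_left(1)[OF U]] by (simp add: hst_1 eI_def)
  ultimately show ?thesis
    using smult_at_zero[of 0] smult_at_zero[of 1] by (simp add: Valg_mult_eq Valg_b_eq)
qed

lemma Valg_b_closed: "Valg_b l \<in> Valg l"
  using hst_biinv[of 1 1] by (simp add: Valg_iff Valg_b_eq biinv_zero)

text \<open>Multiplication by \<open>b\<close> is left multiplication in the Hecke algebra.\<close>

lemma Valg_b_mult_assoc: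
  assumes X: "X \<in> Valg l" and U: "U \<in> Valg l"
  shows "Valg_mult l (Valg_mult l (Valg_b l) X) U = Valg_mult l (Valg_b l) (Valg_mult l X U)"
proof -
  let ?g = "hgamma l a_elt"
  have gH: "?g \<in> Hecke l" by (rule hgamma_Hecke[OF a_elt_Hecke])
  have "hgamma l (hmult l ?g (fst X)) = hmult l a_elt (hgamma l (fst X))"
    "hgamma l (hmult l a_elt (snd X)) = hmult l ?g (hgamma l (snd X))"
    by (simp_all add: hgamma_hmult gH a_elt_Hecke Valg_Hecke[OF X] hgamma_hgamma)
  moreover have "hmult l a (smult_at l (Opm 0) x (fst U) + smult_at l (Opm 1) y (snd U))
      = hmult l a (smult_at l (Opm 0) x (fst U)) + hmult l a (smult_at l (Opm 1) y (snd U))"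
    if "a \<in> Hecke l" "inner_inv 0 x" "inner_inv 1 y" for a x y
    using smult_at_ok(1)[OF that(2) Valg_left(1)[OF U]] smult_at_ok(1)[OF that(3) Valg_left(2)[OF U]]
    by (rule hmult_add_right[OF that(1)])
  ultimately show ?thesis
    unfolding Valg_b_mult[OF X] Valg_b_mult[OF Valg_mult_closed[OF X U]]
    unfolding Valg_mult_eq fst_conv snd_conv
    by (simp add: smult_at_hmult gH a_elt_Hecke Valg_inner[OF X] Valg_left[OF U])
qed

text \<open>The bar involution of \<open>V\<close> commutes with multiplication by \<open>b\<close>, because the
  Kazhdan--Lusztig element \<open>b\<close> and the factor \<open>sigma\<close> are bar-invariant.\<close>

lemma hbar_a_elt:
  assumes v: "left_inv 1 v" and v': "left_inv 1 (hbar l v)"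
  shows "hbar l (hmult l a_elt v) = hmult l a_elt (hbar l v)"
proof (rule smul_cancel[OF _ sigma_neq_0])
  have g: "hgamma l (hst 1) = hmult l a_elt (eI 1)"
    by (simp add: hst_1 hgamma_hmult hgamma_Hecke a_elt_Hecke hst_Hecke hgamma_hgamma eI_def)
  have *: "hmult l (hgamma l (hst 1)) w = sigma \<cdot> hmult l a_elt w" if "left_inv 1 w" for w
    using that left_inv_Hecke[OF that]
    by (simp add: g hmult_assoc a_elt_Hecke eI_Hecke eI_mult hmult_smul_right)
  have "hbar l (hgamma l (hst 1)) = hgamma l (hst 1)"
    using hgamma_hbar[OF hst_Hecke, of 1] hbar_hst_minimal[of 1] by simp
  then have "hbar l (hmult l (hgamma l (hst 1)) v) = hmult l (hgamma l (hst 1)) (hbar l v)"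
    by (simp add: hbar_hmult hgamma_Hecke hst_Hecke left_inv_Hecke[OF v])
  then show "sigma \<cdot> hbar l (hmult l a_elt v) = sigma \<cdot> hmult l a_elt (hbar l v)"
    unfolding *[OF v] *[OF v'] by (simp add: hbar_smul qbar_sigma)
qed

lemma hbar_gamma_a_elt:
  assumes v: "left_inv 0 v" and v': "left_inv 0 (hbar l v)"
  shows "hbar l (hmult l (hgamma l a_elt) v) = hmult l (hgamma l a_elt) (hbar l v)"
proof (rule smul_cancel[OF _ sigma_neq_0])
  have gH: "hgamma l a_elt \<in> Hecke l" by (rule hgamma_Hecke[OF a_elt_Hecke])
  have *: "hmult l (hst 1) w = sigma \<cdot> hmult l (hgamma l a_elt) w" if "left_inv 0 w" for w
    using that left_inv_Hecke[OF that]
    by (simp add: hst_1 hmult_assoc gH hst_Hecke hst_0_mult hmult_smul_right)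
  have "hbar l (hmult l (hst 1) v) = hmult l (hst 1) (hbar l v)"
    using hbar_hst_minimal[of 1] by (simp add: hbar_hmult hst_Hecke left_inv_Hecke[OF v])
  then show "sigma \<cdot> hbar l (hmult l (hgamma l a_elt) v) = sigma \<cdot> hmult l (hgamma l a_elt) (hbar l v)"
    unfolding *[OF v] *[OF v'] by (simp add: hbar_smul qbar_sigma)
qed

subsection \<open>The antilinear comparison map\<close>

text \<open>The component of parity \<open>p\<close> of the map \<open>psi\<close> below.\<close>

definition ps :: "nat \<Rightarrow> (nat \<Rightarrow>\<^sub>0 laurent) \<Rightarrow> hecke" where
  "ps p u = (\<Sum>n | n \<le> l \<and> even (n + p). qbar (lk u n) \<cdot> hst n)"

definition psi :: "(nat \<Rightarrow>\<^sub>0 laurent) \<Rightarrow> hecke \<times> hecke" where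
  "psi u = (ps 0 u, ps 1 u)"

lemma ps_add: "ps p (u + v) = ps p u + ps p v"
  by (simp add: ps_def lookup_add qbar_add smul_add_left sum.distrib)

lemma ps_smul: "ps p (c \<cdot> u) = qbar c \<cdot> ps p u"
  by (simp add: ps_def lookup_smul qbar_mult smul_sum_right)

lemma ps_zero [simp]: "ps p 0 = 0"
  by (simp add: ps_def)

lemma ps_sum: "ps p (sum f A) = (\<Sum>a\<in>A. ps p (f a))"
  by (induction A rule: infinite_finite_induct) (simp_all add: ps_add)

lemma hst_beyond: "n > l \<Longrightarrow> hst n = 0"
proof -
  assume "n > l"
  then have "Dn l n = {}" using Dn_empty by blast
  then show ?thesis by (simp add: hst_def)
qed

lemma ps_feta: "ps p (feta l (int k)) = (if even (k + p) then hst k else 0)"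
proof -
  have "ps p (feta l (int k)) = (\<Sum>n | n \<le> l \<and> even (n + p). if n = k then hst k else 0)"
    unfolding ps_def by (rule sum.cong) (auto simp: lookup_feta)
  then show ?thesis by (cases "k \<le> l") (simp_all add: hst_beyond)
qed

lemma ps_biinv: "biinv p (ps p u)"
  unfolding ps_def by (intro biinv_sum biinv_smul hst_biinv) simp

lemma psi_Valg: "psi u \<in> Valg l"
  using ps_biinv[of 0] ps_biinv[of 1] by (simp add: Valg_iff psi_def)

lemma hmult_sum_right: "a \<in> Hecke l \<Longrightarrow> finite A \<Longrightarrow> (\<And>i. i \<in> A \<Longrightarrow> f i \<in> Hecke l)
    \<Longrightarrow> hmult l a (sum f A) = (\<Sum>i\<in>A. hmult l a (f i))"
proof (induction A rule: infinite_finite_induct)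
  case (insert i A)
  moreover have "sum f A \<in> Hecke l" using insert by (intro Hecke_sum) auto
  ultimately show ?case by (simp add: hmult_add_right)
qed simp_all

lemma ps_bop_feta:
  assumes n: "n \<le> l"
  shows "ps p (bop l (feta l (int n))) = (if even (n + p) then 0 else
    qint (int n + 1) \<cdot> hst (Suc n)
      + (if n = 0 then 0 else (qpow (int l + 1 - 2 * int n) * qint (int l - int n + 1)) \<cdot> hst (n - 1)))"
proof -
  have 1: "ps p (feta l (int n + 1)) = (if even (n + p) then 0 else hst (Suc n))"
    using ps_feta[of p "Suc n"] by (simp add: add.commute)
  have 2: "ps p (feta l (int n - 1)) = (if n = 0 \<or> even (n + p) then 0 else hst (n - 1))"
  proof (cases n)
    case (Suc m)
    then show ?thesis using ps_feta[of p m] by simp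
  qed (simp add: feta_def)
  have q: "qbar (qint (int n + 1)) = qint (int n + 1)" "qbar (qint (int l - int n + 1)) = qint (int l - int n + 1)"
    using n by simp_all
  show ?thesis
    unfolding bop_feta[OF n] ps_add ps_smul 1 2 qbar_mult q qbar_qpow
    by (auto simp: algebra_simps)
qed

lemma ps_bop:
  assumes u: "u \<in> Vmod l"
  shows "ps 0 (bop l u) = hmult l a_elt (ps 1 u)"
    and "ps 1 (bop l u) = hmult l (hgamma l a_elt) (ps 0 u)"
proof -
  have gH: "hgamma l a_elt \<in> Hecke l" by (rule hgamma_Hecke[OF a_elt_Hecke])
  have b: "ps p (bop l u) = (\<Sum>n\<le>l. qbar (lk u n) \<cdot> ps p (bop l (feta l (int n))))" for p
    by (subst Vmod_expand[OF u]) (simp add: bop_sum bop_smul ps_sum ps_smul)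
  have c: "ps p u = (\<Sum>n\<le>l. qbar (lk u n) \<cdot> ps p (feta l (int n)))" for p
    by (subst Vmod_expand[OF u]) (simp add: ps_sum ps_smul)
  have H: "ps p v \<in> Hecke l" for p v by (rule biinv_Hecke[OF ps_biinv])
  have "hmult l a_elt (ps 1 u) = (\<Sum>n\<le>l. qbar (lk u n) \<cdot> hmult l a_elt (ps 1 (feta l (int n))))"
    unfolding c[of 1] by (simp add: hmult_sum_right hmult_smul_right a_elt_Hecke Hecke_smul H)
  also have "\<dots> = ps 0 (bop l u)"
    unfolding b
  proof (rule sum.cong[OF refl])
    fix n assume "n \<in> {..l}"
    then have n: "n \<le> l" by simp
    show "qbar (lk u n) \<cdot> hmult l a_elt (ps 1 (feta l (int n))) = qbar (lk u n) \<cdot> ps 0 (bop l (feta l (int n)))"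
      unfolding ps_feta ps_bop_feta[OF n] using a_elt_hst(1)[OF n] a_elt_Hecke by (cases n) auto
  qed
  finally show "ps 0 (bop l u) = hmult l a_elt (ps 1 u)" ..
  have "hmult l (hgamma l a_elt) (ps 0 u)
      = (\<Sum>n\<le>l. qbar (lk u n) \<cdot> hmult l (hgamma l a_elt) (ps 0 (feta l (int n))))"
    unfolding c[of 0] by (simp add: hmult_sum_right hmult_smul_right gH Hecke_smul H)
  also have "\<dots> = ps 1 (bop l u)"
    unfolding b
  proof (rule sum.cong[OF refl])
    fix n assume "n \<in> {..l}"
    then have n: "n \<le> l" by simp
    show "qbar (lk u n) \<cdot> hmult l (hgamma l a_elt) (ps 0 (feta l (int n)))
        = qbar (lk u n) \<cdot> ps 1 (bop l (feta l (int n)))"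
      unfolding ps_feta ps_bop_feta[OF n] using a_elt_hst(2)[OF n] gH by auto
  qed
  finally show "ps 1 (bop l u) = hmult l (hgamma l a_elt) (ps 0 u)" ..
qed

lemma psi_bop: "u \<in> Vmod l \<Longrightarrow> psi (bop l u) = Valg_mult l (Valg_b l) (psi u)"
  by (simp add: Valg_b_mult[OF psi_Valg]) (simp add: psi_def ps_bop)

lemma lookup_ps:
  assumes "n \<le> l" "even (n + p)"
  shows "lk (ps p u) (shift p (wlong l n)) = qbar (lk u n)"
proof -
  have "lk (ps p u) (shift p (wlong l n)) = (\<Sum>m | m \<le> l \<and> even (m + p). if m = n then qbar (lk u n) else 0)"
    unfolding ps_def lookup_sum
  proof (rule sum.cong[OF refl])
    fix m assume "m \<in> {m. m \<le> l \<and> even (m + p)}"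
    then have "shift m (shift p (wlong l n)) = wlong l n" using shift_parity[of m p] by simp
    then show "lk (qbar (lk u m) \<cdot> hst m) (shift p (wlong l n)) = (if m = n then qbar (lk u n) else 0)"
      using hfun_other[OF wlong_Dn[OF assms(1)], of m] hfun_wlong[OF assms(1)]
      by (simp add: lookup_smul lookup_hst)
  qed
  then show ?thesis using assms by simp
qed

lemma psi_inj:
  assumes u: "u \<in> Vmod l" and v: "v \<in> Vmod l" and eq: "psi u = psi v"
  shows "u = v"
proof (rule poly_mapping_eqI)
  fix n
  show "lk u n = lk v n"
  proof (cases "n \<le> l")
    case True
    have p: "ps 0 u = ps 0 v" "ps 1 u = ps 1 v" using eq by (simp_all add: psi_def)
    have "qbar (lk u n) = qbar (lk v n)"
    proof (cases "even n")
      case ev: True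
      then show ?thesis using lookup_ps[OF True, of 0 u] lookup_ps[OF True, of 0 v] p(1) by simp
    next
      case False
      then show ?thesis using lookup_ps[OF True, of 1 u] lookup_ps[OF True, of 1 v] p(2) by simp
    qed
    then show ?thesis by (metis qbar_qbar)
  qed (use u v in \<open>simp add: Vmod_lookup\<close>)
qed

text \<open>The preimage is read off from the coefficients at the longest elements of the classes.\<close>

lemma psi_surj:
  assumes X: "X \<in> Valg l"
  shows "\<exists>u\<in>Vmod l. psi u = X"
proof -
  define c where "c n = qbar (lk (if even n then fst X else snd X) (shift n (wlong l n)))" for n
  define u where "u = (\<Sum>n\<le>l. c n \<cdot> feta l (int n))"
  have uV: "u \<in> Vmod l" unfolding u_def by (intro Vmod_sum Vmod_smul feta_Vmod)
  have lku: "lk u n = c n" if "n \<le> l" for n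
  proof -
    have "lk u n = (\<Sum>m\<le>l. if m = n then c n else 0)"
      unfolding u_def lookup_sum by (rule sum.cong) (auto simp: lookup_smul lookup_feta)
    then show ?thesis using that by simp
  qed
  have "ps p u = x" if x: "biinv p x" "\<And>n. even (n + p) \<Longrightarrow> x = (if even n then fst X else snd X)" for p x
  proof -
    have "ps p u = (\<Sum>n | n \<le> l \<and> even (n + p). lk x (shift p (wlong l n)) \<cdot> hst n)"
      unfolding ps_def
    proof (rule sum.cong[OF refl])
      fix n assume n: "n \<in> {n. n \<le> l \<and> even (n + p)}"
      then have "shift n = shift p" using shift_parity[of n p] by (simp add: fun_eq_iff)
      then show "qbar (lk u n) \<cdot> hst n = lk x (shift p (wlong l n)) \<cdot> hst n"
        using n x(2)[of n] by (simp add: lku c_def)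
    qed
    then show ?thesis using biinv_expand[OF x(1)] by simp
  qed
  from this[of 0 "fst X"] this[of 1 "snd X"] have "psi u = X"
    using X by (cases X) (simp add: Valg_iff psi_def)
  with uV show ?thesis by blast
qed

subsection \<open>Canonical bases\<close>

lemma ps_can_vec_rec:
  "qint (int n + 1) \<cdot> ps p (can_vec l (Suc n))
    + (if even (l + n) \<and> n > 0 then qint (int n) \<cdot> ps p (can_vec l (n - 1)) else 0)
    = ps p (bop l (can_vec l n))"
  by (simp add: bop_can_vec ps_add ps_smul)

text \<open>Induction along the recursion for \<open>can_vec\<close>, whose scalars are bar-invariant, as is
  multiplication by \<open>b\<close>.\<close>

lemma hbar_ps_can_vec: "p \<in> {0, 1} \<Longrightarrow> hbar l (ps p (can_vec l n)) = ps p (can_vec l n)"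
proof (induction n arbitrary: p rule: less_induct)
  case (less n)
  show ?case
  proof (cases n)
    case 0
    then show ?thesis
      using ps_feta[of p 0] hbar_hst_minimal[of 0] by (simp add: can_vec_0 eta_def)
  next
    case (Suc m)
    let ?v = "can_vec l m"
    let ?r = "if even (l + m) \<and> m > 0 then qint (int m) \<cdot> ps p (can_vec l (m - 1)) else 0"
    have IH: "hbar l (ps 0 ?v) = ps 0 ?v" "hbar l (ps 1 ?v) = ps 1 ?v" using less Suc by auto
    have L: "left_inv 0 (ps 0 ?v)" "left_inv 1 (ps 1 ?v)"
      using ps_biinv by (simp_all add: biinv_D)
    have b: "hbar l (ps p (bop l ?v)) = ps p (bop l ?v)"
      using less.prems hbar_a_elt[OF L(2)] hbar_gamma_a_elt[OF L(1)] L IH ps_bop[OF can_vec_Vmod]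
      by auto
    have q: "qbar (qint (int m + 1)) = qint (int m + 1)" by simp
    have r: "hbar l ?r = ?r"
      using less.IH[of "m - 1" p] less.prems Suc by (simp add: hbar_smul)
    have "hbar l (qint (int m + 1) \<cdot> ps p (can_vec l n) + ?r) = qint (int m + 1) \<cdot> ps p (can_vec l n) + ?r"
      unfolding Suc ps_can_vec_rec by (rule b)
    then have "qint (int m + 1) \<cdot> hbar l (ps p (can_vec l n)) + ?r
        = qint (int m + 1) \<cdot> ps p (can_vec l n) + ?r"
      by (simp only: hbar_add hbar_smul r q)
    then have "qint (int m + 1) \<cdot> hbar l (ps p (can_vec l n)) = qint (int m + 1) \<cdot> ps p (can_vec l n)"
      by (rule add_right_imp_eq)
    then show ?thesis by (rule smul_cancel) (simp add: qint_neq_0)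
  qed
qed

lemma psi_can_vec:
  assumes n: "n \<le> l"
  shows "psi (can_vec l n) = Valg_can l n"
proof -
  define p where "p = n mod 2"
  have p: "p \<in> {0, 1}" "even (n + p)" unfolding p_def by auto
  have lk0: "lk (can_vec l n) m = 0" if "m > n \<or> odd (m + n)" for m
  proof (rule ccontr)
    assume "lk (can_vec l n) m \<noteq> 0"
    moreover have "m \<noteq> n" using that by auto
    ultimately have "m < n \<and> even (n - m)" by (intro lookup_can_vec_qZq(2)[OF n])
    then show False using that by (auto simp: even_diff_nat)
  qed
  have zero: "ps p' (can_vec l n) = 0" if "odd (n + p')" for p'
    unfolding ps_def
  proof (rule sum.neutral, rule ballI)
    fix m assume "m \<in> {m. m \<le> l \<and> even (m + p')}"
    then have "lk (can_vec l n) m = 0" using lk0 that by auto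
    then show "qbar (lk (can_vec l n) m) \<cdot> hst m = 0" by simp
  qed
  have sum: "ps p (can_vec l n) = (\<Sum>m\<le>n. qbar (lk (can_vec l n) m) \<cdot> hst m)"
  proof -
    have z: "qbar (lk (can_vec l n) m) \<cdot> hst m = 0" if "m > n \<or> odd (m + p)" for m
    proof -
      have "lk (can_vec l n) m = 0" using lk0 that p(2) by auto
      then show ?thesis by simp
    qed
    have "ps p (can_vec l n) = (\<Sum>m\<le>l. qbar (lk (can_vec l n) m) \<cdot> hst m)"
      unfolding ps_def by (rule sum.mono_neutral_left) (use z in auto)
    also have "\<dots> = (\<Sum>m\<le>n. qbar (lk (can_vec l n) m) \<cdot> hst m)"
      by (rule sum.mono_neutral_right) (use n z in auto)
    finally show ?thesis .
  qed
  have "KL_cond (ps p (can_vec l n)) (shift n (wlong l n))"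
  proof (rule KL_cond_comb[OF n sum])
    show "hbar l (ps p (can_vec l n)) = ps p (can_vec l n)" by (rule hbar_ps_can_vec[OF p(1)])
    show "qbar (lk (can_vec l n) n) = 1" by (simp add: can_vec_top[OF n])
    show "qbar (lk (can_vec l n) m) \<in> qZq" if "m < n" for m
      using lookup_can_vec_qZq(1)[OF n, of m] that by simp
    show "qbar (lk (can_vec l n) m) = 0" if "m \<le> n" "odd (m + n)" for m
      using lk0 that(2) by simp
  qed
  then have k: "klb l (shift n (wlong l n)) = ps p (can_vec l n)" by (rule klb_eqI)
  show ?thesis
    unfolding Valg_can_eq[OF n] k psi_def using zero[of 0] zero[of 1] p by auto
qed

subsection \<open>The isomorphism\<close>

definition Phi :: "(nat \<Rightarrow>\<^sub>0 laurent) \<Rightarrow> hecke \<times> hecke" where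
  "Phi = (\<lambda>v\<in>Vmod l. psi (Vbar l v))"

lemma Phi_eq: "v \<in> Vmod l \<Longrightarrow> Phi v = psi (Vbar l v)"
  by (simp add: Phi_def)

lemma Phi_Valg: "v \<in> Vmod l \<Longrightarrow> Phi v \<in> Valg l"
  by (simp add: Phi_eq psi_Valg)

lemma Phi_add: "v \<in> Vmod l \<Longrightarrow> w \<in> Vmod l \<Longrightarrow> Phi (v + w) = Phi v + Phi w"
  by (simp add: Phi_eq Vmod_add Vbar_add psi_def ps_add)

lemma Phi_smul: "v \<in> Vmod l \<Longrightarrow> Phi (c \<cdot> v) = Valg_smul c (Phi v)"
  by (simp add: Phi_eq Vmod_smul Vbar_smul psi_def ps_smul Valg_smul_def)

lemma Phi_bij: "bij_betw Phi (Vmod l) (Valg l)"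
proof (rule bij_betwI')
  fix v w assume vw: "v \<in> Vmod l" "w \<in> Vmod l"
  show "Phi v = Phi w \<longleftrightarrow> v = w"
  proof
    assume "Phi v = Phi w"
    then have "psi (Vbar l v) = psi (Vbar l w)" by (simp only: Phi_eq vw)
    then have "Vbar l v = Vbar l w" by (rule psi_inj[OF Vbar_Vmod[OF vw(1)] Vbar_Vmod[OF vw(2)]])
    then have "Vbar l (Vbar l v) = Vbar l (Vbar l w)" by (rule arg_cong)
    then show "v = w" by (simp only: Vbar_Vbar vw)
  qed simp
next
  fix X assume "X \<in> Valg l"
  then obtain u where "u \<in> Vmod l" "psi u = X" using psi_surj by blast
  then show "\<exists>v\<in>Vmod l. X = Phi v"
    by (intro bexI[of _ "Vbar l u"]) (simp_all add: Phi_eq Vbar_Vmod Vbar_Vbar)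
qed (rule Phi_Valg)

lemma module_iso_Phi: "module_iso l Phi"
  unfolding module_iso_def using Phi_bij Phi_add Phi_smul by (simp add: Phi_def)

lemma Phi_feta: "n \<le> l \<Longrightarrow> Phi (Vbar l (feta l (int n))) = Valg_std l n"
  using ps_feta[of 0 n] ps_feta[of 1 n]
  by (simp add: Phi_eq Vbar_Vmod feta_Vmod Vbar_Vbar psi_def Valg_std_eq)

lemma Phi_can_vec: "n \<le> l \<Longrightarrow> Phi (can_vec l n) = Valg_can l n"
  by (simp add: Phi_eq can_vec_Vmod Vbar_can_vec psi_can_vec)

lemma Phi_bop: "v \<in> Vmod l \<Longrightarrow> Phi (bop l v) = Valg_mult l (Valg_b l) (Phi v)"
  by (simp add: Phi_eq bop_Vmod Vbar_bop psi_bop Vbar_Vmod)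

lemma Phi_eta: "Phi (eta l) = (hst 0, 0)"
  using Phi_feta[of 0] Vbar_can_vec[of 0 l] by (simp add: Valg_std_eq can_vec_0 eta_def)

lemma Phi_Vbar:
  assumes "v \<in> Vmod l"
  shows "Phi (Vbar l v) = Valg_bar l (Phi v)"
proof -
  obtain a where a: "v = (\<Sum>n\<le>l. a n \<cdot> can_vec l n)" using can_vec_span assms by blast
  have "Vbar l v = (\<Sum>n\<le>l. qbar (a n) \<cdot> can_vec l n)"
    unfolding a by (simp add: Vbar_sum Vmod_smul can_vec_Vmod Vbar_smul Vbar_can_vec)
  then have "ps p v = hbar l (ps p (Vbar l v))" if "p \<in> {0, 1}" for p
    using that by (simp add: a ps_sum ps_smul hbar_sum hbar_smul hbar_ps_can_vec)
  then show ?thesis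
    by (simp add: Phi_eq assms Vbar_Vmod Vbar_Vbar psi_def Valg_bar_def)
qed

lemma pairing_shift: "pairing (\<lambda>w. X (shift p w)) (\<lambda>w. Y (shift p w)) = pairing X Y"
  using pairing_s0[of X "\<lambda>w. Y (srefl 0 \<circ> w)"]
  by (cases "even p") (simp_all add: shift_def s0_s0 del: o_apply)

lemma sform_ps:
  "sform l (Opm p) (ps p u) (ps p v) = (\<Sum>n | n \<le> l \<and> even (n + p).
     qbar (lk u n) * qbar (lk v n) * (qpow (int n * (int l - int n)) * qbinom l n))"
proof -
  let ?A = "{n. n \<le> l \<and> even (n + p)}" and ?P = "poinc_plus l (Opm p)"
  have H: "ps p u \<in> Hecke l" for u by (rule biinv_Hecke[OF ps_biinv])
  have lk: "lk (ps p u) = (\<lambda>w. (\<lambda>w. \<Sum>n\<in>?A. qbar (lk u n) * hfun n w) (shift p w))" for u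
  proof
    fix w
    show "lk (ps p u) w = (\<Sum>n\<in>?A. qbar (lk u n) * hfun n (shift p w))"
      unfolding ps_def lookup_sum
    proof (rule sum.cong[OF refl])
      fix n assume "n \<in> ?A"
      then have "shift n w = shift p w" by (intro shift_parity) simp
      then show "lk (qbar (lk u n) \<cdot> hst n) w = qbar (lk u n) * hfun n (shift p w)"
        by (simp add: lookup_smul lookup_hst)
    qed
  qed
  have "pairing (lk (ps p u)) (lk (ps p v))
      = pairing (\<lambda>w. \<Sum>n\<in>?A. qbar (lk u n) * hfun n w) (\<lambda>w. \<Sum>n\<in>?A. qbar (lk v n) * hfun n w)"
    unfolding lk by (rule pairing_shift)
  also have "\<dots> = (\<Sum>n\<in>?A. \<Sum>m\<in>?A. qbar (lk u n) * qbar (lk v m) * pairing (hfun n) (hfun m))"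
  proof -
    have "pairing (\<lambda>w. \<Sum>n\<in>?A. qbar (lk u n) * hfun n w) (\<lambda>w. \<Sum>n\<in>?A. qbar (lk v n) * hfun n w)
      = (\<Sum>w\<in>SP l. \<Sum>n\<in>?A. \<Sum>m\<in>?A. qbar (lk u n) * qbar (lk v m) * (hfun n w * hfun m w))"
      unfolding pairing_def sum_product by (intro sum.cong refl) (simp only: ac_simps)
    also have "\<dots> = (\<Sum>n\<in>?A. \<Sum>w\<in>SP l. \<Sum>m\<in>?A. qbar (lk u n) * qbar (lk v m) * (hfun n w * hfun m w))"
      by (rule sum.swap)
    also have "\<dots> = (\<Sum>n\<in>?A. \<Sum>m\<in>?A. \<Sum>w\<in>SP l. qbar (lk u n) * qbar (lk v m) * (hfun n w * hfun m w))"
      by (intro sum.cong refl sum.swap)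
    finally show ?thesis by (simp only: pairing_def sum_distrib_left)
  qed
  also have "\<dots> = (\<Sum>n\<in>?A. \<Sum>m\<in>?A. if m = n then qbar (lk u n) * qbar (lk v n) * pairing (hfun n) (hfun n) else 0)"
    by (intro sum.cong refl) (auto simp: pairing_hfun_neq)
  also have "\<dots> = (\<Sum>n\<in>?A. qbar (lk u n) * qbar (lk v n) * pairing (hfun n) (hfun n))"
    by (rule sum.cong) simp_all
  also have "\<dots> = ?P * (\<Sum>n\<in>?A. qbar (lk u n) * qbar (lk v n) * (qpow (int n * (int l - int n)) * qbinom l n))"
    unfolding sum_distrib_left by (rule sum.cong) (simp_all add: norm_hfun[where p = p] ac_simps)
  finally have "htr (hmult l (hrho (ps p u)) (ps p v))
      = ?P * (\<Sum>n\<in>?A. qbar (lk u n) * qbar (lk v n) * (qpow (int n * (int l - int n)) * qbinom l n))"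
    by (simp only: htr_hmult_hrho[OF H H])
  moreover have "?P \<noteq> 0" by (simp add: poinc_plus_sigma sigma_neq_0)
  ultimately show ?thesis by (simp add: sform_def exact_quot_mult)
qed

lemma Valg_form_psi: "Valg_form l (psi u) (psi v) = qbar (Vform l u v)"
proof -
  let ?F = "\<lambda>n. qbar (lk u n) * qbar (lk v n) * (qpow (int n * (int l - int n)) * qbinom l n)"
  have "Valg_form l (psi u) (psi v)
      = sform l (Opm 0) (ps 0 u) (ps 0 v) + sform l (Opm 1) (ps 1 u) (ps 1 v)"
    by (simp add: Valg_form_def psi_def Opm_simps)
  also have "\<dots> = (\<Sum>n | n \<le> l \<and> even (n + 0). ?F n) + (\<Sum>n | n \<le> l \<and> even (n + 1). ?F n)"
    by (simp only: sform_ps)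
  also have "\<dots> = (\<Sum>n\<in>{n. n \<le> l \<and> even (n + 0)} \<union> {n. n \<le> l \<and> even (n + 1)}. ?F n)"
    by (rule sum.union_disjoint[symmetric]) auto
  also have "{n. n \<le> l \<and> even (n + 0)} \<union> {n. n \<le> l \<and> even (n + 1)} = {..l}" by auto
  also have "(\<Sum>n\<le>l. ?F n) = qbar (Vform l u v)"
    by (simp add: Vform_def qbar_sum qbar_mult mult.assoc)
  finally show ?thesis .
qed

text \<open>Multiplication by \<open>\<phi> (u \<eta>)\<close> is the action of \<open>u\<close>, because multiplication by \<open>b\<close>
  commutes with right multiplication.\<close>

lemma Phi_pact:
  assumes v: "v \<in> Vmod l"
  shows "Phi (pact l p v) = Valg_mult l (Phi (pact l p (eta l))) (Phi v)"
proof (induction p)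
  case 0
  have z: "Phi 0 = 0" using Phi_smul[of 0 0] by (simp add: Valg_smul_def zero_prod_def)
  show ?case using smult_at_zero[of 0] smult_at_zero[of 1] by (simp add: z Valg_mult_eq zero_prod_def)
next
  case (pCons a p)
  have V: "pact l p v \<in> Vmod l" "pact l p (eta l) \<in> Vmod l" by (simp_all add: pact_Vmod v eta_Vmod)
  have C: "Phi v \<in> Valg l" "Phi (eta l) \<in> Valg l" "Phi (pact l p (eta l)) \<in> Valg l"
    by (simp_all add: Phi_Valg V v eta_Vmod)
  have one: "Valg_mult l (Phi (eta l)) (Phi v) = Phi v"
    unfolding Phi_eta by (rule Valg_mult_one[OF C(1)])
  have e: "Phi (pact l (pCons a p) w) = Valg_smul a (Phi w) + Valg_mult l (Valg_b l) (Phi (pact l p w))"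
    if "w \<in> Vmod l" for w
    using that by (simp add: pact_pCons Phi_add Phi_smul Phi_bop Vmod_smul bop_Vmod pact_Vmod)
  show ?case
    unfolding e[OF v] e[OF eta_Vmod] pCons.IH
    by (simp add: Valg_mult_add_left Valg_mult_smul_left Valg_smul_closed Valg_mult_closed
        Valg_b_closed C one Valg_b_mult_assoc)
qed

text \<open>That \<open>u v\<close> is integral for all \<open>v\<close> once it is so for \<open>v = \<eta>\<close> is not clear in \<open>V(l)\<close>;
  it follows because \<open>V\<close> is closed under multiplication.\<close>

lemma Act_exists:
  assumes u: "Act l u (eta l) w" and v: "v \<in> Vmod l"
  obtains x where "Act l u v x" "Phi x = Valg_mult l (Phi w) (Phi v)"
proof -
  obtain d p where 1: "w \<in> Vmod l" "d \<noteq> 0" "smult (to_fract d) u = fract_poly p"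
    "d \<cdot> w = pact l p (eta l)"
    using u by (rule ActE)
  have "Valg_mult l (Phi w) (Phi v) \<in> Valg l" by (intro Valg_mult_closed Phi_Valg 1 v)
  then obtain x where x: "x \<in> Vmod l" "Phi x = Valg_mult l (Phi w) (Phi v)"
    using Phi_bij unfolding bij_betw_def by (metis imageE)
  have "Phi (d \<cdot> x) = Phi (pact l p v)"
    unfolding Phi_pact[OF v] 1(4)[symmetric]
    by (simp add: Phi_smul x 1(1) Valg_mult_smul_left Phi_Valg v)
  then have "d \<cdot> x = pact l p v"
    using Phi_bij Vmod_smul[OF x(1)] pact_Vmod[OF v] by (auto simp: bij_betw_def inj_on_def)
  then have "Act l u v x" by (intro ActI[OF x(1) 1(2,3)])
  then show ?thesis using that x(2) by blast
qed

lemma Phi_unique: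
  assumes m: "module_iso l \<phi>" and f: "\<And>n. n \<le> l \<Longrightarrow> \<phi> (Vbar l (feta l (int n))) = Valg_std l n"
  shows "\<phi> = Phi"
proof (rule extensionalityI)
  show "\<phi> \<in> extensional (Vmod l)" using m by (simp add: module_iso_def)
  show "Phi \<in> extensional (Vmod l)" by (simp add: Phi_def)
  fix v assume v: "v \<in> Vmod l"
  let ?f = "\<lambda>n. Vbar l (feta l (int n))" and ?a = "\<lambda>n. qbar (lk (Vbar l v) n)"
  have F: "?f n \<in> Vmod l" for n by (intro Vbar_Vmod feta_Vmod)
  have "v = Vbar l (\<Sum>n\<le>l. lk (Vbar l v) n \<cdot> feta l (int n))"
    using Vmod_expand[OF Vbar_Vmod[OF v]] Vbar_Vbar[OF v] by simp
  then have e: "v = (\<Sum>n\<le>l. ?a n \<cdot> ?f n)"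
    by (simp add: Vbar_sum Vmod_smul feta_Vmod Vbar_smul)
  have "\<psi> (\<Sum>n\<in>A. ?a n \<cdot> ?f n) = (\<Sum>n\<in>A. Valg_smul (?a n) (\<psi> (?f n)))"
    if \<psi>: "module_iso l \<psi>" and A: "finite A" for \<psi> A
    using A
  proof (induction A rule: finite_induct)
    case empty
    have "\<psi> (0 \<cdot> 0) = Valg_smul 0 (\<psi> 0)" using \<psi> unfolding module_iso_def by (meson Vmod_zero)
    then show ?case by (simp add: Valg_smul_def zero_prod_def)
  next
    case (insert n A)
    have "(\<Sum>n\<in>A. ?a n \<cdot> ?f n) \<in> Vmod l" by (intro Vmod_sum Vmod_smul F)
    then show ?case using insert \<psi> F Vmod_smul[OF F] by (simp add: module_iso_def)
  qed
  from this[OF m finite_atMost[of l]] this[OF module_iso_Phi finite_atMost[of l]]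
  show "\<phi> v = Phi v"
    by (simp only: e[symmetric]) (simp add: f Phi_feta)
qed

text \<open>The elements of a coset all send \<open>\<eta>\<close> to the same vector, so the quotient is identified
  with \<open>V(l)\<close>; multiplicativity is \<open>Act_exists\<close>.\<close>

lemma ring_iso_Phi:
  assumes t: "t \<in> {0, 1}" "[l = t] (mod 2)"
  shows "(\<lambda>X. Phi (orbit_map l X)) \<in> ring_iso (Ui_ring t Quot Ann_eta t l) (Valg_ring l)"
proof -
  let ?R = "Ui_ring t" and ?I = "Ann_eta t l" and ?e = "eta l"
  let ?Q = "?R Quot ?I" and ?h = "\<lambda>X. Phi (orbit_map l X)"
  have A: "Act l u ?e (Ui_act l u ?e)" if "u \<in> Ui t" for u by (rule Act_Ui_exists[OF t that])
  have AV: "Ui_act l u ?e \<in> Vmod l" if "u \<in> Ui t" for u using A[OF that] by (simp add: Act_def)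
  have A0: "Act l i ?e 0" if "i \<in> ?I" for i using that A[of i] by (auto simp: Ann_eta_def)
  have I0: "0 \<in> ?I" using Ui_act_eq[OF Act_zero[of l ?e]] by (simp add: Ann_eta_def Ui_zero)
  have IU: "i \<in> Ui t" if "i \<in> ?I" for i using that by (simp add: Ann_eta_def)
  have coset: "?I +>\<^bsub>?R\<^esub> a = {i + a | i. i \<in> ?I}" for a
    by (auto simp: a_r_coset_def r_coset_def Ui_ring_def)
  have car: "carrier ?Q = {?I +>\<^bsub>?R\<^esub> a | a. a \<in> Ui t}"
    by (auto simp: FactRing_def A_RCOSETS_def RCOSETS_def a_r_coset_def Ui_ring_def)
  have orbit: "orbit_map l X = w" if "X \<noteq> {}" "\<And>u. u \<in> X \<Longrightarrow> Act l u ?e w" for X w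
  proof -
    have "(\<lambda>u. Ui_act l u ?e) ` X = {w}" using that Ui_act_eq by (force simp: image_iff)
    then show ?thesis by (simp add: orbit_map_def)
  qed
  have shiftI: "Act l (i + u) ?e w" if "i \<in> ?I" "Act l u ?e w" for i u w
    using Act_add[OF A0[OF that(1)] that(2)] by simp
  have cosA: "Act l u ?e (Ui_act l a ?e)" if "a \<in> Ui t" "u \<in> ?I +>\<^bsub>?R\<^esub> a" for a u
    using that shiftI[OF _ A[OF that(1)]] by (auto simp: coset)
  have ne: "?I +>\<^bsub>?R\<^esub> a \<noteq> {}" for a using I0 by (auto simp: coset)
  have orb: "orbit_map l (?I +>\<^bsub>?R\<^esub> a) = Ui_act l a ?e" if "a \<in> Ui t" for a
    by (rule orbit[OF ne cosA[OF that]])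
  have h: "?h (?I +>\<^bsub>?R\<^esub> a) = Phi (Ui_act l a ?e)" if "a \<in> Ui t" for a using orb[OF that] by simp
  have mult: "?h (X \<otimes>\<^bsub>?Q\<^esub> Y) = Valg_mult l (?h X) (?h Y)" if XY: "X \<in> carrier ?Q" "Y \<in> carrier ?Q" for X Y
  proof -
    obtain a b where ab: "a \<in> Ui t" "X = ?I +>\<^bsub>?R\<^esub> a" "b \<in> Ui t" "Y = ?I +>\<^bsub>?R\<^esub> b"
      using XY car by auto
    obtain x where x: "Act l a (Ui_act l b ?e) x" "Phi x = Valg_mult l (Phi (Ui_act l a ?e)) (Phi (Ui_act l b ?e))"
      using Act_exists[OF A[OF ab(1)] AV[OF ab(3)]] .
    have x': "Act l (a' * b') ?e x" if XY': "a' \<in> X" "b' \<in> Y" for a' b'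
    proof -
      obtain x' where x': "Act l a' (Ui_act l b ?e) x'"
        "Phi x' = Valg_mult l (Phi (Ui_act l a ?e)) (Phi (Ui_act l b ?e))"
        by (rule Act_exists[OF cosA[OF ab(1) XY'(1)[unfolded ab(2)]] AV[OF ab(3)]])
      have "x' = x"
        using x' x Phi_bij by (metis ActE bij_betw_def inj_on_def)
      then show ?thesis using Act_mult[OF cosA[OF ab(3)] x'(1)] XY'(2) ab(4) by simp
    qed
    have XYe: "X \<otimes>\<^bsub>?Q\<^esub> Y = (\<Union>a'\<in>X. \<Union>b'\<in>Y. ?I +>\<^bsub>?R\<^esub> (a' * b'))"
      by (simp add: FactRing_def rcoset_mult_def Ui_ring_def)
    have "orbit_map l (X \<otimes>\<^bsub>?Q\<^esub> Y) = x"
    proof (rule orbit)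
      have "c \<in> ?I +>\<^bsub>?R\<^esub> c" for c unfolding coset using I0 by force
      then have "a \<in> X" "b \<in> Y" unfolding ab(2,4) by simp_all
      moreover obtain u where "u \<in> ?I +>\<^bsub>?R\<^esub> (a * b)" using ne by fast
      ultimately have "u \<in> X \<otimes>\<^bsub>?Q\<^esub> Y" unfolding XYe by fast
      then show "X \<otimes>\<^bsub>?Q\<^esub> Y \<noteq> {}" by fast
      fix u assume "u \<in> X \<otimes>\<^bsub>?Q\<^esub> Y"
      then obtain a' b' i where "a' \<in> X" "b' \<in> Y" "i \<in> ?I" "u = i + a' * b'"
        unfolding XYe coset by blast
      then show "Act l u ?e x" using shiftI x' by blast
    qed
    then show ?thesis using x(2) h ab by simp
  qed
  have add: "?h (X \<oplus>\<^bsub>?Q\<^esub> Y) = ?h X + ?h Y" if XY: "X \<in> carrier ?Q" "Y \<in> carrier ?Q" for X Y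
  proof -
    obtain a b where ab: "a \<in> Ui t" "X = ?I +>\<^bsub>?R\<^esub> a" "b \<in> Ui t" "Y = ?I +>\<^bsub>?R\<^esub> b"
      using XY car by auto
    have XYe: "X \<oplus>\<^bsub>?Q\<^esub> Y = {u + v | u v. u \<in> X \<and> v \<in> Y}"
      by (auto simp: FactRing_def set_add_def set_mult_def Ui_ring_def)
    have "orbit_map l (X \<oplus>\<^bsub>?Q\<^esub> Y) = Ui_act l a ?e + Ui_act l b ?e"
    proof (rule orbit)
      show "X \<oplus>\<^bsub>?Q\<^esub> Y \<noteq> {}" unfolding XYe using ne[of a] ne[of b] ab by blast
      fix u assume "u \<in> X \<oplus>\<^bsub>?Q\<^esub> Y"
      then show "Act l u ?e (Ui_act l a ?e + Ui_act l b ?e)"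
        unfolding XYe using cosA ab by (auto intro!: Act_add)
    qed
    then show ?thesis using h ab by (simp add: Phi_add AV)
  qed
  have one: "?h \<one>\<^bsub>?Q\<^esub> = (klb l (wmax l (Oplus l)), 0)"
  proof -
    have "\<one>\<^bsub>?Q\<^esub> = ?I +>\<^bsub>?R\<^esub> 1" by (simp add: FactRing_def Ui_ring_def)
    then show ?thesis
      using h[OF Ui_one] Ui_act_eq[OF Act_one[OF eta_Vmod]] by (simp add: Phi_eta Valg_one)
  qed
  have inj: "inj_on ?h (carrier ?Q)"
  proof (rule inj_onI)
    fix X Y assume XY: "X \<in> carrier ?Q" "Y \<in> carrier ?Q" "?h X = ?h Y"
    then obtain a b where ab: "a \<in> Ui t" "X = ?I +>\<^bsub>?R\<^esub> a" "b \<in> Ui t" "Y = ?I +>\<^bsub>?R\<^esub> b"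
      using car by auto
    have eq: "Ui_act l a ?e = Ui_act l b ?e"
      using XY(3) h ab Phi_bij AV by (simp add: bij_betw_def inj_on_def)
    have sub: "?I +>\<^bsub>?R\<^esub> c \<subseteq> ?I +>\<^bsub>?R\<^esub> d"
      if cd: "c \<in> Ui t" "d \<in> Ui t" "Ui_act l c ?e = Ui_act l d ?e" for c d
    proof
      fix u assume "u \<in> ?I +>\<^bsub>?R\<^esub> c"
      then obtain i where i: "i \<in> ?I" "u = i + c" by (auto simp: coset)
      have "Act l (smult (to_fract (- 1)) d) ?e ((- 1) \<cdot> Ui_act l d ?e)"
        by (rule Act_smult[OF A[OF cd(2)]])
      from Act_add[OF shiftI[OF i(1) A[OF cd(1)]] this]
      have "Act l (i + c - d) ?e 0" by (simp add: cd(3) smul_minus_left)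
      moreover have "i + c - d \<in> Ui t" by (intro Ui_diff Ui_add IU i cd)
      ultimately have "i + c - d \<in> ?I" using Ui_act_eq by (simp add: Ann_eta_def)
      then show "u \<in> ?I +>\<^bsub>?R\<^esub> d" unfolding coset i(2) by (auto intro!: exI[of _ "i + c - d"])
    qed
    show "X = Y" unfolding ab(2,4) using sub[of a b] sub[of b a] eq ab by auto
  qed
  have surj: "?h ` carrier ?Q = Valg l"
  proof
    show "?h ` carrier ?Q \<subseteq> Valg l" 
      unfolding car using h Phi_Valg[OF AV] by fastforce
    show "Valg l \<subseteq> ?h ` carrier ?Q"
    proof
      fix X assume "X \<in> Valg l"
      then obtain v where v: "v \<in> Vmod l" "X = Phi v" using Phi_bij by (auto simp: bij_betw_def)
      then obtain a where a: "a \<in> Ui t" "Ui_act l a ?e = v" using Ui_orbit[OF t] by blast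
      then have "?I +>\<^bsub>?R\<^esub> a \<in> carrier ?Q" "X = ?h (?I +>\<^bsub>?R\<^esub> a)" using car h v by auto
      then show "X \<in> ?h ` carrier ?Q" by blast
    qed
  qed
  have "?h \<in> ring_hom ?Q (Valg_ring l)"
  proof (rule ring_hom_memI)
    show "?h X \<in> carrier (Valg_ring l)" if "X \<in> carrier ?Q" for X
      using surj that by (auto simp: Valg_ring_def)
  qed (use mult add one in \<open>simp_all add: Valg_ring_def\<close>)
  then show ?thesis using inj surj by (simp add: ring_iso_def bij_betw_def Valg_ring_def)
qed

end

theorem theorem4p5:
  fixes l t :: nat
  assumes "l \<ge> 2" and "t \<in> {0, 1}" and "[l = t] (mod 2)"
  shows "(\<exists>!\<phi>. module_iso l \<phi> \<and> matches_bases t l \<phi>)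
    \<and> (\<forall>\<phi>. module_iso l \<phi> \<and> matches_bases t l \<phi> \<longrightarrow>
          (\<lambda>X. \<phi> (orbit_map l X)) \<in> ring_iso (Ui_ring t Quot Ann_eta t l) (Valg_ring l)
        \<and> (\<forall>v\<in>Vmod l. \<phi> (bop l v) = Valg_mult l (Valg_b l) (\<phi> v))
        \<and> (\<forall>v\<in>Vmod l. \<phi> (Vbar l v) = Valg_bar l (\<phi> v))
        \<and> (\<forall>v\<in>Vmod l. \<forall>w\<in>Vmod l.
             qbar (Vform l (Vbar l v) (Vbar l w)) = Valg_form l (\<phi> v) (\<phi> w)))"
proof -
  interpret type_D l by unfold_locales (rule assms(1))
  have "matches_bases t l Phi"
    using Ui_act_eq[OF Act_bdiv[OF assms(2,3)]] by (simp add: matches_bases_def Phi_feta Phi_can_vec)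
  moreover have unique: "\<phi> = Phi" if "module_iso l \<phi> \<and> matches_bases t l \<phi>" for \<phi>
    using that by (intro Phi_unique) (auto simp: matches_bases_def)
  moreover note module_iso_Phi
  moreover have "qbar (Vform l (Vbar l v) (Vbar l w)) = Valg_form l (Phi v) (Phi w)"
    if "v \<in> Vmod l" "w \<in> Vmod l" for v w
    using that by (simp add: Phi_eq Valg_form_psi)
  ultimately show ?thesis
    using ring_iso_Phi[OF assms(2,3)] Phi_bop Phi_Vbar by metis
qed

end
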